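(* Let $J:\mathbb{R}^d\to[0,+\infty)$ be integrable with $\int_{\mathbb{R}^d} J(x)\,dx=1$, $\int_{\mathbb{R}^d} J(x)x\,dx=0$, $\int_{\mathbb{R}^d} J(x)x_ix_j\,dx=2\delta_{ij}$ for $i,j=1,\dots,d$, and assume moreover that $J\in L^p(\mathbb{R}^d)$ for some $p\in(1,\infty]$. For $\varepsilon\in(0,1]$ consider the equation $$\partial_t u=\frac1{\varepsilon^2}\big(J_\varepsilon*u-u\big)+\operatorname{div}(xu).\qquad(\mathrm{NLFP})$$ (i) Suppose $J\in L^1_{k'}$ for some $k'>2$. Then for every $\varepsilon\in(0,1]$ there exists a unique probability equilibrium $F_\varepsilon$ of (NLFP) in $L^1_{k'}$. Additionally, for every $0<k\le k'$ there exist constants $C\ge1$ and $\gamma>0$, independent of $\varepsilon$, such that for every $\varepsilon\in(0,1]$ any mild solution $u$ of (NLFP) in $L^1_k$ whose initial condition $u_0\in L^1_k$ is a probability density satisfies $$\|u(t,\cdot)-F_\varepsilon\|_{L^1_k}\le Ce^{-\gamma t}\|u_0-F_\varepsilon\|_{L^1_k}\qquad\text{for every } t\ge0.$$ (ii) Suppose $J\in L^1_{\exp,a'}$ for some $a'>0$. Then for every $\varepsilon\in(0,1]$ there exists a unique probability equilibrium $F_\varepsilon$ of (NLFP) in $L^1_{\exp,a}$, for all $0<a<a'$. Additionally, for every such $a$ there exist constants $C\ge1$ and $\gamma>0$, independent of $\varepsilon$, such that for every $\varepsilon\in(0,1]$ any mild solution $u$ of (NLFP) in $L^1_{\exp,a}$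 whose initial condition $u_0\in L^1_{\exp,a}$ is a probability density satisfies $$\|u(t,\cdot)-F_\varepsilon\|_{L^1_{\exp,a}}\le Ce^{-\gamma t}\|u_0-F_\varepsilon\|_{L^1_{\exp,a}}\qquad\text{for every } t\ge0.$$ Moreover, the unique equilibrium $F_\varepsilon$ also belongs to $L^1_{\exp,b}$ for any $b<a'\varepsilon^{-1}$.
   Context: Notation: $J_\varepsilon(x):=\varepsilon^{-d}J(x/\varepsilon)$; convolution is in the $x$ variable. For $k\ge0$, $L^1_k$ is the weighted Lebesgue space with norm $\|\varphi\|_{L^1_k}=\int_{\mathbb{R}^d}(1+|x|^k)|\varphi(x)|\,dx$. For $a>0$, $L^1_{\exp,a}$ is the weighted Lebesgue space with norm $\|\varphi\|_{L^1_{\exp,a}}=\int_{\mathbb{R}^d}e^{a|x|}|\varphi(x)|\,dx$. Mild solutions: for $t\ge0$ set $T_tf(x):=e^{(d-1/\varepsilon^2)t}f(e^tx)$. A mild solution of (NLFP) in $X$ (with $X=L^1_k$ or $X=L^1_{\exp,a}$) with initial condition $u_0\in X$ is a function $u\in\mathcal{C}([0,\infty),X)$ such that $u(t)=T_tu_0+\frac1{\varepsilon^2}\int_0^tT_{t-s}[J_\varepsilon*u(s)]\,ds$ for all $t\ge0$; we write $u(t,x)=u(t)(x)$. Equilibria: an equilibrium of (NLFP) is a function $F_\varepsilon\in L^1(\mathbb{R}^d)$ satisfying $\frac1{\varepsilon^2}(J_\varepsilon*F_\varepsilon-F_\varepsilon)+\operatorname{div}(xF_\varepsilon)=0$ in the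 sense of distributions; a probability equilibrium is a nonnegative equilibrium with $\int_{\mathbb{R}^d} F_\varepsilon\,dx=1$. A probability density is a nonnegative integrable function with integral $1$. *)

theory Defs
  imports "HOL-Analysis.Analysis"
begin

text \<open>
  \<open>\<real>\<^sup>d\<close> is an arbitrary Euclidean space \<^typ>\<open>'a::euclidean_space\<close> with \<open>d = DIM('a)\<close>. Elements of
  Lebesgue spaces are represented by Lebesgue measurable functions; every notion below depends only
  on the class of a function modulo equality almost everywhere.
\<close>

definition weight_pow :: "real \<Rightarrow> 'a::euclidean_space \<Rightarrow> real"
  where "weight_pow k x = 1 + norm x powr k"

definition weight_exp :: "real \<Rightarrow> 'a::euclidean_space \<Rightarrow> real"
  where "weight_exp a x = exp (a * norm x)"

definition L1w :: "('a::euclidean_space \<Rightarrow> real) \<Rightarrow> ('a \<Rightarrow> real) set"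
  where "L1w w = {f \<in> borel_measurable lebesgue. integrable lebesgue (\<lambda>x. w x * \<bar>f x\<bar>)}"

definition L1w_norm :: "('a::euclidean_space \<Rightarrow> real) \<Rightarrow> ('a \<Rightarrow> real) \<Rightarrow> real"
  where "L1w_norm w f = (LINT x|lebesgue. w x * \<bar>f x\<bar>)"

definition in_Lp :: "ennreal \<Rightarrow> ('a::euclidean_space \<Rightarrow> real) \<Rightarrow> bool"
  where "in_Lp p f \<longleftrightarrow> f \<in> borel_measurable lebesgue \<and>
    (if p = \<infinity> then \<exists>M. AE x in lebesgue. \<bar>f x\<bar> \<le> M
     else integrable lebesgue (\<lambda>x. \<bar>f x\<bar> powr enn2real p))"

definition rescale :: "real \<Rightarrow> ('a::euclidean_space \<Rightarrow> real) \<Rightarrow> 'a \<Rightarrow> real"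
  where "rescale \<epsilon> J x = inverse (\<epsilon> ^ DIM('a)) * J (x /\<^sub>R \<epsilon>)"

text \<open>For integrable functions the integral exists for almost every \<open>x\<close>; on the remaining null set
  the value is \<open>0\<close> by the convention for the Bochner integral.\<close>

definition convolve :: "('a::euclidean_space \<Rightarrow> real) \<Rightarrow> ('a \<Rightarrow> real) \<Rightarrow> 'a \<Rightarrow> real"
  where "convolve f g x = (LINT y|lebesgue. f (x - y) * g y)"

definition probability_density :: "('a::euclidean_space \<Rightarrow> real) \<Rightarrow> bool"
  where "probability_density f \<longleftrightarrow>
    (AE x in lebesgue. 0 \<le> f x) \<and> has_bochner_integral lebesgue f 1"

primrec C_k :: "nat \<Rightarrow> ('a::euclidean_space \<Rightarrow> real) \<Rightarrow> bool"
  where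
    "C_k 0 f \<longleftrightarrow> continuous_on UNIV f"
  | "C_k (Suc n) f \<longleftrightarrow> (\<forall>x. f differentiable (at x)) \<and>
       (\<forall>i\<in>Basis. C_k n (\<lambda>x. frechet_derivative f (at x) i))"

definition test_function :: "('a::euclidean_space \<Rightarrow> real) \<Rightarrow> bool"
  where "test_function \<phi> \<longleftrightarrow> (\<forall>n. C_k n \<phi>) \<and> (\<exists>K. compact K \<and> (\<forall>x. x \<notin> K \<longrightarrow> \<phi> x = 0))"

text \<open>The distribution \<open>div (x F)\<close> acts on \<open>\<phi>\<close> as \<open>- \<integral> F(x) x \<cdot> \<nabla>\<phi>(x) dx\<close>, and \<open>x \<cdot> \<nabla>\<phi>(x)\<close> is the
  derivative of \<open>\<phi>\<close> at \<open>x\<close> applied to the vector \<open>x\<close>.\<close>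

definition equilibrium ::
    "('a::euclidean_space \<Rightarrow> real) \<Rightarrow> real \<Rightarrow> ('a \<Rightarrow> real) \<Rightarrow> bool"
  where "equilibrium J \<epsilon> F \<longleftrightarrow> integrable lebesgue F \<and>
    (\<forall>\<phi>. test_function \<phi> \<longrightarrow>
      (LINT x|lebesgue. 1 / \<epsilon>\<^sup>2 * (convolve (rescale \<epsilon> J) F x - F x) * \<phi> x)
      - (LINT x|lebesgue. F x * frechet_derivative \<phi> (at x) x) = 0)"

definition probability_equilibrium ::
    "('a::euclidean_space \<Rightarrow> real) \<Rightarrow> real \<Rightarrow> ('a \<Rightarrow> real) \<Rightarrow> bool"
  where "probability_equilibrium J \<epsilon> F \<longleftrightarrow> equilibrium J \<epsilon> F \<and> probability_density F"

definition unique_probability_equilibrium_in ::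
    "('a \<Rightarrow> real) \<Rightarrow> ('a::euclidean_space \<Rightarrow> real) \<Rightarrow> real \<Rightarrow> ('a \<Rightarrow> real) \<Rightarrow> bool"
  where "unique_probability_equilibrium_in w J \<epsilon> F \<longleftrightarrow>
    F \<in> L1w w \<and> probability_equilibrium J \<epsilon> F \<and>
    (\<forall>G. G \<in> L1w w \<and> probability_equilibrium J \<epsilon> G \<longrightarrow> (AE x in lebesgue. G x = F x))"

definition transport :: "real \<Rightarrow> real \<Rightarrow> ('a::euclidean_space \<Rightarrow> real) \<Rightarrow> 'a \<Rightarrow> real"
  where "transport \<epsilon> t f x = exp ((real DIM('a) - 1 / \<epsilon>\<^sup>2) * t) * f (exp t *\<^sub>R x)"

text \<open>
  Vector-valued integration over \<open>[a, b]\<close> in the space \<open>L1w w\<close>: the gauge characterisation of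
  \<^const>\<open>has_integral\<close> (lemma \<open>has_integral\<close>), with the norm of \<open>L1w w\<close> in place of that of a type of
  class \<open>real_normed_vector\<close>. For integrands that are continuous in \<open>L1w w\<close>, the only ones
  used here, it is the Riemann (equivalently, Bochner) integral.
\<close>

definition has_integral_L1w ::
    "('a::euclidean_space \<Rightarrow> real) \<Rightarrow> (real \<Rightarrow> 'a \<Rightarrow> real) \<Rightarrow> ('a \<Rightarrow> real) \<Rightarrow> real \<Rightarrow> real \<Rightarrow> bool"
  where "has_integral_L1w w g v a b \<longleftrightarrow>
    (\<forall>s\<in>{a..b}. g s \<in> L1w w) \<and> v \<in> L1w w \<and>
    (\<forall>e>0. \<exists>\<gamma>. gauge \<gamma> \<and>
      (\<forall>\<D>. \<D> tagged_division_of (cbox a b) \<and> \<gamma> fine \<D> \<longrightarrow>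
        L1w_norm w (\<lambda>x. (\<Sum>(s, K)\<in>\<D>. measure lborel K * g s x) - v x) < e))"

definition mild_solution ::
    "('a \<Rightarrow> real) \<Rightarrow> ('a::euclidean_space \<Rightarrow> real) \<Rightarrow> real \<Rightarrow> ('a \<Rightarrow> real) \<Rightarrow> (real \<Rightarrow> 'a \<Rightarrow> real) \<Rightarrow> bool"
  where "mild_solution w J \<epsilon> u0 u \<longleftrightarrow>
    u0 \<in> L1w w \<and>
    (\<forall>t\<ge>0. u t \<in> L1w w) \<and>
    (\<forall>t\<ge>0. ((\<lambda>s. L1w_norm w (\<lambda>x. u s x - u t x)) \<longlongrightarrow> 0) (at t within {0..})) \<and>
    (\<forall>t\<ge>0. \<exists>I. has_integral_L1w w
                  (\<lambda>s. transport \<epsilon> (t - s) (convolve (rescale \<epsilon> J) (u s))) I 0 t \<and>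
               (AE x in lebesgue. u t x = transport \<epsilon> t u0 x + 1 / \<epsilon>\<^sup>2 * I x))"

end

theory Submission
  imports Defs "HOL-Probability.Probability"
begin

text \<open>
  The equation is the forward equation of \<open>dX = -X dt\<close> plus jumps \<open>\<epsilon> Y\<close>, \<open>Y \<sim> J\<close>, at rate
  \<open>1 / \<epsilon>\<^sup>2\<close>. Hence its semigroup is explicit: a dilation by \<open>e\<^sup>t\<close> followed by convolution with the
  compound Poisson law of \<open>\<epsilon> e\<^bsup>-tr\<^esup> Y\<close>, \<open>r\<close> uniform in \<open>[0, 1]\<close>, and intensity \<open>t / \<epsilon>\<^sup>2\<close>. Exponential
  decay follows from Harris' theorem with constants uniform in \<open>\<epsilon>\<close>. The Lyapunov condition is a
  second order expansion of the weight, where the centring of \<open>J\<close> removes the first order term, so that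
  a jump of size \<open>c\<close> costs a factor \<open>1 + M c\<^sup>2\<close> and the \<open>t / \<epsilon>\<^sup>2\<close> jumps together a bounded one. The
  minorisation is replaced by a total variation bound for small shifts of the compound Poisson law: by
  Steinhaus' theorem \<open>J\<close> overlaps its small translates, so by Mineka's coupling \<open>n\<close> jumps hide a shift
  of the size of one jump up to an error of order \<open>1 / \<surd>n\<close>; shifts of order one are sums of \<open>1 / \<epsilon>\<close>
  such shifts, while \<open>n\<close> is of order \<open>1 / \<epsilon>\<^sup>2\<close>, and the dilation makes all shifts small.
  Mild solutions and distributional equilibria are identified with orbits and fixed points of the
  semigroup on the Fourier side, where the equation is a linear ordinary differential equation along rays.
\<close>

section \<open>Compound Poisson laws\<close>

text \<open>Growth bound and loss of memory must both be uniform in \<epsilon>, and a minorisation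
  on balls would require lower bounds for the density of a sum of many tiny jumps. Total variation
  is instead measured only by testing with bounded Borel functions: the evolution of a datum is then
  seen through differences \<open>P x - P 0\<close> of one averaged test function, and for data of
  mean zero subtracting the constant \<open>P 0\<close> costs nothing. No solution theory is built;
  transforms are computed one frequency at a time, and their injectivity returns equality almost
  everywhere, which is all that weighted norms see. The given weights may have a kink at the origin,
  where a second order expansion fails, so estimates are made for equivalent smooth weights at the
  price of a constant. Decay for mean zero data yields the rest: existence, because the increments
  of an orbit have mean zero and are summable; uniqueness, because a stationary difference of two
  densities must vanish; and the convergence of solutions.\<close>

locale borel_prob = prob_space M for M :: "'a::euclidean_space measure" +
  assumes sets_M [simp, measurable_cong]: "sets M = sets borel"
begin

lemma space_M [simp]: "space M = UNIV"
  using sets_eq_imp_space_eq[OF sets_M] by simp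

lemma integrable_bounded [intro]:
  fixes f :: "'a \<Rightarrow> 'b::{banach, second_countable_topology}"
  assumes "f \<in> borel_measurable borel" "\<And>x. norm (f x) \<le> B"
  shows "integrable M f"
  using assms by (intro integrable_const_bound[of _ B]) auto

text \<open>Holds for arbitrary \<open>f\<close>, since a non-integrable one has Bochner integral
  \<open>0\<close>, and \<open>0 \<le> B\<close>.\<close>

lemma integral_bounded_le:
  fixes f :: "'a \<Rightarrow> 'b::{banach, second_countable_topology}"
  assumes "\<And>x. norm (f x) \<le> B"
  shows "norm (LINT x|M. f x) \<le> B"
proof (cases "integrable M f")
  case True
  have "norm (LINT x|M. f x) \<le> (LINT x|M. norm (f x))"
    by (rule integral_norm_bound)
  also have "\<dots> \<le> (LINT x|M. B)"
    using True assms by (intro integral_mono) auto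
  finally show ?thesis by (simp add: prob_space del: space_M)
next
  case False
  have "0 \<le> B" using assms[of 0] norm_ge_zero order_trans by blast
  then show ?thesis using False by (simp add: not_integrable_integral_eq)
qed

end

section \<open>Sums of independent variables\<close>

definition conv2 :: "'a::euclidean_space measure \<Rightarrow> 'a measure \<Rightarrow> 'a measure" where
  "conv2 M N = distr (M \<Otimes>\<^sub>M N) borel (\<lambda>(x, y). x + y)"

lemma borel_prob_conv2:
  assumes "borel_prob M" "borel_prob N"
  shows "borel_prob (conv2 M N)"
proof -
  interpret M: borel_prob M by fact
  interpret N: borel_prob N by fact
  interpret P: pair_prob_space M N ..
  show ?thesis
    unfolding conv2_def borel_prob_def borel_prob_axioms_def
    by (auto intro!: P.prob_space_distr)
qed

lemma
  fixes f :: "'a::euclidean_space \<Rightarrow> 'b::{banach, second_countable_topology}"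
  assumes "borel_prob M" "borel_prob N" and f[measurable]: "f \<in> borel_measurable borel"
    and B: "\<And>x. norm (f x) \<le> B"
  shows integral_conv2: "(LINT x|conv2 M N. f x) = (LINT x|M. LINT y|N. f (x + y))"
    and integral_conv2': "(LINT x|conv2 M N. f x) = (LINT y|N. LINT x|M. f (x + y))"
proof -
  interpret M: borel_prob M by fact
  interpret N: borel_prob N by fact
  interpret P: pair_prob_space M N ..
  have i: "integrable (M \<Otimes>\<^sub>M N) (\<lambda>z. f (fst z + snd z))"
    using B by (intro P.integrable_const_bound[of _ B]) auto
  have "(LINT x|conv2 M N. f x) = (LINT z|(M \<Otimes>\<^sub>M N). f (fst z + snd z))"
    by (simp add: conv2_def integral_distr case_prod_beta)
  moreover have "(LINT y|N. LINT x|M. f (x + y)) = (LINT z|(M \<Otimes>\<^sub>M N). f (fst z + snd z))"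
    using P.integral_snd[of "\<lambda>x y. f (x + y)"] i by (simp add: split_beta')
  ultimately show "(LINT x|conv2 M N. f x) = (LINT x|M. LINT y|N. f (x + y))"
    "(LINT x|conv2 M N. f x) = (LINT y|N. LINT x|M. f (x + y))"
    using P.integral_fst'[OF i] by (simp_all add: case_prod_beta)
qed

lemma nn_integral_conv2:
  assumes "borel_prob M" "borel_prob N" and f[measurable]: "f \<in> borel_measurable borel"
  shows "(\<integral>\<^sup>+x. f x \<partial>conv2 M N) = (\<integral>\<^sup>+x. \<integral>\<^sup>+y. f (x + y) \<partial>N \<partial>M)"
proof -
  interpret M: borel_prob M by fact
  interpret N: borel_prob N by fact
  interpret P: pair_prob_space M N ..
  show ?thesis
    by (simp add: conv2_def nn_integral_distr case_prod_beta N.nn_integral_fst[symmetric])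
qed

primrec convpow :: "'a::euclidean_space measure \<Rightarrow> nat \<Rightarrow> 'a measure" where
  "convpow M 0 = return borel 0"
| "convpow M (Suc n) = conv2 (convpow M n) M"

lemma borel_prob_convpow:
  assumes "borel_prob M" shows "borel_prob (convpow M n)"
proof (induction n)
  case 0
  show ?case
    by (auto simp: borel_prob_def borel_prob_axioms_def intro: prob_space_return)
next
  case (Suc n)
  then show ?case using assms by (simp add: borel_prob_conv2)
qed

definition cf :: "'a::euclidean_space measure \<Rightarrow> 'a \<Rightarrow> complex" where
  "cf M \<xi> = (LINT x|M. cis (\<xi> \<bullet> x))"

lemma borel_measurable_cis [measurable]: "cis \<in> borel_measurable borel"
  by (intro borel_measurable_continuous_onI continuous_intros)

lemma cf_conv2:
  assumes "borel_prob M" "borel_prob N"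
  shows "cf (conv2 M N) \<xi> = cf M \<xi> * cf N \<xi>"
proof -
  have "cf (conv2 M N) \<xi> = (LINT x|M. LINT y|N. cis (\<xi> \<bullet> (x + y)))"
    unfolding cf_def by (rule integral_conv2[OF assms, of _ 1]) auto
  then show ?thesis
    by (simp add: cf_def inner_add_right cis_mult[symmetric])
qed

lemma cf_convpow:
  assumes "borel_prob M"
  shows "cf (convpow M n) \<xi> = cf M \<xi> ^ n"
proof (induction n)
  case 0
  have "cf (return borel 0) \<xi> = cis (\<xi> \<bullet> 0)"
    unfolding cf_def by (rule integral_return) auto
  then show ?case by simp
next
  case (Suc n)
  then show ?case
    using assms by (simp add: cf_conv2 borel_prob_convpow)
qed

text \<open>The one-jump bound holds from every starting point, so it applies to the last jump with
  the sum of the earlier ones added to the starting point; each jump costs one factor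
  \<open>c\<close>.\<close>

lemma nn_integral_convpow_le:
  assumes M: "borel_prob M" and V[measurable]: "V \<in> borel_measurable borel"
    and c: "\<And>x. (\<integral>\<^sup>+z. V (x + z) \<partial>M) \<le> c * V x"
  shows "(\<integral>\<^sup>+z. V (x + z) \<partial>convpow M n) \<le> c ^ n * V x"
proof (induction n arbitrary: x)
  case 0
  then show ?case by (simp add: nn_integral_return)
next
  case (Suc n)
  interpret M: borel_prob M by fact
  interpret N: borel_prob "convpow M n" by (rule borel_prob_convpow[OF M])
  have "(\<integral>\<^sup>+z. V (x + z) \<partial>convpow M (Suc n)) = (\<integral>\<^sup>+y. \<integral>\<^sup>+z. V ((x + y) + z) \<partial>M \<partial>convpow M n)"
    using M N.borel_prob_axioms by (simp add: nn_integral_conv2 add.assoc)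
  also have "\<dots> \<le> (\<integral>\<^sup>+y. c * V (x + y) \<partial>convpow M n)"
    by (intro nn_integral_mono c)
  also have "\<dots> = c * (\<integral>\<^sup>+y. V (x + y) \<partial>convpow M n)"
    by (rule nn_integral_cmult) measurable
  also have "\<dots> \<le> c * (c ^ n * V x)"
    by (intro mult_left_mono Suc) auto
  finally show ?case by (simp add: mult.assoc)
qed

section \<open>Random numbers of jumps\<close>

definition cpoisson :: "real \<Rightarrow> 'a::euclidean_space measure \<Rightarrow> 'a measure" where
  "cpoisson l M = measure_pmf (poisson_pmf l) \<bind> convpow M"

lemma convpow_measurable:
  assumes "borel_prob M"
  shows "convpow M \<in> measurable (measure_pmf p) (subprob_algebra borel)"
proof -
  have "convpow M n \<in> space (subprob_algebra borel)" for n
    using borel_prob_convpow[OF assms, of n]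
    by (simp add: space_subprob_algebra borel_prob_def borel_prob_axioms_def
        prob_space_imp_subprob_space)
  then show ?thesis by simp
qed

lemma borel_prob_cpoisson:
  assumes M: "borel_prob M"
  shows "borel_prob (cpoisson l M)"
  unfolding borel_prob_def borel_prob_axioms_def
proof
  show "prob_space (cpoisson l M)"
    unfolding cpoisson_def using borel_prob_convpow[OF M]
    by (intro prob_space.prob_space_bind[where S = borel] prob_space_measure_pmf convpow_measurable M)
      (simp add: borel_prob_def)
  show "sets (cpoisson l M) = sets borel"
    unfolding cpoisson_def using borel_prob_convpow[OF M]
    by (intro sets_bind) (auto simp: borel_prob_def borel_prob_axioms_def)
qed

lemma nn_integral_cpoisson:
  assumes "borel_prob M" "0 < l" and f[measurable]: "f \<in> borel_measurable borel"
  shows "(\<integral>\<^sup>+x. f x \<partial>cpoisson l M) =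
    (\<Sum>n. ennreal (l ^ n / fact n * exp (- l)) * (\<integral>\<^sup>+x. f x \<partial>convpow M n))"
proof -
  have "(\<integral>\<^sup>+x. f x \<partial>cpoisson l M) = (\<integral>\<^sup>+n. \<integral>\<^sup>+x. f x \<partial>convpow M n \<partial>measure_pmf (poisson_pmf l))"
    unfolding cpoisson_def
    by (rule nn_integral_bind[where B = borel]) (rule f, rule convpow_measurable, fact)
  then show ?thesis
    using \<open>0 < l\<close> by (simp add: nn_integral_measure_pmf nn_integral_count_space_nat)
qed

lemma cpoisson_sums:
  fixes f :: "'a::euclidean_space \<Rightarrow> real"
  assumes M: "borel_prob M" and l: "0 < l" and f[measurable]: "f \<in> borel_measurable borel"
    and B: "\<And>x. \<bar>f x\<bar> \<le> B"
  shows "(\<lambda>n. l ^ n / fact n * exp (- l) * (LINT x|convpow M n. f x)) sums (LINT x|cpoisson l M. f x)"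
proof -
  let ?p = "measure_pmf (poisson_pmf l)"
  have bd: "\<bar>LINT x|convpow M n. f x\<bar> \<le> B" for n
    using borel_prob.integral_bounded_le[OF borel_prob_convpow[OF M], of f B] B by simp
  have "(LINT x|cpoisson l M. f x) = (LINT n|?p. LINT x|convpow M n. f x)"
    unfolding cpoisson_def
  proof (rule integral_bind[where K = borel and B = B and B' = 1])
    show "AE n in ?p. emeasure (convpow M n) (space (convpow M n)) \<le> ennreal 1"
      using borel_prob_convpow[OF M] by (simp add: borel_prob_def prob_space.emeasure_space_1)
  qed (use B convpow_measurable[OF M] measure_pmf.finite_measure_axioms in \<open>simp_all add: f\<close>)
  also have "(LINT n|?p. LINT x|convpow M n. f x) = (LINT n|count_space UNIV. l ^ n / fact n * exp (- l) * (LINT x|convpow M n. f x))"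
    using l by (simp add: measure_pmf_eq_density integral_density)
  finally have *: "(LINT x|cpoisson l M. f x) = (LINT n|count_space UNIV. l ^ n / fact n * exp (- l) * (LINT x|convpow M n. f x))" .
  have "integrable ?p (\<lambda>n. LINT x|convpow M n. f x)"
    using bd by (intro measure_pmf.integrable_const_bound[where B = B]) auto
  then have "integrable (count_space UNIV) (\<lambda>n. l ^ n / fact n * exp (- l) * (LINT x|convpow M n. f x))"
    using l by (simp add: measure_pmf_eq_density integrable_density)
  from sums_integral_count_space_nat[OF this] show ?thesis
    by (simp add: *)
qed

lemma cf_cpoisson:
  assumes M: "borel_prob M" and l: "0 < l"
  shows "cf (cpoisson l M) \<xi> = exp (of_real l * (cf M \<xi> - 1))"
proof -
  let ?p = "\<lambda>n. l ^ n / fact n * exp (- l)"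
  \<comment> \<open>\<open>cpoisson_sums\<close> is about real integrands, so the plane wave is
    split into cosine and sine.\<close>
  have Re: "Re (cf K \<xi>) = (LINT x|K. cos (\<xi> \<bullet> x))" and Im: "Im (cf K \<xi>) = (LINT x|K. sin (\<xi> \<bullet> x))"
    if "borel_prob K" for K
  proof -
    have "integrable K (\<lambda>x. cis (\<xi> \<bullet> x))"
      by (rule borel_prob.integrable_bounded[OF that, of _ 1]) auto
    then show "Re (cf K \<xi>) = (LINT x|K. cos (\<xi> \<bullet> x))" "Im (cf K \<xi>) = (LINT x|K. sin (\<xi> \<bullet> x))"
      by (simp_all add: cf_def integral_Re[symmetric] integral_Im[symmetric] del: integral_Re integral_Im)
  qed
  have "(\<lambda>n. of_real (?p n) * cf (convpow M n) \<xi>) sums cf (cpoisson l M) \<xi>"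
    using cpoisson_sums[OF M l, of "\<lambda>x. cos (\<xi> \<bullet> x)" 1] cpoisson_sums[OF M l, of "\<lambda>x. sin (\<xi> \<bullet> x)" 1]
    by (simp add: sums_complex_iff Re Im M borel_prob_cpoisson borel_prob_convpow
        del: of_real_mult of_real_power of_real_divide times_divide_eq_left)
  then have 1: "(\<lambda>n. of_real (?p n) * cf M \<xi> ^ n) sums cf (cpoisson l M) \<xi>"
    by (simp add: cf_convpow M)
  have "(\<lambda>n. exp (- of_real l) * ((of_real l * cf M \<xi>) ^ n /\<^sub>R fact n)) sums
      (exp (- of_real l) * exp (of_real l * cf M \<xi>))"
    by (intro sums_mult exp_converges)
  also have "(\<lambda>n. exp (- of_real l) * ((of_real l * cf M \<xi>) ^ n /\<^sub>R fact n)) =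
      (\<lambda>n. of_real (?p n) * cf M \<xi> ^ n)"
    by (simp add: fun_eq_iff scaleR_conv_of_real power_mult_distrib field_simps exp_of_real[symmetric])
  finally have "cf (cpoisson l M) \<xi> = exp (- of_real l) * exp (of_real l * cf M \<xi>)"
    using 1 sums_unique2 by blast
  then show ?thesis
    by (simp add: exp_add[symmetric] algebra_simps)
qed

text \<open>The Poisson generating function: averaging \<open>c ^ n\<close> over a Poisson number of
  jumps gives \<open>exp (l * (c - 1))\<close>. This stays bounded when \<open>l\<close> is of order
  \<open>1 / \<epsilon>\<^sup>2\<close> and \<open>c - 1\<close> of order
  \<open>\<epsilon>\<^sup>2\<close>.\<close>

lemma nn_integral_cpoisson_le:
  assumes M: "borel_prob M" and l: "0 < l" and V[measurable]: "V \<in> borel_measurable borel"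
    and c: "\<And>x. (\<integral>\<^sup>+z. V (x + z) \<partial>M) \<le> ennreal c * V x" and "0 \<le> c"
  shows "(\<integral>\<^sup>+z. V (x + z) \<partial>cpoisson l M) \<le> ennreal (exp (l * (c - 1))) * V x"
proof -
  have s: "(\<lambda>n. l ^ n / fact n * exp (- l) * c ^ n) sums (exp (- l) * exp (l * c))"
    using sums_mult[OF exp_converges[of "l * c"], of "exp (- l)"]
    by (simp add: power_mult_distrib field_simps)
  have "(\<integral>\<^sup>+z. V (x + z) \<partial>cpoisson l M) =
      (\<Sum>n. ennreal (l ^ n / fact n * exp (- l)) * (\<integral>\<^sup>+z. V (x + z) \<partial>convpow M n))"
    by (intro nn_integral_cpoisson M l) measurable
  also have "\<dots> \<le> (\<Sum>n. ennreal (l ^ n / fact n * exp (- l)) * (ennreal c ^ n * V x))"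
    by (intro suminf_le mult_left_mono nn_integral_convpow_le M c) (auto intro: summableI)
  also have "\<dots> = (\<Sum>n. ennreal (l ^ n / fact n * exp (- l) * c ^ n) * V x)"
    using l \<open>0 \<le> c\<close>
    by (simp add: ennreal_mult[symmetric] ennreal_power mult.assoc[symmetric] del: times_divide_eq_left)
  also have "\<dots> = (\<Sum>n. ennreal (l ^ n / fact n * exp (- l) * c ^ n)) * V x"
    by (rule ennreal_suminf_multc)
  also have "(\<Sum>n. ennreal (l ^ n / fact n * exp (- l) * c ^ n)) = ennreal (exp (- l) * exp (l * c))"
    using s l \<open>0 \<le> c\<close> by (intro suminf_ennreal_eq) auto
  also have "exp (- l) * exp (l * c) = exp (l * (c - 1))"
    by (simp add: exp_add[symmetric] algebra_simps)
  finally show ?thesis .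
qed

section \<open>Shifts of compound Poisson laws\<close>

text \<open>A Wallis type bound, squared to keep the induction free of roots. Passing from
  \<open>k\<close> to \<open>k + 1\<close> multiplies the left side by
  \<open>4 * (2 * k + 1) * (2 * k + 3) / (k + 1)\<^sup>2\<close>, which is at most
  \<open>16\<close>.\<close>

lemma central_binomial_square_le: "(real ((2 * k) choose k))\<^sup>2 * (2 * real k + 1) \<le> 16 ^ k"
proof (induction k)
  case (Suc k)
  define c c' where "c = real ((2 * k) choose k)" and "c' = real ((2 * Suc k) choose Suc k)"
  have "Suc k * (Suc (2 * k) choose Suc k) = Suc (2 * k) * ((2 * k) choose k)"
    by (rule Suc_times_binomial)
  moreover have "(2 * Suc k) choose Suc k = 2 * (Suc (2 * k) choose Suc k)"
    using binomial_symmetric[of k "Suc (2 * k)"] by simp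
  ultimately have "Suc k * ((2 * Suc k) choose Suc k) = 2 * (Suc (2 * k) * ((2 * k) choose k))"
    by (metis mult.left_commute)
  then have "real (Suc k * ((2 * Suc k) choose Suc k)) = real (2 * (Suc (2 * k) * ((2 * k) choose k)))"
    by (rule arg_cong)
  then have *: "(real k + 1) * c' = 2 * (2 * real k + 1) * c"
    unfolding c_def c'_def of_nat_mult by (simp add: algebra_simps del: binomial_Suc_Suc)
  have IH: "c\<^sup>2 * (2 * real k + 1) \<le> 16 ^ k" using Suc by (simp add: c_def)
  have "(real k + 1)\<^sup>2 * (c'\<^sup>2 * (2 * real k + 3)) = ((real k + 1) * c')\<^sup>2 * (2 * real k + 3)"
    by (simp add: power_mult_distrib)
  also have "\<dots> = 4 * (c\<^sup>2 * (2 * real k + 1)) * ((2 * real k + 1) * (2 * real k + 3))"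
    unfolding * by (simp add: power2_eq_square algebra_simps)
  also have "\<dots> \<le> 4 * 16 ^ k * (4 * (real k + 1)\<^sup>2)"
  proof (rule mult_mono)
    show "(2 * real k + 1) * (2 * real k + 3) \<le> 4 * (real k + 1)\<^sup>2"
      by (simp add: power2_eq_square algebra_simps)
  qed (use IH in auto)
  finally have "(real k + 1)\<^sup>2 * (c'\<^sup>2 * (2 * real k + 3)) \<le> (real k + 1)\<^sup>2 * 16 ^ Suc k"
    by simp
  then have "c'\<^sup>2 * (2 * real k + 3) \<le> 16 ^ Suc k"
    by (rule mult_left_le_imp_le) simp
  then show ?case unfolding c'_def by (simp add: add.commute)
qed simp

text \<open>The central coefficient of an odd row is half that of the next row, which is
  even.\<close>

lemma middle_binomial_le: "real (n choose (n div 2)) / 2 ^ n \<le> 1 / sqrt (real n + 1)"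
proof -
  have 16: "(2 ^ (2 * k))\<^sup>2 = (16::real) ^ k" for k
    by (simp add: power_mult[symmetric] mult.commute[of k]) (simp add: power_mult)
  have "real (n choose (n div 2)) ^ 2 * (real n + 1) \<le> (2 ^ n) ^ 2"
  proof (cases "even n")
    case True
    then obtain k where n: "n = 2 * k" by blast
    show ?thesis using central_binomial_square_le[of k] by (simp add: n 16)
  next
    case False
    then obtain k where n: "n = 2 * k + 1" by (metis oddE)
    define c where "c = real (Suc (2 * k) choose k)"
    have "(2 * Suc k) choose Suc k = 2 * (Suc (2 * k) choose k)"
      using binomial_symmetric[of k "Suc (2 * k)"] by simp
    then have "(2 * c)\<^sup>2 * (2 * real k + 3) \<le> 16 ^ Suc k"
      using central_binomial_square_le[of "Suc k"] unfolding c_def by (simp add: algebra_simps)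
    then have "c\<^sup>2 * (2 * real k + 3) \<le> 4 * 16 ^ k"
      by (simp add: power_mult_distrib)
    moreover have "c\<^sup>2 * (2 * real k + 2) \<le> c\<^sup>2 * (2 * real k + 3)"
      by (intro mult_left_mono) auto
    ultimately have "c\<^sup>2 * (2 * real k + 2) \<le> 4 * 16 ^ k" by linarith
    then show ?thesis by (simp add: n power_mult_distrib 16 c_def add.commute)
  qed
  then have "(real (n choose (n div 2)) * sqrt (real n + 1)) ^ 2 \<le> (2 ^ n) ^ 2"
    by (simp add: power_mult_distrib)
  then have "real (n choose (n div 2)) * sqrt (real n + 1) \<le> 2 ^ n"
    by (rule power2_le_imp_le) simp
  then show ?thesis by (simp add: field_simps)
qed

section \<open>Fair coin tosses against a shift\<close>

text \<open>The effect on \<phi> of a shift by \<open>h\<close>, averaged over \<open>j\<close> fair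
  coin tosses that each add \<open>0\<close> or \<open>h\<close>. It acts on a function rather than
  on laws because total variation is bounded by testing.\<close>

primrec avg_diff :: "('a::real_vector \<Rightarrow> real) \<Rightarrow> 'a \<Rightarrow> nat \<Rightarrow> 'a \<Rightarrow> real" where
  "avg_diff \<phi> h 0 x = \<phi> (x + h) - \<phi> x"
| "avg_diff \<phi> h (Suc j) x = (avg_diff \<phi> h j x + avg_diff \<phi> h j (x + h)) / 2"

text \<open>\<open>bdiff j i\<close> is the coefficient of \<open>\<phi> (x + i h)\<close> in \<open>2 ^ j\<close> times the \<open>j\<close>-fold average of the
  difference \<open>\<phi> (x + h) - \<phi> x\<close>; the coefficients change sign only once, so the sum of their moduli
  telescopes to a central binomial coefficient.\<close>

definition bdiff :: "nat \<Rightarrow> nat \<Rightarrow> real" where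
  "bdiff j i = (if i = 0 then 0 else real (j choose (i - 1))) - real (j choose i)"

lemma bdiff_Suc: "bdiff (Suc j) i = bdiff j i + (if i = 0 then 0 else bdiff j (i - 1))"
  by (cases i; cases "i - 1") (auto simp: bdiff_def)

lemma bdiff_beyond: "bdiff j (Suc (Suc j)) = 0"
  by (simp add: bdiff_def binomial_eq_0)

lemma avg_diff_eq: "avg_diff \<phi> h j x = (\<Sum>i\<le>Suc j. bdiff j i * \<phi> (x + real i *\<^sub>R h)) / 2 ^ j"
proof (induction j arbitrary: x)
  case 0
  show ?case by (simp add: bdiff_def)
next
  case (Suc j)
  let ?g = "\<lambda>i. \<phi> (x + real i *\<^sub>R h)"
  have "(\<Sum>i\<le>Suc (Suc j). bdiff (Suc j) i * ?g i) =
      (\<Sum>i\<le>Suc (Suc j). bdiff j i * ?g i) + (\<Sum>i\<le>Suc (Suc j). (if i = 0 then 0 else bdiff j (i - 1)) * ?g i)"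
    by (simp only: bdiff_Suc distrib_right sum.distrib)
  also have "(\<Sum>i\<le>Suc (Suc j). bdiff j i * ?g i) = (\<Sum>i\<le>Suc j. bdiff j i * ?g i)"
    by (subst sum.atMost_Suc) (simp add: bdiff_beyond)
  also have "(\<Sum>i\<le>Suc (Suc j). (if i = 0 then 0 else bdiff j (i - 1)) * ?g i) =
      (\<Sum>i\<le>Suc j. bdiff j i * ?g (Suc i))"
    by (subst sum.atMost_Suc_shift) simp
  finally have "(\<Sum>i\<le>Suc (Suc j). bdiff (Suc j) i * ?g i) =
    (\<Sum>i\<le>Suc j. bdiff j i * ?g i) + (\<Sum>i\<le>Suc j. bdiff j i * ?g (Suc i))" .
  moreover have "x + h + real i *\<^sub>R h = x + real (Suc i) *\<^sub>R h" for i
    by (simp add: algebra_simps)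
  ultimately show ?case
    by (simp only: avg_diff.simps Suc.IH) (simp add: field_simps)
qed

lemma sum_abs_bdiff: "(\<Sum>i\<le>Suc j. \<bar>bdiff j i\<bar>) = 2 * real (j choose (j div 2))"
proof -
  let ?m = "j div 2"
  have 1: "(\<Sum>i\<le>k. \<bar>bdiff j i\<bar>) = real (j choose k)" if "k \<le> ?m" for k
    using that
  proof (induction k)
    case (Suc k)
    then have "j choose k \<le> j choose Suc k"
      by (intro binomial_mono) auto
    with Suc show ?case by (simp add: bdiff_def)
  qed (simp add: bdiff_def)
  have 2: "(\<Sum>i\<in>{?m<..?m + k}. \<bar>bdiff j i\<bar>) = real (j choose ?m) - real (j choose (?m + k))"
    if "?m + k \<le> Suc j" for k
    using that
  proof (induction k)
    case (Suc k)
    have "j choose Suc (?m + k) \<le> j choose (?m + k)"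
    proof (cases "Suc (?m + k) \<le> j")
      case True
      then show ?thesis by (intro binomial_antimono) auto
    qed (simp add: binomial_eq_0)
    moreover have "{?m<..?m + Suc k} = insert (Suc (?m + k)) {?m<..?m + k}" by auto
    ultimately show ?case using Suc by (simp add: bdiff_def)
  qed simp
  \<comment> \<open>Both ranges telescope to the middle coefficient. The index \<open>Suc j\<close>
    has to be included: the second sum ends only where \<open>j choose Suc j\<close> is
    \<open>0\<close>.\<close>
  have "{..Suc j} = {..?m} \<union> {?m<..?m + (Suc j - ?m)}" by auto
  then have "(\<Sum>i\<le>Suc j. \<bar>bdiff j i\<bar>) = (\<Sum>i\<le>?m. \<bar>bdiff j i\<bar>) + (\<Sum>i\<in>{?m<..?m + (Suc j - ?m)}. \<bar>bdiff j i\<bar>)"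
    by (simp only:) (rule sum.union_disjoint, auto)
  also have "\<dots> = 2 * real (j choose ?m)"
    by (subst 1, simp, subst 2) (auto simp: binomial_eq_0)
  finally show ?thesis .
qed

text \<open>A binomial law is unimodal, so the absolute differences between it and its translate by
  one step add up to twice its largest weight.\<close>

lemma avg_diff_le:
  assumes "\<And>x. \<bar>\<phi> x\<bar> \<le> 1"
  shows "\<bar>avg_diff \<phi> h j x\<bar> \<le> 2 / sqrt (real j + 1)"
proof -
  have "\<bar>\<Sum>i\<le>Suc j. bdiff j i * \<phi> (x + real i *\<^sub>R h)\<bar> \<le> (\<Sum>i\<le>Suc j. \<bar>bdiff j i\<bar> * 1)"
    by (intro order_trans[OF sum_abs] sum_mono) (unfold abs_mult, intro mult_left_mono assms, simp)
  also have "\<dots> = 2 * real (j choose (j div 2))"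
    using sum_abs_bdiff by simp
  finally have "\<bar>avg_diff \<phi> h j x\<bar> \<le> 2 * (real (j choose (j div 2)) / 2 ^ j)"
    unfolding avg_diff_eq by (simp add: field_simps)
  also have "\<dots> \<le> 2 * (1 / sqrt (real j + 1))"
    by (intro mult_left_mono middle_binomial_le) simp
  finally show ?thesis by simp
qed

lemma avg_diff_measurable [measurable]:
  fixes \<phi> :: "'a::euclidean_space \<Rightarrow> real"
  assumes [measurable]: "\<phi> \<in> borel_measurable borel"
  shows "avg_diff \<phi> h j \<in> borel_measurable borel"
proof (induction j)
  case 0
  have "avg_diff \<phi> h 0 = (\<lambda>x. \<phi> (x + h) - \<phi> x)" by auto
  then show ?case by simp
next
  case (Suc j)
  note [measurable] = Suc
  have "avg_diff \<phi> h (Suc j) = (\<lambda>x. (avg_diff \<phi> h j x + avg_diff \<phi> h j (x + h)) / 2)" by auto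
  then show ?case by simp
qed

section \<open>Mineka's coupling\<close>

text \<open>The induction step of the coupling: with probability \<open>p\<close> the budget
  \<open>y\<close> gains one toss, otherwise nothing. As \<open>1 / sqrt\<close> is convex, the mean
  cannot be bounded by the value at \<open>y + p\<close>; a quarter of the gain survives.\<close>

lemma inverse_sqrt_convex_step:
  fixes p y :: real
  assumes "0 \<le> p" "p \<le> 1" "1 \<le> y"
  shows "p * (1 / sqrt (y + 1)) + (1 - p) * (1 / sqrt y) \<le> 1 / sqrt (y + p / 4)"
proof -
  have 1: "sqrt (y / (y + 1)) \<le> 1 - 1 / (2 * (y + 1))"
  proof (rule real_le_lsqrt)
    have "(1 - t / 2)\<^sup>2 = 1 - t + (t / 2)\<^sup>2" for t :: real
      by (simp add: power2_eq_square field_simps)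
    from this[of "1 / (y + 1)"] have "(1 - 1 / (2 * (y + 1)))\<^sup>2 = 1 - 1 / (y + 1) + (1 / (2 * (y + 1)))\<^sup>2"
      by (simp add: mult.commute)
    also have "1 - 1 / (y + 1) = y / (y + 1)" using assms by (simp add: field_simps)
    finally show "y / (y + 1) \<le> (1 - 1 / (2 * (y + 1)))\<^sup>2" by simp
    show "0 \<le> 1 - 1 / (2 * (y + 1))" using assms by (simp add: field_simps)
  qed
  \<comment> \<open>After multiplication by \<open>sqrt y\<close> two roots are compared:
    \<open>sqrt (y / (y + 1))\<close> is bounded above by a rational function, and
    \<open>sqrt (1 - u)\<close> below by \<open>1 - u\<close>. The quarter and
    \<open>1 \<le> y\<close> together give \<open>u \<le> p / (2 * (y + 1))\<close>.\<close>
  define u where "u = (p / 4) / (y + p / 4)"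
  have u: "0 \<le> u" "u \<le> 1" "u \<le> p / (2 * (y + 1))"
  proof -
    show "0 \<le> u" "u \<le> 1" using assms by (auto simp: u_def field_simps)
    have "u \<le> (p / 4) / y" unfolding u_def using assms by (intro divide_left_mono) auto
    also have "\<dots> \<le> p / (2 * (y + 1))"
    proof -
      have "p * (2 * (y + 1)) \<le> p * (4 * y)" using assms by (intro mult_left_mono) auto
      then show ?thesis using assms by (simp add: field_simps)
    qed
    finally show "u \<le> p / (2 * (y + 1))" .
  qed
  have "1 - u \<le> sqrt (1 - u)"
    using u by (intro real_le_rsqrt) (simp add: power2_eq_square mult_left_le)
  moreover have "1 - u = y / (y + p / 4)"
    using assms by (simp add: u_def field_simps)
  ultimately have 2: "1 - p / (2 * (y + 1)) \<le> sqrt (y / (y + p / 4))"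
    using u by simp
  have "p * sqrt (y / (y + 1)) + (1 - p) \<le> p * (1 - 1 / (2 * (y + 1))) + (1 - p)"
    using 1 assms by (intro add_right_mono mult_left_mono) auto
  also have "\<dots> = 1 - p / (2 * (y + 1))" by (simp add: algebra_simps)
  also note 2
  finally have "(p * sqrt (y / (y + 1)) + (1 - p)) / sqrt y \<le> sqrt (y / (y + p / 4)) / sqrt y"
    using assms by (intro divide_right_mono) auto
  then show ?thesis
    using assms by (simp add: real_sqrt_divide add_divide_distrib)
qed

text \<open>A jump with law \<open>M\<close> contains, with probability \<open>p\<close>, a fair coin toss between \<open>z\<close> and \<open>z + h\<close>.\<close>

locale split_shift = M: borel_prob M + A: finite_measure A
  for M A :: "'a::euclidean_space measure" and h :: 'a and p :: real +
  assumes sets_A [simp, measurable_cong]: "sets A = sets borel"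
    and p_def: "p = measure A UNIV"
    and dom: "\<And>(g :: 'a \<Rightarrow> real) B. g \<in> borel_measurable borel \<Longrightarrow> (\<And>x. 0 \<le> g x \<and> g x \<le> B) \<Longrightarrow>
      (LINT z|A. (g z + g (z + h)) / 2) \<le> (LINT z|M. g z)"
begin

lemma space_A [simp]: "space A = UNIV"
  using sets_eq_imp_space_eq[OF sets_A] by simp

lemma A_integrable:
  fixes f :: "'a \<Rightarrow> real"
  assumes [measurable]: "f \<in> borel_measurable borel" and "\<And>x. \<bar>f x\<bar> \<le> B"
  shows "integrable A f"
  using assms by (intro A.integrable_const_bound[of _ B]) auto

lemma p_nonneg: "0 \<le> p"
  by (simp add: p_def)

lemma p_le_1: "p \<le> 1"
  using dom[of "\<lambda>_. 1" 1] M.prob_space by (simp add: p_def)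

text \<open>What remains of \<open>M\<close> once the coin toss is removed is a positive functional
  of mass \<open>1 - p\<close>. Positivity is read off from \<open>dom\<close>, applied to the
  nonnegative functions \<open>s + g\<close> and \<open>s - g\<close>.\<close>

lemma rest_le:
  assumes g[measurable]: "g \<in> borel_measurable borel" and s: "\<And>x. \<bar>g x\<bar> \<le> s"
  shows "\<bar>(LINT z|M. g z) - (LINT z|A. (g z + g (z + h)) / 2)\<bar> \<le> s * (1 - p)"
proof -
  have i: "integrable M g" using s by (intro M.integrable_bounded[of _ s]) auto
  have iA: "integrable A (\<lambda>z. (g z + g (z + h)) / 2)"
  proof (rule A_integrable[of _ s])
    show "\<bar>(g x + g (x + h)) / 2\<bar> \<le> s" for x using s[of x] s[of "x + h"] by (simp add: abs_le_iff)
  qed measurable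
  have s': "- s \<le> g x" "g x \<le> s" for x using s[of x] by auto
  have "(LINT z|A. ((s + g z) + (s + g (z + h))) / 2) \<le> (LINT z|M. s + g z)"
  proof (rule dom[of _ "2 * s"])
    show "0 \<le> s + g x \<and> s + g x \<le> 2 * s" for x using s'[of x] by auto
  qed measurable
  also have "(\<lambda>z. ((s + g z) + (s + g (z + h))) / 2) = (\<lambda>z. s + (g z + g (z + h)) / 2)"
    by (auto simp: field_simps)
  finally have 1: "p * s + (LINT z|A. (g z + g (z + h)) / 2) \<le> s + (LINT z|M. g z)"
    using i iA M.prob_space by (simp add: p_def del: M.space_M space_A) simp
  have "(LINT z|A. ((s - g z) + (s - g (z + h))) / 2) \<le> (LINT z|M. s - g z)"
  proof (rule dom[of _ "2 * s"])
    show "0 \<le> s - g x \<and> s - g x \<le> 2 * s" for x using s'[of x] by auto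
  qed measurable
  also have "(\<lambda>z. ((s - g z) + (s - g (z + h))) / 2) = (\<lambda>z. s - (g z + g (z + h)) / 2)"
    by (auto simp: field_simps)
  finally have 2: "p * s - (LINT z|A. (g z + g (z + h)) / 2) \<le> s - (LINT z|M. g z)"
    using i iA M.prob_space by (simp add: p_def del: M.space_M space_A) simp
  from 1 2 show ?thesis by (simp add: abs_le_iff algebra_simps)
qed

text \<open>The coupling in analytic form: a jump that contains a toss raises \<open>j\<close> by
  one, while the rest of the jump law, of mass \<open>1 - p\<close>, leaves \<open>j\<close> as it
  is. Hence the induction over \<open>n\<close> keeps \<open>j\<close> arbitrary and tracks the
  budget \<open>p * n / 4 + j + 1\<close>.\<close>

lemma convpow_avg_diff_le:
  assumes [measurable]: "\<phi> \<in> borel_measurable borel" and \<phi>: "\<And>x. \<bar>\<phi> x\<bar> \<le> 1"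
  shows "\<bar>LINT z|convpow M n. avg_diff \<phi> h j (x + z)\<bar> \<le> 2 / sqrt (p * real n / 4 + real j + 1)"
proof (induction n arbitrary: j x)
  case 0
  show ?case using avg_diff_le[of \<phi> h j x, OF \<phi>] by (simp add: integral_return)
next
  case (Suc n)
  note M = M.borel_prob_axioms
  interpret N: borel_prob "convpow M n" by (rule borel_prob_convpow[OF M])
  interpret NA: pair_sigma_finite "convpow M n" A ..
  let ?G = "\<lambda>j z. LINT y|convpow M n. avg_diff \<phi> h j (x + z + y)"
  have bd: "\<bar>avg_diff \<phi> h j z\<bar> \<le> 2" for j z
    using avg_diff_le[of \<phi> h j z, OF \<phi>] by (rule order_trans) (auto simp: field_simps)
  have int: "integrable (convpow M n) (\<lambda>y. avg_diff \<phi> h j (z + y))" for j z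
    using bd by (intro N.integrable_bounded[of _ 2]) auto
  have [measurable]: "?G j \<in> borel_measurable borel" for j
    by measurable
  have G: "\<bar>?G j z\<bar> \<le> 2 / sqrt (p * real n / 4 + real j + 1)" for j z
    using Suc.IH by blast
  have "(LINT z|convpow M (Suc n). avg_diff \<phi> h j (x + z)) = (LINT z|M. LINT y|convpow M n. avg_diff \<phi> h j (x + (y + z)))"
    unfolding convpow.simps using bd
    by (intro integral_conv2'[OF N.borel_prob_axioms M, of _ 2]) auto
  then have e1: "(LINT z|convpow M (Suc n). avg_diff \<phi> h j (x + z)) = (LINT z|M. ?G j z)"
    by (simp add: algebra_simps)
  \<comment> \<open>Averaging over \<open>z\<close> and \<open>z + h\<close> is one more toss, by
    the recursion of \<open>avg_diff\<close>.\<close>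
  have e2: "(?G j z + ?G j (z + h)) / 2 = ?G (Suc j) z" for z
  proof -
    have "?G (Suc j) z = (LINT y|convpow M n. (avg_diff \<phi> h j (x + z + y) + avg_diff \<phi> h j (x + (z + h) + y)) / 2)"
      by (simp add: algebra_simps)
    also have "\<dots> = (?G j z + ?G j (z + h)) / 2"
      using int by (simp del: add.assoc)
    finally show ?thesis by simp
  qed
  have y: "1 \<le> p * real n / 4 + real j + 1" using p_nonneg by simp
  have "\<bar>LINT z|A. ?G (Suc j) z\<bar> \<le> (LINT z|A. \<bar>?G (Suc j) z\<bar>)"
    using integral_norm_bound[of A "?G (Suc j)"] by simp
  also have "\<dots> \<le> (LINT z|A. 2 / sqrt (p * real n / 4 + real (Suc j) + 1))"
  proof (rule integral_mono[OF _ _ G])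
    have "\<bar>\<bar>?G (Suc j) z\<bar>\<bar> \<le> 2 / sqrt (p * real n / 4 + real (Suc j) + 1)" for z
      using G[of "Suc j"] by (simp only: abs_abs)
    then show "integrable A (\<lambda>z. \<bar>?G (Suc j) z\<bar>)"
      by (intro A_integrable) measurable
  qed simp
  finally have a: "\<bar>LINT z|A. ?G (Suc j) z\<bar> \<le> p * (2 / sqrt (p * real n / 4 + real j + 1 + 1))"
    by (simp add: p_def add_ac)
  have "\<bar>(LINT z|M. ?G j z) - (LINT z|A. ?G (Suc j) z)\<bar> \<le> (2 / sqrt (p * real n / 4 + real j + 1)) * (1 - p)"
    unfolding e2[symmetric] by (intro rest_le G) measurable
  with a have "\<bar>LINT z|M. ?G j z\<bar> \<le>
      2 * (p * (1 / sqrt (p * real n / 4 + real j + 1 + 1)) + (1 - p) * (1 / sqrt (p * real n / 4 + real j + 1)))"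
    by (simp add: algebra_simps del: avg_diff.simps)
  also have "\<dots> \<le> 2 * (1 / sqrt (p * real n / 4 + real j + 1 + p / 4))"
    by (intro mult_left_mono inverse_sqrt_convex_step p_nonneg p_le_1 y) simp
  finally show ?case unfolding e1 by (simp add: field_simps)
qed

end

text \<open>The mean of \<open>1 / (N + 1)\<close> for a Poisson variable \<open>N\<close>: an
  exponential series with its index moved by one. It stands in for the mean of
  \<open>1 / sqrt (N + 1)\<close>, which has no such closed form.\<close>

lemma poisson_inverse_sums:
  fixes l :: real
  assumes "0 < l"
  shows "(\<lambda>n. l ^ n / fact n * exp (- l) * (1 / (real n + 1))) sums ((1 - exp (- l)) / l)"
proof -
  have "(\<lambda>n. l ^ Suc n /\<^sub>R fact (Suc n)) sums (exp l - 1)"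
    using exp_converges[of l] by (subst sums_Suc_iff) simp
  from sums_mult[OF this, of "exp (- l) / l"] show ?thesis
    using assms by (simp add: field_simps exp_minus)
qed

context split_shift
begin

text \<open>By \<open>convpow_avg_diff_le\<close> a shift is hidden by \<open>n\<close> jumps up to
  order \<open>1 / sqrt (p * (n + 1))\<close>; averaging over the Poisson number of jumps replaces
  \<open>n + 1\<close> by \<open>l\<close>.\<close>

lemma cpoisson_shift_le:
  assumes [measurable]: "\<phi> \<in> borel_measurable borel" and \<phi>: "\<And>x. \<bar>\<phi> x\<bar> \<le> 1"
    and l: "0 < l" and p: "0 < p"
  shows "\<bar>(LINT z|cpoisson l M. \<phi> (x + h + z)) - (LINT z|cpoisson l M. \<phi> (x + z))\<bar> \<le> 4 / sqrt (p * l)"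
proof -
  note M = M.borel_prob_axioms
  interpret P: borel_prob "cpoisson l M" by (rule borel_prob_cpoisson[OF M])
  let ?w = "\<lambda>n. l ^ n / fact n * exp (- l)"
  let ?I = "\<lambda>n. LINT z|convpow M n. avg_diff \<phi> h 0 (x + z)"
  have w: "0 \<le> ?w n" for n using l by simp
  have wsum: "?w sums 1"
    using sums_mult[OF exp_converges[of l], of "exp (- l)"] by (simp add: exp_minus field_simps)
  have I: "\<bar>?I n\<bar> \<le> 4 / sqrt p * (1 / sqrt (real n + 1))" for n
  proof -
    have "\<bar>?I n\<bar> \<le> 2 / sqrt (p * real n / 4 + real 0 + 1)"
      by (rule convpow_avg_diff_le) (use \<phi> in auto)
    also have "\<dots> \<le> 2 / sqrt (p / 4 * (real n + 1))"
    proof (rule divide_left_mono)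
      have "0 < p * real n / 4 + real 0 + 1" "0 < p / 4 * (real n + 1)"
        using p by (auto intro: add_nonneg_pos)
      then show "0 < sqrt (p * real n / 4 + real 0 + 1) * sqrt (p / 4 * (real n + 1))"
        by (simp only: real_sqrt_gt_zero mult_pos_pos)
    qed (use p p_le_1 in \<open>auto simp: field_simps\<close>)
    also have "\<dots> = 4 / sqrt p * (1 / sqrt (real n + 1))"
      by (simp add: real_sqrt_mult real_sqrt_divide)
    finally show ?thesis .
  qed
  let ?t = "1 / sqrt l"
  \<comment> \<open>The inequality between the arithmetic and geometric means, balanced so that both
    terms have Poisson mean at most \<open>1 / sqrt l\<close>.\<close>
  have amgm: "1 / sqrt (real n + 1) \<le> (?t + sqrt l * (1 / (real n + 1))) / 2" for n
  proof -
    define a b where "a = 1 / sqrt (sqrt l)" and "b = sqrt (sqrt l) / sqrt (real n + 1)"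
    have "2 * a * b \<le> a\<^sup>2 + b\<^sup>2" by (rule sum_squares_bound)
    moreover have "a * b = 1 / sqrt (real n + 1)" "a\<^sup>2 = ?t" "b\<^sup>2 = sqrt l * (1 / (real n + 1))"
      using l by (auto simp: a_def b_def power_divide)
    ultimately show ?thesis by simp
  qed
  have s: "(\<lambda>n. ?w n * ?I n) sums (LINT z|cpoisson l M. avg_diff \<phi> h 0 (x + z))"
  proof (rule cpoisson_sums[OF M l, of _ 2])
    show "\<bar>avg_diff \<phi> h 0 (x + z)\<bar> \<le> 2" for z
      using \<phi>[of "x + z"] \<phi>[of "x + z + h"] by simp
  qed (simp del: avg_diff.simps)
  have u: "(\<lambda>n. 4 / sqrt p * ((?t * ?w n + sqrt l * (?w n * (1 / (real n + 1)))) / 2)) sums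
      (4 / sqrt p * ((?t * 1 + sqrt l * ((1 - exp (- l)) / l)) / 2))"
    by (intro sums_mult sums_divide sums_add wsum poisson_inverse_sums l)
  have le: "\<bar>?w n * ?I n\<bar> \<le> 4 / sqrt p * ((?t * ?w n + sqrt l * (?w n * (1 / (real n + 1)))) / 2)" for n
  proof -
    have "\<bar>?w n * ?I n\<bar> \<le> ?w n * (4 / sqrt p * (1 / sqrt (real n + 1)))"
      using mult_left_mono[OF I[of n] w[of n]] w[of n] by (simp only: abs_mult[of "?w n"] abs_of_nonneg)
    also have "\<dots> \<le> ?w n * (4 / sqrt p * ((?t + sqrt l * (1 / (real n + 1))) / 2))"
      using p by (intro mult_left_mono amgm w) auto
    also have "\<dots> = 4 / sqrt p * ((?t * ?w n + sqrt l * (?w n * (1 / (real n + 1)))) / 2)"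
      by (simp add: algebra_simps)
    finally show ?thesis .
  qed
  have "\<bar>LINT z|cpoisson l M. avg_diff \<phi> h 0 (x + z)\<bar> \<le> 4 / sqrt p * ((?t * 1 + sqrt l * ((1 - exp (- l)) / l)) / 2)"
  proof -
    have "norm (suminf (\<lambda>n. ?w n * ?I n)) \<le> suminf (\<lambda>n. 4 / sqrt p * ((?t * ?w n + sqrt l * (?w n * (1 / (real n + 1)))) / 2))"
      using le u by (intro norm_suminf_le) (auto simp: sums_iff simp del: avg_diff.simps)
    then show ?thesis using s u by (simp add: sums_iff del: avg_diff.simps)
  qed
  also have "\<dots> \<le> 4 / sqrt p * ((?t * 1 + sqrt l * (1 / l)) / 2)"
    using l p by (intro mult_left_mono divide_right_mono add_left_mono) auto
  also have "sqrt l * (1 / l) = ?t"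
    using l by (simp add: field_simps)
  finally have "\<bar>LINT z|cpoisson l M. avg_diff \<phi> h 0 (x + z)\<bar> \<le> 4 / sqrt (p * l)"
    by (simp add: real_sqrt_mult)
  moreover have "(LINT z|cpoisson l M. avg_diff \<phi> h 0 (x + z)) =
      (LINT z|cpoisson l M. \<phi> (x + h + z)) - (LINT z|cpoisson l M. \<phi> (x + z))"
    using \<phi> by (subst Bochner_Integration.integral_diff[symmetric])
      (auto intro!: P.integrable_bounded[of _ 1] simp: add_ac)
  ultimately show ?thesis by simp
qed

end

section \<open>Convolution and the Fourier transform\<close>

lemma nn_integral_lborel_affine:
  fixes f :: "'a::euclidean_space \<Rightarrow> ennreal"
  assumes [measurable]: "f \<in> borel_measurable borel" and c: "c \<noteq> 0"
  shows "(\<integral>\<^sup>+x. f x \<partial>lborel) = ennreal (\<bar>c\<bar> ^ DIM('a)) * (\<integral>\<^sup>+x. f (t + c *\<^sub>R x) \<partial>lborel)"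
  by (subst lborel_affine[OF c, of t]) (simp add: nn_integral_density nn_integral_distr nn_integral_cmult ennreal_power)

lemma integrable_lborel_affine:
  fixes f :: "'a::euclidean_space \<Rightarrow> 'b::{banach, second_countable_topology}"
  assumes f: "integrable lborel f" and c: "c \<noteq> 0"
  shows "integrable lborel (\<lambda>x. f (t + c *\<^sub>R x))"
proof -
  have [measurable]: "f \<in> borel_measurable borel" using f by (auto dest: borel_measurable_integrable)
  have "(\<integral>\<^sup>+x. norm (f x) \<partial>lborel) = ennreal (\<bar>c\<bar> ^ DIM('a)) * (\<integral>\<^sup>+x. norm (f (t + c *\<^sub>R x)) \<partial>lborel)"
    by (rule nn_integral_lborel_affine[OF _ c]) measurable
  moreover have "(\<integral>\<^sup>+x. norm (f x) \<partial>lborel) < \<infinity>"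
    using f by (simp add: integrable_iff_bounded)
  ultimately show ?thesis
    using c by (auto simp: integrable_iff_bounded ennreal_mult_less_top)
qed

lemma integral_lborel_affine:
  fixes f :: "'a::euclidean_space \<Rightarrow> 'b::{banach, second_countable_topology}"
  assumes f: "integrable lborel f" and c: "c \<noteq> 0"
  shows "(LINT x|lborel. f x) = \<bar>c\<bar> ^ DIM('a) *\<^sub>R (LINT x|lborel. f (t + c *\<^sub>R x))"
proof -
  have [measurable]: "f \<in> borel_measurable borel" using f by (auto dest: borel_measurable_integrable)
  show ?thesis
    using integrable_lborel_affine[OF f c, of t]
    by (subst lborel_affine[OF c, of t])
      (simp add: integral_density integral_distr ennreal_power)
qed

section \<open>Convolution of a function with a law\<close>

definition conv :: "('a::euclidean_space \<Rightarrow> real) \<Rightarrow> 'a measure \<Rightarrow> 'a \<Rightarrow> real" where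
  "conv f M x = (LINT z|M. f (x - z))"

lemma conv_measurable [measurable]:
  assumes [measurable]: "f \<in> borel_measurable borel" and "borel_prob M"
  shows "conv f M \<in> borel_measurable borel"
proof -
  interpret borel_prob M by fact
  show ?thesis unfolding conv_def[abs_def] by measurable
qed

lemma nn_integral_translate:
  fixes f :: "'a::euclidean_space \<Rightarrow> ennreal"
  assumes [measurable]: "f \<in> borel_measurable borel"
  shows "(\<integral>\<^sup>+x. f (x + z) \<partial>lborel) = (\<integral>\<^sup>+x. f x \<partial>lborel)"
  using nn_integral_lborel_affine[of f 1 z] by (simp add: add.commute)

lemma nn_integral_conv_pair:
  fixes f :: "'a::euclidean_space \<Rightarrow> real" and V :: "'a \<Rightarrow> ennreal"
  assumes "borel_prob M" and [measurable]: "f \<in> borel_measurable borel" "V \<in> borel_measurable borel"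
  shows "(\<integral>\<^sup>+x. \<integral>\<^sup>+z. V x * ennreal \<bar>f (x - z)\<bar> \<partial>M \<partial>lborel) =
    (\<integral>\<^sup>+y. ennreal \<bar>f y\<bar> * (\<integral>\<^sup>+z. V (y + z) \<partial>M) \<partial>lborel)"
proof -
  interpret borel_prob M by fact
  interpret P: pair_sigma_finite lborel M ..
  have "(\<integral>\<^sup>+x. \<integral>\<^sup>+z. V x * ennreal \<bar>f (x - z)\<bar> \<partial>M \<partial>lborel) =
      (\<integral>\<^sup>+z. \<integral>\<^sup>+x. V x * ennreal \<bar>f (x - z)\<bar> \<partial>lborel \<partial>M)"
    by (rule P.Fubini'[symmetric]) measurable
  also have "\<dots> = (\<integral>\<^sup>+z. \<integral>\<^sup>+y. V (y + z) * ennreal \<bar>f y\<bar> \<partial>lborel \<partial>M)"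
  proof (rule nn_integral_cong)
    fix z
    show "(\<integral>\<^sup>+x. V x * ennreal \<bar>f (x - z)\<bar> \<partial>lborel) = (\<integral>\<^sup>+y. V (y + z) * ennreal \<bar>f y\<bar> \<partial>lborel)"
      using nn_integral_translate[of "\<lambda>x. V x * ennreal \<bar>f (x - z)\<bar>" z] by simp
  qed
  also have "\<dots> = (\<integral>\<^sup>+y. \<integral>\<^sup>+z. V (y + z) * ennreal \<bar>f y\<bar> \<partial>M \<partial>lborel)"
    by (rule P.Fubini') measurable
  also have "\<dots> = (\<integral>\<^sup>+y. (\<integral>\<^sup>+z. V (y + z) \<partial>M) * ennreal \<bar>f y\<bar> \<partial>lborel)"
    by (intro nn_integral_cong nn_integral_multc) measurable
  finally show ?thesis
    by (simp add: mult.commute)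
qed

text \<open>The weight of a convolution is moved to \<open>f\<close> as the weight averaged over the
  law; this is where Lyapunov bounds for laws enter. Where the integrand is not integrable,
  \<open>conv\<close> is \<open>0\<close> and the bound is trivial.\<close>

lemma nn_integral_conv_le:
  fixes f :: "'a::euclidean_space \<Rightarrow> real" and V :: "'a \<Rightarrow> ennreal"
  assumes M: "borel_prob M" and [measurable]: "f \<in> borel_measurable borel" "V \<in> borel_measurable borel"
  shows "(\<integral>\<^sup>+x. V x * ennreal \<bar>conv f M x\<bar> \<partial>lborel) \<le> (\<integral>\<^sup>+y. ennreal \<bar>f y\<bar> * (\<integral>\<^sup>+z. V (y + z) \<partial>M) \<partial>lborel)"
proof -
  interpret borel_prob M by fact
  have "V x * ennreal \<bar>conv f M x\<bar> \<le> (\<integral>\<^sup>+z. V x * ennreal \<bar>f (x - z)\<bar> \<partial>M)" for x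
  proof (cases "integrable M (\<lambda>z. f (x - z))")
    case True
    from integral_norm_bound_ennreal[OF this]
    have "ennreal \<bar>conv f M x\<bar> \<le> (\<integral>\<^sup>+z. ennreal \<bar>f (x - z)\<bar> \<partial>M)"
      by (simp add: conv_def)
    then show ?thesis by (simp add: nn_integral_cmult mult_left_mono)
  qed (simp add: conv_def not_integrable_integral_eq)
  then have "(\<integral>\<^sup>+x. V x * ennreal \<bar>conv f M x\<bar> \<partial>lborel) \<le> (\<integral>\<^sup>+x. \<integral>\<^sup>+z. V x * ennreal \<bar>f (x - z)\<bar> \<partial>M \<partial>lborel)"
    by (intro nn_integral_mono)
  then show ?thesis using nn_integral_conv_pair[OF M, of f V] by simp
qed

lemma integrable_conv_pair:
  fixes f :: "'a::euclidean_space \<Rightarrow> real" and \<phi> :: "'a \<Rightarrow> 'b::{banach, second_countable_topology}"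
  assumes M: "borel_prob M" and f: "integrable lborel f"
    and [measurable]: "\<phi> \<in> borel_measurable borel" and B: "\<And>x. norm (\<phi> x) \<le> B"
  shows "integrable (lborel \<Otimes>\<^sub>M M) (\<lambda>(x, z). f (x - z) *\<^sub>R \<phi> x)"
proof (rule integrableI_bounded)
  interpret borel_prob M by fact
  have [measurable]: "f \<in> borel_measurable borel" using f by (auto dest: borel_measurable_integrable)
  show "(\<lambda>(x, z). f (x - z) *\<^sub>R \<phi> x) \<in> borel_measurable (lborel \<Otimes>\<^sub>M M)" by measurable
  have "(\<integral>\<^sup>+p. ennreal (norm ((\<lambda>(x, z). f (x - z) *\<^sub>R \<phi> x) p)) \<partial>(lborel \<Otimes>\<^sub>M M)) =
      (\<integral>\<^sup>+x. \<integral>\<^sup>+z. ennreal (norm (f (x - z) *\<^sub>R \<phi> x)) \<partial>M \<partial>lborel)"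
    by (subst nn_integral_fst[symmetric]) auto
  also have "\<dots> \<le> (\<integral>\<^sup>+x. \<integral>\<^sup>+z. ennreal B * ennreal \<bar>f (x - z)\<bar> \<partial>M \<partial>lborel)"
  proof (intro nn_integral_mono)
    fix x z
    have "0 \<le> B" using B[of 0] norm_ge_zero order_trans by blast
    then show "ennreal (norm (f (x - z) *\<^sub>R \<phi> x)) \<le> ennreal B * ennreal \<bar>f (x - z)\<bar>"
      using mult_right_mono[OF B[of x], of "\<bar>f (x - z)\<bar>"]
      by (auto simp: ennreal_mult'[symmetric] mult.commute intro!: ennreal_leI)
  qed
  also have "\<dots> = (\<integral>\<^sup>+y. ennreal \<bar>f y\<bar> * ennreal B \<partial>lborel)"
    using emeasure_space_1 by (subst nn_integral_conv_pair[OF M]) auto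
  also have "\<dots> = (\<integral>\<^sup>+y. ennreal \<bar>f y\<bar> \<partial>lborel) * ennreal B"
    by (rule nn_integral_multc) measurable
  also have "\<dots> < \<infinity>"
    using f by (auto simp: integrable_iff_bounded ennreal_mult_less_top)
  finally show "(\<integral>\<^sup>+p. ennreal (norm ((\<lambda>(x, z). f (x - z) *\<^sub>R \<phi> x) p)) \<partial>(lborel \<Otimes>\<^sub>M M)) < \<infinity>" .
qed

lemma integrable_conv:
  assumes M: "borel_prob M" and f: "integrable lborel f"
  shows "integrable lborel (conv f M)"
proof -
  interpret borel_prob M by fact
  interpret P: pair_sigma_finite lborel M ..
  show ?thesis
    using P.integrable_fst'[OF integrable_conv_pair[OF M f, of "\<lambda>_. 1::real" 1]]
    by (simp add: conv_def[abs_def])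
qed

lemma integrable_mult_bounded:
  fixes f :: "'a \<Rightarrow> real" and \<phi> :: "'a \<Rightarrow> 'b::{banach, second_countable_topology}"
  assumes f: "integrable M f" and [measurable]: "\<phi> \<in> borel_measurable M" and B: "\<And>x. norm (\<phi> x) \<le> B"
  shows "integrable M (\<lambda>x. f x *\<^sub>R \<phi> x)"
proof (rule Bochner_Integration.integrable_bound)
  show "integrable M (\<lambda>x. B * f x)" using f by simp
  show "(\<lambda>x. f x *\<^sub>R \<phi> x) \<in> borel_measurable M" using f by measurable
  have "\<bar>f x\<bar> * norm (\<phi> x) \<le> \<bar>f x\<bar> * \<bar>B\<bar>" for x
    using B[of x] by (intro mult_left_mono) auto
  then show "AE x in M. norm (f x *\<^sub>R \<phi> x) \<le> norm (B * f x)"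
    by (simp add: abs_mult mult.commute)
qed

text \<open>Convolution with \<open>M\<close> and averaging over translates are adjoint, by Fubini.
  The test function may be vector valued, so that both plane waves and real test functions are
  covered.\<close>

lemma integral_conv_pairing:
  fixes \<phi> :: "'a::euclidean_space \<Rightarrow> 'b::{banach, second_countable_topology}"
  assumes M: "borel_prob M" and f: "integrable lborel f"
    and \<phi>[measurable]: "\<phi> \<in> borel_measurable borel" and B: "\<And>x. norm (\<phi> x) \<le> B"
  shows "(LINT x|lborel. conv f M x *\<^sub>R \<phi> x) = (LINT y|lborel. f y *\<^sub>R (LINT z|M. \<phi> (y + z)))"
proof -
  interpret borel_prob M by fact
  interpret P: pair_sigma_finite lborel M ..
  have [measurable]: "f \<in> borel_measurable borel" using f by (auto dest: borel_measurable_integrable)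
  note i = integrable_conv_pair[OF M f \<phi> B]
  have i': "integrable (lborel \<Otimes>\<^sub>M M) (\<lambda>(y, z). f y *\<^sub>R \<phi> (y + z))"
  proof (rule integrableI_bounded)
    have "(\<integral>\<^sup>+p. ennreal (norm ((\<lambda>(y, z). f y *\<^sub>R \<phi> (y + z)) p)) \<partial>(lborel \<Otimes>\<^sub>M M)) =
        (\<integral>\<^sup>+y. \<integral>\<^sup>+z. ennreal (norm (f y *\<^sub>R \<phi> (y + z))) \<partial>M \<partial>lborel)"
      by (subst nn_integral_fst[symmetric]) auto
    also have "\<dots> \<le> (\<integral>\<^sup>+y. \<integral>\<^sup>+z. ennreal \<bar>f y\<bar> * ennreal B \<partial>M \<partial>lborel)"
      using B by (intro nn_integral_mono) (auto simp: ennreal_mult'[symmetric] intro!: ennreal_leI mult_left_mono)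
    also have "\<dots> = (\<integral>\<^sup>+y. ennreal \<bar>f y\<bar> \<partial>lborel) * ennreal B"
      using emeasure_space_1 by (simp add: nn_integral_multc)
    also have "\<dots> < \<infinity>"
      using f by (auto simp: integrable_iff_bounded ennreal_mult_less_top)
    finally show "(\<integral>\<^sup>+p. ennreal (norm ((\<lambda>(y, z). f y *\<^sub>R \<phi> (y + z)) p)) \<partial>(lborel \<Otimes>\<^sub>M M)) < \<infinity>" .
  qed measurable
  have "(LINT x|lborel. conv f M x *\<^sub>R \<phi> x) = (LINT x|lborel. LINT z|M. f (x - z) *\<^sub>R \<phi> x)"
  proof (rule integral_cong_AE)
    have "AE x in lborel. integrable M (\<lambda>z. f (x - z))"
      using P.AE_integrable_fst'[OF integrable_conv_pair[OF M f, of "\<lambda>_. 1::real" 1]] by simp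
    then show "AE x in lborel. conv f M x *\<^sub>R \<phi> x = (LINT z|M. f (x - z) *\<^sub>R \<phi> x)"
      by eventually_elim (simp add: conv_def)
  qed (use M in measurable)
  also have "\<dots> = (LINT z|M. LINT x|lborel. f (x - z) *\<^sub>R \<phi> x)"
    using P.Fubini_integral[of "\<lambda>x z. f (x - z) *\<^sub>R \<phi> x"] i by simp
  also have "\<dots> = (LINT z|M. LINT y|lborel. f y *\<^sub>R \<phi> (y + z))"
  proof (rule Bochner_Integration.integral_cong[OF refl])
    fix z
    have "integrable lborel (\<lambda>x. f (x - z))"
      using integrable_lborel_affine[OF f, of 1 "- z"] by simp
    then have "integrable lborel (\<lambda>x. f (x - z) *\<^sub>R \<phi> x)"
      by (rule integrable_mult_bounded[OF _ _ B]) measurable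
    from integral_lborel_affine[OF this, of 1 z]
    show "(LINT x|lborel. f (x - z) *\<^sub>R \<phi> x) = (LINT y|lborel. f y *\<^sub>R \<phi> (y + z))"
      by (simp add: add.commute)
  qed
  also have "\<dots> = (LINT y|lborel. LINT z|M. f y *\<^sub>R \<phi> (y + z))"
    using P.Fubini_integral[of "\<lambda>y z. f y *\<^sub>R \<phi> (y + z)"] i' by simp
  also have "\<dots> = (LINT y|lborel. f y *\<^sub>R (LINT z|M. \<phi> (y + z)))"
    by simp
  finally show ?thesis .
qed

section \<open>Fourier transform and its injectivity\<close>

definition fourier :: "('a::euclidean_space \<Rightarrow> real) \<Rightarrow> 'a \<Rightarrow> complex" where
  "fourier f \<xi> = (LINT x|lborel. f x *\<^sub>R cis (\<xi> \<bullet> x))"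

lemma integrable_fourier: "integrable lborel f \<Longrightarrow> integrable lborel (\<lambda>x. f x *\<^sub>R cis (\<xi> \<bullet> x))"
  by (rule integrable_mult_bounded[of _ _ _ 1]) auto

lemma fourier_conv:
  assumes M: "borel_prob M" and f: "integrable lborel f"
  shows "fourier (conv f M) \<xi> = fourier f \<xi> * cf M \<xi>"
proof -
  have "fourier (conv f M) \<xi> = (LINT y|lborel. f y *\<^sub>R (LINT z|M. cis (\<xi> \<bullet> (y + z))))"
    unfolding fourier_def by (rule integral_conv_pairing[OF M f, of _ 1]) auto
  also have "\<dots> = (LINT y|lborel. (f y *\<^sub>R cis (\<xi> \<bullet> y)) * cf M \<xi>)"
    by (simp add: inner_add_right cis_mult[symmetric] cf_def scaleR_conv_of_real mult.assoc)
  also have "\<dots> = (LINT y|lborel. f y *\<^sub>R cis (\<xi> \<bullet> y)) * cf M \<xi>"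
    by (rule integral_mult_left_zero)
  finally show ?thesis by (simp add: fourier_def)
qed

text \<open>The density of \<open>exp (- t) *\<^sub>R X\<close> when \<open>X\<close> has density
  \<open>f\<close>: the action of the drift.\<close>

definition dil :: "real \<Rightarrow> ('a::euclidean_space \<Rightarrow> real) \<Rightarrow> 'a \<Rightarrow> real" where
  "dil t f x = exp (real DIM('a) * t) * f (exp t *\<^sub>R x)"

lemma dil_measurable [measurable]:
  assumes [measurable]: "f \<in> borel_measurable borel"
  shows "dil t f \<in> borel_measurable borel"
  unfolding dil_def[abs_def] by measurable

lemma integrable_dil:
  assumes f: "integrable lborel f"
  shows "integrable lborel (dil t f)"
  unfolding dil_def[abs_def] using integrable_lborel_affine[OF f, of "exp t" 0] by simp

lemma integral_dil:
  fixes \<phi> :: "'a::euclidean_space \<Rightarrow> 'b::{banach, second_countable_topology}"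
  assumes f: "integrable lborel f" and [measurable]: "\<phi> \<in> borel_measurable borel" and B: "\<And>x. norm (\<phi> x) \<le> B"
  shows "(LINT x|lborel. dil t f x *\<^sub>R \<phi> x) = (LINT y|lborel. f y *\<^sub>R \<phi> (exp (- t) *\<^sub>R y))"
proof -
  have "integrable lborel (\<lambda>y. f y *\<^sub>R \<phi> (exp (- t) *\<^sub>R y))"
    by (rule integrable_mult_bounded[OF f _ B]) measurable
  from integral_lborel_affine[OF this, of "exp t" 0]
  have "(LINT y|lborel. f y *\<^sub>R \<phi> (exp (- t) *\<^sub>R y)) =
      exp t ^ DIM('a) *\<^sub>R (LINT x|lborel. f (exp t *\<^sub>R x) *\<^sub>R \<phi> (exp (- t) *\<^sub>R exp t *\<^sub>R x))"
    by simp
  moreover have "exp (- t) *\<^sub>R exp t *\<^sub>R x = x" for x :: 'a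
    by (simp add: exp_minus)
  ultimately show ?thesis
    by (simp add: dil_def exp_of_nat_mult scaleR_scaleR[symmetric] del: scaleR_scaleR)
qed

lemma nn_integral_dil:
  fixes V :: "'a::euclidean_space \<Rightarrow> ennreal"
  assumes [measurable]: "f \<in> borel_measurable borel" "V \<in> borel_measurable borel"
  shows "(\<integral>\<^sup>+x. ennreal \<bar>dil t f x\<bar> * V x \<partial>lborel) = (\<integral>\<^sup>+y. ennreal \<bar>f y\<bar> * V (exp (- t) *\<^sub>R y) \<partial>lborel)"
proof -
  have "(\<integral>\<^sup>+y. ennreal \<bar>f y\<bar> * V (exp (- t) *\<^sub>R y) \<partial>lborel) =
      ennreal (exp t ^ DIM('a)) * (\<integral>\<^sup>+x. ennreal \<bar>f (exp t *\<^sub>R x)\<bar> * V x \<partial>lborel)"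
    using nn_integral_lborel_affine[of "\<lambda>y. ennreal \<bar>f y\<bar> * V (exp (- t) *\<^sub>R y)" "exp t" 0]
    by (simp add: exp_minus)
  also have "\<dots> = (\<integral>\<^sup>+x. ennreal (exp t ^ DIM('a)) * (ennreal \<bar>f (exp t *\<^sub>R x)\<bar> * V x) \<partial>lborel)"
    by (rule nn_integral_cmult[symmetric]) measurable
  finally show ?thesis
    by (simp add: dil_def exp_of_nat_mult abs_mult ennreal_mult mult.assoc)
qed

lemma fourier_dil:
  assumes "integrable lborel f"
  shows "fourier (dil t f) \<xi> = fourier f (exp (- t) *\<^sub>R \<xi>)"
  unfolding fourier_def by (subst integral_dil[OF assms, of _ 1]) auto

text \<open>The characteristic function of the standard normal law is a Gaussian, so a Gaussian
  factor in one coordinate is a superposition of plane waves; multiplying by a wave only translates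
  the transform of \<open>g\<close>, which vanishes everywhere.\<close>

lemma fourier_mult_gaussian:
  fixes g :: "'a::euclidean_space \<Rightarrow> real"
  assumes g: "integrable lborel g" and 0: "\<And>\<xi>. fourier g \<xi> = 0"
  shows "fourier (\<lambda>x. g x * exp (- ((s * (x \<bullet> j - a))\<^sup>2) / 2)) \<xi> = 0"
proof -
  interpret N: real_distribution std_normal_distribution
    by (rule real_dist_normal_dist)
  interpret P: pair_sigma_finite lborel std_normal_distribution ..
  have [measurable]: "g \<in> borel_measurable borel" using g by (auto dest: borel_measurable_integrable)
  let ?k = "\<lambda>x u. g x *\<^sub>R (cis (u * (s * (x \<bullet> j - a))) * cis (\<xi> \<bullet> x))"
  have char: "of_real (exp (- (v\<^sup>2) / 2)) = (LINT u|std_normal_distribution. cis (u * v))" for v :: real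
    using fun_cong[OF char_std_normal_distribution, of v]
    by (simp add: char_def cis_conv_exp mult.commute)
  have i: "integrable (lborel \<Otimes>\<^sub>M std_normal_distribution) (\<lambda>(x, u). ?k x u)"
  proof (rule integrableI_bounded)
    have "(\<integral>\<^sup>+p. ennreal (norm ((\<lambda>(x, u). ?k x u) p)) \<partial>(lborel \<Otimes>\<^sub>M std_normal_distribution)) =
        (\<integral>\<^sup>+x. \<integral>\<^sup>+u. ennreal (norm (?k x u)) \<partial>std_normal_distribution \<partial>lborel)"
      by (subst N.nn_integral_fst[symmetric]) auto
    also have "\<dots> = (\<integral>\<^sup>+x. ennreal \<bar>g x\<bar> \<partial>lborel)"
      using N.emeasure_space_1 by (simp add: norm_mult)
    also have "\<dots> < \<infinity>" using g by (simp add: integrable_iff_bounded)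
    finally show "(\<integral>\<^sup>+p. ennreal (norm ((\<lambda>(x, u). ?k x u) p)) \<partial>(lborel \<Otimes>\<^sub>M std_normal_distribution)) < \<infinity>" .
  qed measurable
  have "fourier (\<lambda>x. g x * exp (- ((s * (x \<bullet> j - a))\<^sup>2) / 2)) \<xi> =
      (LINT x|lborel. g x *\<^sub>R (of_real (exp (- ((s * (x \<bullet> j - a))\<^sup>2) / 2)) * cis (\<xi> \<bullet> x)))"
    unfolding fourier_def by (simp add: scaleR_conv_of_real mult.assoc)
  also have "\<dots> = (LINT x|lborel. LINT u|std_normal_distribution. ?k x u)"
    unfolding char by simp
  also have "\<dots> = (LINT u|std_normal_distribution. LINT x|lborel. ?k x u)"
    using P.Fubini_integral[of ?k] i by simp
  also have "\<dots> = (LINT u|std_normal_distribution. cis (- (u * s * a)) * fourier g (\<xi> + (u * s) *\<^sub>R j))"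
  proof (intro Bochner_Integration.integral_cong refl)
    fix u
    have "?k x u = cis (- (u * s * a)) * (g x *\<^sub>R cis ((\<xi> + (u * s) *\<^sub>R j) \<bullet> x))" for x
      by (simp add: cis_mult algebra_simps inner_commute[of _ j])
    then have "(LINT x|lborel. ?k x u) =
        (LINT x|lborel. cis (- (u * s * a)) * (g x *\<^sub>R cis ((\<xi> + (u * s) *\<^sub>R j) \<bullet> x)))"
      by (simp only:)
    then show "(LINT x|lborel. ?k x u) = cis (- (u * s * a)) * fourier g (\<xi> + (u * s) *\<^sub>R j)"
      by (simp add: fourier_def del: mult_scaleR_right)
  qed
  finally show ?thesis by (simp add: 0)
qed

definition gauss :: "'a::euclidean_space \<Rightarrow> real" where
  "gauss x = (\<Prod>j\<in>Basis. std_normal_density (x \<bullet> j))"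

lemma gauss_measurable [measurable]: "gauss \<in> borel_measurable borel"
  unfolding gauss_def[abs_def] by measurable

lemma gauss_pos: "0 < gauss x"
  unfolding gauss_def by (intro prod_pos) (simp add: normal_density_pos)

lemma gauss_eq: "gauss (x :: 'a::euclidean_space) = (1 / sqrt (2 * pi)) ^ DIM('a) * (\<Prod>j\<in>Basis. exp (- (x \<bullet> j)\<^sup>2 / 2))"
  unfolding gauss_def std_normal_density_def prod.distrib by simp

lemma nn_integral_gauss: "(\<integral>\<^sup>+x. ennreal (gauss (x :: 'a::euclidean_space)) \<partial>lborel) = 1"
proof -
  interpret N: real_distribution std_normal_distribution
    by (rule real_dist_normal_dist)
  have "(\<integral>\<^sup>+x. ennreal (std_normal_density x) \<partial>lborel) = 1"
    using N.emeasure_space_1 by (simp add: emeasure_density)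
  then show ?thesis
    using nn_integral_lborel_prod[where f = "\<lambda>(_::'a) x. ennreal (std_normal_density x)"]
    by (simp add: gauss_def prod_ennreal)
qed

definition gauss_measure :: "'a::euclidean_space measure" where
  "gauss_measure = density lborel (\<lambda>x. ennreal (gauss x))"

lemma borel_prob_gauss_scaled: "borel_prob (distr gauss_measure borel (\<lambda>z. c *\<^sub>R z :: 'a::euclidean_space))"
proof -
  have "prob_space (gauss_measure :: 'a measure)"
    by (rule prob_spaceI) (simp add: gauss_measure_def emeasure_density nn_integral_gauss)
  then interpret prob_space "gauss_measure :: 'a measure" .
  show ?thesis
    unfolding borel_prob_def borel_prob_axioms_def
    by (auto intro!: prob_space_distr) (simp add: gauss_measure_def)
qed

text \<open>The Gaussian is a product over the coordinates, so its factors are inserted one at a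
  time; the transform at frequency \<open>0\<close> is the integral.\<close>

lemma fourier_mult_gauss:
  fixes f :: "'a::euclidean_space \<Rightarrow> real"
  assumes f: "integrable lborel f" and 0: "\<And>\<xi>. fourier f \<xi> = 0"
  shows "(LINT x|lborel. f x * gauss (s *\<^sub>R (x - y))) = 0"
proof -
  let ?e = "\<lambda>j x. exp (- ((s * (x \<bullet> j - y \<bullet> j))\<^sup>2) / 2)"
  have [measurable]: "f \<in> borel_measurable borel" using f by (auto dest: borel_measurable_integrable)
  have i: "integrable lborel (\<lambda>x. f x * (\<Prod>j\<in>I. ?e j x))" if "finite I" for I :: "'a set"
  proof -
    have "integrable lborel (\<lambda>x. f x *\<^sub>R (\<Prod>j\<in>I. ?e j x))"
    proof (rule integrable_mult_bounded[OF f, of _ 1])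
      show "norm (\<Prod>j\<in>I. ?e j x) \<le> 1" for x
        by (auto simp: abs_prod intro!: prod_le_1)
    qed measurable
    then show ?thesis by simp
  qed
  have "fourier (\<lambda>x. f x * (\<Prod>j\<in>I. ?e j x)) \<xi> = 0" if "finite I" for I :: "'a set" and \<xi>
    using that
  proof (induction I arbitrary: \<xi>)
    case (insert j I)
    have "fourier (\<lambda>x. (f x * (\<Prod>j\<in>I. ?e j x)) * ?e j x) \<xi> = 0"
      by (rule fourier_mult_gaussian[OF i[OF insert.hyps(1)] insert.IH])
    moreover have "(\<lambda>x. f x * (\<Prod>j\<in>insert j I. ?e j x)) = (\<lambda>x. (f x * (\<Prod>j\<in>I. ?e j x)) * ?e j x)"
      using insert.hyps by (simp add: fun_eq_iff mult_ac)
    ultimately show ?case by simp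
  qed (simp add: 0)
  from this[of Basis 0] have "(LINT x|lborel. complex_of_real (f x * (\<Prod>j\<in>Basis. ?e j x))) = 0"
    by (simp add: fourier_def scaleR_conv_of_real)
  then have "(LINT x|lborel. f x * (\<Prod>j\<in>Basis. ?e j x)) = 0"
    by (simp only: integral_complex_of_real of_real_eq_0_iff)
  moreover have "f x * gauss (s *\<^sub>R (x - y)) = (1 / sqrt (2 * pi)) ^ DIM('a) * (f x * (\<Prod>j\<in>Basis. ?e j x))" for x
    by (simp only: gauss_eq inner_diff_left inner_scaleR_left mult_ac)
  ultimately show ?thesis by (simp only: integral_mult_right_zero mult_zero_right)
qed

lemma frontier_box_AE:
  fixes a b :: "'a::euclidean_space"
  shows "AE x in lborel. x \<notin> frontier (box a b)"
proof -
  have "frontier (box a b) \<in> null_sets lebesgue"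
    using negligible_convex_frontier[of "box a b"] convex_box by (auto simp: negligible_iff_null_sets)
  then have "frontier (box a b) \<in> null_sets lborel"
    by (auto simp: null_sets_completion_iff)
  then show ?thesis by (rule AE_not_in)
qed

text \<open>The Gaussian is its own Fourier transform, so the smoothings of \<open>f\<close> by Gaussians vanish; as their
  width tends to \<open>0\<close>, they recover the mass of \<open>f\<close> on boxes, whose boundaries are null sets.\<close>

lemma fourier_zero_box:
  fixes f :: "'a::euclidean_space \<Rightarrow> real"
  assumes f: "integrable lborel f" and 0: "\<And>\<xi>. fourier f \<xi> = 0"
  shows "(LINT x|lborel. f x * indicator (box a b) x) = 0"
proof -
  have [measurable]: "f \<in> borel_measurable borel" using f by (auto dest: borel_measurable_integrable)
  let ?M = "\<lambda>n::nat. distr gauss_measure borel (\<lambda>z. inverse (real (Suc n)) *\<^sub>R z :: 'a)"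
  let ?\<phi> = "indicator (box a b) :: 'a \<Rightarrow> real"
  have [measurable_cong]: "sets gauss_measure = sets borel" by (simp add: gauss_measure_def)
  interpret G: borel_prob "gauss_measure :: 'a measure"
    using borel_prob_gauss_scaled[of 1] by (simp add: distr_id2 gauss_measure_def)
  \<comment> \<open>The substitution \<open>y = x - z / (n + 1)\<close> turns the smoothing at
    \<open>x\<close> into the pairing of \<open>f\<close> with a Gaussian centred at
    \<open>x\<close>.\<close>
  have conv0: "conv f (?M n) x = 0" for n x
  proof -
    let ?s = "real (Suc n)"
    have "conv f (?M n) x = (LINT z|gauss_measure. f (x - inverse ?s *\<^sub>R z))"
      by (simp add: conv_def integral_distr)
    also have "\<dots> = (LINT z|lborel. gauss z * f (x - inverse ?s *\<^sub>R z))"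
      unfolding gauss_measure_def using gauss_pos[THEN less_imp_le] by (subst integral_density) auto
    also have "\<dots> = 0"
    proof (cases "integrable lborel (\<lambda>z. gauss z * f (x - inverse ?s *\<^sub>R z))")
      case True
      have sym: "gauss (- v) = gauss v" for v :: 'a by (simp add: gauss_eq)
      have "(LINT z|lborel. gauss z * f (x - inverse ?s *\<^sub>R z)) =
          \<bar>- ?s\<bar> ^ DIM('a) *\<^sub>R (LINT y|lborel. gauss (?s *\<^sub>R x + (- ?s) *\<^sub>R y) * f (x - inverse ?s *\<^sub>R (?s *\<^sub>R x + (- ?s) *\<^sub>R y)))"
        by (rule integral_lborel_affine[OF True]) simp
      also have "(\<lambda>y. gauss (?s *\<^sub>R x + (- ?s) *\<^sub>R y) * f (x - inverse ?s *\<^sub>R (?s *\<^sub>R x + (- ?s) *\<^sub>R y))) =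
          (\<lambda>y. f y * gauss (?s *\<^sub>R (y - x)))"
      proof
        fix y
        have "?s *\<^sub>R x + (- ?s) *\<^sub>R y = - (?s *\<^sub>R (y - x))" by (simp add: algebra_simps)
        moreover have "x - inverse ?s *\<^sub>R (- (?s *\<^sub>R (y - x))) = y" by (simp del: of_nat_Suc)
        ultimately show "gauss (?s *\<^sub>R x + (- ?s) *\<^sub>R y) * f (x - inverse ?s *\<^sub>R (?s *\<^sub>R x + (- ?s) *\<^sub>R y)) =
          f y * gauss (?s *\<^sub>R (y - x))"
          by (simp only: sym mult.commute)
      qed
      finally show ?thesis using fourier_mult_gauss[OF f 0, of ?s x] by simp
    qed (simp add: not_integrable_integral_eq)
    finally show ?thesis .
  qed
  \<comment> \<open>By duality the vanishing smoothings of \<open>f\<close> become pairings of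
    \<open>f\<close> with smoothed indicators, which converge to the indicator off the frontier of
    the box.\<close>
  have z: "(LINT y|lborel. f y * (LINT z|gauss_measure. ?\<phi> (y + inverse (real (Suc n)) *\<^sub>R z))) = 0" for n
  proof -
    have "(LINT x|lborel. conv f (?M n) x *\<^sub>R ?\<phi> x) = (LINT y|lborel. f y *\<^sub>R (LINT z|?M n. ?\<phi> (y + z)))"
      by (rule integral_conv_pairing[OF borel_prob_gauss_scaled f, of _ 1]) (auto simp: indicator_def)
    then show ?thesis by (simp add: conv0 integral_distr del: of_nat_Suc)
  qed
  have "(\<lambda>n. LINT y|lborel. f y * (LINT z|gauss_measure. ?\<phi> (y + inverse (real (Suc n)) *\<^sub>R z)))
      \<longlonglongrightarrow> (LINT y|lborel. f y * ?\<phi> y)"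
  proof (rule integral_dominated_convergence[where w = "\<lambda>y. \<bar>f y\<bar>"])
    show "AE y in lborel. (\<lambda>n. f y * (LINT z|gauss_measure. ?\<phi> (y + inverse (real (Suc n)) *\<^sub>R z))) \<longlonglongrightarrow> f y * ?\<phi> y"
      using frontier_box_AE[of a b]
    proof eventually_elim
      case (elim y)
      have cont: "isCont ?\<phi> y"
      proof (cases "y \<in> box a b")
        case True
        then have "\<forall>\<^sub>F x in nhds y. ?\<phi> x = 1"
          using eventually_nhds_in_open[OF open_box True] by (auto elim!: eventually_mono)
        then have "isCont ?\<phi> y \<longleftrightarrow> isCont (\<lambda>_. 1 :: real) y" by (rule isCont_cong)
        then show ?thesis by simp
      next
        case False
        then have "y \<in> - closure (box a b)"
          using elim closure_Un_frontier[of "box a b"] by auto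
        then have "\<forall>\<^sub>F x in nhds y. x \<in> - closure (box a b)"
          by (intro eventually_nhds_in_open) auto
        then have "\<forall>\<^sub>F x in nhds y. ?\<phi> x = 0"
          by (rule eventually_mono) (use closure_subset in \<open>auto simp: indicator_def\<close>)
        then have "isCont ?\<phi> y \<longleftrightarrow> isCont (\<lambda>_. 0 :: real) y" by (rule isCont_cong)
        then show ?thesis by simp
      qed
      have "(\<lambda>n. LINT z|gauss_measure. ?\<phi> (y + inverse (real (Suc n)) *\<^sub>R z)) \<longlonglongrightarrow> (LINT z|(gauss_measure :: 'a measure). ?\<phi> y)"
      proof (rule integral_dominated_convergence[where w = "\<lambda>_. 1"])
        have "(\<lambda>n. y + inverse (real (Suc n)) *\<^sub>R z) \<longlonglongrightarrow> y" for z :: 'a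
          using tendsto_add[OF tendsto_const[of y] tendsto_scaleR[OF LIMSEQ_inverse_real_of_nat tendsto_const[of z]]]
          by (simp del: of_nat_Suc)
        then show "AE z in gauss_measure. (\<lambda>n. ?\<phi> (y + inverse (real (Suc n)) *\<^sub>R z)) \<longlonglongrightarrow> ?\<phi> y"
          using isCont_tendsto_compose[OF cont] by blast
      qed (auto simp: indicator_def)
      then show ?case
        using G.prob_space by (intro tendsto_mult tendsto_const) (simp del: of_nat_Suc G.space_M)
    qed
    show "AE y in lborel. norm (f y * (LINT z|gauss_measure. ?\<phi> (y + inverse (real (Suc n)) *\<^sub>R z))) \<le> \<bar>f y\<bar>" for n
    proof (rule AE_I2)
      fix y
      have "norm (LINT z|gauss_measure. ?\<phi> (y + inverse (real (Suc n)) *\<^sub>R z)) \<le> 1"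
        by (rule G.integral_bounded_le) (simp add: indicator_def)
      then show "norm (f y * (LINT z|gauss_measure. ?\<phi> (y + inverse (real (Suc n)) *\<^sub>R z))) \<le> \<bar>f y\<bar>"
        by (simp add: abs_mult mult_left_le)
    qed
  qed (use f in \<open>auto simp: indicator_def\<close>)
  with z show ?thesis by (simp add: LIMSEQ_const_iff)
qed

text \<open>The positive and negative parts of \<open>f\<close> are densities of two measures that
  agree on boxes, an intersection-stable generator of the Borel sets.\<close>

lemma fourier_injective:
  fixes f :: "'a::euclidean_space \<Rightarrow> real"
  assumes f: "integrable lborel f" and 0: "\<And>\<xi>. fourier f \<xi> = 0"
  shows "AE x in lborel. f x = 0"
proof -
  have [measurable]: "f \<in> borel_measurable borel" using f by (auto dest: borel_measurable_integrable)
  let ?p = "\<lambda>x. max 0 (f x)" and ?n = "\<lambda>x. max 0 (- f x)"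
  have i: "integrable lborel ?p" "integrable lborel ?n"
    using f by (auto intro!: integrable_max)
  have "density lborel (\<lambda>x. ennreal (?p x)) = density lborel (\<lambda>x. ennreal (?n x))"
  proof (rule measure_eqI_generator_eq)
    let ?E = "range (\<lambda>(a, b). box a b::'a set)"
    show "Int_stable ?E"
      by (auto simp: Int_stable_def box_Int_box)
    show "?E \<subseteq> Pow UNIV" "sets (density lborel (\<lambda>x. ennreal (?p x))) = sigma_sets UNIV ?E"
      "sets (density lborel (\<lambda>x. ennreal (?n x))) = sigma_sets UNIV ?E"
      by (simp_all add: borel_eq_box)
    let ?A = "\<lambda>n::nat. box (- (real n *\<^sub>R One)) (real n *\<^sub>R One) :: 'a set"
    show "range ?A \<subseteq> ?E" "(\<Union>i. ?A i) = UNIV"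
      unfolding UN_box_eq_UNIV by auto
    have em: "emeasure (density lborel (\<lambda>x. ennreal (g x))) X = ennreal (LINT x|lborel. g x * indicator X x)"
      if "integrable lborel g" "\<And>x. 0 \<le> g x" "X \<in> sets borel" for g :: "'a \<Rightarrow> real" and X
    proof -
      have [measurable]: "g \<in> borel_measurable borel" using that by (auto dest: borel_measurable_integrable)
      have "emeasure (density lborel (\<lambda>x. ennreal (g x))) X = (\<integral>\<^sup>+x. ennreal (g x * indicator X x) \<partial>lborel)"
        using that by (subst emeasure_density) (auto intro!: nn_integral_cong simp: indicator_def)
      also have "\<dots> = ennreal (LINT x|lborel. g x * indicator X x)"
        using that by (intro nn_integral_eq_integral) (auto intro!: integrable_real_mult_indicator)
      finally show ?thesis .
    qed
    show "emeasure (density lborel (\<lambda>x. ennreal (?p x))) (?A n) \<noteq> \<infinity>" for n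
      using i by (subst em) auto
    show "emeasure (density lborel (\<lambda>x. ennreal (?p x))) X = emeasure (density lborel (\<lambda>x. ennreal (?n x))) X"
      if "X \<in> ?E" for X
    proof -
      from that obtain a b where X: "X = box a b" by auto
      have "(LINT x|lborel. ?p x * indicator X x) - (LINT x|lborel. ?n x * indicator X x) =
          (LINT x|lborel. ?p x * indicator X x - ?n x * indicator X x)"
        using i X by (intro Bochner_Integration.integral_diff[symmetric] integrable_real_mult_indicator) auto
      also have "\<dots> = (LINT x|lborel. f x * indicator X x)"
        by (intro Bochner_Integration.integral_cong) (auto simp: indicator_def)
      also have "\<dots> = 0"
        unfolding X by (rule fourier_zero_box[OF f 0])
      finally show ?thesis using i X by (subst em, simp, simp, simp, subst em) auto
    qed
  qed
  then have "AE x in lborel. ennreal (?p x) = ennreal (?n x)"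
    by (subst (asm) sigma_finite_measure.density_unique_iff[OF sigma_finite_lborel]) auto
  then show ?thesis
    by eventually_elim (auto simp: max_def split: if_splits)
qed

section \<open>The semigroup\<close>

lemma (in borel_prob) isCont_cf: "isCont (cf M) \<xi>"
  unfolding continuous_at_sequentially
proof safe
  fix X assume X: "X \<longlonglongrightarrow> \<xi>"
  show "(cf M \<circ> X) \<longlonglongrightarrow> cf M \<xi>"
    unfolding comp_def cf_def
  proof (rule integral_dominated_convergence[where w="\<lambda>_. 1"])
    show "AE x in M. (\<lambda>n. cis (X n \<bullet> x)) \<longlonglongrightarrow> cis (\<xi> \<bullet> x)"
      by (intro AE_I2 isCont_tendsto_compose[of _ cis] tendsto_intros X continuous_intros)
  qed auto
qed

section \<open>The law of the accumulated jumps\<close>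

definition unif :: "real measure" where
  "unif = density lborel (indicator {0..1})"

lemma sets_unif [simp, measurable_cong]: "sets unif = sets borel"
  by (simp add: unif_def)

lemma space_unif [simp]: "space unif = UNIV"
  by (simp add: unif_def)

lemma prob_space_unif: "prob_space unif"
proof (rule prob_spaceI)
  have "(\<integral>\<^sup>+x. indicator {0..1::real} x \<partial>lborel) = 1"
    by (subst nn_integral_indicator) auto
  then show "emeasure unif (space unif) = 1"
    by (simp add: unif_def emeasure_density)
qed

lemma nn_integral_unif:
  assumes [measurable]: "f \<in> borel_measurable borel"
  shows "(\<integral>\<^sup>+r. f r \<partial>unif) = (\<integral>\<^sup>+r. f r * indicator {0..1} r \<partial>lborel)"
  unfolding unif_def by (subst nn_integral_density) (auto simp: mult.commute)

lemma integral_unif: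
  fixes g :: "real \<Rightarrow> complex"
  assumes g: "continuous_on UNIV g"
  shows "(LINT r|unif. g r) = integral {0..1} g"
proof -
  have [measurable]: "g \<in> borel_measurable borel" by (intro borel_measurable_continuous_onI g)
  have "(LINT r|unif. g r) = (LINT r|lborel. indicator {0..1} r *\<^sub>R g r)"
  proof -
    have *: "unif = density lborel (\<lambda>r. ennreal (indicator {0..1} r))"
      unfolding unif_def by (auto intro!: arg_cong[where f = "density lborel"] simp: indicator_def)
    show ?thesis unfolding * by (subst integral_density) auto
  qed
  also have "\<dots> = integral {0..1} g"
    using set_borel_integral_eq_integral(2)[OF borel_integrable_atLeastAtMost'[of 0 1 g]] continuous_on_subset[OF g]
    by (simp add: set_lebesgue_integral_def)
  finally show ?thesis .
qed

locale jump_kernel =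
  fixes J :: "'a::euclidean_space \<Rightarrow> real"
  assumes J_measurable [measurable]: "J \<in> borel_measurable borel"
    and J_nonneg: "\<And>x. 0 \<le> J x"
    and J_mass: "(\<integral>\<^sup>+x. ennreal (J x) \<partial>lborel) = 1"
begin

definition JM :: "'a measure" where
  "JM = density lborel (\<lambda>x. ennreal (J x))"

lemma sets_JM [simp, measurable_cong]: "sets JM = sets borel"
  by (simp add: JM_def)

lemma borel_prob_JM: "borel_prob JM"
proof -
  have "prob_space JM"
    by (rule prob_spaceI) (simp add: JM_def emeasure_density J_mass)
  then show ?thesis by (simp add: borel_prob_def borel_prob_axioms_def)
qed

sublocale JM: borel_prob JM by (rule borel_prob_JM)

lemma nn_integral_JM:
  assumes [measurable]: "f \<in> borel_measurable borel"
  shows "(\<integral>\<^sup>+y. f y \<partial>JM) = (\<integral>\<^sup>+y. ennreal (J y) * f y \<partial>lborel)"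
  unfolding JM_def by (rule nn_integral_density) auto

text \<open>Given their number, the times of the jumps in \<open>[0, t]\<close> are independent and
  uniform, and a jump of age \<open>t * r\<close> has been contracted by
  \<open>exp (- (t * r))\<close>. This is the law at time \<open>t\<close> of one of these
  jumps.\<close>

definition kap :: "real \<Rightarrow> real \<Rightarrow> 'a measure" where
  "kap \<epsilon> t = distr (unif \<Otimes>\<^sub>M JM) borel (\<lambda>(r, y). (\<epsilon> * exp (- (t * r))) *\<^sub>R y)"

lemma borel_prob_kap: "borel_prob (kap \<epsilon> t)"
proof -
  interpret U: prob_space unif by (rule prob_space_unif)
  interpret P: pair_prob_space unif JM ..
  show ?thesis
    unfolding kap_def borel_prob_def borel_prob_axioms_def
    by (auto intro!: P.prob_space_distr)
qed

lemma nn_integral_kap: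
  assumes [measurable]: "f \<in> borel_measurable borel"
  shows "(\<integral>\<^sup>+z. f z \<partial>kap \<epsilon> t) = (\<integral>\<^sup>+r. \<integral>\<^sup>+y. f ((\<epsilon> * exp (- (t * r))) *\<^sub>R y) \<partial>JM \<partial>unif)"
  unfolding kap_def by (simp add: nn_integral_distr JM.nn_integral_fst[symmetric] case_prod_beta)

lemma integral_kap:
  fixes f :: "'a \<Rightarrow> 'b::{banach, second_countable_topology}"
  assumes [measurable]: "f \<in> borel_measurable borel" and B: "\<And>x. norm (f x) \<le> B"
  shows "(LINT z|kap \<epsilon> t. f z) = (LINT r|unif. LINT y|JM. f ((\<epsilon> * exp (- (t * r))) *\<^sub>R y))"
proof -
  interpret U: prob_space unif by (rule prob_space_unif)
  interpret P: pair_prob_space unif JM ..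
  have i: "integrable (unif \<Otimes>\<^sub>M JM) (\<lambda>p. f ((\<epsilon> * exp (- (t * fst p))) *\<^sub>R snd p))"
    using B by (intro P.integrable_const_bound[of _ B]) auto
  have "(LINT z|kap \<epsilon> t. f z) = (LINT p|(unif \<Otimes>\<^sub>M JM). f ((\<epsilon> * exp (- (t * fst p))) *\<^sub>R snd p))"
    by (simp add: kap_def integral_distr case_prod_beta)
  then show ?thesis using P.integral_fst'[OF i] by simp
qed

lemma continuous_cf_JM: "continuous_on A (\<lambda>s. cf JM (c s *\<^sub>R \<xi>))" if "continuous_on A c" for c :: "real \<Rightarrow> real"
proof -
  have "continuous_on UNIV (cf JM)"
    using JM.isCont_cf by (simp add: continuous_at_imp_continuous_on)
  then show ?thesis
    by (rule continuous_on_compose2) (auto intro!: continuous_intros that)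
qed

text \<open>The Levy exponent of the law of the jumps accumulated, and contracted by the drift, up to
  time \<open>t\<close>.\<close>

definition psi :: "real \<Rightarrow> real \<Rightarrow> 'a \<Rightarrow> complex" where
  "psi \<epsilon> t \<xi> = integral {0..t} (\<lambda>s. (cf JM ((\<epsilon> * exp (- s)) *\<^sub>R \<xi>) - 1) / of_real (\<epsilon>\<^sup>2))"

lemma psi_integrable: "(\<lambda>s. (cf JM ((\<epsilon> * exp (- s)) *\<^sub>R \<xi>) - 1) / of_real (\<epsilon>\<^sup>2)) integrable_on {a..b}"
proof (cases "\<epsilon> = 0")
  case False
  then show ?thesis
    by (intro integrable_continuous_interval continuous_intros continuous_cf_JM) auto
qed (simp add: integrable_0)

text \<open>Cocycle identity: of the jumps during a time \<open>s + t\<close>, those of age at most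
  \<open>t\<close> contribute the first term; the older ones form a batch over time \<open>s\<close>
  that the drift has contracted by a further \<open>exp (- t)\<close>.\<close>

lemma psi_add:
  assumes "0 \<le> s" "0 \<le> t"
  shows "psi \<epsilon> (s + t) \<xi> = psi \<epsilon> t \<xi> + psi \<epsilon> s (exp (- t) *\<^sub>R \<xi>)"
proof -
  define g where "g s = (cf JM ((\<epsilon> * exp (- s)) *\<^sub>R \<xi>) - 1) / of_real (\<epsilon>\<^sup>2)" for s
  have cont: "continuous_on {0 + t..s + t} g"
  proof (cases "\<epsilon> = 0")
    case False
    then show ?thesis unfolding g_def by (intro continuous_intros continuous_cf_JM) auto
  qed (simp add: g_def)
  have "psi \<epsilon> (s + t) \<xi> = integral {0..t} g + integral {t..s + t} g"
    unfolding psi_def g_def using assms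
    by (intro Henstock_Kurzweil_Integration.integral_combine[symmetric] psi_integrable) auto
  also have "integral {t..s + t} g = integral {0..s} (\<lambda>r. g (r + t))"
    using integral_shift[OF cont] by (simp add: comp_def)
  also have "(\<lambda>r. g (r + t)) = (\<lambda>r. (cf JM ((\<epsilon> * exp (- r)) *\<^sub>R exp (- t) *\<^sub>R \<xi>) - 1) / of_real (\<epsilon>\<^sup>2))"
    by (simp add: g_def exp_add exp_diff exp_minus field_simps)
  finally show ?thesis by (simp add: psi_def g_def)
qed

text \<open>The factor \<open>t\<close> of the intensity times the mean over the uniform variable is
  a time integral, by the substitution \<open>s = t * r\<close>.\<close>

lemma cf_kap:
  assumes t: "0 < t"
  shows "of_real (t / \<epsilon>\<^sup>2) * (cf (kap \<epsilon> t) \<xi> - 1) = psi \<epsilon> t \<xi>"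
proof (cases "\<epsilon> = 0")
  case False
  let ?g = "\<lambda>s. cf JM ((\<epsilon> * exp (- s)) *\<^sub>R \<xi>)"
  let ?h = "\<lambda>s. (?g s - 1) / of_real (\<epsilon>\<^sup>2)"
  have gi: "(\<lambda>r. ?g (t * r)) integrable_on {0..1}"
    by (intro integrable_continuous_interval continuous_intros continuous_cf_JM)
  have "cf (kap \<epsilon> t) \<xi> = (LINT r|unif. LINT y|JM. cis (\<xi> \<bullet> ((\<epsilon> * exp (- (t * r))) *\<^sub>R y)))"
    unfolding cf_def by (rule integral_kap[of _ 1]) auto
  also have "\<dots> = (LINT r|unif. ?g (t * r))"
    by (simp add: cf_def)
  also have "\<dots> = integral {0..1} (\<lambda>r. ?g (t * r))"
    by (intro integral_unif continuous_cf_JM continuous_intros)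
  finally have "of_real (t / \<epsilon>\<^sup>2) * (cf (kap \<epsilon> t) \<xi> - 1) =
      of_real (t / \<epsilon>\<^sup>2) * (integral {0..1} (\<lambda>r. ?g (t * r)) - integral {0..1::real} (\<lambda>r. 1))"
    by simp
  also have "\<dots> = of_real (t / \<epsilon>\<^sup>2) * integral {0..1} (\<lambda>r. ?g (t * r) - 1)"
    using gi by (subst Henstock_Kurzweil_Integration.integral_diff) auto
  also have "\<dots> = integral {0..1} (\<lambda>r. t *\<^sub>R ?h (t * r))"
    by (subst integral_mult_right[symmetric]) (simp add: scaleR_conv_of_real)
  also have "\<dots> = psi \<epsilon> t \<xi>"
  proof -
    have "(?h has_integral psi \<epsilon> t \<xi>) {0..t}"
      unfolding psi_def by (intro integrable_integral psi_integrable)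
    from has_integral_stretch_real[OF this, of t]
    have "((\<lambda>r. ?h (t * r)) has_integral (1 / \<bar>t\<bar>) *\<^sub>R psi \<epsilon> t \<xi>) ((\<lambda>x. x / t) ` {0..t})"
      using t by simp
    moreover have "(\<lambda>x. x / t) ` {0..t} = {0..1}"
      using t image_mult_atLeastAtMost[of "1 / t" 0 t] by (simp add: field_simps)
    ultimately have "((\<lambda>r. ?h (t * r)) has_integral (1 / t) *\<^sub>R psi \<epsilon> t \<xi>) {0..1}"
      using t by simp
    from has_integral_cmul[OF this, of t] show ?thesis
      using t by (intro integral_unique) simp
  qed
  finally show ?thesis .
qed (simp add: psi_def)

section \<open>The solution operators and their growth\<close>

definition mu :: "real \<Rightarrow> real \<Rightarrow> 'a measure" where
  "mu \<epsilon> t = cpoisson (t / \<epsilon>\<^sup>2) (kap \<epsilon> t)"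

lemma borel_prob_mu: "borel_prob (mu \<epsilon> t)"
  unfolding mu_def by (intro borel_prob_cpoisson borel_prob_kap)

lemma cf_mu: "0 < \<epsilon> \<Longrightarrow> 0 < t \<Longrightarrow> cf (mu \<epsilon> t) \<xi> = exp (psi \<epsilon> t \<xi>)"
  unfolding mu_def by (subst cf_cpoisson) (auto simp: borel_prob_kap cf_kap[symmetric])

text \<open>The dilation moves the initial datum alone, since the effect of the drift on the jumps
  is already contained in \<open>mu\<close>.\<close>

definition S :: "real \<Rightarrow> real \<Rightarrow> ('a \<Rightarrow> real) \<Rightarrow> 'a \<Rightarrow> real" where
  "S \<epsilon> t f = conv (dil t f) (mu \<epsilon> t)"

lemma S_measurable [measurable]: "f \<in> borel_measurable borel \<Longrightarrow> S \<epsilon> t f \<in> borel_measurable borel"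
  unfolding S_def by (intro conv_measurable dil_measurable borel_prob_mu)

lemma integrable_S: "integrable lborel f \<Longrightarrow> integrable lborel (S \<epsilon> t f)"
  unfolding S_def by (intro integrable_conv integrable_dil borel_prob_mu)

lemma fourier_S:
  assumes "0 < \<epsilon>" "0 < t" "integrable lborel f"
  shows "fourier (S \<epsilon> t f) \<xi> = fourier f (exp (- t) *\<^sub>R \<xi>) * exp (psi \<epsilon> t \<xi>)"
  unfolding S_def using assms
  by (subst fourier_conv) (auto simp: borel_prob_mu integrable_dil cf_mu fourier_dil)

lemma fourier_eq_AE:
  assumes f: "integrable lborel f" and g: "integrable lborel g" and e: "\<And>\<xi>. fourier f \<xi> = fourier g \<xi>"
  shows "AE x in lborel. f x = g x"
proof -
  have "AE x in lborel. f x - g x = 0"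
  proof (rule fourier_injective)
    fix \<xi>
    have "fourier (\<lambda>x. f x - g x) \<xi> = fourier f \<xi> - fourier g \<xi>"
      using f g by (simp add: fourier_def scaleR_diff_left integrable_fourier)
    then show "fourier (\<lambda>x. f x - g x) \<xi> = 0" using e by simp
  qed (use f g in simp)
  then show ?thesis by eventually_elim simp
qed

text \<open>For transforms this is \<open>psi_add\<close>; transforms determine functions up to null
  sets, so the semigroup law holds almost everywhere.\<close>

lemma S_S:
  assumes "0 < \<epsilon>" "0 < s" "0 < t" and f: "integrable lborel f"
  shows "AE x in lborel. S \<epsilon> s (S \<epsilon> t f) x = S \<epsilon> (s + t) f x"
proof (rule fourier_eq_AE)
  show "fourier (S \<epsilon> s (S \<epsilon> t f)) \<xi> = fourier (S \<epsilon> (s + t) f) \<xi>" for \<xi>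
    using assms psi_add[of t s \<epsilon> \<xi>]
    by (simp add: fourier_S integrable_S add.commute[of s t] exp_add[symmetric] mult.assoc)
      (simp add: exp_add mult_ac)
qed (use f in \<open>auto intro: integrable_S\<close>)

lemma S_cong_AE:
  assumes [measurable]: "f \<in> borel_measurable borel" "g \<in> borel_measurable borel"
    and f: "integrable lborel f" and e: "AE x in lborel. f x = g x" and "0 < \<epsilon>" "0 < t"
  shows "AE x in lborel. S \<epsilon> t f x = S \<epsilon> t g x"
proof (rule fourier_eq_AE)
  have g: "integrable lborel g"
    using e f by (subst integrable_cong_AE[symmetric, of f]) auto
  have "fourier f \<xi> = fourier g \<xi>" for \<xi>
    unfolding fourier_def by (rule integral_cong_AE) (use e in auto)
  then show "fourier (S \<epsilon> t f) \<xi> = fourier (S \<epsilon> t g) \<xi>" for \<xi>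
    using assms g by (simp add: fourier_S)
  show "integrable lborel (S \<epsilon> t f)" "integrable lborel (S \<epsilon> t g)"
    using f g by (auto intro: integrable_S)
qed

lemma S_diff:
  assumes f: "integrable lborel f" and g: "integrable lborel g" and "0 < \<epsilon>" "0 < t"
  shows "AE x in lborel. S \<epsilon> t (\<lambda>x. f x - g x) x = S \<epsilon> t f x - S \<epsilon> t g x"
proof (rule fourier_eq_AE)
  have d: "fourier (\<lambda>x. u x - v x) \<xi> = fourier u \<xi> - fourier v \<xi>"
    if "integrable lborel u" "integrable lborel v" for u v \<xi>
    using that by (simp add: fourier_def scaleR_diff_left integrable_fourier)
  show "fourier (S \<epsilon> t (\<lambda>x. f x - g x)) \<xi> = fourier (\<lambda>x. S \<epsilon> t f x - S \<epsilon> t g x) \<xi>" for \<xi>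
    using assms by (simp add: fourier_S integrable_S d algebra_simps)
qed (use f g in \<open>auto intro!: integrable_S Bochner_Integration.integrable_diff\<close>)

lemma integral_S:
  assumes f: "integrable lborel f"
  shows "(LINT x|lborel. S \<epsilon> t f x) = (LINT x|lborel. f x)"
proof -
  interpret borel_prob "mu \<epsilon> t" by (rule borel_prob_mu)
  have "(LINT x|lborel. S \<epsilon> t f x *\<^sub>R (1::real)) = (LINT y|lborel. dil t f y *\<^sub>R (LINT z|mu \<epsilon> t. 1))"
    unfolding S_def by (rule integral_conv_pairing[OF borel_prob_mu integrable_dil[OF f], of _ 1]) auto
  also have "\<dots> = (LINT y|lborel. dil t f y *\<^sub>R 1)"
    using prob_space by simp
  also have "\<dots> = (LINT x|lborel. f x *\<^sub>R (1::real))"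
    by (rule integral_dil[OF f, of _ 1]) auto
  finally show ?thesis by simp
qed

lemma S_pairing:
  fixes \<phi> :: "'a \<Rightarrow> real"
  assumes f: "integrable lborel f" and [measurable]: "\<phi> \<in> borel_measurable borel" and B: "\<And>x. \<bar>\<phi> x\<bar> \<le> B"
  shows "(LINT x|lborel. S \<epsilon> t f x * \<phi> x) = (LINT y|lborel. f y * (LINT z|mu \<epsilon> t. \<phi> (exp (- t) *\<^sub>R y + z)))"
proof -
  interpret borel_prob "mu \<epsilon> t" by (rule borel_prob_mu)
  have "(LINT x|lborel. S \<epsilon> t f x *\<^sub>R \<phi> x) = (LINT y|lborel. dil t f y *\<^sub>R (LINT z|mu \<epsilon> t. \<phi> (y + z)))"
    unfolding S_def by (rule integral_conv_pairing[OF borel_prob_mu integrable_dil[OF f], of _ B]) (use B in auto)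
  also have "\<dots> = (LINT y|lborel. f y *\<^sub>R (LINT z|mu \<epsilon> t. \<phi> (exp (- t) *\<^sub>R y + z)))"
    using integral_bounded_le[of "\<lambda>z. \<phi> (y + z)" B for y] B
    by (intro integral_dil[OF f, of _ B]) auto
  finally show ?thesis by simp
qed

text \<open>A jump of age \<open>s\<close> costs
  \<open>1 + M * (\<epsilon> * exp (- s))\<^sup>2\<close>. Averaged over the age and multiplied by
  the intensity \<open>t / \<epsilon>\<^sup>2\<close>, the excess is
  \<open>M * (1 - exp (- 2 * t)) / 2\<close>: old jumps are contracted so much that the bound is
  uniform in \<open>t\<close> as well as in \<epsilon>. Only sizes up to \<epsilon> occur, which
  leaves room for weights adapted to a fixed \<epsilon>.\<close>

lemma nn_integral_mu_le:
  fixes V :: "'a \<Rightarrow> ennreal"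
  assumes [measurable]: "V \<in> borel_measurable borel" and e: "0 < \<epsilon>" and t: "0 < t" and M: "0 \<le> M"
    and V: "\<And>c x. 0 \<le> c \<Longrightarrow> c \<le> \<epsilon> \<Longrightarrow> (\<integral>\<^sup>+y. V (x + c *\<^sub>R y) \<partial>JM) \<le> ennreal (1 + M * c\<^sup>2) * V x"
  shows "(\<integral>\<^sup>+z. V (x + z) \<partial>mu \<epsilon> t) \<le> ennreal (exp (M / 2)) * V x"
proof -
  let ?m = "1 + M * \<epsilon>\<^sup>2 * ((1 - exp (- 2 * t)) / (2 * t))"
  have m: "1 \<le> ?m" using t M by simp
  have int: "(\<integral>\<^sup>+r. ennreal (1 + M * (\<epsilon> * exp (- (t * r)))\<^sup>2) \<partial>unif) = ennreal ?m"
  proof -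
    have sq: "(exp (- (t * r)))\<^sup>2 = exp (- 2 * t * r)" for r
      by (simp add: power2_eq_square exp_add[symmetric])
    have "(\<integral>\<^sup>+r. ennreal (1 + M * (\<epsilon> * exp (- (t * r)))\<^sup>2) \<partial>unif) =
        (\<integral>\<^sup>+r. ennreal (1 + M * \<epsilon>\<^sup>2 * exp (- 2 * t * r)) * indicator {0..1} r \<partial>lborel)"
      by (subst nn_integral_unif) (auto simp: power_mult_distrib sq mult.assoc)
    also have "\<dots> = ennreal ((1 - M * \<epsilon>\<^sup>2 * exp (- 2 * t * 1) / (2 * t)) - (0 - M * \<epsilon>\<^sup>2 * exp (- 2 * t * 0) / (2 * t)))"
    proof (rule nn_integral_FTC_Icc)
      show "((\<lambda>r. r - M * \<epsilon>\<^sup>2 * exp (- 2 * t * r) / (2 * t)) has_real_derivative 1 + M * \<epsilon>\<^sup>2 * exp (- 2 * t * r)) (at r)" for r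
        using t by (auto intro!: derivative_eq_intros simp: field_simps)
    qed (use M in auto)
    also have "(1 - M * \<epsilon>\<^sup>2 * exp (- 2 * t * 1) / (2 * t)) - (0 - M * \<epsilon>\<^sup>2 * exp (- 2 * t * 0) / (2 * t)) = ?m"
      by (simp add: field_simps diff_divide_distrib[symmetric] add_divide_distrib[symmetric])
    finally show ?thesis .
  qed
  have "(\<integral>\<^sup>+z. V (x + z) \<partial>kap \<epsilon> t) \<le> ennreal ?m * V x" for x
  proof -
    have "(\<integral>\<^sup>+z. V (x + z) \<partial>kap \<epsilon> t) = (\<integral>\<^sup>+r. (\<integral>\<^sup>+y. V (x + (\<epsilon> * exp (- (t * r))) *\<^sub>R y) \<partial>JM) * indicator {0..1} r \<partial>lborel)"
      by (simp add: nn_integral_kap nn_integral_unif)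
    also have "\<dots> \<le> (\<integral>\<^sup>+r. (ennreal (1 + M * (\<epsilon> * exp (- (t * r)))\<^sup>2) * V x) * indicator {0..1} r \<partial>lborel)"
    proof (intro nn_integral_mono)
      fix r :: real
      show "(\<integral>\<^sup>+y. V (x + (\<epsilon> * exp (- (t * r))) *\<^sub>R y) \<partial>JM) * indicator {0..1} r \<le>
          (ennreal (1 + M * (\<epsilon> * exp (- (t * r)))\<^sup>2) * V x) * indicator {0..1} r"
      proof (cases "r \<in> {0..1}")
        case True
        then have "\<epsilon> * exp (- (t * r)) \<le> \<epsilon>" using e t by (simp add: mult_left_le)
        then show ?thesis using e True V[of "\<epsilon> * exp (- (t * r))" x] by simp
      qed simp
    qed
    also have "\<dots> = (\<integral>\<^sup>+r. ennreal (1 + M * (\<epsilon> * exp (- (t * r)))\<^sup>2) * V x \<partial>unif)"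
      by (simp add: nn_integral_unif)
    also have "\<dots> = ennreal ?m * V x"
      by (subst nn_integral_multc) (auto simp: int)
    finally show ?thesis .
  qed
  then have "(\<integral>\<^sup>+z. V (x + z) \<partial>mu \<epsilon> t) \<le> ennreal (exp (t / \<epsilon>\<^sup>2 * (?m - 1))) * V x"
    unfolding mu_def using e t m
    by (intro nn_integral_cpoisson_le borel_prob_kap) auto
  also have "\<dots> \<le> ennreal (exp (M / 2)) * V x"
  proof -
    have "t / \<epsilon>\<^sup>2 * (?m - 1) = M * (1 - exp (- 2 * t)) / 2"
      using e t by (simp add: field_simps)
    also have "\<dots> \<le> M / 2" using M by (simp add: mult_left_le)
    finally show ?thesis by (intro mult_right_mono ennreal_leI) auto
  qed
  finally show ?thesis .
qed

lemma nn_integral_S_le: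
  fixes V :: "'a \<Rightarrow> ennreal"
  assumes [measurable]: "V \<in> borel_measurable borel" "f \<in> borel_measurable borel"
    and le: "\<And>x. (\<integral>\<^sup>+z. V (x + z) \<partial>mu \<epsilon> t) \<le> B * V x"
  shows "(\<integral>\<^sup>+x. V x * ennreal \<bar>S \<epsilon> t f x\<bar> \<partial>lborel) \<le> B * (\<integral>\<^sup>+y. V (exp (- t) *\<^sub>R y) * ennreal \<bar>f y\<bar> \<partial>lborel)"
proof -
  have "(\<integral>\<^sup>+x. V x * ennreal \<bar>S \<epsilon> t f x\<bar> \<partial>lborel) \<le> (\<integral>\<^sup>+y. ennreal \<bar>dil t f y\<bar> * (\<integral>\<^sup>+z. V (y + z) \<partial>mu \<epsilon> t) \<partial>lborel)"
    unfolding S_def by (rule nn_integral_conv_le[OF borel_prob_mu]) measurable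
  also have "\<dots> \<le> (\<integral>\<^sup>+y. ennreal \<bar>dil t f y\<bar> * (B * V y) \<partial>lborel)"
    by (intro nn_integral_mono mult_left_mono le) auto
  also have "\<dots> = (\<integral>\<^sup>+y. B * (ennreal \<bar>dil t f y\<bar> * V y) \<partial>lborel)"
    by (simp add: mult_ac)
  also have "\<dots> = B * (\<integral>\<^sup>+y. ennreal \<bar>dil t f y\<bar> * V y \<partial>lborel)"
    by (rule nn_integral_cmult) measurable
  finally show ?thesis by (simp add: nn_integral_dil mult.commute[of "V _"])
qed

end

section \<open>Overlap of the kernel with its translates\<close>

lemma positive_superlevel:
  fixes J :: "'a::euclidean_space \<Rightarrow> real"
  assumes [measurable]: "J \<in> borel_measurable borel" and "(\<integral>\<^sup>+x. ennreal (J x) \<partial>lborel) \<noteq> 0"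
  obtains c where "c > 0" "emeasure lborel {x. c < J x} \<noteq> 0"
proof (rule ccontr)
  assume *: "\<not> thesis"
  have "AE x in lborel. \<not> inverse (real (Suc n)) < J x" for n
  proof -
    have "emeasure lborel {x. inverse (real (Suc n)) < J x} = 0"
      using * that[of "inverse (real (Suc n))"] by fastforce
    then show ?thesis by (intro AE_I[where N = "{x. inverse (real (Suc n)) < J x}"]) simp_all
  qed
  then have "AE x in lborel. \<forall>n. \<not> inverse (real (Suc n)) < J x"
    by (simp add: AE_all_countable)
  then have "AE x in lborel. ennreal (J x) = 0"
  proof eventually_elim
    case (elim x)
    have "\<not> 0 < J x"
    proof
      assume "0 < J x"
      then obtain n where "inverse (real (Suc n)) < J x" using reals_Archimedean by blast
      with elim show False by blast
    qed
    then show ?case by (simp add: ennreal_neg)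
  qed
  then have "(\<integral>\<^sup>+x. ennreal (J x) \<partial>lborel) = 0"
    by (simp add: nn_integral_0_iff_AE)
  with assms show False by simp
qed

text \<open>Steinhaus' argument: a compact set of positive measure meets its small translates
  in at least half of its measure.\<close>

lemma translate_overlap:
  fixes J :: "'a::euclidean_space \<Rightarrow> real"
  assumes [measurable]: "J \<in> borel_measurable borel" and nn: "\<And>x. 0 \<le> J x"
    and i: "(\<integral>\<^sup>+x. ennreal (J x) \<partial>lborel) = 1"
  obtains \<eta> p where "\<eta> > 0" "p > 0"
    "\<And>h. norm h \<le> \<eta> \<Longrightarrow> ennreal p \<le> (\<integral>\<^sup>+x. ennreal (min (J x) (J (x + h))) \<partial>lborel)"
proof -
  obtain c where c: "c > 0" "emeasure lborel {x. c < J x} \<noteq> 0"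
    using positive_superlevel[of J] i by auto
  define A where "A = {x. c < J x}"
  have A[measurable]: "A \<in> sets borel" by (simp add: A_def)
  \<comment> \<open>Inner regularity is applied to this finite measure; absolute continuity then
    shows that the compact set found has positive Lebesgue measure too.\<close>
  define M where "M = density lborel (\<lambda>x. ennreal (J x))"
  have MA: "0 < emeasure M A"
  proof (rule ccontr)
    assume "\<not> 0 < emeasure M A"
    then have "(\<integral>\<^sup>+x. ennreal (J x) * indicator A x \<partial>lborel) = 0"
      by (simp add: M_def emeasure_density)
    then have "AE x in lborel. ennreal (J x) * indicator A x = 0"
      by (subst (asm) nn_integral_0_iff_AE) auto
    then have "AE x in lborel. x \<notin> A"
      by eventually_elim (use c(1) in \<open>auto simp: A_def indicator_def ennreal_eq_0_iff\<close>)
    then have "emeasure lborel A = 0"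
      by (subst (asm) AE_iff_measurable[of A]) auto
    with c(2) show False by (simp add: A_def)
  qed
  obtain K where K: "compact K" "K \<subseteq> A" "emeasure lborel K > 0"
  proof -
    have "emeasure M A = (SUP K\<in>{K. K \<subseteq> A \<and> compact K}. emeasure M K)"
      by (rule inner_regular) (use i in \<open>auto simp: M_def emeasure_density\<close>)
    then obtain K where K: "compact K" "K \<subseteq> A" "emeasure M K > 0"
      using MA by (auto simp: less_SUP_iff)
    have "emeasure lborel K \<noteq> 0"
    proof
      assume "emeasure lborel K = 0"
      then have "K \<in> null_sets lborel" using borel_compact[OF K(1)] by (intro null_setsI) auto
      then have "K \<in> null_sets M"
        using absolutely_continuousI_density[of "\<lambda>x. ennreal (J x)" lborel]
        unfolding absolutely_continuous_def M_def by (auto simp del: null_sets_density_iff)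
      with K(3) show False by (simp add: null_setsD1)
    qed
    then have "emeasure lborel K > 0" by (simp add: zero_less_iff_neq_zero)
    with K show ?thesis using that by blast
  qed
  have [measurable]: "K \<in> sets borel" using K(1) by (simp add: borel_compact)
  have Kfin: "emeasure lborel K < \<infinity>" by (rule emeasure_compact_finite[OF K(1)])
  define m where "m = measure lborel K"
  have m: "emeasure lborel K = ennreal m" "m > 0"
  proof -
    show eq: "emeasure lborel K = ennreal m"
      using Kfin by (simp add: m_def emeasure_eq_ennreal_measure)
    show "m > 0" using K(3) unfolding eq by simp
  qed
  \<comment> \<open>Small translates of \<open>K\<close> stay inside \<open>U\<close>, and
    \<open>U\<close> exceeds \<open>K\<close> by less than half of the measure of \<open>K\<close>;
    so at most half of a translate can miss \<open>K\<close>.\<close>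
  obtain U where U: "open U" "K \<subseteq> U" "emeasure lborel (U - K) < ennreal (m / 2)"
  proof -
    have "K \<in> sets lebesgue" by (simp add: sets_completionI_sets)
    then obtain U where U: "open U" "K \<subseteq> U" "emeasure lebesgue (U - K) < ennreal (m / 2)"
      by (rule sets_lebesgue_outer_open[of K "m / 2"]) (use m(2) in simp_all)
    moreover have "emeasure lebesgue (U - K) = emeasure lborel (U - K)"
      using U(1) by simp
    ultimately show ?thesis using that by simp
  qed
  have [measurable]: "U \<in> sets borel" using U(1) by simp
  obtain e where e: "e > 0" "(\<Union>x\<in>K. cball x e) \<subseteq> U"
    using compact_subset_open_imp_cball_epsilon_subset[OF K(1) U(1,2)] by blast
  show ?thesis
  proof (rule that[of e "c * (m / 2)"])
    show "e > 0" "c * (m / 2) > 0" using e c m by auto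
    fix h :: 'a assume h: "norm h \<le> e"
    define L where "L = {x. x + h \<in> K}"
    have [measurable]: "L \<in> sets borel" unfolding L_def by measurable
    have "L \<subseteq> U"
    proof
      fix x assume "x \<in> L"
      then have "x + h \<in> K" "x \<in> cball (x + h) e" using h by (auto simp: L_def dist_norm)
      then show "x \<in> U" using e(2) by blast
    qed
    have "emeasure lborel L = (\<integral>\<^sup>+x. indicator K (x + h) \<partial>lborel)"
    proof -
      have "indicator K (x + h) = (indicator L x :: ennreal)" for x
        by (simp add: L_def indicator_def)
      then show ?thesis by simp
    qed
    also have "\<dots> = emeasure lborel K"
      by (subst nn_integral_translate) auto
    finally have eL: "emeasure lborel L = ennreal m" using m by simp
    have "emeasure lborel L \<le> emeasure lborel ((L \<inter> K) \<union> (U - K))"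
      using \<open>L \<subseteq> U\<close> by (intro emeasure_mono) auto
    also have "\<dots> \<le> emeasure lborel (L \<inter> K) + emeasure lborel (U - K)"
      by (rule emeasure_subadditive) auto
    also have "\<dots> \<le> emeasure lborel (L \<inter> K) + ennreal (m / 2)"
      using U(3) by (intro add_left_mono) auto
    finally have *: "ennreal (m / 2 + m / 2) \<le> emeasure lborel (L \<inter> K) + ennreal (m / 2)"
      by (simp add: eL)
    have half: "ennreal (m / 2) \<le> emeasure lborel (L \<inter> K)"
    proof (cases "emeasure lborel (L \<inter> K)")
      case (real r)
      then have "ennreal (m / 2 + m / 2) \<le> ennreal (r + m / 2)"
        using * m(2) by (simp add: ennreal_plus[symmetric] del: ennreal_plus)
      then have "m / 2 + m / 2 \<le> r + m / 2"
        using m(2) real(1) by (subst (asm) ennreal_le_iff) auto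
      then show ?thesis using real by (auto intro!: ennreal_leI)
    qed simp
    have "ennreal (c * (m / 2)) = ennreal c * ennreal (m / 2)"
      using c m by (intro ennreal_mult) auto
    also have "\<dots> \<le> ennreal c * emeasure lborel (L \<inter> K)"
      by (intro mult_left_mono half) auto
    also have "\<dots> = (\<integral>\<^sup>+x. ennreal c * indicator (L \<inter> K) x \<partial>lborel)"
      by (simp add: nn_integral_cmult_indicator)
    also have "\<dots> \<le> (\<integral>\<^sup>+x. ennreal (min (J x) (J (x + h))) \<partial>lborel)"
    proof (rule nn_integral_mono)
      fix x
      have "c \<le> J y" if "y \<in> K" for y using that K(2) by (force simp: A_def)
      then show "ennreal c * indicator (L \<inter> K) x \<le> ennreal (min (J x) (J (x + h)))"
        by (auto simp: L_def indicator_def intro!: ennreal_leI)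
    qed
    finally show "ennreal (c * (m / 2)) \<le> (\<integral>\<^sup>+x. ennreal (min (J x) (J (x + h))) \<partial>lborel)" .
  qed
qed

context jump_kernel
begin

text \<open>Only the part \<open>r \<le> \<tau> / t\<close> of the jump law is used: there the jumps are not contracted by more
  than \<open>e\<^bsup>-\<tau>\<^esup>\<close>, and it is met about \<open>\<tau> / \<epsilon>\<^sup>2\<close> times, whatever \<open>t\<close> is.\<close>

lemma split_shift_kap:
  assumes ov: "\<And>h. norm h \<le> \<eta> \<Longrightarrow> ennreal p \<le> (\<integral>\<^sup>+x. ennreal (min (J x) (J (x + h))) \<partial>lborel)"
    and e: "0 < \<epsilon>" and \<tau>: "0 < \<tau>" "\<tau> \<le> t" and h: "norm h \<le> \<epsilon> * exp (- \<tau>) * \<eta>" and p: "0 < p"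
  obtains A q where "split_shift (kap \<epsilon> t) A h q" "\<tau> / t * p \<le> q"
proof -
  define c where "c r = \<epsilon> * exp (- (t * r))" for r
  \<comment> \<open>Shifting the contracted jump \<open>c r *\<^sub>R y\<close> by \<open>h\<close>
    means shifting \<open>y\<close> by \<open>h /\<^sub>R c r\<close>; the minimum is the common
    part of the kernel and this translate.\<close>
  define a where "a = (\<lambda>(r, y). (indicator {..\<tau> / t} r :: ennreal) * ennreal (min (J y) (J (y + h /\<^sub>R c r))))"
  have c: "c r > 0" for r using e by (simp add: c_def)
  have [measurable]: "c \<in> borel_measurable borel" unfolding c_def[abs_def] by measurable
  have [measurable]: "a \<in> borel_measurable (borel \<Otimes>\<^sub>M borel)" unfolding a_def by measurable
  let ?P = "unif \<Otimes>\<^sub>M lborel"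
  define A where "A = distr (density ?P a) borel (\<lambda>(r, y). c r *\<^sub>R y)"
  have sA: "sets A = sets borel" by (simp add: A_def)
  have nnA: "(\<integral>\<^sup>+z. g z \<partial>A) = (\<integral>\<^sup>+r. \<integral>\<^sup>+y. a (r, y) * g (c r *\<^sub>R y) \<partial>lborel \<partial>unif)"
    if [measurable]: "g \<in> borel_measurable borel" for g :: "'a \<Rightarrow> ennreal"
    unfolding A_def
    by (simp add: nn_integral_distr nn_integral_density lborel.nn_integral_fst[symmetric] case_prod_beta)
  have k: "(\<integral>\<^sup>+z. g z \<partial>kap \<epsilon> t) = (\<integral>\<^sup>+r. \<integral>\<^sup>+y. ennreal (J y) * g (c r *\<^sub>R y) \<partial>lborel \<partial>unif)"
    if [measurable]: "g \<in> borel_measurable borel" for g :: "'a \<Rightarrow> ennreal"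
    by (simp add: nn_integral_kap c_def[symmetric] nn_integral_JM)
  \<comment> \<open>\<open>A\<close> and its translate by \<open>h\<close> are dominated by the jump
    law separately; \<open>split_shift\<close> asks for the average of the two statements.\<close>
  have 1: "(\<integral>\<^sup>+z. g z \<partial>A) \<le> (\<integral>\<^sup>+z. g z \<partial>kap \<epsilon> t)"
    if [measurable]: "g \<in> borel_measurable borel" for g :: "'a \<Rightarrow> ennreal"
    unfolding nnA[OF that] k[OF that]
    by (intro nn_integral_mono mult_right_mono) (auto simp: a_def indicator_def intro!: ennreal_leI)
  have 2: "(\<integral>\<^sup>+z. g (z + h) \<partial>A) \<le> (\<integral>\<^sup>+z. g z \<partial>kap \<epsilon> t)"
    if [measurable]: "g \<in> borel_measurable borel" for g :: "'a \<Rightarrow> ennreal"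
  proof -
    have "(\<integral>\<^sup>+z. g (z + h) \<partial>A) = (\<integral>\<^sup>+r. \<integral>\<^sup>+y. a (r, y) * g (c r *\<^sub>R y + h) \<partial>lborel \<partial>unif)"
      by (subst nnA) auto
    also have "\<dots> \<le> (\<integral>\<^sup>+r. \<integral>\<^sup>+y. ennreal (J (y + h /\<^sub>R c r)) * g (c r *\<^sub>R (y + h /\<^sub>R c r)) \<partial>lborel \<partial>unif)"
    proof (intro nn_integral_mono mult_mono)
      fix r y
      have "c r *\<^sub>R (y + h /\<^sub>R c r) = c r *\<^sub>R y + h" using c[of r] by (simp add: scaleR_add_right)
      then show "g (c r *\<^sub>R y + h) \<le> g (c r *\<^sub>R (y + h /\<^sub>R c r))" by simp
    qed (auto simp: a_def indicator_def intro!: ennreal_leI)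
    also have "\<dots> = (\<integral>\<^sup>+r. \<integral>\<^sup>+y. ennreal (J y) * g (c r *\<^sub>R y) \<partial>lborel \<partial>unif)"
      by (intro nn_integral_cong nn_integral_translate[where f = "\<lambda>y. ennreal (J y) * g (c r *\<^sub>R y)" for r]) measurable
    finally show ?thesis by (simp add: k)
  qed
  interpret K: borel_prob "kap \<epsilon> t" by (rule borel_prob_kap)
  interpret A: finite_measure A
  proof
    have "emeasure A (space A) = (\<integral>\<^sup>+z. 1 \<partial>A)" by simp
    also have "\<dots> \<le> (\<integral>\<^sup>+z. 1 \<partial>kap \<epsilon> t)" by (rule 1) simp
    finally show "emeasure A (space A) \<noteq> \<infinity>"
      using K.emeasure_space_1 by (auto simp: top_unique)
  qed
  define q where "q = measure A UNIV"
  have ss: "split_shift (kap \<epsilon> t) A h q"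
  proof (unfold_locales)
    show "sets A = sets borel" "q = measure A UNIV" by (auto simp: sA q_def)
    fix g :: "'a \<Rightarrow> real" and B assume [measurable]: "g \<in> borel_measurable borel" and g: "\<And>x. 0 \<le> g x \<and> g x \<le> B"
    have [measurable_cong]: "sets A = sets borel" by (rule sA)
    have iA: "integrable A g" "integrable A (\<lambda>z. g (z + h))"
      using g by (auto intro!: A.integrable_const_bound[of _ B])
    have iK: "integrable (kap \<epsilon> t) g"
      using g by (intro K.integrable_bounded[of _ B]) auto
    have "ennreal (LINT z|A. g z) \<le> ennreal (LINT z|kap \<epsilon> t. g z)"
      using 1[of "\<lambda>z. ennreal (g z)"] g iA iK by (simp add: nn_integral_eq_integral)
    moreover have "ennreal (LINT z|A. g (z + h)) \<le> ennreal (LINT z|kap \<epsilon> t. g z)"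
      using 2[of "\<lambda>z. ennreal (g z)"] g iA iK by (simp add: nn_integral_eq_integral)
    moreover have "0 \<le> (LINT z|kap \<epsilon> t. g z)" using g by simp
    ultimately have "(LINT z|A. g z) \<le> (LINT z|kap \<epsilon> t. g z)" "(LINT z|A. g (z + h)) \<le> (LINT z|kap \<epsilon> t. g z)"
      by (auto simp: ennreal_le_iff)
    then show "(LINT z|A. (g z + g (z + h)) / 2) \<le> (LINT z|kap \<epsilon> t. g z)"
      using iA by simp
  qed
  have "ennreal (\<tau> / t * p) \<le> emeasure A UNIV"
  proof -
    have "ennreal (\<tau> / t * p) = (\<integral>\<^sup>+r. ennreal p * indicator {0..\<tau> / t} r \<partial>lborel)"
    proof -
      have "ennreal (\<tau> / t * p) = ennreal p * ennreal (\<tau> / t)"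
        using \<tau> p by (subst mult.commute, intro ennreal_mult) auto
      then show ?thesis using \<tau> by (simp add: nn_integral_cmult_indicator)
    qed
    also have "\<dots> = (\<integral>\<^sup>+r. (ennreal p * indicator {..\<tau> / t} r) * indicator {0..1} r \<partial>lborel)"
    proof (rule nn_integral_cong)
      fix r :: real
      have "r \<le> 1" if "r \<le> \<tau> / t" using that \<tau> by (smt (verit) divide_le_eq_1)
      then show "ennreal p * indicator {0..\<tau> / t} r = (ennreal p * indicator {..\<tau> / t} r) * indicator {0..1} r"
        by (auto simp: indicator_def)
    qed
    also have "\<dots> = (\<integral>\<^sup>+r. ennreal p * indicator {..\<tau> / t} r \<partial>unif)"
      by (subst nn_integral_unif) auto
    also have "\<dots> \<le> (\<integral>\<^sup>+r. \<integral>\<^sup>+y. a (r, y) * 1 \<partial>lborel \<partial>unif)"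
    proof (intro nn_integral_mono)
      fix r
      show "ennreal p * indicator {..\<tau> / t} r \<le> (\<integral>\<^sup>+y. a (r, y) * 1 \<partial>lborel)"
      proof (cases "r \<le> \<tau> / t")
        case True
        then have "t * r \<le> \<tau>" using \<tau> by (simp add: field_simps)
        then have "\<epsilon> * exp (- \<tau>) \<le> c r" using e by (simp add: c_def)
        moreover have "0 \<le> \<eta>"
        proof (rule ccontr)
          assume "\<not> 0 \<le> \<eta>"
          then have "\<epsilon> * exp (- \<tau>) * \<eta> < 0" using e by (simp add: mult_pos_neg)
          with h show False using norm_ge_zero[of h] by linarith
        qed
        ultimately have "norm h \<le> c r * \<eta>"
          using h mult_right_mono[of "\<epsilon> * exp (- \<tau>)" "c r" \<eta>] by linarith
        then have "norm (h /\<^sub>R c r) \<le> \<eta>" using c[of r] by (simp add: field_simps)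
        from ov[OF this] show ?thesis using True by (simp add: a_def)
      qed simp
    qed
    also have "\<dots> = (\<integral>\<^sup>+z. 1 \<partial>A)" by (subst nnA) auto
    also have "\<dots> = emeasure A UNIV" using sets_eq_imp_space_eq[OF sA] by simp
    finally show ?thesis .
  qed
  also have "emeasure A UNIV = ennreal q" by (simp add: q_def A.emeasure_eq_measure)
  finally have "\<tau> / t * p \<le> q" by (simp add: q_def)
  with ss show ?thesis by (rule that)
qed

text \<open>A shift of order one is cut into at most \<open>3 / \<epsilon>\<close> shifts of the
  size of one contracted jump. Each is hidden up to \<open>\<epsilon> / 8\<close>, so that the total
  error stays below one half.\<close>

lemma mu_shift_le_half:
  obtains h1 T0 where "h1 > 0" "T0 > 0"
    "\<And>\<epsilon> t (\<phi> :: 'a \<Rightarrow> real) x h. 0 < \<epsilon> \<Longrightarrow> \<epsilon> \<le> 1 \<Longrightarrow> T0 \<le> t \<Longrightarrow> \<phi> \<in> borel_measurable borel \<Longrightarrow> (\<And>x. \<bar>\<phi> x\<bar> \<le> 1) \<Longrightarrow> norm h \<le> h1 \<Longrightarrow>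
      \<bar>(LINT z|mu \<epsilon> t. \<phi> (x + h + z)) - (LINT z|mu \<epsilon> t. \<phi> (x + z))\<bar> \<le> 1 / 2"
proof -
  obtain \<eta> p where \<eta>: "\<eta> > 0" and p: "p > 0" and
    ov: "\<And>h. norm h \<le> \<eta> \<Longrightarrow> ennreal p \<le> (\<integral>\<^sup>+x. ennreal (min (J x) (J (x + h))) \<partial>lborel)"
    using translate_overlap[OF J_measurable J_nonneg J_mass] by blast
  \<comment> \<open>Chosen so that \<open>\<tau> * p\<close> is the square of \<open>32\<close>:
    with \<open>\<tau> / t * p \<le> q\<close> the bound
    \<open>4 / sqrt (q * (t / \<epsilon>\<^sup>2))\<close> is then at most
    \<open>\<epsilon> / 8\<close>, whatever \<open>t\<close> is.\<close>
  define \<tau> where "\<tau> = 1024 / p"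
  have \<tau>: "\<tau> > 0" "\<tau> * p = 1024" using p by (auto simp: \<tau>_def)
  define h1 where "h1 = exp (- \<tau>) * \<eta>"
  have h1: "h1 > 0" using \<eta> by (simp add: h1_def)
  show ?thesis
  proof (rule that[OF h1 \<tau>(1)])
    fix \<epsilon> t :: real and \<phi> and x h :: 'a
    assume e: "0 < \<epsilon>" "\<epsilon> \<le> 1" and t: "\<tau> \<le> t" and [measurable]: "\<phi> \<in> borel_measurable borel"
      and \<phi>: "\<And>x :: 'a. \<bar>\<phi> x\<bar> \<le> (1 :: real)" and h: "norm h \<le> h1"
    \<comment> \<open>The added \<open>1\<close> keeps \<open>m\<close> positive when
      \<open>h = 0\<close>.\<close>
    define m where "m = nat \<lceil>norm h / (\<epsilon> * h1)\<rceil> + 1"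
    define k where "k = h /\<^sub>R real m"
    have m: "real m > 0" by (simp add: m_def)
    have mh: "real m *\<^sub>R k = h" using m by (simp add: k_def)
    have "norm h / (\<epsilon> * h1) \<le> real m"
      unfolding m_def by linarith
    then have nk: "norm k \<le> \<epsilon> * h1"
      using m e h1 by (simp add: k_def field_simps)
    have "real m \<le> norm h / (\<epsilon> * h1) + 2"
      unfolding m_def using e h1 by (simp add: of_nat_nat) linarith
    also have "norm h / (\<epsilon> * h1) \<le> 1 / \<epsilon>"
      using h h1 e by (simp add: field_simps)
    also have "1 / \<epsilon> + 2 \<le> 3 / \<epsilon>" using e by (simp add: field_simps)
    finally have m3: "real m \<le> 3 / \<epsilon>" by simp
    obtain A q where ss: "split_shift (kap \<epsilon> t) A k q" and q: "\<tau> / t * p \<le> q"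
      using split_shift_kap[OF ov e(1) \<tau>(1) t _ p, where h = k] nk unfolding h1_def by (auto simp: mult.assoc)
    have "0 < \<tau> / t * p" using \<tau> p t by simp
    with q have q0: "0 < q" by linarith
    let ?I = "\<lambda>x. LINT z|mu \<epsilon> t. \<phi> (x + z)"
    have l: "0 < t / \<epsilon>\<^sup>2" using e t \<tau> by simp
    have step: "\<bar>?I (x + k) - ?I x\<bar> \<le> \<epsilon> / 8" for x
    proof -
      have "\<bar>?I (x + k) - ?I x\<bar> \<le> 4 / sqrt (q * (t / \<epsilon>\<^sup>2))"
        unfolding mu_def by (rule split_shift.cpoisson_shift_le[OF ss]) (use \<phi> l q0 in auto)
      also have "\<dots> \<le> 4 / sqrt ((32 / \<epsilon>)\<^sup>2)"
      proof (intro divide_left_mono real_sqrt_le_mono mult_pos_pos real_sqrt_gt_zero zero_less_power)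
        have "(32 / \<epsilon>)\<^sup>2 = (\<tau> / t * p) * (t / \<epsilon>\<^sup>2)"
          using \<tau> t by (simp add: power_divide)
        also have "\<dots> \<le> q * (t / \<epsilon>\<^sup>2)"
          using q l by (intro mult_right_mono) auto
        finally show "(32 / \<epsilon>)\<^sup>2 \<le> q * (t / \<epsilon>\<^sup>2)" .
              show "0 < q" "0 < t / \<epsilon>\<^sup>2" "0 < 32 / \<epsilon>" using q0 l e by auto
      qed simp
      also have "\<dots> = \<epsilon> / 8" using e by simp
      finally show ?thesis .
    qed
    have "\<bar>?I (x + real i *\<^sub>R k) - ?I x\<bar> \<le> real i * (\<epsilon> / 8)" for i
    proof (induction i)
      case (Suc i)
      have e: "x + real (Suc i) *\<^sub>R k = x + real i *\<^sub>R k + k" by (simp add: algebra_simps)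
      have "\<bar>?I (x + real (Suc i) *\<^sub>R k) - ?I x\<bar> \<le> \<bar>?I (x + real i *\<^sub>R k) - ?I x\<bar> + \<epsilon> / 8"
        unfolding e
        using step[of "x + real i *\<^sub>R k"] by linarith
      also have "\<dots> \<le> real (Suc i) * (\<epsilon> / 8)" using Suc by (simp add: algebra_simps)
      finally show ?case .
    qed simp
    from this[of m] have "\<bar>?I (x + h) - ?I x\<bar> \<le> real m * (\<epsilon> / 8)" unfolding mh .
    then show "\<bar>?I (x + h) - ?I x\<bar> \<le> 1 / 2"
      using mult_right_mono[OF m3, of "\<epsilon> / 8"] e by simp
  qed
qed

end

section \<open>Contraction in weighted spaces\<close>

text \<open>\<open>V_shrink\<close> for the drift and \<open>V_jump\<close> for the jumps make
  \<open>V\<close> a Lyapunov function, \<open>V_coercive\<close> lets the weight pay for data far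
  from the origin, and \<open>V_ray\<close> yields a plain bound at every positive time.\<close>

locale weighted_jump_kernel = jump_kernel J for J :: "'a::euclidean_space \<Rightarrow> real" +
  fixes V :: "'a \<Rightarrow> real" and M :: real
  assumes V_cont: "continuous_on UNIV V"
    and V_ge_1: "\<And>x. 1 \<le> V x"
    and V_ray: "\<And>\<theta> x. 0 \<le> \<theta> \<Longrightarrow> \<theta> \<le> 1 \<Longrightarrow> V (\<theta> *\<^sub>R x) \<le> V x"
    and V_shrink: "\<And>\<alpha>. 0 < \<alpha> \<Longrightarrow> \<exists>K t0. \<forall>t\<ge>t0. \<forall>x. V (exp (- t) *\<^sub>R x) \<le> \<alpha> * V x + K"
    and V_coercive: "\<And>L. \<exists>R. \<forall>x. R < norm x \<longrightarrow> L \<le> V x"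
    and M_nonneg: "0 \<le> M"
    and V_jump: "\<And>c x. 0 \<le> c \<Longrightarrow> c \<le> 1 \<Longrightarrow>
      (\<integral>\<^sup>+y. ennreal (V (x + c *\<^sub>R y)) \<partial>JM) \<le> ennreal (1 + M * c\<^sup>2) * ennreal (V x)"
begin

lemma V_measurable [measurable]: "V \<in> borel_measurable borel"
  by (intro borel_measurable_continuous_onI V_cont)

lemma V_pos: "0 < V x" and V_nonneg: "0 \<le> V x"
  using V_ge_1[of x] by auto

section \<open>Weighted norms and Harris' contraction\<close>

definition VL :: "('a \<Rightarrow> real) \<Rightarrow> bool" where
  "VL f \<longleftrightarrow> f \<in> borel_measurable borel \<and> integrable lborel (\<lambda>x. V x * \<bar>f x\<bar>)"

lemma VL_measurable [measurable_dest]: "VL f \<Longrightarrow> f \<in> borel_measurable borel"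
  by (simp add: VL_def)

lemma VL_V: "VL f \<Longrightarrow> integrable lborel (\<lambda>x. V x * \<bar>f x\<bar>)"
  by (simp add: VL_def)

lemma VL_integrable: "VL f \<Longrightarrow> integrable lborel f"
proof -
  assume f: "VL f"
  show ?thesis
  proof (rule Bochner_Integration.integrable_bound[OF VL_V[OF f]])
    show "AE x in lborel. norm (f x) \<le> norm (V x * \<bar>f x\<bar>)"
      using mult_right_mono[OF V_ge_1 abs_ge_zero] V_nonneg by (intro AE_I2) (simp add: abs_mult)
  qed (use f in measurable)
qed

lemma VL_diff: "VL f \<Longrightarrow> VL g \<Longrightarrow> VL (\<lambda>x. f x - g x)"
proof -
  assume fg: "VL f" "VL g"
  have "integrable lborel (\<lambda>x. V x * \<bar>f x\<bar> + V x * \<bar>g x\<bar>)"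
    using fg by (intro Bochner_Integration.integrable_add VL_V)
  then have "integrable lborel (\<lambda>x. V x * \<bar>f x - g x\<bar>)"
  proof (rule Bochner_Integration.integrable_bound)
    show "AE x in lborel. norm (V x * \<bar>f x - g x\<bar>) \<le> norm (V x * \<bar>f x\<bar> + V x * \<bar>g x\<bar>)"
    proof (rule AE_I2)
      fix x
      have "V x * \<bar>f x - g x\<bar> \<le> V x * (\<bar>f x\<bar> + \<bar>g x\<bar>)"
        by (intro mult_left_mono V_nonneg) auto
      then show "norm (V x * \<bar>f x - g x\<bar>) \<le> norm (V x * \<bar>f x\<bar> + V x * \<bar>g x\<bar>)"
        using V_nonneg[of x] by (simp add: abs_mult algebra_simps)
    qed
  qed (use fg in measurable)
  moreover have "(\<lambda>x. f x - g x) \<in> borel_measurable borel" using fg by measurable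
  ultimately show ?thesis by (simp add: VL_def)
qed

definition NV :: "('a \<Rightarrow> real) \<Rightarrow> real" where
  "NV f = (LINT x|lborel. V x * \<bar>f x\<bar>)"

definition N1 :: "('a \<Rightarrow> real) \<Rightarrow> real" where
  "N1 f = (LINT x|lborel. \<bar>f x\<bar>)"

lemma NV_nonneg: "0 \<le> NV f" and N1_nonneg: "0 \<le> N1 f"
  by (auto simp: NV_def N1_def V_nonneg intro!: integral_nonneg_AE)

lemma nn_NV: "VL f \<Longrightarrow> (\<integral>\<^sup>+x. ennreal (V x) * ennreal \<bar>f x\<bar> \<partial>lborel) = ennreal (NV f)"
  unfolding NV_def using nn_integral_eq_integral[OF VL_V] V_nonneg
  by (simp add: ennreal_mult)

lemma N1_le_NV: "VL f \<Longrightarrow> N1 f \<le> NV f"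
  unfolding N1_def NV_def
  by (intro integral_mono integrable_abs VL_integrable VL_V)
    (use mult_right_mono[OF V_ge_1 abs_ge_zero] in auto)

abbreviation "B \<equiv> exp (M / 2)"

text \<open>The drift acts first and shrinks the weight, up to an additive constant that is paid in
  plain mass; the jumps then multiply by \<open>B\<close>.\<close>

lemma S_bound:
  assumes f: "VL f" and e: "0 < \<epsilon>" "\<epsilon> \<le> 1" and t: "0 < t"
    and a: "\<And>y. V (exp (- t) *\<^sub>R y) \<le> \<alpha> * V y + K" "0 \<le> \<alpha>" "0 \<le> K"
  shows "VL (S \<epsilon> t f)" "NV (S \<epsilon> t f) \<le> B * (\<alpha> * NV f + K * N1 f)"
proof -
  have [measurable]: "f \<in> borel_measurable borel" using f by measurable
  have "(\<integral>\<^sup>+x. ennreal (V x) * ennreal \<bar>S \<epsilon> t f x\<bar> \<partial>lborel) \<le>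
      ennreal B * (\<integral>\<^sup>+y. ennreal (V (exp (- t) *\<^sub>R y)) * ennreal \<bar>f y\<bar> \<partial>lborel)"
  proof (rule nn_integral_S_le)
    show "(\<integral>\<^sup>+z. ennreal (V (x + z)) \<partial>mu \<epsilon> t) \<le> ennreal B * ennreal (V x)" for x
      by (rule nn_integral_mu_le) (use e t M_nonneg V_jump in auto)
  qed measurable
  also have "(\<integral>\<^sup>+y. ennreal (V (exp (- t) *\<^sub>R y)) * ennreal \<bar>f y\<bar> \<partial>lborel) \<le>
      (\<integral>\<^sup>+y. ennreal (\<alpha> * (V y * \<bar>f y\<bar>) + K * \<bar>f y\<bar>) \<partial>lborel)"
  proof (rule nn_integral_mono)
    fix y
    have "V (exp (- t) *\<^sub>R y) * \<bar>f y\<bar> \<le> (\<alpha> * V y + K) * \<bar>f y\<bar>"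
      by (intro mult_right_mono a) auto
    then show "ennreal (V (exp (- t) *\<^sub>R y)) * ennreal \<bar>f y\<bar> \<le> ennreal (\<alpha> * (V y * \<bar>f y\<bar>) + K * \<bar>f y\<bar>)"
      by (subst ennreal_mult[symmetric]) (auto simp: V_nonneg algebra_simps intro!: ennreal_leI)
  qed
  also have "\<dots> = ennreal (\<alpha> * NV f + K * N1 f)"
  proof -
    have i: "integrable lborel (\<lambda>y. V y * \<bar>f y\<bar>)" "integrable lborel (\<lambda>y. \<bar>f y\<bar>)"
      using VL_V[OF f] VL_integrable[OF f] by auto
    have "(\<integral>\<^sup>+y. ennreal (\<alpha> * (V y * \<bar>f y\<bar>) + K * \<bar>f y\<bar>) \<partial>lborel) = ennreal (LINT y|lborel. \<alpha> * (V y * \<bar>f y\<bar>) + K * \<bar>f y\<bar>)"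
      using i a V_nonneg by (intro nn_integral_eq_integral) auto
    then show ?thesis using i by (simp add: NV_def N1_def)
  qed
  finally have *: "(\<integral>\<^sup>+x. ennreal (V x * \<bar>S \<epsilon> t f x\<bar>) \<partial>lborel) \<le> ennreal (B * (\<alpha> * NV f + K * N1 f))"
    using a NV_nonneg[of f] N1_nonneg[of f] V_nonneg
    by (simp add: ennreal_mult mult_left_mono)
  show VL: "VL (S \<epsilon> t f)"
    unfolding VL_def
  proof
    show "integrable lborel (\<lambda>x. V x * \<bar>S \<epsilon> t f x\<bar>)"
    proof (rule integrableI_bounded)
      have "(\<integral>\<^sup>+x. ennreal (norm (V x * \<bar>S \<epsilon> t f x\<bar>)) \<partial>lborel) = (\<integral>\<^sup>+x. ennreal (V x * \<bar>S \<epsilon> t f x\<bar>) \<partial>lborel)"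
        by (simp add: abs_mult V_nonneg)
      also note *
      finally show "(\<integral>\<^sup>+x. ennreal (norm (V x * \<bar>S \<epsilon> t f x\<bar>)) \<partial>lborel) < \<infinity>"
        by (rule le_less_trans) simp
    qed measurable
  qed measurable
  from * nn_NV[OF VL] show "NV (S \<epsilon> t f) \<le> B * (\<alpha> * NV f + K * N1 f)"
    using a NV_nonneg[of f] N1_nonneg[of f] V_nonneg
    by (simp add: ennreal_mult[symmetric] ennreal_le_iff)
qed

lemma S_bounded:
  assumes f: "VL f" and e: "0 < \<epsilon>" "\<epsilon> \<le> 1" and t: "0 < t"
  shows "VL (S \<epsilon> t f)" "NV (S \<epsilon> t f) \<le> B * NV f"
  using S_bound[OF assms, of 1 0] V_ray t by auto

lemma N1_S_le:
  assumes f: "integrable lborel f"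
  shows "N1 (S \<epsilon> t f) \<le> N1 f"
proof -
  interpret borel_prob "mu \<epsilon> t" by (rule borel_prob_mu)
  have [measurable]: "f \<in> borel_measurable borel" using f by (auto dest: borel_measurable_integrable)
  have "(\<integral>\<^sup>+x. 1 * ennreal \<bar>S \<epsilon> t f x\<bar> \<partial>lborel) \<le> 1 * (\<integral>\<^sup>+y. 1 * ennreal \<bar>f y\<bar> \<partial>lborel)"
    by (rule nn_integral_S_le) (use emeasure_space_1 in auto)
  then show ?thesis
    using f integrable_S[OF f, of \<epsilon> t]
    by (simp add: N1_def nn_integral_eq_integral ennreal_le_iff)
qed

text \<open>The norm is attained by testing against the sign of \<open>S \<epsilon> t f\<close>. As
  \<open>f\<close> has mean zero, \<open>P 0\<close> may be subtracted, so only the oscillation of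
  \<open>P\<close> counts: at most \<open>1 / 2\<close> at points that the drift has brought within
  \<open>h1\<close> of the origin, and at most \<open>2\<close>, charged to the weight, at all
  others.\<close>

lemma N1_S_mean_zero:
  assumes f: "VL f" and 0: "(LINT x|lborel. f x) = 0" and L: "0 < L"
    and h1: "\<And>\<phi> x h. \<phi> \<in> borel_measurable borel \<Longrightarrow> (\<And>x. \<bar>\<phi> x :: real\<bar> \<le> 1) \<Longrightarrow> norm h \<le> h1 \<Longrightarrow>
      \<bar>(LINT z|mu \<epsilon> t. \<phi> (x + h + z)) - (LINT z|mu \<epsilon> t. \<phi> (x + z))\<bar> \<le> 1 / 2"
    and far: "\<And>y. h1 < norm (exp (- t) *\<^sub>R y) \<Longrightarrow> L \<le> V y"
  shows "N1 (S \<epsilon> t f) \<le> N1 f / 2 + 2 / L * NV f"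
proof -
  interpret borel_prob "mu \<epsilon> t" by (rule borel_prob_mu)
  have [measurable]: "f \<in> borel_measurable borel" using f by measurable
  note fi = VL_integrable[OF f]
  define \<phi> where "\<phi> x = sgn (S \<epsilon> t f x)" for x
  have [measurable]: "\<phi> \<in> borel_measurable borel" unfolding \<phi>_def by measurable
  have \<phi>: "\<bar>\<phi> x\<bar> \<le> 1" for x by (simp add: \<phi>_def sgn_if)
  define P where "P x = (LINT z|mu \<epsilon> t. \<phi> (x + z))" for x
  have [measurable]: "P \<in> borel_measurable borel" unfolding P_def by measurable
  have P1: "\<bar>P x\<bar> \<le> 1" for x
    unfolding P_def using integral_bounded_le[of "\<lambda>z. \<phi> (x + z)" 1] \<phi> by simp
  have Pd: "\<bar>P (exp (- t) *\<^sub>R y) - P 0\<bar> \<le> 1 / 2 + 2 / L * V y" for y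
  proof (cases "norm (exp (- t) *\<^sub>R y) \<le> h1")
    case True
    have "\<bar>P (0 + exp (- t) *\<^sub>R y) - P 0\<bar> \<le> 1 / 2"
      unfolding P_def by (rule h1) (use True \<phi> in auto)
    also have "\<dots> \<le> 1 / 2 + 2 / L * V y" using L V_nonneg[of y] by simp
    finally show ?thesis by simp
  next
    case False
    then have "2 \<le> 2 / L * V y" using far[of y] L by (simp add: field_simps)
    moreover have "\<bar>P (exp (- t) *\<^sub>R y) - P 0\<bar> \<le> 2"
      using P1[of "exp (- t) *\<^sub>R y"] P1[of 0] by linarith
    ultimately show ?thesis by linarith
  qed
  have "N1 (S \<epsilon> t f) = (LINT x|lborel. S \<epsilon> t f x * \<phi> x)"
    unfolding N1_def \<phi>_def by (intro Bochner_Integration.integral_cong) (auto simp: abs_sgn)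
  also have "\<dots> = (LINT y|lborel. f y * P (exp (- t) *\<^sub>R y))"
    unfolding P_def by (rule S_pairing[OF fi _ \<phi>]) measurable
  also have "\<dots> = (LINT y|lborel. f y * (P (exp (- t) *\<^sub>R y) - P 0))"
  proof -
    have "integrable lborel (\<lambda>y. f y *\<^sub>R P (exp (- t) *\<^sub>R y))"
      by (rule integrable_mult_bounded[OF fi, of _ 1]) (use P1 in auto)
    then show ?thesis using fi 0 by (simp add: right_diff_distrib)
  qed
  also have "\<dots> \<le> (LINT y|lborel. \<bar>f y\<bar> / 2 + 2 / L * (V y * \<bar>f y\<bar>))"
  proof (rule integral_mono)
    have "norm (P (exp (- t) *\<^sub>R y) - P 0) \<le> 2" for y
      using P1[of "exp (- t) *\<^sub>R y"] P1[of 0] unfolding real_norm_def by linarith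
    then have "integrable lborel (\<lambda>y. f y *\<^sub>R (P (exp (- t) *\<^sub>R y) - P 0))"
      by (intro integrable_mult_bounded[OF fi, of _ 2]) auto
    then show "integrable lborel (\<lambda>y. f y * (P (exp (- t) *\<^sub>R y) - P 0))" by simp
    show "integrable lborel (\<lambda>y. \<bar>f y\<bar> / 2 + 2 / L * (V y * \<bar>f y\<bar>))"
      using fi VL_V[OF f] by auto
    show "f y * (P (exp (- t) *\<^sub>R y) - P 0) \<le> \<bar>f y\<bar> / 2 + 2 / L * (V y * \<bar>f y\<bar>)" for y
    proof -
      have "f y * (P (exp (- t) *\<^sub>R y) - P 0) \<le> \<bar>f y\<bar> * \<bar>P (exp (- t) *\<^sub>R y) - P 0\<bar>"
        by (metis abs_ge_self abs_mult)
      also have "\<dots> \<le> \<bar>f y\<bar> * (1 / 2 + 2 / L * V y)"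
        by (intro mult_left_mono Pd) auto
      finally show ?thesis by (simp add: algebra_simps)
    qed
  qed
  also have "\<dots> = N1 f / 2 + 2 / L * NV f"
    using fi VL_V[OF f] by (simp add: N1_def NV_def)
  finally show ?thesis .
qed

text \<open>Harris' theorem in a mixed norm whose parameter \<beta> balances the two bounds. Mass
  receives \<open>1 / 2\<close> from the shift estimate and \<open>1 / 4\<close> from the Lyapunov
  constant, as \<open>\<beta> * (B * K) = 1 / 4\<close>; the weighted part receives
  \<open>\<beta> / 2\<close> from far points, as \<open>L = 4 / \<beta>\<close>, and
  \<open>\<beta> / 4\<close> from the shrinking by \<open>1 / (4 * B)\<close>.\<close>

lemma contraction_step:
  obtains \<beta> T where "\<beta> > 0" "T > 0"
    "\<And>\<epsilon> f. 0 < \<epsilon> \<Longrightarrow> \<epsilon> \<le> 1 \<Longrightarrow> VL f \<Longrightarrow> (LINT x|lborel. f x) = 0 \<Longrightarrow>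
      N1 (S \<epsilon> T f) + \<beta> * NV (S \<epsilon> T f) \<le> 3 / 4 * (N1 f + \<beta> * NV f)"
proof -
  obtain h1 T0 where h1: "h1 > 0" and T0: "T0 > 0" and
    mu: "\<And>\<epsilon> t (\<phi> :: 'a \<Rightarrow> real) x h. 0 < \<epsilon> \<Longrightarrow> \<epsilon> \<le> 1 \<Longrightarrow> T0 \<le> t \<Longrightarrow> \<phi> \<in> borel_measurable borel \<Longrightarrow> (\<And>x. \<bar>\<phi> x\<bar> \<le> 1) \<Longrightarrow> norm h \<le> h1 \<Longrightarrow>
      \<bar>(LINT z|mu \<epsilon> t. \<phi> (x + h + z)) - (LINT z|mu \<epsilon> t. \<phi> (x + z))\<bar> \<le> 1 / 2"
    using mu_shift_le_half by blast
  obtain K0 t0 where K0: "\<And>t x. t0 \<le> t \<Longrightarrow> V (exp (- t) *\<^sub>R x) \<le> 1 / (4 * B) * V x + K0"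
    using V_shrink[of "1 / (4 * B)"] by auto
  define K where "K = max K0 1"
  define \<beta> where "\<beta> = 1 / (4 * (B * K))"
  have K: "1 \<le> K" and K': "\<And>t x. t0 \<le> t \<Longrightarrow> V (exp (- t) *\<^sub>R x) \<le> 1 / (4 * B) * V x + K"
    by (simp add: K_def) (use K0 in \<open>fastforce simp: K_def intro: order_trans add_left_mono\<close>)
  have \<beta>: "\<beta> > 0" "\<beta> * (B * K) = 1 / 4" using K by (auto simp: \<beta>_def)
  define L where "L = 4 / \<beta>"
  have L: "L > 0" using \<beta> by (simp add: L_def)
  obtain R where R: "\<And>x. R < norm x \<Longrightarrow> L \<le> V x" using V_coercive by blast
  \<comment> \<open>The logarithm ensures \<open>R \<le> exp T * h1\<close>: a point that the drift
    has not brought within \<open>h1\<close> started outside the ball of radius \<open>R\<close>.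
    The maximum with \<open>1\<close> keeps its argument positive.\<close>
  define T where "T = max (max T0 t0) (ln (max R 1 / h1))"
  have T: "T0 \<le> T" "t0 \<le> T" "0 < T" using T0 by (auto simp: T_def)
  have "max R 1 / h1 \<le> exp T"
    using h1 unfolding T_def by (subst ln_le_cancel_iff[symmetric]) auto
  then have RT: "R \<le> exp T * h1"
    using h1 by (simp add: field_simps)
  show ?thesis
  proof (rule that[OF \<beta>(1) T(3)])
    fix \<epsilon> :: real and f assume e: "0 < \<epsilon>" "\<epsilon> \<le> 1" and f: "VL f" and 0: "(LINT x|lborel. f x) = 0"
    have "N1 (S \<epsilon> T f) \<le> N1 f / 2 + 2 / L * NV f"
    proof (rule N1_S_mean_zero[OF f 0 L, of h1])
      fix y :: 'a assume "h1 < norm (exp (- T) *\<^sub>R y)"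
      then have "exp T * h1 < exp T * (exp (- T) * norm y)" by (intro mult_strict_left_mono) auto
      also have "\<dots> = norm y" by (simp add: exp_minus)
      finally show "L \<le> V y" using RT R by simp
    qed (use mu e T in auto)
    also have "2 / L = \<beta> / 2" by (simp add: L_def)
    finally have 1: "N1 (S \<epsilon> T f) \<le> N1 f / 2 + \<beta> / 2 * NV f" .
    have "NV (S \<epsilon> T f) \<le> B * (1 / (4 * B) * NV f + K * N1 f)"
      by (rule S_bound[OF f e T(3)]) (use K' T K in auto)
    also have "\<dots> = NV f / 4 + (B * K) * N1 f"
      by (simp add: algebra_simps)
    finally have "\<beta> * NV (S \<epsilon> T f) \<le> \<beta> * (NV f / 4 + (B * K) * N1 f)"
      using \<beta> by (intro mult_left_mono) auto
    also have "\<dots> = \<beta> * NV f / 4 + (\<beta> * (B * K)) * N1 f"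
      by (simp add: algebra_simps)
    also have "\<dots> = \<beta> * NV f / 4 + N1 f / 4"
      unfolding \<beta>(2) by simp
    finally show "N1 (S \<epsilon> T f) + \<beta> * NV (S \<epsilon> T f) \<le> 3 / 4 * (N1 f + \<beta> * NV f)"
      using 1 by simp
  qed
qed

lemma NV_cong: "VL f \<Longrightarrow> VL g \<Longrightarrow> AE x in lborel. f x = g x \<Longrightarrow> NV f = NV g"
  unfolding NV_def by (intro integral_cong_AE) (auto elim!: eventually_mono)

lemma N1_cong: "VL f \<Longrightarrow> VL g \<Longrightarrow> AE x in lborel. f x = g x \<Longrightarrow> N1 f = N1 g"
  unfolding N1_def by (intro integral_cong_AE) (auto elim!: eventually_mono)

lemma NV_zero_AE: "VL f \<Longrightarrow> NV f \<le> 0 \<Longrightarrow> AE x in lborel. f x = 0"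
proof -
  assume f: "VL f" and "NV f \<le> 0"
  then have "NV f = 0" using NV_nonneg[of f] by simp
  then have "AE x in lborel. V x * \<bar>f x\<bar> = 0"
    unfolding NV_def using VL_V[OF f] V_nonneg by (subst (asm) integral_nonneg_eq_0_iff_AE) auto
  then show ?thesis
    by eventually_elim (use V_pos in \<open>auto simp: less_imp_neq[symmetric]\<close>)
qed

lemma iterate_S:
  assumes e: "0 < \<epsilon>" "\<epsilon> \<le> 1" and T: "0 < T" and r: "0 < r" and f: "VL f"
  shows "VL ((S \<epsilon> T ^^ n) (S \<epsilon> r f)) \<and> (AE x in lborel. (S \<epsilon> T ^^ n) (S \<epsilon> r f) x = S \<epsilon> (real n * T + r) f x)"
proof (induction n)
  case 0
  then show ?case using S_bounded(1)[OF f e r] by simp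
next
  case (Suc n)
  let ?g = "(S \<epsilon> T ^^ n) (S \<epsilon> r f)"
  have g: "VL ?g" and ge: "AE x in lborel. ?g x = S \<epsilon> (real n * T + r) f x" using Suc by auto
  have nr: "0 < real n * T + r" using T r by (simp add: add_nonneg_pos)
  have [measurable]: "f \<in> borel_measurable borel" "?g \<in> borel_measurable borel" using f g by auto
  have "AE x in lborel. S \<epsilon> T ?g x = S \<epsilon> T (S \<epsilon> (real n * T + r) f) x"
    by (rule S_cong_AE[OF _ _ VL_integrable[OF g] ge e(1) T]) measurable
  moreover have "AE x in lborel. S \<epsilon> T (S \<epsilon> (real n * T + r) f) x = S \<epsilon> (T + (real n * T + r)) f x"
    by (rule S_S[OF e(1) T nr VL_integrable[OF f]])
  moreover have "T + (real n * T + r) = real (Suc n) * T + r" by (simp add: algebra_simps)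
  ultimately have "AE x in lborel. S \<epsilon> T ?g x = S \<epsilon> (real (Suc n) * T + r) f x"
    by (simp only:) (auto elim: AE_mp)
  then show ?case using S_bounded(1)[OF g e T] by simp
qed

lemma iterate_contraction:
  assumes step: "\<And>f. VL f \<Longrightarrow> (LINT x|lborel. f x) = 0 \<Longrightarrow>
      N1 (S \<epsilon> T f) + \<beta> * NV (S \<epsilon> T f) \<le> 3 / 4 * (N1 f + \<beta> * NV f)"
    and e: "0 < \<epsilon>" "\<epsilon> \<le> 1" and T: "0 < T" and f: "VL f" "(LINT x|lborel. f x) = 0"
  shows "VL ((S \<epsilon> T ^^ n) f) \<and> (LINT x|lborel. (S \<epsilon> T ^^ n) f x) = 0 \<and>
    N1 ((S \<epsilon> T ^^ n) f) + \<beta> * NV ((S \<epsilon> T ^^ n) f) \<le> (3 / 4) ^ n * (N1 f + \<beta> * NV f)"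
proof (induction n)
  case (Suc n)
  let ?g = "(S \<epsilon> T ^^ n) f"
  have g: "VL ?g" "(LINT x|lborel. ?g x) = 0"
    and le: "N1 ?g + \<beta> * NV ?g \<le> (3 / 4) ^ n * (N1 f + \<beta> * NV f)" using Suc by auto
  have "N1 (S \<epsilon> T ?g) + \<beta> * NV (S \<epsilon> T ?g) \<le> 3 / 4 * (N1 ?g + \<beta> * NV ?g)"
    by (rule step[OF g])
  then show ?case
    using S_bounded(1)[OF g(1) e T] integral_S[OF VL_integrable[OF g(1)]] g(2) le by simp
qed (use f in simp)

lemma exponential_contraction:
  obtains C \<gamma> where "C \<ge> 1" "\<gamma> > 0"
    "\<And>\<epsilon> f t. 0 < \<epsilon> \<Longrightarrow> \<epsilon> \<le> 1 \<Longrightarrow> VL f \<Longrightarrow> (LINT x|lborel. f x) = 0 \<Longrightarrow> 0 < t \<Longrightarrow>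
      NV (S \<epsilon> t f) \<le> C * exp (- \<gamma> * t) * NV f"
proof -
  obtain \<beta> T where \<beta>: "\<beta> > 0" and T: "T > 0" and
    step: "\<And>\<epsilon> f. 0 < \<epsilon> \<Longrightarrow> \<epsilon> \<le> 1 \<Longrightarrow> VL f \<Longrightarrow> (LINT x|lborel. f x) = 0 \<Longrightarrow>
      N1 (S \<epsilon> T f) + \<beta> * NV (S \<epsilon> T f) \<le> 3 / 4 * (N1 f + \<beta> * NV f)"
    using contraction_step by blast
  define \<gamma> where "\<gamma> = ln (4 / 3) / T"
  \<comment> \<open>The \<open>4 / 3\<close> pays for rounding the time to full periods,
    \<open>1 + \<beta> * B\<close> for the mixed norm after the initial time \<open>r\<close>, and
    the division by \<beta> returns to \<open>NV\<close>.\<close>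
  define C where "C = 4 / 3 * (1 + \<beta> * B) / \<beta>"
  have "1 \<le> B" using M_nonneg by simp
  have "1 \<le> C"
  proof -
    have "\<beta> \<le> \<beta> * B" using \<beta> \<open>1 \<le> B\<close> by simp
    moreover have "0 \<le> \<beta> * B" using \<beta> by simp
    ultimately have "3 * \<beta> \<le> 3 * (\<beta> * B) + (4 + \<beta> * B)" by linarith
    then have "3 * \<beta> \<le> 4 * (1 + \<beta> * B)" by simp
    then show ?thesis using \<beta> by (simp add: C_def le_divide_eq)
  qed
  moreover have "0 < \<gamma>" using T by (simp add: \<gamma>_def)
  ultimately show ?thesis
  proof (rule that)
    fix \<epsilon> t :: real and f assume e: "0 < \<epsilon>" "\<epsilon> \<le> 1" and f: "VL f" "(LINT x|lborel. f x) = 0" and t: "0 < t"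
    \<comment> \<open>Rounding up and subtracting one, instead of rounding down, puts the remainder
      \<open>r\<close> into \<open>(0, T]\<close>: the estimates for \<open>S\<close> concern
      positive times.\<close>
    define n where "n = nat (\<lceil>t / T\<rceil> - 1)"
    define r where "r = t - real n * T"
    have "1 \<le> \<lceil>t / T\<rceil>" using t T by simp
    then have n: "real n = of_int \<lceil>t / T\<rceil> - 1" by (simp add: n_def)
    have "real n < t / T" "t / T \<le> real n + 1" unfolding n by linarith+
    then have r: "0 < r" "t \<le> (real n + 1) * T" using T by (auto simp: r_def field_simps)
    have t': "real n * T + r = t" by (simp add: r_def)
    let ?g = "S \<epsilon> r f"
    have g: "VL ?g" "(LINT x|lborel. ?g x) = 0"
      using S_bounded(1)[OF f(1) e r(1)] integral_S[OF VL_integrable[OF f(1)]] f(2) by auto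
    have it: "VL ((S \<epsilon> T ^^ n) ?g)" "AE x in lborel. (S \<epsilon> T ^^ n) ?g x = S \<epsilon> t f x"
      using iterate_S[OF e T r(1) f(1), of n] unfolding t' by auto
    have "\<beta> * NV (S \<epsilon> t f) = \<beta> * NV ((S \<epsilon> T ^^ n) ?g)"
      using NV_cong[OF it(1) S_bounded(1)[OF f(1) e t] it(2)] by simp
    also have "\<dots> \<le> N1 ((S \<epsilon> T ^^ n) ?g) + \<beta> * NV ((S \<epsilon> T ^^ n) ?g)"
      using N1_nonneg by simp
    also have "\<dots> \<le> (3 / 4) ^ n * (N1 ?g + \<beta> * NV ?g)"
      using iterate_contraction[OF step[OF e] e T g, of n] by auto
    also have "\<dots> \<le> (3 / 4) ^ n * (NV f + \<beta> * (B * NV f))"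
      using N1_S_le[OF VL_integrable[OF f(1)], of \<epsilon> r] N1_le_NV[OF f(1)] S_bounded(2)[OF f(1) e r(1)] \<beta>
      by (intro mult_left_mono add_mono) auto
    also have "\<dots> = (3 / 4) ^ n * ((1 + \<beta> * B) * NV f)" by (simp add: algebra_simps)
    also have "\<dots> \<le> (4 / 3 * exp (- \<gamma> * t)) * ((1 + \<beta> * B) * NV f)"
    proof (rule mult_right_mono)
      have "\<gamma> * t \<le> real (Suc n) * ln (4 / 3)"
      proof -
        have "\<gamma> * t \<le> \<gamma> * ((real n + 1) * T)" using r \<open>0 < \<gamma>\<close> by (intro mult_left_mono) auto
        also have "\<dots> = real (Suc n) * ln (4 / 3)" using T by (simp add: \<gamma>_def)
        finally show ?thesis .
      qed
      then have "exp (- (real (Suc n) * ln (4 / 3))) \<le> exp (- \<gamma> * t)" by simp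
      also have "exp (- (real (Suc n) * ln (4 / 3))) = (3 / 4 :: real) ^ Suc n"
        by (simp add: exp_minus exp_of_nat_mult power_inverse[symmetric] del: of_nat_Suc power_Suc)
      finally show "(3 / 4) ^ n \<le> 4 / 3 * exp (- \<gamma> * t)" by simp
      show "0 \<le> (1 + \<beta> * B) * NV f" using \<beta> NV_nonneg[of f] by simp
    qed
    also have "\<dots> = \<beta> * (C * exp (- \<gamma> * t) * NV f)"
      using \<beta> by (simp add: C_def)
    finally have "\<beta> * NV (S \<epsilon> t f) \<le> \<beta> * (C * exp (- \<gamma> * t) * NV f)" .
    then show "NV (S \<epsilon> t f) \<le> C * exp (- \<gamma> * t) * NV f" using \<beta> by simp
  qed
qed

text \<open>At the time when the contraction factor equals \<open>1 / 2\<close>, stationarity gives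
  \<open>NV f \<le> NV f / 2\<close>.\<close>

lemma stationary_zero:
  assumes e: "0 < \<epsilon>" "\<epsilon> \<le> 1" and f: "VL f" "(LINT x|lborel. f x) = 0"
    and st: "\<And>t. 0 < t \<Longrightarrow> AE x in lborel. S \<epsilon> t f x = f x"
  shows "AE x in lborel. f x = 0"
proof -
  obtain C \<gamma> where C: "C \<ge> 1" "\<gamma> > 0"
    "\<And>\<epsilon> f t. 0 < \<epsilon> \<Longrightarrow> \<epsilon> \<le> 1 \<Longrightarrow> VL f \<Longrightarrow> (LINT x|lborel. f x) = 0 \<Longrightarrow> 0 < t \<Longrightarrow>
      NV (S \<epsilon> t f) \<le> C * exp (- \<gamma> * t) * NV f"
    using exponential_contraction by blast
  define t where "t = ln (2 * C) / \<gamma>"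
  have t: "0 < t" using C by (simp add: t_def)
  have "NV f = NV (S \<epsilon> t f)"
    using NV_cong[OF S_bounded(1)[OF f(1) e t] f(1) st[OF t]] by simp
  also have "\<dots> \<le> C * exp (- \<gamma> * t) * NV f" by (rule C(3)[OF e f t])
  also have "C * exp (- \<gamma> * t) = 1 / 2"
    using C by (simp add: t_def exp_minus)
  finally have "NV f \<le> 0" by simp
  then show ?thesis by (rule NV_zero_AE[OF f(1)])
qed

lemma S_nonneg: "(\<And>x. 0 \<le> f x) \<Longrightarrow> 0 \<le> S \<epsilon> t f x"
  unfolding S_def conv_def dil_def by (intro integral_nonneg_AE AE_I2) simp

lemma iterate_nonneg: "(\<And>x. 0 \<le> f x) \<Longrightarrow> 0 \<le> (S \<epsilon> T ^^ n) f x"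
  by (induction n arbitrary: x) (auto intro!: S_nonneg)

text \<open>In the last clause the jump estimate is required for \<open>c \<le> \<epsilon>\<close> only, so \<open>W\<close> may grow faster than
  the weights for which the contraction is uniform in \<open>\<epsilon>\<close>.\<close>

lemma exists_stationary:
  assumes e: "0 < \<epsilon>" "\<epsilon> \<le> 1"
  obtains F where "VL F" "AE x in lborel. 0 \<le> F x" "(LINT x|lborel. F x) = 1"
    "\<And>t. 0 < t \<Longrightarrow> AE x in lborel. S \<epsilon> t F x = F x"
    "\<And>W m. continuous_on UNIV W \<Longrightarrow> (\<And>x. 0 \<le> W x) \<Longrightarrow>
      (\<And>\<theta> x. 0 \<le> \<theta> \<Longrightarrow> \<theta> \<le> 1 \<Longrightarrow> W (\<theta> *\<^sub>R x) \<le> W x) \<Longrightarrow> 0 \<le> m \<Longrightarrow>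
      (\<And>c x. 0 \<le> c \<Longrightarrow> c \<le> \<epsilon> \<Longrightarrow>
        (\<integral>\<^sup>+y. ennreal (W (x + c *\<^sub>R y)) \<partial>JM) \<le> ennreal (1 + m * c\<^sup>2) * ennreal (W x)) \<Longrightarrow>
      integrable lborel (\<lambda>x. W x * \<bar>F x\<bar>)"
proof -
  obtain \<beta> T where \<beta>: "\<beta> > 0" and T: "T > 0" and
    step: "\<And>\<epsilon> f. 0 < \<epsilon> \<Longrightarrow> \<epsilon> \<le> 1 \<Longrightarrow> VL f \<Longrightarrow> (LINT x|lborel. f x) = 0 \<Longrightarrow>
      N1 (S \<epsilon> T f) + \<beta> * NV (S \<epsilon> T f) \<le> 3 / 4 * (N1 f + \<beta> * NV f)"
    using contraction_step by blast
  let ?C = "cball 0 1 :: 'a set"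
  define v where "v = measure lborel ?C"
  have v: "v > 0" unfolding v_def using content_cball_pos[of 1 "0 :: 'a"] by simp
  \<comment> \<open>A bounded density with compact support is integrable against every continuous
    weight, in particular against the unspecified \<open>W\<close> of the last clause.\<close>
  define f0 where "f0 x = indicator ?C x / v" for x :: 'a
  have [measurable]: "?C \<in> sets borel" by simp
  have [measurable]: "f0 \<in> borel_measurable borel" unfolding f0_def[abs_def] by (intro borel_measurable_divide borel_measurable_indicator) auto
  have f0_nonneg: "0 \<le> f0 x" for x using v by (simp add: f0_def)
  have f0W: "integrable lborel (\<lambda>x. W x * \<bar>f0 x\<bar>)" if "continuous_on UNIV W" for W :: "'a \<Rightarrow> real"
  proof -
    have "set_integrable lborel ?C (\<lambda>x. W x / v)"
      unfolding set_integrable_def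
      using v by (intro borel_integrable_compact continuous_intros continuous_on_subset[OF that]) auto
    moreover have "(\<lambda>x. indicator ?C x *\<^sub>R (W x / v)) = (\<lambda>x. W x * \<bar>f0 x\<bar>)"
      using v by (auto simp: f0_def indicator_def)
    ultimately show ?thesis by (simp add: set_integrable_def)
  qed
  have f0: "VL f0" unfolding VL_def using f0W[OF V_cont] by simp
  have f0_int: "(LINT x|lborel. f0 x) = 1"
    using v by (simp add: f0_def[abs_def] v_def)
  define g where "g n = (S \<epsilon> T ^^ n) (S \<epsilon> T f0)" for n
  \<comment> \<open>Increments have mean zero, so they shrink geometrically in the mixed norm; their
    series converges almost everywhere with an integrable weighted majorant.\<close>
  define d where "d n x = g (Suc n) x - g n x" for n x
  have g: "VL (g n)" "AE x in lborel. g n x = S \<epsilon> (real n * T + T) f0 x" for n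
    using iterate_S[OF e T T f0, of n] by (auto simp: g_def)
  have g_Suc: "g (Suc n) = S \<epsilon> T (g n)" for n by (simp add: g_def)
  have g_nonneg: "0 \<le> g n x" for n x
    unfolding g_def by (intro iterate_nonneg S_nonneg f0_nonneg)
  have g_int: "(LINT x|lborel. g n x) = 1" for n
  proof (induction n)
    case 0
    then show ?case using integral_S[OF VL_integrable[OF f0]] f0_int by (simp add: g_def)
  next
    case (Suc n)
    then show ?case unfolding g_Suc using integral_S[OF VL_integrable[OF g(1)]] by simp
  qed
  have d: "VL (d n)" for n unfolding d_def[abs_def] by (intro VL_diff g)
  have d_int: "(LINT x|lborel. d n x) = 0" for n
    unfolding d_def[abs_def] using g_int VL_integrable[OF g(1)] by (subst Bochner_Integration.integral_diff) auto
  have [measurable]: "g n \<in> borel_measurable borel" "d n \<in> borel_measurable borel" for n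
    using g(1)[of n] d[of n] by auto
  have d_Suc: "AE x in lborel. d (Suc n) x = S \<epsilon> T (d n) x" for n
    using S_diff[OF VL_integrable[OF g(1)[of "Suc n"]] VL_integrable[OF g(1)[of n]] e(1) T]
    unfolding d_def[abs_def] g_Suc[symmetric] by eventually_elim simp
  have dN: "N1 (d n) + \<beta> * NV (d n) \<le> (3 / 4) ^ n * (N1 (d 0) + \<beta> * NV (d 0))" for n
  proof (induction n)
    case (Suc n)
    have "N1 (d (Suc n)) + \<beta> * NV (d (Suc n)) = N1 (S \<epsilon> T (d n)) + \<beta> * NV (S \<epsilon> T (d n))"
      using N1_cong[OF d S_bounded(1)[OF d e T] d_Suc] NV_cong[OF d S_bounded(1)[OF d e T] d_Suc] by simp
    also have "\<dots> \<le> 3 / 4 * (N1 (d n) + \<beta> * NV (d n))" by (rule step[OF e d d_int])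
    finally show ?case using Suc by simp
  qed simp
  define c where "c = (N1 (d 0) + \<beta> * NV (d 0)) / \<beta>"
  have NVd: "NV (d n) \<le> (3 / 4) ^ n * c" for n
  proof -
    have "\<beta> * NV (d n) \<le> (3 / 4) ^ n * (N1 (d 0) + \<beta> * NV (d 0))"
      using dN[of n] N1_nonneg[of "d n"] by linarith
    then show ?thesis using \<beta> by (simp add: c_def field_simps)
  qed
  have c0: "0 \<le> c" unfolding c_def using \<beta> N1_nonneg NV_nonneg by simp
  have sumNV: "summable (\<lambda>n. NV (d n))"
  proof (rule summable_comparison_test')
    show "summable (\<lambda>n. (3 / 4) ^ n * c)" by (intro summable_mult2 summable_geometric) simp
    show "norm (NV (d n)) \<le> (3 / 4) ^ n * c" for n using NVd NV_nonneg by simp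
  qed
  have AEsum: "AE x in lborel. summable (\<lambda>n. V x * \<bar>d n x\<bar>)"
  proof -
    have "(\<integral>\<^sup>+x. (\<Sum>n. ennreal (V x * \<bar>d n x\<bar>)) \<partial>lborel) = (\<Sum>n. \<integral>\<^sup>+x. ennreal (V x * \<bar>d n x\<bar>) \<partial>lborel)"
      by (rule nn_integral_suminf) measurable
    also have "\<dots> = (\<Sum>n. ennreal (NV (d n)))"
      unfolding NV_def using VL_V[OF d] V_nonneg by (intro suminf_cong nn_integral_eq_integral) auto
    also have "\<dots> \<noteq> \<infinity>"
      using sumNV NV_nonneg by (simp add: suminf_ennreal2)
    finally have "AE x in lborel. (\<Sum>n. ennreal (V x * \<bar>d n x\<bar>)) \<noteq> \<infinity>"
      by (intro nn_integral_PInf_AE) simp_all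
    then show ?thesis
    proof eventually_elim
      case (elim x)
      show ?case by (rule summable_suminf_not_top) (use elim V_nonneg in auto)
    qed
  qed
  have intsum: "integrable lborel (\<lambda>x. \<Sum>n. V x * \<bar>d n x\<bar>)"
  proof (rule integrable_suminf)
    have *: "norm (V x * \<bar>d n x\<bar>) = V x * \<bar>d n x\<bar>" for n x
      using V_nonneg by (simp add: abs_mult)
    show "AE x in lborel. summable (\<lambda>n. norm (V x * \<bar>d n x\<bar>))"
      unfolding * by (rule AEsum)
    show "summable (\<lambda>n. LINT x|lborel. norm (V x * \<bar>d n x\<bar>))"
      unfolding * NV_def[symmetric] by (rule sumNV)
  qed (rule VL_V[OF d])
  define F where "F x = g 0 x + (\<Sum>n. d n x)" for x
  have [measurable]: "F \<in> borel_measurable borel" unfolding F_def[abs_def] by measurable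
  have lim: "AE x in lborel. (\<lambda>n. g n x) \<longlonglongrightarrow> F x \<and> (\<forall>n. V x * \<bar>g n x\<bar> \<le> V x * \<bar>g 0 x\<bar> + (\<Sum>n. V x * \<bar>d n x\<bar>))"
    using AEsum
  proof eventually_elim
    case (elim x)
    have dx: "summable (\<lambda>n. \<bar>d n x\<bar>)"
    proof -
      have "(\<lambda>n. 1 / V x * (V x * \<bar>d n x\<bar>)) = (\<lambda>n. \<bar>d n x\<bar>)" using V_pos[of x] by auto
      then show ?thesis using summable_mult[OF elim, of "1 / V x"] by (simp only:)
    qed
    have part: "g n x = g 0 x + (\<Sum>i<n. d i x)" for n
      by (induction n) (auto simp: d_def)
    have "(\<lambda>n. \<Sum>i<n. d i x) \<longlonglongrightarrow> (\<Sum>n. d n x)"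
      using summable_LIMSEQ[OF summable_rabs_cancel[OF dx]] .
    then have "(\<lambda>n. g 0 x + (\<Sum>i<n. d i x)) \<longlonglongrightarrow> F x"
      unfolding F_def by (intro tendsto_intros)
    then have "(\<lambda>n. g n x) \<longlonglongrightarrow> F x"
      unfolding part[symmetric] .
    moreover have "V x * \<bar>g n x\<bar> \<le> V x * \<bar>g 0 x\<bar> + (\<Sum>n. V x * \<bar>d n x\<bar>)" for n
    proof -
      have "V x * \<bar>g n x\<bar> \<le> V x * (\<bar>g 0 x\<bar> + (\<Sum>i<n. \<bar>d i x\<bar>))"
        unfolding part[of n]
        by (intro mult_left_mono V_nonneg order_trans[OF abs_triangle_ineq] add_left_mono sum_abs)
      also have "\<dots> = V x * \<bar>g 0 x\<bar> + (\<Sum>i<n. V x * \<bar>d i x\<bar>)"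
        by (simp add: distrib_left sum_distrib_left)
      also have "(\<Sum>i<n. V x * \<bar>d i x\<bar>) \<le> (\<Sum>n. V x * \<bar>d n x\<bar>)"
        by (rule sum_le_suminf[OF elim]) (auto simp: V_nonneg)
      finally show ?thesis by simp
    qed
    ultimately show ?case by blast
  qed
  define D where "D x = V x * \<bar>g 0 x\<bar> + (\<Sum>n. V x * \<bar>d n x\<bar>)" for x
  have D: "integrable lborel D"
    unfolding D_def using VL_V[OF g(1)] intsum by auto
  have F: "VL F"
    unfolding VL_def
  proof
    show "integrable lborel (\<lambda>x. V x * \<bar>F x\<bar>)"
    proof (rule Bochner_Integration.integrable_bound[OF D])
      show "AE x in lborel. norm (V x * \<bar>F x\<bar>) \<le> norm (D x)"
        using lim
      proof eventually_elim
        case (elim x)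
        have "(\<lambda>n. V x * \<bar>g n x\<bar>) \<longlonglongrightarrow> V x * \<bar>F x\<bar>" using elim by (intro tendsto_intros) auto
        then have "V x * \<bar>F x\<bar> \<le> D x"
          by (rule LIMSEQ_le_const2) (use elim in \<open>auto simp: D_def\<close>)
        then show ?case using V_nonneg[of x] by (simp add: abs_mult)
      qed
    qed measurable
  qed measurable
  have F_nonneg: "AE x in lborel. 0 \<le> F x"
    using lim
  proof eventually_elim
    case (elim x)
    then show ?case using g_nonneg by (intro LIMSEQ_le_const[of "\<lambda>n. g n x"]) auto
  qed
  have four: "(\<lambda>n. fourier (g n) \<xi>) \<longlonglongrightarrow> fourier F \<xi>" for \<xi>
    unfolding fourier_def
  proof (rule integral_dominated_convergence[OF _ _ D])
    show "AE x in lborel. (\<lambda>n. g n x *\<^sub>R cis (\<xi> \<bullet> x)) \<longlonglongrightarrow> F x *\<^sub>R cis (\<xi> \<bullet> x)"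
      using lim by eventually_elim (auto intro!: tendsto_intros)
    show "AE x in lborel. norm (g n x *\<^sub>R cis (\<xi> \<bullet> x)) \<le> D x" for n
      using lim
    proof eventually_elim
      case (elim x)
      have "1 * \<bar>g n x\<bar> \<le> V x * \<bar>g n x\<bar>" by (intro mult_right_mono V_ge_1) auto
      then show ?case using elim by (auto simp: D_def intro: order_trans)
    qed
  qed measurable
  have F1: "(LINT x|lborel. F x) = 1"
  proof -
    have *: "fourier f 0 = of_real (LINT x|lborel. f x)" for f :: "'a \<Rightarrow> real"
      by (simp add: fourier_def scaleR_conv_of_real)
    have "(\<lambda>n. 1) \<longlonglongrightarrow> fourier F 0" using four[of 0] by (simp add: * g_int)
    then have "fourier F 0 = 1" by (simp add: LIMSEQ_const_iff)
    then show ?thesis by (simp add: *)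
  qed
  have FT: "AE x in lborel. S \<epsilon> T F x = F x"
  proof (rule fourier_eq_AE)
    fix \<xi>
    have "(\<lambda>n. fourier (g (Suc n)) \<xi>) \<longlonglongrightarrow> fourier F \<xi>"
      by (rule LIMSEQ_Suc[OF four])
    moreover have "(\<lambda>n. fourier (g (Suc n)) \<xi>) \<longlonglongrightarrow> fourier F (exp (- T) *\<^sub>R \<xi>) * exp (psi \<epsilon> T \<xi>)"
      unfolding g_Suc fourier_S[OF e(1) T VL_integrable[OF g(1)]] by (intro tendsto_intros four)
    ultimately have "fourier F \<xi> = fourier F (exp (- T) *\<^sub>R \<xi>) * exp (psi \<epsilon> T \<xi>)"
      by (rule LIMSEQ_unique)
    then show "fourier (S \<epsilon> T F) \<xi> = fourier F \<xi>"
      by (simp add: fourier_S[OF e(1) T VL_integrable[OF F]])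
  qed (use VL_integrable[OF F] in \<open>auto intro: integrable_S\<close>)
  \<comment> \<open>So far only time \<open>T\<close> is covered. As \<open>S \<epsilon> t\<close>
    and \<open>S \<epsilon> T\<close> commute, the difference \<open>S \<epsilon> t F - F\<close> is
    again fixed by \<open>S \<epsilon> T\<close>; it has mean zero, so the strict contraction
    annihilates it.\<close>
  have St: "AE x in lborel. S \<epsilon> t F x = F x" if t: "0 < t" for t
  proof -
    let ?D = "\<lambda>x. S \<epsilon> t F x - F x"
    have SF: "VL (S \<epsilon> t F)" by (rule S_bounded(1)[OF F e t])
    have D': "VL ?D" by (rule VL_diff[OF SF F])
    have D0: "(LINT x|lborel. ?D x) = 0"
      using VL_integrable[OF SF] VL_integrable[OF F] integral_S[OF VL_integrable[OF F], of \<epsilon> t] by simp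
    have [measurable]: "S \<epsilon> t F \<in> borel_measurable borel" "S \<epsilon> T F \<in> borel_measurable borel" by measurable
    have a: "AE x in lborel. S \<epsilon> T (S \<epsilon> t F) x = S \<epsilon> (T + t) F x"
      by (rule S_S[OF e(1) T t VL_integrable[OF F]])
    have b: "AE x in lborel. S \<epsilon> t (S \<epsilon> T F) x = S \<epsilon> (t + T) F x"
      by (rule S_S[OF e(1) t T VL_integrable[OF F]])
    have c: "AE x in lborel. S \<epsilon> t (S \<epsilon> T F) x = S \<epsilon> t F x"
      by (rule S_cong_AE[OF _ _ integrable_S[OF VL_integrable[OF F]] FT e(1) t]) measurable
    have dd: "AE x in lborel. S \<epsilon> T ?D x = S \<epsilon> T (S \<epsilon> t F) x - S \<epsilon> T F x"
      by (rule S_diff[OF VL_integrable[OF SF] VL_integrable[OF F] e(1) T])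
    have SD: "AE x in lborel. S \<epsilon> T ?D x = ?D x"
      using a b c dd FT by eventually_elim (simp add: add.commute)
    have "N1 ?D + \<beta> * NV ?D = N1 (S \<epsilon> T ?D) + \<beta> * NV (S \<epsilon> T ?D)"
      using N1_cong[OF S_bounded(1)[OF D' e T] D' SD] NV_cong[OF S_bounded(1)[OF D' e T] D' SD] by simp
    also have "\<dots> \<le> 3 / 4 * (N1 ?D + \<beta> * NV ?D)" by (rule step[OF e D' D0])
    finally have "N1 ?D + \<beta> * NV ?D \<le> 0" by simp
    then have "\<beta> * NV ?D \<le> 0" using N1_nonneg[of ?D] by linarith
    then have "NV ?D \<le> 0" using \<beta> by (simp add: mult_le_0_iff)
    from NV_zero_AE[OF D' this] show ?thesis by eventually_elim simp
  qed
  show ?thesis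
  proof (rule that[OF F F_nonneg F1 St])
    fix W m
    assume W: "continuous_on UNIV W" "\<And>x. 0 \<le> W x"
      "\<And>\<theta> x. 0 \<le> \<theta> \<Longrightarrow> \<theta> \<le> 1 \<Longrightarrow> W (\<theta> *\<^sub>R x) \<le> W x" "0 \<le> m"
      "\<And>c x. 0 \<le> c \<Longrightarrow> c \<le> \<epsilon> \<Longrightarrow> (\<integral>\<^sup>+y. ennreal (W (x + c *\<^sub>R y)) \<partial>JM) \<le> ennreal (1 + m * c\<^sup>2) * ennreal (W x)"
    have [measurable]: "W \<in> borel_measurable borel" by (intro borel_measurable_continuous_onI W)
    let ?I = "ennreal (exp (m / 2)) * (\<integral>\<^sup>+y. ennreal (W y * \<bar>f0 y\<bar>) \<partial>lborel)"
    have bound: "(\<integral>\<^sup>+x. ennreal (W x) * ennreal \<bar>g n x\<bar> \<partial>lborel) \<le> ?I" for n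
    proof -
      let ?t = "real n * T + T"
      have t: "0 < ?t" using T by (simp add: add_nonneg_pos)
      have "(\<integral>\<^sup>+x. ennreal (W x) * ennreal \<bar>g n x\<bar> \<partial>lborel) = (\<integral>\<^sup>+x. ennreal (W x) * ennreal \<bar>S \<epsilon> ?t f0 x\<bar> \<partial>lborel)"
        by (intro nn_integral_cong_AE) (use g(2)[of n] in \<open>auto elim!: eventually_mono\<close>)
      also have "\<dots> \<le> ennreal (exp (m / 2)) * (\<integral>\<^sup>+y. ennreal (W (exp (- ?t) *\<^sub>R y)) * ennreal \<bar>f0 y\<bar> \<partial>lborel)"
      proof (rule nn_integral_S_le)
        show "(\<integral>\<^sup>+z. ennreal (W (x + z)) \<partial>mu \<epsilon> ?t) \<le> ennreal (exp (m / 2)) * ennreal (W x)" for x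
          by (rule nn_integral_mu_le) (use W e t in auto)
      qed measurable
      also have "\<dots> \<le> ?I"
      proof (intro mult_left_mono nn_integral_mono)
        fix y
        show "ennreal (W (exp (- ?t) *\<^sub>R y)) * ennreal \<bar>f0 y\<bar> \<le> ennreal (W y * \<bar>f0 y\<bar>)"
          using W(2) W(3)[of "exp (- ?t)" y] t
          by (subst ennreal_mult[symmetric]) (auto intro!: ennreal_leI mult_right_mono)
      qed simp
      finally show ?thesis .
    qed
    have "(\<integral>\<^sup>+x. ennreal (W x * \<bar>F x\<bar>) \<partial>lborel) = (\<integral>\<^sup>+x. liminf (\<lambda>n. ennreal (W x * \<bar>g n x\<bar>)) \<partial>lborel)"
    proof (rule nn_integral_cong_AE)
      show "AE x in lborel. ennreal (W x * \<bar>F x\<bar>) = liminf (\<lambda>n. ennreal (W x * \<bar>g n x\<bar>))"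
        using lim
      proof eventually_elim
        case (elim x)
        have "(\<lambda>n. ennreal (W x * \<bar>g n x\<bar>)) \<longlonglongrightarrow> ennreal (W x * \<bar>F x\<bar>)"
          using elim by (intro tendsto_ennrealI tendsto_intros) auto
        then show ?case by (simp add: lim_imp_Liminf)
      qed
    qed
    \<comment> \<open>Fatou's lemma: the \<open>W\<close>-moments of the iterates are bounded by
      \<open>?I\<close>, while their convergence to \<open>F\<close> is known pointwise and in the
      weight \<open>V\<close>.\<close>
    also have "\<dots> \<le> liminf (\<lambda>n. \<integral>\<^sup>+x. ennreal (W x * \<bar>g n x\<bar>) \<partial>lborel)"
      by (rule nn_integral_liminf) measurable
    also have "\<dots> \<le> liminf (\<lambda>n. ?I)"
      by (intro Liminf_mono always_eventually allI) (use bound W(2) in \<open>simp add: ennreal_mult\<close>)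
    also have "\<dots> = ?I" by (simp add: Liminf_const)
    also have "?I < \<infinity>"
      using f0W[OF W(1)] W(2) by (auto simp: integrable_iff_bounded abs_mult ennreal_mult_less_top)
    finally have "(\<integral>\<^sup>+x. ennreal (W x * \<bar>F x\<bar>) \<partial>lborel) < \<infinity>" .
    then show "integrable lborel (\<lambda>x. W x * \<bar>F x\<bar>)"
      using W(2) by (intro integrableI_bounded) (auto simp: abs_mult)
  qed
qed

end

section \<open>Polynomial and exponential weights\<close>

text \<open>Taylor expansion arranged for later cancellation: the one-sided bound on
  \<open>d\<close> keeps the linear part \<open>l\<close> intact, while the two-sided bound enters
  the quadratic remainder only.\<close>

lemma exp_le_quadratic:
  fixes d l c c1 n :: real
  assumes "d \<le> l + c * n\<^sup>2" "\<bar>d\<bar> \<le> c1 * n" "0 \<le> n"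
  shows "exp d \<le> 1 + l + (c + c1\<^sup>2 * exp (c1 * n)) * n\<^sup>2"
proof -
  obtain t where t: "\<bar>t\<bar> \<le> \<bar>d\<bar>" "exp d = (\<Sum>m<2. d ^ m / fact m) + exp t / fact 2 * d ^ 2"
    using Maclaurin_exp_le[of d 2] by auto
  have "exp t / fact 2 * d\<^sup>2 \<le> exp (c1 * n) * (c1 * n)\<^sup>2"
  proof (rule mult_mono)
    have "exp t \<le> exp (c1 * n)" using t assms by simp
    then show "exp t / fact 2 \<le> exp (c1 * n)"
      using exp_gt_zero[of "c1 * n"] unfolding fact_2 by (auto simp: divide_le_eq intro: order_trans[of _ "exp (c1 * n) * 1"])
    show "d\<^sup>2 \<le> (c1 * n)\<^sup>2" using assms(2) by (metis abs_ge_zero abs_le_square_iff abs_of_nonneg order_trans)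
  qed auto
  moreover have "(\<Sum>m<2. d ^ m / fact m) = 1 + d" by (simp add: numeral_2_eq_2)
  ultimately have "exp d \<le> 1 + d + exp (c1 * n) * (c1 * n)\<^sup>2" using t by simp
  with assms(1) show ?thesis by (simp add: power_mult_distrib algebra_simps)
qed

context jump_kernel
begin

text \<open>Integration against \<open>J\<close> annihilates the term
  \<open>l x \<bullet> y\<close>. The majorant \<open>Q\<close> is the same for all scales
  \<open>c \<le> e\<close>, so the constant in front of \<open>c\<^sup>2\<close> depends neither on
  \<open>c\<close> nor on \<open>x\<close>.\<close>

lemma nn_integral_jump_le:
  fixes V :: "'a \<Rightarrow> real" and l :: "'a \<Rightarrow> 'a" and q Q :: "'a \<Rightarrow> real"
  assumes [measurable]: "V \<in> borel_measurable borel" and Vn: "\<And>x. 0 \<le> V x"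
    and mean: "\<And>u. integrable lborel (\<lambda>y. J y * (u \<bullet> y))" "\<And>u. (LINT y|lborel. J y * (u \<bullet> y)) = 0"
    and V: "\<And>x y. V (x + y) \<le> V x + l x \<bullet> y + V x * q y"
    and Q: "\<And>c y. 0 \<le> c \<Longrightarrow> c \<le> e \<Longrightarrow> q (c *\<^sub>R y) \<le> c\<^sup>2 * Q y"
    and Qi: "integrable lborel (\<lambda>y. J y * Q y)"
    and c: "0 \<le> c" "c \<le> e"
  shows "(\<integral>\<^sup>+y. ennreal (V (x + c *\<^sub>R y)) \<partial>JM) \<le> ennreal (1 + (LINT y|lborel. J y * Q y) * c\<^sup>2) * ennreal (V x)"
proof -
  have Ji: "integrable lborel J" and J1: "(LINT y|lborel. J y) = 1"
    using J_mass J_nonneg by (auto intro!: integrableI_bounded integral_eq_nn_integral[THEN trans])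
  let ?R = "\<lambda>y. V x + (c *\<^sub>R l x) \<bullet> y + (V x * c\<^sup>2) * Q y"
  have le: "V (x + c *\<^sub>R y) \<le> ?R y" for y
  proof -
    have "V (x + c *\<^sub>R y) \<le> V x + l x \<bullet> (c *\<^sub>R y) + V x * q (c *\<^sub>R y)" by (rule V)
    also have "V x * q (c *\<^sub>R y) \<le> V x * (c\<^sup>2 * Q y)" by (intro mult_left_mono Q c Vn)
    finally show ?thesis by (simp add: mult.assoc)
  qed
  have e: "J y * ?R y = V x * J y + J y * ((c *\<^sub>R l x) \<bullet> y) + (V x * c\<^sup>2) * (J y * Q y)" for y
    by (simp add: algebra_simps)
  have i: "integrable lborel (\<lambda>y. J y * ?R y)"
    unfolding e by (intro Bochner_Integration.integrable_add integrable_mult_right Ji mean Qi)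
  have "(\<integral>\<^sup>+y. ennreal (V (x + c *\<^sub>R y)) \<partial>JM) = (\<integral>\<^sup>+y. ennreal (J y) * ennreal (V (x + c *\<^sub>R y)) \<partial>lborel)"
    by (rule nn_integral_JM) measurable
  also have "\<dots> \<le> (\<integral>\<^sup>+y. ennreal (J y * ?R y) \<partial>lborel)"
    using le Vn J_nonneg by (intro nn_integral_mono) (auto simp: ennreal_mult[symmetric] intro!: ennreal_leI mult_left_mono)
  also have "\<dots> = ennreal (LINT y|lborel. J y * ?R y)"
    using i le Vn J_nonneg by (intro nn_integral_eq_integral) (auto intro!: AE_I2 mult_nonneg_nonneg intro: order_trans)
  also have "(LINT y|lborel. J y * ?R y) = (1 + (LINT y|lborel. J y * Q y) * c\<^sup>2) * V x"
  proof -
    have "(LINT y|lborel. J y * ?R y) = V x * (LINT y|lborel. J y) + (LINT y|lborel. J y * ((c *\<^sub>R l x) \<bullet> y)) + (V x * c\<^sup>2) * (LINT y|lborel. J y * Q y)"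
    proof -
      have a: "integrable lborel (\<lambda>y. V x * J y)" using Ji by simp
      note b = mean(1)[of "c *\<^sub>R l x"]
      have c: "integrable lborel (\<lambda>y. (V x * c\<^sup>2) * (J y * Q y))" using Qi by simp
      show ?thesis
        unfolding e Bochner_Integration.integral_add[OF Bochner_Integration.integrable_add[OF a b] c]
          Bochner_Integration.integral_add[OF a b] by simp
    qed
    also have "\<dots> = (1 + (LINT y|lborel. J y * Q y) * c\<^sup>2) * V x"
      unfolding J1 mean(2) by (simp add: algebra_simps)
    finally show ?thesis .
  qed
  finally show ?thesis
    using Vn[of x] by (simp only: ennreal_mult''[OF Vn])
qed

end

section \<open>Smooth substitutes for the weights\<close>

text \<open>The square of the Japanese bracket: it grows like the squared norm, but it and its root
  are smooth at the origin and bounded away from \<open>0\<close>.\<close>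

definition jap :: "'a::euclidean_space \<Rightarrow> real" where
  "jap x = 1 + (norm x)\<^sup>2"

lemma jap_pos: "0 < jap x" and jap_ge_1: "1 \<le> jap x"
  by (auto simp: jap_def add_pos_nonneg)

lemma jap_add: "jap (x + y) = jap x + (2 * (x \<bullet> y) + (norm y)\<^sup>2)"
  by (simp add: jap_def power2_norm_eq_inner inner_add_left inner_add_right inner_commute)

lemma continuous_jap [continuous_intros]: "continuous_on UNIV jap"
  unfolding jap_def by (intro continuous_intros)

lemma jap_ray: "0 \<le> \<theta> \<Longrightarrow> \<theta> \<le> 1 \<Longrightarrow> jap (\<theta> *\<^sub>R x) \<le> jap x"
  by (simp add: jap_def abs_square_le_1 power_mult_distrib power_mono mult_left_le_one_le power_le_one)

lemma jap_add_le: "jap (x + y) \<le> jap x * exp (2 * norm y)"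
proof -
  have "2 * (x \<bullet> y) \<le> jap x * norm y"
  proof -
    have "2 * (x \<bullet> y) \<le> (2 * norm x) * norm y" using norm_cauchy_schwarz[of x y] by simp
    also have "2 * norm x \<le> jap x" using sum_squares_bound[of "norm x" 1] by (simp add: jap_def add.commute)
    then have "(2 * norm x) * norm y \<le> jap x * norm y" by (intro mult_right_mono) auto
    finally show ?thesis .
  qed
  moreover have "(norm y)\<^sup>2 \<le> jap x * (norm y)\<^sup>2"
    using mult_right_mono[OF jap_ge_1, of "(norm y)\<^sup>2" x] by simp
  ultimately have "jap (x + y) \<le> jap x * (1 + norm y + (norm y)\<^sup>2)"
    by (simp add: jap_add algebra_simps)
  also have "1 + norm y + (norm y)\<^sup>2 \<le> exp (2 * norm y)"
  proof -
    have "1 + 2 * norm y + (2 * norm y)\<^sup>2 / 2 \<le> exp (2 * norm y)"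
      by (rule exp_lower_Taylor_quadratic) simp
    moreover have "(2 * norm y)\<^sup>2 / 2 = 2 * (norm y)\<^sup>2" by (simp add: power_mult_distrib)
    ultimately show ?thesis using zero_le_power2[of "norm y"] norm_ge_zero[of y] by linarith
  qed
  finally show ?thesis using jap_pos[of x] by (simp add: mult_left_mono)
qed

lemma ln_jap_diff: "\<bar>ln (jap (x + y)) - ln (jap x)\<bar> \<le> 2 * norm y"
proof -
  have "ln (jap (x + y)) \<le> ln (jap x * exp (2 * norm y))" for x y :: 'a
    using jap_add_le[of x y] jap_pos[of "x + y"] by (intro ln_mono) auto
  then have *: "ln (jap (x + y)) \<le> ln (jap x) + 2 * norm y" for x y :: 'a
  proof -
    have "ln (jap x * exp (2 * norm y)) = ln (jap x) + 2 * norm y" using jap_pos[of x] by (simp add: ln_mult)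
    then show ?thesis using \<open>\<And>x y :: 'a. ln (jap (x + y)) \<le> ln (jap x * exp (2 * norm y))\<close>[of x y] by simp
  qed
  show ?thesis using *[of x y] *[of "x + y" "- y"] by (simp add: abs_le_iff)
qed

text \<open>Concavity of the logarithm, as \<open>ln z \<le> z - 1\<close>, gives an upper expansion
  with exact linear term and a remainder uniform in \<open>x\<close>.\<close>

lemma ln_jap_upper: "ln (jap (x + y)) - ln (jap x) \<le> (2 / jap x) *\<^sub>R x \<bullet> y + (norm y)\<^sup>2"
proof -
  have "ln (jap (x + y)) - ln (jap x) = ln (jap (x + y) / jap x)"
    using jap_pos[of x] jap_pos[of "x + y"] by (simp add: ln_div)
  also have "\<dots> \<le> jap (x + y) / jap x - 1"
    using jap_pos[of x] jap_pos[of "x + y"] by (intro ln_le_minus_one) simp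
  also have "\<dots> = (2 / jap x) *\<^sub>R x \<bullet> y + (norm y)\<^sup>2 / jap x"
    using jap_pos[of x] by (simp add: jap_add field_simps)
  also have "(norm y)\<^sup>2 / jap x \<le> (norm y)\<^sup>2"
    using jap_ge_1[of x] by (simp add: divide_le_eq mult_left_le mult_le_cancel_left1)
  finally show ?thesis by simp
qed

lemma sqrt_jap_diff: "\<bar>sqrt (jap (x + y)) - sqrt (jap x)\<bar> \<le> norm y"
proof -
  have *: "sqrt (jap (x + y)) \<le> sqrt (jap x) + norm y" for x y :: 'a
  proof (rule real_le_lsqrt)
    have "x \<bullet> y \<le> sqrt (jap x) * norm y"
    proof -
      have "norm x \<le> sqrt (jap x)" by (intro real_le_rsqrt) (simp add: jap_def)
      then have "norm x * norm y \<le> sqrt (jap x) * norm y" by (intro mult_right_mono) auto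
      then show ?thesis using norm_cauchy_schwarz[of x y] by linarith
    qed
    then show "jap (x + y) \<le> (sqrt (jap x) + norm y)\<^sup>2"
      using jap_pos[of x] by (simp add: jap_add power2_sum)
    show "0 \<le> sqrt (jap x) + norm y" using jap_pos[of x] by simp
  qed
  show ?thesis using *[of x y] *[of "x + y" "- y"] by (simp add: abs_le_iff)
qed

text \<open>The counterpart for the root: its concavity, in the form
  \<open>2 * a * b \<le> a\<^sup>2 + b\<^sup>2\<close>, again leaves the linear term exact.\<close>

lemma sqrt_jap_upper: "sqrt (jap (x + y)) - sqrt (jap x) \<le> (1 / sqrt (jap x)) *\<^sub>R x \<bullet> y + 1 / 2 * (norm y)\<^sup>2"
proof -
  let ?A = "jap x"
  have s: "1 \<le> sqrt ?A" using jap_ge_1[of x] by simp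
  have "2 * sqrt ?A * sqrt (jap (x + y)) \<le> (sqrt ?A)\<^sup>2 + (sqrt (jap (x + y)))\<^sup>2"
    by (rule sum_squares_bound)
  then have *: "2 * sqrt ?A * sqrt (jap (x + y)) \<le> 2 * (sqrt ?A)\<^sup>2 + (2 * (x \<bullet> y) + (norm y)\<^sup>2)"
    using jap_pos[of x] jap_pos[of "x + y"] by (simp add: jap_add)
  then have "sqrt (jap (x + y)) - sqrt ?A \<le> (x \<bullet> y) / sqrt ?A + (norm y)\<^sup>2 / (2 * sqrt ?A)"
  proof -
    define a b where "a = sqrt ?A" and "b = sqrt (jap (x + y))"
    have "2 * a * b \<le> 2 * a\<^sup>2 + (2 * (x \<bullet> y) + (norm y)\<^sup>2)" "0 < a"
      using * s by (simp_all add: a_def b_def)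
    then have "b - a \<le> (x \<bullet> y) / a + (norm y)\<^sup>2 / (2 * a)"
      by (simp add: field_simps power2_eq_square)
    then show ?thesis by (simp add: a_def b_def)
  qed
  also have "(norm y)\<^sup>2 / (2 * sqrt ?A) \<le> (norm y)\<^sup>2 / 2"
    using s by (intro divide_left_mono) auto
  finally show ?thesis by simp
qed

text \<open>The Japanese bracket to the power \<open>k\<close>, written as an exponential so that
  \<open>exp_le_quadratic\<close> serves both families of weights.\<close>

definition Vpow :: "real \<Rightarrow> 'a::euclidean_space \<Rightarrow> real" where
  "Vpow k x = exp (k / 2 * ln (jap x))"

definition Vexp :: "real \<Rightarrow> 'a::euclidean_space \<Rightarrow> real" where
  "Vexp a x = exp (a * sqrt (jap x))"

lemma Vexp_step:
  assumes a: "0 \<le> a"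
  shows "Vexp a (x + y) \<le> Vexp a x + ((Vexp a x * a / sqrt (jap x)) *\<^sub>R x) \<bullet> y +
    Vexp a x * ((a / 2 + a\<^sup>2 * exp (a * norm y)) * (norm y)\<^sup>2)"
proof -
  let ?d = "a * sqrt (jap (x + y)) - a * sqrt (jap x)"
  have "exp ?d \<le> 1 + a * ((1 / sqrt (jap x)) *\<^sub>R x \<bullet> y) + (a / 2 + a\<^sup>2 * exp (a * norm y)) * (norm y)\<^sup>2"
  proof (rule exp_le_quadratic)
    show "?d \<le> a * ((1 / sqrt (jap x)) *\<^sub>R x \<bullet> y) + a / 2 * (norm y)\<^sup>2"
      using mult_left_mono[OF sqrt_jap_upper[of x y] a] by (simp add: algebra_simps)
    have "\<bar>?d\<bar> = a * \<bar>sqrt (jap (x + y)) - sqrt (jap x)\<bar>"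
      using a by (simp add: right_diff_distrib[symmetric] abs_mult)
    also have "\<dots> \<le> a * norm y" by (intro mult_left_mono sqrt_jap_diff a)
    finally show "\<bar>?d\<bar> \<le> a * norm y" .
  qed simp
  from mult_left_mono[OF this, of "Vexp a x"]
  have "Vexp a x * exp ?d \<le> Vexp a x * (1 + a * ((1 / sqrt (jap x)) *\<^sub>R x \<bullet> y) + (a / 2 + a\<^sup>2 * exp (a * norm y)) * (norm y)\<^sup>2)"
    by (simp add: Vexp_def)
  moreover have "Vexp a x * exp ?d = Vexp a (x + y)"
    by (simp add: Vexp_def exp_add[symmetric])
  ultimately show ?thesis by (simp add: algebra_simps)
qed

text \<open>For \<open>norm y \<le> 1\<close> this is the quadratic expansion. For larger
  \<open>y\<close> its exponential remainder would be useless with polynomial moments; there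
  \<open>jap (x + y) \<le> jap x * (2 * norm y)\<^sup>2\<close> gives the growth
  \<open>norm y powr k\<close> directly.\<close>

lemma Vpow_step:
  assumes k: "0 < k"
  shows "Vpow k (x + y) \<le> Vpow k x + ((Vpow k x * k / jap x) *\<^sub>R x) \<bullet> y +
    Vpow k x * ((k + k\<^sup>2 * exp k + 2 powr k) * ((norm y)\<^sup>2 + norm y powr (max k 2)))"
proof -
  let ?d = "k / 2 * ln (jap (x + y)) - k / 2 * ln (jap x)" and ?l = "(k / jap x) *\<^sub>R x \<bullet> y"
  let ?n = "norm y"
  have d: "\<bar>?d\<bar> \<le> k * ?n"
  proof -
    have "?d = k / 2 * (ln (jap (x + y)) - ln (jap x))" by (rule right_diff_distrib[symmetric])
    then have "\<bar>?d\<bar> = k / 2 * \<bar>ln (jap (x + y)) - ln (jap x)\<bar>"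
      using k by (simp only: abs_mult)
    also have "\<dots> \<le> k / 2 * (2 * ?n)" using k by (intro mult_left_mono ln_jap_diff) auto
    finally show ?thesis by simp
  qed
  have l: "\<bar>?l\<bar> \<le> k * ?n"
  proof -
    have "\<bar>x \<bullet> y\<bar> \<le> norm x * ?n" by (rule Cauchy_Schwarz_ineq2)
    also have "norm x \<le> jap x" using sum_squares_bound[of "norm x" 1] norm_ge_zero[of x] unfolding jap_def power2_eq_square by linarith
    then have "norm x * ?n \<le> jap x * ?n" by (intro mult_right_mono) auto
    finally have "\<bar>x \<bullet> y\<bar> / jap x \<le> ?n" using jap_pos[of x] by (simp add: field_simps)
    then have "k * (\<bar>x \<bullet> y\<bar> / jap x) \<le> k * ?n" using k by (intro mult_left_mono) auto
    then show ?thesis using k jap_pos[of x] by (simp add: abs_mult)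
  qed
  let ?C = "k + k\<^sup>2 * exp k + 2 powr k" and ?p = "?n powr (max k 2)"
  have "exp ?d \<le> 1 + ?l + ?C * (?n\<^sup>2 + ?p)"
  proof (cases "?n \<le> 1")
    case True
    have "exp ?d \<le> 1 + ?l + (k / 2 + k\<^sup>2 * exp (k * ?n)) * ?n\<^sup>2"
    proof (rule exp_le_quadratic[OF _ d])
      show "?d \<le> ?l + k / 2 * ?n\<^sup>2"
        using mult_left_mono[OF ln_jap_upper[of x y], of "k / 2"] k by (simp add: algebra_simps)
    qed simp
    also have "(k / 2 + k\<^sup>2 * exp (k * ?n)) * ?n\<^sup>2 \<le> ?C * (?n\<^sup>2 + ?p)"
    proof (rule mult_mono)
      have "k\<^sup>2 * exp (k * ?n) \<le> k\<^sup>2 * exp k" using True k by (intro mult_left_mono) (auto simp: mult_left_le)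
      moreover have p2: "0 \<le> 2 powr k" by simp
      ultimately show "k / 2 + k\<^sup>2 * exp (k * ?n) \<le> ?C" using k by linarith
      have "0 \<le> k\<^sup>2 * exp k" by simp
      with p2 show "0 \<le> ?C" using k by linarith
    qed auto
    finally show ?thesis by simp
  next
    case False
    then have n: "1 < ?n" by simp
    have n2: "?n \<le> ?n\<^sup>2" using n mult_left_mono[of 1 ?n ?n] by (simp add: power2_eq_square)
    have "jap (x + y) \<le> jap x * (2 * ?n)\<^sup>2"
    proof -
      have "jap (x + y) \<le> 1 + (norm x + ?n)\<^sup>2"
        unfolding jap_def by (intro add_left_mono power_mono norm_triangle_ineq) auto
      also have "\<dots> \<le> 1 + 2 * (norm x)\<^sup>2 + 2 * ?n\<^sup>2"
        using sum_squares_bound[of "norm x" ?n] by (simp add: power2_sum)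
      also have "\<dots> \<le> (1 + (norm x)\<^sup>2) * (4 * ?n\<^sup>2)"
      proof -
        have "1 \<le> ?n\<^sup>2" using n n2 by linarith
        then have "(norm x)\<^sup>2 * 1 \<le> (norm x)\<^sup>2 * ?n\<^sup>2" by (intro mult_left_mono) auto
        moreover have "0 \<le> (norm x)\<^sup>2" by simp
        moreover have "(1 + (norm x)\<^sup>2) * (4 * ?n\<^sup>2) = 4 * ?n\<^sup>2 + 4 * ((norm x)\<^sup>2 * ?n\<^sup>2)" by (simp add: algebra_simps)
        ultimately show ?thesis using \<open>1 \<le> ?n\<^sup>2\<close> by linarith
      qed
      finally show ?thesis by (simp add: jap_def power_mult_distrib)
    qed
    then have "ln (jap (x + y)) \<le> ln (jap x * (2 * ?n)\<^sup>2)"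
      using jap_pos[of "x + y"] by (intro ln_mono) auto
    also have "\<dots> = ln (jap x) + 2 * ln (2 * ?n)"
    proof -
      have "0 < 2 * ?n" using n by linarith
      then have "ln (jap x * (2 * ?n)\<^sup>2) = ln (jap x) + ln ((2 * ?n)\<^sup>2)" using jap_pos[of x] by (intro ln_mult_pos) auto
      also have "ln ((2 * ?n)\<^sup>2) = 2 * ln (2 * ?n)" using \<open>0 < 2 * ?n\<close> by (subst ln_realpow) auto
      finally show ?thesis .
    qed
    finally have "k / 2 * ln (jap (x + y)) \<le> k / 2 * (ln (jap x) + 2 * ln (2 * ?n))"
      using k by (intro mult_left_mono) auto
    then have "?d \<le> k * ln (2 * ?n)"
      by (simp only: distrib_left)
    then have "exp ?d \<le> exp (k * ln (2 * ?n))" by simp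
    also have "\<dots> = (2 * ?n) powr k" using n by (auto simp: powr_def)
    also have "\<dots> = 2 powr k * ?n powr k" using n by (simp add: powr_mult)
    also have "\<dots> \<le> 2 powr k * ?p" using n by (intro mult_left_mono powr_mono) auto
    finally have 1: "exp ?d \<le> 2 powr k * ?p" .
    \<comment> \<open>The linear term has no use here and may be negative; it is absorbed by the
      quadratic one, because \<open>norm y\<close> exceeds \<open>1\<close>.\<close>
    have 2: "- ?l \<le> k * ?n\<^sup>2" using l mult_left_mono[OF n2, of k] k by linarith
    have 3: "0 \<le> k * ?p" "0 \<le> k\<^sup>2 * exp k * (?n\<^sup>2 + ?p)" "0 \<le> 2 powr k * ?n\<^sup>2" using k by auto
    have "?C * (?n\<^sup>2 + ?p) = k * ?n\<^sup>2 + k * ?p + k\<^sup>2 * exp k * (?n\<^sup>2 + ?p) + 2 powr k * ?n\<^sup>2 + 2 powr k * ?p"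
      by (simp add: algebra_simps)
    with 1 2 3 show ?thesis by linarith
  qed
  from mult_left_mono[OF this, of "Vpow k x"]
  have "Vpow k x * exp ?d \<le> Vpow k x * (1 + ?l + ?C * (?n\<^sup>2 + ?p))"
    by (simp add: Vpow_def)
  moreover have "Vpow k x * exp ?d = Vpow k (x + y)"
    by (simp add: Vpow_def exp_add[symmetric])
  ultimately show ?thesis by (simp add: algebra_simps)
qed

lemma powr_le_1_plus:
  fixes n :: real
  assumes "0 \<le> n" "p \<le> q" "0 < p"
  shows "n powr p \<le> 1 + n powr q"
proof (cases "n \<le> 1")
  case True
  then have "n powr p \<le> 1" using assms by (intro powr_le1) auto
  then show ?thesis by (smt (verit) powr_ge_zero)
next
  case False
  then have "n powr p \<le> n powr q" using assms by (intro powr_mono) auto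
  then show ?thesis by simp
qed

lemma Vexp_ge_1: "0 \<le> a \<Longrightarrow> 1 \<le> Vexp a x"
  using jap_pos[of x] by (simp add: Vexp_def)

lemma Vexp_ray:
  assumes "0 \<le> a" "0 \<le> \<theta>" "\<theta> \<le> 1"
  shows "Vexp a (\<theta> *\<^sub>R x) \<le> Vexp a x"
  unfolding Vexp_def using assms by (simp add: jap_ray mult_left_mono)

lemma continuous_Vexp: "continuous_on UNIV (Vexp a)"
  unfolding Vexp_def[abs_def] by (intro continuous_intros)

lemma Vexp_lower: "0 \<le> a \<Longrightarrow> exp (a * norm x) \<le> Vexp a x"
  unfolding Vexp_def by (auto intro!: mult_left_mono real_le_rsqrt simp: jap_def)

lemma Vexp_upper: "0 \<le> a \<Longrightarrow> Vexp a x \<le> exp a * exp (a * norm x)"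
proof -
  assume a: "0 \<le> a"
  have "sqrt (jap x) \<le> 1 + norm x"
    by (rule real_le_lsqrt) (auto simp: jap_def power2_sum)
  then have "a * sqrt (jap x) \<le> a * (1 + norm x)" using a by (intro mult_left_mono) auto
  then show ?thesis by (simp add: Vexp_def exp_add[symmetric] algebra_simps)
qed

lemma Vpow_pos: "0 < Vpow k x"
  by (simp add: Vpow_def)

lemma Vpow_ge_1: "0 \<le> k \<Longrightarrow> 1 \<le> Vpow k x"
  using jap_ge_1[of x] by (simp add: Vpow_def)

lemma Vpow_mono: "0 \<le> k \<Longrightarrow> jap x \<le> jap y \<Longrightarrow> Vpow k x \<le> Vpow k y"
  unfolding Vpow_def using jap_pos[of x] jap_pos[of y] by (simp add: mult_left_mono)

lemma continuous_Vpow: "continuous_on UNIV (Vpow k)"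
  unfolding Vpow_def[abs_def] by (intro continuous_intros) (metis jap_pos less_irrefl)

lemma Vpow_lower: "0 < k \<Longrightarrow> norm x powr k \<le> Vpow k x"
proof (cases "x = 0")
  case False
  assume k: "0 < k"
  have "norm x powr k = exp (k / 2 * ln ((norm x)\<^sup>2))"
    using False by (simp add: powr_def ln_realpow)
  also have "\<dots> \<le> Vpow k x"
    using False k jap_pos[of x] unfolding Vpow_def by (auto intro!: mult_left_mono ln_mono simp: jap_def)
  finally show ?thesis .
qed (simp add: less_imp_le[OF Vpow_pos])

lemma Vpow_upper: "0 < k \<Longrightarrow> Vpow k x \<le> 2 powr k * (1 + norm x powr k)"
proof -
  assume k: "0 < k"
  define n where "n = max 1 (norm x)"
  have n: "1 \<le> n" "norm x \<le> n" by (auto simp: n_def)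
  have "(norm x)\<^sup>2 \<le> n\<^sup>2" "1 \<le> n\<^sup>2" using n by (auto simp: power_mono one_le_power)
  then have "jap x \<le> (2 * n)\<^sup>2" unfolding jap_def by (simp add: power_mult_distrib)
  then have "ln (jap x) \<le> ln ((2 * n)\<^sup>2)" using jap_pos[of x] by (intro ln_mono) auto
  also have "\<dots> = 2 * ln (2 * n)" using n by (subst ln_realpow) auto
  finally have "k / 2 * ln (jap x) \<le> k / 2 * (2 * ln (2 * n))" using k by (intro mult_left_mono) auto
  then have "Vpow k x \<le> exp (k * ln (2 * n))" by (simp add: Vpow_def)
  also have "\<dots> = (2 * n) powr k" using n by (auto simp: powr_def)
  also have "\<dots> = 2 powr k * n powr k" using n by (simp add: powr_mult)
  also have "n powr k \<le> 1 + norm x powr k"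
    by (cases "norm x \<le> 1") (auto simp: n_def max_def)
  finally show ?thesis by simp
qed

text \<open>After time \<open>ln 2\<close> the drift has halved the norm, so the weight has become
  at most a multiple of the square root \<open>X\<close> of \<open>exp (a * norm x)\<close>; and a
  multiple of \<open>X\<close> is bounded by \<open>\<alpha> * X\<^sup>2\<close> plus a
  constant.\<close>

lemma Vexp_shrink:
  assumes a: "0 < a" and \<alpha>: "0 < \<alpha>"
  shows "\<exists>K t0. \<forall>t\<ge>t0. \<forall>x. Vexp a (exp (- t) *\<^sub>R x) \<le> \<alpha> * Vexp a x + K"
proof (intro exI allI impI)
  fix t :: real and x :: 'a assume t: "ln 2 \<le> t"
  have "exp (- t) \<le> exp (- ln 2)" using t by simp
  then have th: "exp (- t) \<le> 1 / 2" by (simp add: exp_minus)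
  define X where "X = exp (a * norm x / 2)"
  have "Vexp a (exp (- t) *\<^sub>R x) \<le> exp a * exp (a * norm (exp (- t) *\<^sub>R x))" using a by (intro Vexp_upper) auto
  also have "norm (exp (- t) *\<^sub>R x) \<le> norm x / 2" using mult_right_mono[OF th, of "norm x"] by simp
  then have "exp (a * norm (exp (- t) *\<^sub>R x)) \<le> X"
    using a mult_left_mono[of "norm (exp (- t) *\<^sub>R x)" "norm x / 2" a] unfolding X_def by simp
  then have "exp a * exp (a * norm (exp (- t) *\<^sub>R x)) \<le> exp a * X" by (intro mult_left_mono) auto
  also have "exp a * X \<le> \<alpha> * X\<^sup>2 + (exp a)\<^sup>2 / (4 * \<alpha>)"
  proof -
    have "0 \<le> (2 * \<alpha> * X - exp a)\<^sup>2" by simp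
    then have "4 * \<alpha> * (exp a * X) \<le> 4 * \<alpha> * (\<alpha> * X\<^sup>2) + (exp a)\<^sup>2"
      by (simp add: power2_eq_square algebra_simps)
    then show ?thesis using \<alpha> by (simp add: field_simps)
  qed
  also have "X\<^sup>2 = exp (a * norm x)" unfolding X_def power2_eq_square exp_add[symmetric] by simp
  also have "\<alpha> * exp (a * norm x) \<le> \<alpha> * Vexp a x" using \<alpha> a by (intro mult_left_mono Vexp_lower) auto
  finally show "Vexp a (exp (- t) *\<^sub>R x) \<le> \<alpha> * Vexp a x + (exp a)\<^sup>2 / (4 * \<alpha>)" by simp
qed

lemma Vpow_shrink:
  assumes k: "0 < k" and \<alpha>: "0 < \<alpha>"
  shows "\<exists>K t0. \<forall>t\<ge>t0. \<forall>x. Vpow k (exp (- t) *\<^sub>R x) \<le> \<alpha> * Vpow k x + K"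
proof (intro exI allI impI)
  \<comment> \<open>The waiting time from which the contraction factor
    \<open>exp (- (k * t))\<close>, times the comparison constant \<open>2 powr k\<close>, is at
    most \<alpha>.\<close>
  fix t :: real and x :: 'a assume t: "ln (2 powr k / \<alpha>) / k \<le> t"
  have "ln (2 powr k / \<alpha>) \<le> k * t" using t k by (simp add: field_simps)
  then have "exp (ln (2 powr k / \<alpha>)) \<le> exp (k * t)" by simp
  then have "2 powr k / \<alpha> \<le> exp (k * t)" using \<alpha> by (subst (asm) exp_ln) auto
  then have *: "2 powr k * exp (- (k * t)) \<le> \<alpha>" using \<alpha> by (simp add: exp_minus field_simps)
  have "Vpow k (exp (- t) *\<^sub>R x) \<le> 2 powr k * (1 + norm (exp (- t) *\<^sub>R x) powr k)" using k by (rule Vpow_upper)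
  also have "norm (exp (- t) *\<^sub>R x) powr k = exp (- (k * t)) * norm x powr k"
    by (simp add: powr_mult exp_powr_real mult.commute)
  also have "2 powr k * (1 + exp (- (k * t)) * norm x powr k) = 2 powr k + (2 powr k * exp (- (k * t))) * norm x powr k"
    by (simp add: algebra_simps)
  also have "\<dots> \<le> 2 powr k + \<alpha> * Vpow k x"
    using * \<alpha> Vpow_lower[OF k, of x] by (intro add_left_mono mult_mono) auto
  finally show "Vpow k (exp (- t) *\<^sub>R x) \<le> \<alpha> * Vpow k x + 2 powr k" by simp
qed

lemma Vexp_coercive: "0 < a \<Longrightarrow> \<exists>R. \<forall>x. R < norm x \<longrightarrow> L \<le> Vexp a x"
proof (intro exI allI impI)
  fix x :: 'a assume a: "0 < a" and x: "L / a < norm x"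
  have "L \<le> a * norm x" using a x by (simp add: field_simps)
  also have "\<dots> \<le> exp (a * norm x)" using exp_ge_add_one_self[of "a * norm x"] by linarith
  also have "\<dots> \<le> Vexp a x" using a by (intro Vexp_lower) auto
  finally show "L \<le> Vexp a x" .
qed

lemma Vpow_coercive: "0 < k \<Longrightarrow> \<exists>R. \<forall>x. R < norm x \<longrightarrow> L \<le> Vpow k x"
proof (intro exI allI impI)
  fix x :: 'a assume k: "0 < k" and x: "max L 1 powr (1 / k) < norm x"
  have "L \<le> max L 1" by simp
  also have "\<dots> = (max L 1 powr (1 / k)) powr k" using k by (simp add: powr_powr)
  also have "\<dots> \<le> norm x powr k" using x k by (intro powr_mono2) auto
  also have "\<dots> \<le> Vpow k x" using k by (rule Vpow_lower)
  finally show "L \<le> Vpow k x" .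
qed

context jump_kernel
begin

text \<open>Jumps of size at most \<open>e * norm y\<close> leave a remainder of order
  \<open>(norm y)\<^sup>2 * exp (b * e * norm y)\<close>; the gap
  \<open>\<delta> = a' - b * e\<close> pays for the quadratic factor. With \<open>e\<close> equal to
  \<epsilon>, exponents \<open>b\<close> up to \<open>a' / \<epsilon>\<close> are reached.\<close>

lemma Vexp_jump:
  assumes mean: "\<And>u. integrable lborel (\<lambda>y. J y * (u \<bullet> y))" "\<And>u. (LINT y|lborel. J y * (u \<bullet> y)) = 0"
    and a': "integrable lborel (\<lambda>y. J y * exp (a' * norm y))" and b: "0 \<le> b" and e: "0 \<le> e" and be: "b * e < a'"
  shows "\<exists>M\<ge>0. \<forall>c x. 0 \<le> c \<longrightarrow> c \<le> e \<longrightarrow>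
    (\<integral>\<^sup>+y. ennreal (Vexp b (x + c *\<^sub>R y)) \<partial>JM) \<le> ennreal (1 + M * c\<^sup>2) * ennreal (Vexp b x)"
proof -
  define Q where "Q y = (b / 2 + b\<^sup>2 * exp (b * e * norm y)) * (norm y)\<^sup>2" for y :: 'a
  define q where "q y = (b / 2 + b\<^sup>2 * exp (b * norm y)) * (norm y)\<^sup>2" for y :: 'a
  have [measurable]: "Q \<in> borel_measurable borel" unfolding Q_def by measurable
  have [measurable]: "Vexp b \<in> borel_measurable borel"
    by (intro borel_measurable_continuous_onI continuous_Vexp)
  have Q0: "0 \<le> Q y" for y using b by (simp add: Q_def)
  define \<delta> where "\<delta> = a' - b * e"
  have \<delta>: "0 < \<delta>" using be by (simp add: \<delta>_def)
  have Qle: "Q y \<le> (b / 2 + b\<^sup>2) * (2 / \<delta>\<^sup>2) * exp (a' * norm y)" for y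
  proof -
    let ?n = "norm y"
    have "1 + \<delta> * ?n + (\<delta> * ?n)\<^sup>2 / 2 \<le> exp (\<delta> * ?n)"
      using \<delta> by (intro exp_lower_Taylor_quadratic) auto
    moreover have "0 \<le> \<delta> * ?n" using \<delta> by simp
    ultimately have "(\<delta> * ?n)\<^sup>2 / 2 \<le> exp (\<delta> * ?n)" by linarith
    then have n2: "?n\<^sup>2 \<le> 2 / \<delta>\<^sup>2 * exp (\<delta> * ?n)" using \<delta> by (simp add: power_mult_distrib field_simps)
    have "b / 2 * 1 \<le> b / 2 * exp (b * e * ?n)" using b e by (intro mult_left_mono) auto
    then have "b / 2 + b\<^sup>2 * exp (b * e * ?n) \<le> (b / 2 + b\<^sup>2) * exp (b * e * ?n)"
      by (simp add: algebra_simps)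
    then have "Q y \<le> ((b / 2 + b\<^sup>2) * exp (b * e * ?n)) * (2 / \<delta>\<^sup>2 * exp (\<delta> * ?n))"
      unfolding Q_def using n2 b by (intro mult_mono) auto
    also have "\<dots> = (b / 2 + b\<^sup>2) * (2 / \<delta>\<^sup>2) * (exp (b * e * ?n) * exp (\<delta> * ?n))" by simp
    also have "exp (b * e * ?n) * exp (\<delta> * ?n) = exp (a' * ?n)"
      by (simp add: exp_add[symmetric] \<delta>_def algebra_simps)
    finally show ?thesis .
  qed
  have Qi: "integrable lborel (\<lambda>y. J y * Q y)"
  proof (rule Bochner_Integration.integrable_bound)
    show "integrable lborel (\<lambda>y. ((b / 2 + b\<^sup>2) * (2 / \<delta>\<^sup>2)) * (J y * exp (a' * norm y)))" using a' by simp
    show "AE y in lborel. norm (J y * Q y) \<le> norm (((b / 2 + b\<^sup>2) * (2 / \<delta>\<^sup>2)) * (J y * exp (a' * norm y)))"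
    proof (rule AE_I2)
      fix y
      have "J y * Q y \<le> J y * ((b / 2 + b\<^sup>2) * (2 / \<delta>\<^sup>2) * exp (a' * norm y))"
        by (intro mult_left_mono Qle J_nonneg)
      also have "\<dots> = ((b / 2 + b\<^sup>2) * (2 / \<delta>\<^sup>2)) * (J y * exp (a' * norm y))" by (simp add: mult_ac)
      finally show "norm (J y * Q y) \<le> norm (((b / 2 + b\<^sup>2) * (2 / \<delta>\<^sup>2)) * (J y * exp (a' * norm y)))"
        using mult_nonneg_nonneg[OF J_nonneg[of y] Q0[of y]] unfolding real_norm_def by linarith
    qed
  qed measurable
  have "0 \<le> (LINT y|lborel. J y * Q y)" using J_nonneg Q0 by (intro integral_nonneg_AE) auto
  moreover have "(\<integral>\<^sup>+y. ennreal (Vexp b (x + c *\<^sub>R y)) \<partial>JM) \<le> ennreal (1 + (LINT y|lborel. J y * Q y) * c\<^sup>2) * ennreal (Vexp b x)"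
    if c: "0 \<le> c" "c \<le> e" for c x
  proof (rule nn_integral_jump_le[OF _ _ mean _ _ Qi c])
    show "Vexp b (x + y) \<le> Vexp b x + ((Vexp b x * b / sqrt (jap x)) *\<^sub>R x) \<bullet> y + Vexp b x * q y" for x y
      unfolding q_def by (rule Vexp_step[OF b])
    fix c :: real and y :: 'a assume c: "0 \<le> c" "c \<le> e"
    have "b * (c * norm y) \<le> b * e * norm y" using b c by (simp add: mult_left_mono mult_right_mono mult.assoc)
    then have "q (c *\<^sub>R y) \<le> (b / 2 + b\<^sup>2 * exp (b * e * norm y)) * (c * norm y)\<^sup>2"
      unfolding q_def using c by (auto intro!: mult_right_mono mult_left_mono)
    then show "q (c *\<^sub>R y) \<le> c\<^sup>2 * Q y" by (simp add: Q_def power_mult_distrib mult_ac)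
  next
    show "Vexp b \<in> borel_measurable borel" by measurable
    show "0 \<le> Vexp b x" for x :: 'a by (simp add: Vexp_def)
  qed
  ultimately show ?thesis by blast
qed

lemma weighted_Vexp:
  assumes mean: "\<And>u. integrable lborel (\<lambda>y. J y * (u \<bullet> y))" "\<And>u. (LINT y|lborel. J y * (u \<bullet> y)) = 0"
    and a': "integrable lborel (\<lambda>y. J y * exp (a' * norm y))" and a: "0 < a" "a < a'"
  shows "\<exists>M. weighted_jump_kernel J (Vexp a) M"
proof -
  obtain M where M: "M \<ge> 0" "\<And>c x. 0 \<le> c \<Longrightarrow> c \<le> 1 \<Longrightarrow>
    (\<integral>\<^sup>+y. ennreal (Vexp a (x + c *\<^sub>R y)) \<partial>JM) \<le> ennreal (1 + M * c\<^sup>2) * ennreal (Vexp a x)"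
    using Vexp_jump[OF mean a', of a 1] a by (auto simp del: ennreal_plus)
  have "weighted_jump_kernel J (Vexp a) M"
    using a continuous_Vexp Vexp_ge_1[OF less_imp_le[OF a(1)]] Vexp_ray[OF less_imp_le[OF a(1)]]
      Vexp_shrink[OF a(1)] Vexp_coercive[OF a(1)]
    by unfold_locales (auto intro!: M simp del: ennreal_plus)
  then show ?thesis ..
qed

lemma weighted_Vpow:
  assumes mean: "\<And>u. integrable lborel (\<lambda>y. J y * (u \<bullet> y))" "\<And>u. (LINT y|lborel. J y * (u \<bullet> y)) = 0"
    and k': "integrable lborel (\<lambda>y. J y * (1 + norm y powr k'))" and k: "0 < k" "k \<le> k'" "2 \<le> k'"
  shows "\<exists>M. weighted_jump_kernel J (Vpow k) M"
proof -
  \<comment> \<open>The remainder involves second moments even when \<open>k < 2\<close>, whence the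
    maximum; both powers are covered by the moment of order \<open>k'\<close>.\<close>
  define m where "m = max k 2"
  have m: "2 \<le> m" "m \<le> k'" using k by (auto simp: m_def)
  define C where "C = k + k\<^sup>2 * exp k + 2 powr k"
  have C: "0 \<le> C" using k by (simp add: C_def add_nonneg_nonneg)
  define q where "q y = C * ((norm y)\<^sup>2 + norm y powr m)" for y :: 'a
  have [measurable]: "q \<in> borel_measurable borel" unfolding q_def by measurable
  have [measurable]: "Vpow k \<in> borel_measurable borel"
    by (intro borel_measurable_continuous_onI continuous_Vpow)
  have q0: "0 \<le> q y" for y using C by (simp add: q_def)
  have qle: "q y \<le> (2 * C) * (1 + norm y powr k')" for y
  proof -
    have "norm y powr 2 \<le> 1 + norm y powr k'" "norm y powr m \<le> 1 + norm y powr k'"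
      using m k by (intro powr_le_1_plus; simp)+
    moreover have "norm y powr 2 = (norm y)\<^sup>2" by (cases "y = 0") auto
    ultimately have "(norm y)\<^sup>2 + norm y powr m \<le> 2 * (1 + norm y powr k')" by simp
    then have "C * ((norm y)\<^sup>2 + norm y powr m) \<le> C * (2 * (1 + norm y powr k'))" using C by (intro mult_left_mono)
    then show ?thesis by (simp add: q_def mult_ac)
  qed
  have Qi: "integrable lborel (\<lambda>y. J y * q y)"
  proof (rule Bochner_Integration.integrable_bound)
    show "integrable lborel (\<lambda>y. (2 * C) * (J y * (1 + norm y powr k')))" using k' by simp
    show "AE y in lborel. norm (J y * q y) \<le> norm ((2 * C) * (J y * (1 + norm y powr k')))"
    proof (rule AE_I2)
      fix y
      have "J y * q y \<le> J y * ((2 * C) * (1 + norm y powr k'))"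
        by (intro mult_left_mono qle J_nonneg)
      also have "\<dots> = (2 * C) * (J y * (1 + norm y powr k'))" by (simp add: mult_ac)
      finally show "norm (J y * q y) \<le> norm ((2 * C) * (J y * (1 + norm y powr k')))"
        using mult_nonneg_nonneg[OF J_nonneg[of y] q0[of y]] unfolding real_norm_def by linarith
    qed
  qed measurable
  define M where "M = (LINT y|lborel. J y * q y)"
  have M: "0 \<le> M" unfolding M_def using J_nonneg q0 by (intro integral_nonneg_AE) auto
  have jump: "(\<integral>\<^sup>+y. ennreal (Vpow k (x + c *\<^sub>R y)) \<partial>JM) \<le> ennreal (1 + M * c\<^sup>2) * ennreal (Vpow k x)"
    if c: "0 \<le> c" "c \<le> 1" for c x
    unfolding M_def
  proof (rule nn_integral_jump_le[OF _ _ mean _ _ Qi c])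
    show "Vpow k (x + y) \<le> Vpow k x + ((Vpow k x * k / jap x) *\<^sub>R x) \<bullet> y + Vpow k x * q y" for x y
      unfolding q_def C_def m_def by (rule Vpow_step[OF k(1)])
    fix c :: real and y :: 'a assume c: "0 \<le> c" "c \<le> 1"
    have "c powr m \<le> c powr 2"
    proof (cases "c = 0")
      case False
      then show ?thesis using c m by (intro powr_mono') auto
    qed simp
    also have "c powr 2 = c\<^sup>2" using c by (cases "c = 0") auto
    finally have "c powr m * norm y powr m \<le> c\<^sup>2 * norm y powr m" by (intro mult_right_mono) auto
    then have "(norm (c *\<^sub>R y))\<^sup>2 + norm (c *\<^sub>R y) powr m \<le> c\<^sup>2 * ((norm y)\<^sup>2 + norm y powr m)"
      using c by (simp add: power_mult_distrib powr_mult algebra_simps)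
    then have "C * ((norm (c *\<^sub>R y))\<^sup>2 + norm (c *\<^sub>R y) powr m) \<le> C * (c\<^sup>2 * ((norm y)\<^sup>2 + norm y powr m))"
      using C by (intro mult_left_mono)
    then show "q (c *\<^sub>R y) \<le> c\<^sup>2 * q y" by (simp add: q_def mult_ac)
  next
    show "Vpow k \<in> borel_measurable borel" by measurable
    show "0 \<le> Vpow k x" for x :: 'a by (simp add: Vpow_def)
  qed
  have ray: "Vpow k (\<theta> *\<^sub>R x) \<le> Vpow k x" if "0 \<le> \<theta>" "\<theta> \<le> 1" for \<theta> x
    using that k by (intro Vpow_mono jap_ray) auto
  have "weighted_jump_kernel J (Vpow k) M"
    using M k continuous_Vpow Vpow_ge_1[OF less_imp_le[OF k(1)]] ray Vpow_shrink[OF k(1)] Vpow_coercive[OF k(1)]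
    by unfold_locales (auto intro!: jump simp del: ennreal_plus)
  then show ?thesis ..
qed

end

section \<open>Mild solutions\<close>

lemma AE_lborel_affine:
  fixes P :: "'a::euclidean_space \<Rightarrow> bool"
  assumes P: "AE x in lborel. P x" and c: "c \<noteq> 0"
  shows "AE x in lborel. P (t + c *\<^sub>R x)"
proof -
  from P obtain N where N: "N \<in> null_sets lborel" "{x. \<not> P x} \<subseteq> N"
    by (auto simp: eventually_ae_filter)
  have [measurable]: "N \<in> sets borel" using N by auto
  have "(\<integral>\<^sup>+x. indicator N x \<partial>lborel) = ennreal (\<bar>c\<bar> ^ DIM('a)) * (\<integral>\<^sup>+x. indicator N (t + c *\<^sub>R x) \<partial>lborel)"
    by (rule nn_integral_lborel_affine[OF _ c]) measurable
  moreover have "(\<integral>\<^sup>+x. indicator N x \<partial>lborel) = 0" using N by (simp add: null_setsD1)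
  ultimately have "(\<integral>\<^sup>+x. indicator N (t + c *\<^sub>R x) \<partial>lborel) = 0" using c by auto
  then have "AE x in lborel. indicator N (t + c *\<^sub>R x) = (0 :: ennreal)"
    by (subst (asm) nn_integral_0_iff_AE) auto
  then show ?thesis
    by eventually_elim (use N(2) in \<open>auto simp: indicator_def split: if_splits\<close>)
qed

lemma lebesgue_measurable_AE:
  fixes F G :: "'a::euclidean_space \<Rightarrow> 'b::{banach, second_countable_topology}"
  assumes G: "G \<in> borel_measurable borel" and e: "AE x in lborel. F x = G x"
  shows "F \<in> borel_measurable lebesgue"
proof (rule measurableI)
  fix A :: "'b set" assume A: "A \<in> sets borel"
  from e obtain N where N: "N \<in> null_sets lborel" "{x. F x \<noteq> G x} \<subseteq> N"
    by (auto simp: eventually_ae_filter)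
  have NL: "N \<in> null_sets lebesgue" using N(1) by (rule null_sets_completionI)
  have "F -` A \<inter> space lebesgue = (G -` A - N) \<union> (F -` A \<inter> N)" using N(2) by auto
  moreover have "G -` A - N \<in> sets lebesgue"
    using measurable_sets[OF G A] NL by (auto simp: null_sets_def)
  moreover have "F -` A \<inter> N \<in> sets lebesgue"
    using null_sets_completion_subset[OF _ NL, of "F -` A \<inter> N"] by auto
  ultimately show "F -` A \<inter> space lebesgue \<in> sets lebesgue" by (simp only: sets.Un)
qed simp

lemma
  fixes F G :: "'a::euclidean_space \<Rightarrow> 'b::{banach, second_countable_topology}"
  assumes G: "G \<in> borel_measurable borel" and e: "AE x in lborel. F x = G x"
  shows lebesgue_integrable_AE: "integrable lebesgue F \<longleftrightarrow> integrable lborel G"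
    and lebesgue_integral_AE: "(LINT x|lebesgue. F x) = (LINT x|lborel. G x)"
proof -
  have G': "G \<in> borel_measurable lborel" using G by simp
  have F: "F \<in> borel_measurable lebesgue" by (rule lebesgue_measurable_AE[OF assms])
  have GL: "G \<in> borel_measurable lebesgue" by (rule measurable_completion[OF G'])
  have eL: "AE x in lebesgue. F x = G x" using e by (rule AE_completion)
  show "integrable lebesgue F \<longleftrightarrow> integrable lborel G"
    using integrable_cong_AE[OF F GL eL] integrable_completion[OF G'] by simp
  show "(LINT x|lebesgue. F x) = (LINT x|lborel. G x)"
    using integral_cong_AE[OF F GL eL] integral_completion[OF G'] by simp
qed

lemma obtain_borel_version:
  fixes f :: "'a::euclidean_space \<Rightarrow> real"
  assumes "f \<in> borel_measurable lebesgue"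
  obtains g where "g \<in> borel_measurable borel" "AE x in lborel. f x = g x"
  using completion_ex_borel_measurable_real[OF assms] by auto

section \<open>Duhamel's formula in terms of Fourier transforms\<close>

definition fourierL :: "('a::euclidean_space \<Rightarrow> real) \<Rightarrow> 'a \<Rightarrow> complex" where
  "fourierL f \<xi> = (LINT x|lebesgue. f x *\<^sub>R cis (\<xi> \<bullet> x))"

lemma fourierL_eq:
  assumes [measurable]: "g \<in> borel_measurable borel" and e: "AE x in lborel. f x = g x"
  shows "fourierL f \<xi> = fourier g \<xi>"
  unfolding fourierL_def fourier_def
  by (rule lebesgue_integral_AE) (use e in \<open>auto elim!: eventually_mono\<close>)

lemma integrable_fourierL:
  assumes "integrable lebesgue f"
  shows "integrable lebesgue (\<lambda>x. f x *\<^sub>R cis (\<xi> \<bullet> x))"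
proof (rule integrable_mult_bounded[OF assms, of _ 1])
  have "(\<lambda>x. cis (\<xi> \<bullet> x)) \<in> borel_measurable lborel" by measurable
  then show "(\<lambda>x. cis (\<xi> \<bullet> x)) \<in> borel_measurable lebesgue" by (rule measurable_completion)
qed simp

text \<open>The gauge condition survives the passage to the Fourier transform, which is bounded by the
  weighted norm.\<close>

lemma has_integral_fourierL:
  fixes w :: "'a::euclidean_space \<Rightarrow> real"
  assumes I: "has_integral_L1w w g v a b" and w: "\<And>x. 1 \<le> w x"
    and int: "\<And>f. f \<in> L1w w \<Longrightarrow> integrable lebesgue f"
    and wm: "w \<in> borel_measurable borel"
  shows "((\<lambda>s. fourierL (g s) \<xi>) has_integral fourierL v \<xi>) {a..b}"
  unfolding cbox_interval[symmetric] has_integral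
proof (intro allI impI)
  fix e :: real assume "e > 0"
  have *: "\<forall>e>0. \<exists>\<gamma>. gauge \<gamma> \<and> (\<forall>\<D>. \<D> tagged_division_of (cbox a b) \<and> \<gamma> fine \<D> \<longrightarrow>
        L1w_norm w (\<lambda>x. (\<Sum>(s, K)\<in>\<D>. measure lborel K * g s x) - v x) < e)"
    using I unfolding has_integral_L1w_def by (elim conjE)
  obtain \<gamma> where \<gamma>: "gauge \<gamma>" and D': "\<forall>\<D>. \<D> tagged_division_of (cbox a b) \<and> \<gamma> fine \<D> \<longrightarrow>
        L1w_norm w (\<lambda>x. (\<Sum>(s, K)\<in>\<D>. measure lborel K * g s x) - v x) < e"
    using *[rule_format, OF \<open>e > 0\<close>] by (elim exE conjE)
  have D: "L1w_norm w (\<lambda>x. (\<Sum>(s, K)\<in>\<D>. measure lborel K * g s x) - v x) < e"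
    if "\<D> tagged_division_of (cbox a b)" "\<gamma> fine \<D>" for \<D>
    by (rule D'[rule_format]) (rule conjI[OF that])
  have gL: "g s \<in> L1w w" if "s \<in> {a..b}" for s using I that unfolding has_integral_L1w_def by (elim conjE) (erule bspec)
  have vL: "v \<in> L1w w" using I unfolding has_integral_L1w_def by (elim conjE)
  show "\<exists>\<gamma>. gauge \<gamma> \<and> (\<forall>\<D>. \<D> tagged_division_of cbox a b \<and> \<gamma> fine \<D> \<longrightarrow>
      norm ((\<Sum>(x, k)\<in>\<D>. measure lborel k *\<^sub>R fourierL (g x) \<xi>) - fourierL v \<xi>) < e)"
  proof (intro exI conjI allI impI; (elim conjE)?)
    show "gauge \<gamma>" by (rule \<gamma>)
    fix \<D> assume d: "\<D> tagged_division_of cbox a b" "\<gamma> fine \<D>"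
    have fin: "finite \<D>" using d(1) by (rule tagged_division_of_finite)
    have s: "s \<in> {a..b}" if "(s, K) \<in> \<D>" for s K
      using tag_in_interval[OF d(1) that] by (simp add: cbox_interval)
    let ?r = "\<lambda>x. (\<Sum>(s, K)\<in>\<D>. measure lborel K * g s x) - v x"
    have wL: "w \<in> borel_measurable lebesgue" using wm by (intro measurable_completion) simp
    have gi: "integrable lebesgue (g s)" if "(s, K) \<in> \<D>" for s K using int[OF gL[OF s[OF that]]] .
    have gi': "integrable lebesgue (g (fst p))" if "p \<in> \<D>" for p
      using gi[of "fst p" "snd p"] that by simp
    have ri: "integrable lebesgue ?r"
      unfolding split_beta
      by (intro Bochner_Integration.integrable_diff Bochner_Integration.integrable_sum int[OF vL] integrable_mult_right gi')
    have rw: "integrable lebesgue (\<lambda>x. w x * \<bar>?r x\<bar>)"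
    proof (rule Bochner_Integration.integrable_bound)
      have gwi: "integrable lebesgue (\<lambda>x. w x * \<bar>g s x\<bar>)" if "(s, K) \<in> \<D>" for s K
        using gL[OF s[OF that]] by (simp add: L1w_def)
      show "integrable lebesgue (\<lambda>x. (\<Sum>(s, K)\<in>\<D>. measure lborel K * (w x * \<bar>g s x\<bar>)) + w x * \<bar>v x\<bar>)"
      proof (intro Bochner_Integration.integrable_add Bochner_Integration.integrable_sum)
        show "integrable lebesgue (\<lambda>x. w x * \<bar>v x\<bar>)" using vL by (simp add: L1w_def)
        show "integrable lebesgue (\<lambda>x. case p of (s, K) \<Rightarrow> measure lborel K * (w x * \<bar>g s x\<bar>))" if "p \<in> \<D>" for p
          using gwi[of "fst p" "snd p"] that by (simp add: split_beta)
      qed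
      show "(\<lambda>x. w x * \<bar>?r x\<bar>) \<in> borel_measurable lebesgue"
        using ri wL by (intro borel_measurable_times borel_measurable_abs) auto
      show "AE x in lebesgue. norm (w x * \<bar>?r x\<bar>) \<le> norm ((\<Sum>(s, K)\<in>\<D>. measure lborel K * (w x * \<bar>g s x\<bar>)) + w x * \<bar>v x\<bar>)"
      proof (rule AE_I2)
        fix x
        have w0: "0 \<le> w x" using w[of x] by simp
        have "\<bar>?r x\<bar> \<le> \<bar>\<Sum>(s, K)\<in>\<D>. measure lborel K * g s x\<bar> + \<bar>v x\<bar>" by (rule abs_triangle_ineq4)
        also have "\<bar>\<Sum>(s, K)\<in>\<D>. measure lborel K * g s x\<bar> \<le> (\<Sum>(s, K)\<in>\<D>. measure lborel K * \<bar>g s x\<bar>)"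
          by (rule order_trans[OF sum_abs], rule sum_mono) (simp add: split_beta abs_mult)
        finally have "w x * \<bar>?r x\<bar> \<le> w x * ((\<Sum>(s, K)\<in>\<D>. measure lborel K * \<bar>g s x\<bar>) + \<bar>v x\<bar>)"
          using w0 by (intro mult_left_mono) auto
        also have "\<dots> = (\<Sum>(s, K)\<in>\<D>. measure lborel K * (w x * \<bar>g s x\<bar>)) + w x * \<bar>v x\<bar>"
          unfolding split_beta by (simp only: distrib_left sum_distrib_left mult.left_commute)
        finally show "norm (w x * \<bar>?r x\<bar>) \<le> norm ((\<Sum>(s, K)\<in>\<D>. measure lborel K * (w x * \<bar>g s x\<bar>)) + w x * \<bar>v x\<bar>)"
          using w0 by (simp add: abs_mult)
      qed
    qed
    \<comment> \<open>The Riemann sum of the transforms is the transform of the Riemann sum, whose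
      weighted distance from \<open>v\<close> is what the gauge condition controls.\<close>
    have "(\<Sum>(s, K)\<in>\<D>. measure lborel K *\<^sub>R fourierL (g s) \<xi>) - fourierL v \<xi> = (LINT x|lebesgue. ?r x *\<^sub>R cis (\<xi> \<bullet> x))"
    proof -
      have pi: "integrable lebesgue (\<lambda>x. measure lborel (snd p) *\<^sub>R (g (fst p) x *\<^sub>R cis (\<xi> \<bullet> x)))" if "p \<in> \<D>" for p
        by (intro integrable_scaleR_right integrable_fourierL gi' that)
      have "(\<Sum>(s, K)\<in>\<D>. measure lborel K *\<^sub>R fourierL (g s) \<xi>) = (\<Sum>p\<in>\<D>. LINT x|lebesgue. measure lborel (snd p) *\<^sub>R (g (fst p) x *\<^sub>R cis (\<xi> \<bullet> x)))"
        by (simp add: fourierL_def split_beta del: scaleR_scaleR)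
      also have "\<dots> = (LINT x|lebesgue. (\<Sum>p\<in>\<D>. measure lborel (snd p) *\<^sub>R (g (fst p) x *\<^sub>R cis (\<xi> \<bullet> x))))"
        by (rule Bochner_Integration.integral_sum[symmetric]) (rule pi)
      finally have "(\<Sum>(s, K)\<in>\<D>. measure lborel K *\<^sub>R fourierL (g s) \<xi>) - fourierL v \<xi> =
        (LINT x|lebesgue. (\<Sum>p\<in>\<D>. measure lborel (snd p) *\<^sub>R (g (fst p) x *\<^sub>R cis (\<xi> \<bullet> x))) - v x *\<^sub>R cis (\<xi> \<bullet> x))"
        unfolding fourierL_def
        by (subst Bochner_Integration.integral_diff[OF Bochner_Integration.integrable_sum[OF pi] integrable_fourierL[OF int[OF vL]]])
          simp_all
      then show ?thesis
        by (simp add: scaleR_diff_left scaleR_sum_left split_beta)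
    qed
    then have "norm ((\<Sum>(s, K)\<in>\<D>. measure lborel K *\<^sub>R fourierL (g s) \<xi>) - fourierL v \<xi>) \<le> (LINT x|lebesgue. norm (?r x *\<^sub>R cis (\<xi> \<bullet> x)))"
      by (simp only:) (rule integral_norm_bound)
    also have "\<dots> \<le> (LINT x|lebesgue. w x * \<bar>?r x\<bar>)"
    proof (rule integral_mono[OF _ rw])
      show "integrable lebesgue (\<lambda>x. norm (?r x *\<^sub>R cis (\<xi> \<bullet> x)))" using ri by simp
      show "norm (?r x *\<^sub>R cis (\<xi> \<bullet> x)) \<le> w x * \<bar>?r x\<bar>" for x
        using mult_right_mono[OF w[of x] abs_ge_zero[of "?r x"]] by simp
    qed
    also have "\<dots> < e" using D[OF d] by (simp add: L1w_norm_def)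
    finally show "norm ((\<Sum>(x, k)\<in>\<D>. measure lborel k *\<^sub>R fourierL (g x) \<xi>) - fourierL v \<xi>) < e" .
  qed
qed

text \<open>Integrating factor: \<open>y\<close> times \<open>E\<close> has derivative
  \<open>0\<close> on the interval, one-sided at its ends.\<close>

lemma linear_ode_solution:
  fixes A y :: "real \<Rightarrow> complex"
  assumes A: "continuous_on {0..T} A" and T: "0 \<le> T"
    and y: "\<And>t. t \<in> {0..T} \<Longrightarrow> (y has_vector_derivative A t * y t) (at t within {0..T})"
  shows "y T = y 0 * exp (integral {0..T} A)"
proof -
  define E where "E t = exp (- integral {0..t} A)" for t
  have "((\<lambda>t. y t * E t) has_vector_derivative 0) (at t within {0..T})" if t: "t \<in> {0..T}" for t
  proof -
    have "((\<lambda>t. integral {0..t} A) has_vector_derivative A t) (at t within {0..T})"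
      by (rule integral_has_vector_derivative[OF A t])
    then have "((\<lambda>t. - integral {0..t} A) has_vector_derivative - A t) (at t within {0..T})"
      by (rule has_vector_derivative_minus)
    from field_vector_diff_chain_within[OF this DERIV_exp[THEN has_field_derivative_at_within]]
    have "(E has_vector_derivative - A t * E t) (at t within {0..T})"
      unfolding E_def comp_def .
    from has_vector_derivative_mult[OF y[OF t] this] show ?thesis
      by (simp add: mult_ac)
  qed
  then obtain c where c: "\<And>t. t \<in> {0..T} \<Longrightarrow> y t * E t = c"
    using has_vector_derivative_zero_constant[of "{0..T}" "\<lambda>t. y t * E t"] by blast
  have "y T * E T = y 0 * E 0" using T c[of T] c[of 0] by simp
  moreover have "E 0 = 1" by (simp add: E_def)
  moreover have "E T * exp (integral {0..T} A) = 1" by (simp add: E_def exp_minus)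
  ultimately have 1: "y T * E T = y 0" "E T * exp (integral {0..T} A) = 1" by simp_all
  have "y T = y T * (E T * exp (integral {0..T} A))" unfolding 1 by simp
  also have "\<dots> = y 0 * exp (integral {0..T} A)" 
  proof -
    have "y T * (E T * exp (integral {0..T} A)) = (y T * E T) * exp (integral {0..T} A)" by (rule mult.assoc[symmetric])
    then show ?thesis by (simp only: 1(1))
  qed
  finally show ?thesis .
qed

text \<open>\<open>J\<close> is the given Lebesgue measurable kernel and \<open>J0\<close> a Borel measurable version of it.\<close>

locale jump_version = jump_kernel J0 for J0 :: "'a::euclidean_space \<Rightarrow> real" +
  fixes J :: "'a \<Rightarrow> real"
  assumes J_AE: "AE x in lborel. J x = J0 x"
begin

text \<open>The law of a jump before any contraction; its density is the rescaled kernel.\<close>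

definition jm :: "real \<Rightarrow> 'a measure" where
  "jm \<epsilon> = distr JM borel (\<lambda>z. \<epsilon> *\<^sub>R z)"

lemma borel_prob_jm: "borel_prob (jm \<epsilon>)"
  unfolding jm_def borel_prob_def borel_prob_axioms_def
  by (auto intro!: JM.prob_space_distr)

lemma cf_jm: "cf (jm \<epsilon>) \<xi> = cf JM (\<epsilon> *\<^sub>R \<xi>)"
  unfolding cf_def jm_def by (simp add: integral_distr)

text \<open>An equality at every \<open>x\<close>: for fixed \<open>x\<close> the two integrands
  differ on a null set only, and if one of the integrals does not exist, neither does the other and
  both are \<open>0\<close>.\<close>

lemma convolve_eq:
  assumes e: "0 < \<epsilon>" and [measurable]: "g \<in> borel_measurable borel" and fg: "AE x in lborel. f x = g x"
  shows "convolve (rescale \<epsilon> J) f x = conv g (jm \<epsilon>) x"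
proof -
  let ?h = "\<lambda>y. inverse (\<epsilon> ^ DIM('a)) * J0 ((x - y) /\<^sub>R \<epsilon>) * g y"
  have "convolve (rescale \<epsilon> J) f x = (LINT y|lborel. ?h y)"
    unfolding convolve_def
  proof (rule lebesgue_integral_AE)
    have "AE y in lborel. J (x /\<^sub>R \<epsilon> + (- inverse \<epsilon>) *\<^sub>R y) = J0 (x /\<^sub>R \<epsilon> + (- inverse \<epsilon>) *\<^sub>R y)"
      by (rule AE_lborel_affine[OF J_AE]) (use e in simp)
    with fg show "AE y in lborel. rescale \<epsilon> J (x - y) * f y = ?h y"
      by eventually_elim (simp add: rescale_def scaleR_diff_right)
  qed measurable
  also have "\<dots> = (LINT z|lborel. J0 z * g (x - \<epsilon> *\<^sub>R z))"
  proof -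
    have s: "?h (x + (- \<epsilon>) *\<^sub>R z) = inverse (\<epsilon> ^ DIM('a)) * (J0 z * g (x - \<epsilon> *\<^sub>R z))" for z
      using e by simp
    show ?thesis
    proof (cases "integrable lborel ?h")
      case True
      from integral_lborel_affine[OF True, of "- \<epsilon>" x] show ?thesis
        unfolding s using e by simp
    next
      case False
      have "\<not> integrable lborel (\<lambda>z. J0 z * g (x - \<epsilon> *\<^sub>R z))"
      proof
        assume "integrable lborel (\<lambda>z. J0 z * g (x - \<epsilon> *\<^sub>R z))"
        then have "integrable lborel (\<lambda>z. ?h (x + (- \<epsilon>) *\<^sub>R z))" unfolding s by simp
        from integrable_lborel_affine[OF this, of "- inverse \<epsilon>" "x /\<^sub>R \<epsilon>"] False e show False
          by (simp add: scaleR_diff_right)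
      qed
      with False show ?thesis by (simp add: not_integrable_integral_eq)
    qed
  qed
  also have "\<dots> = conv g (jm \<epsilon>) x"
    unfolding conv_def jm_def JM_def using J_nonneg
    by (subst integral_distr) (auto simp: integral_density)
  finally show ?thesis .
qed

text \<open>\<open>psi\<close> integrates over the age of a jump, while the differential equation
  along a ray runs in elapsed time and starts from the frequency
  \<open>exp (- t) *\<^sub>R \<xi>\<close>; the substitution \<open>s\<close> to
  \<open>t - s\<close> links the two.\<close>

lemma psi_reversed:
  assumes e: "0 < \<epsilon>" and t: "0 \<le> t"
  shows "integral {0..t} (\<lambda>s. (cf JM ((\<epsilon> * exp s) *\<^sub>R exp (- t) *\<^sub>R \<xi>) - 1) / of_real (\<epsilon>\<^sup>2)) = psi \<epsilon> t \<xi>"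
proof -
  define g where "g s = (cf JM ((\<epsilon> * exp (- s)) *\<^sub>R \<xi>) - 1) / of_real (\<epsilon>\<^sup>2)" for s
  have cont: "continuous_on A (\<lambda>r. g (- r))" for A
    unfolding g_def using e by (intro continuous_intros continuous_cf_JM) auto
  have "psi \<epsilon> t \<xi> = integral {0..t} g" unfolding psi_def g_def[abs_def] ..
  also have "\<dots> = integral {-t..-0} (\<lambda>r. g (- r))" using Henstock_Kurzweil_Integration.integral_reflect_real[of t 0 g] by simp
  also have "\<dots> = integral {0 + (- t)..t + (- t)} (\<lambda>r. g (- r))" by simp
  also have "\<dots> = integral {0..t} ((\<lambda>r. g (- r)) \<circ> (\<lambda>x. x + (- t)))"
    by (rule integral_shift[symmetric]) (rule cont)
  also have "((\<lambda>r. g (- r)) \<circ> (\<lambda>x. x + (- t))) = (\<lambda>s. (cf JM ((\<epsilon> * exp s) *\<^sub>R exp (- t) *\<^sub>R \<xi>) - 1) / of_real (\<epsilon>\<^sup>2))"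
  proof
    fix s
    have "exp (- (- (s + - t))) = exp s * exp (- t)" by (simp only: minus_minus exp_add)
    then have "(\<epsilon> * exp (- (- (s + - t)))) *\<^sub>R \<xi> = (\<epsilon> * exp s) *\<^sub>R exp (- t) *\<^sub>R \<xi>"
      by (simp only: scaleR_scaleR mult.assoc)
    then show "((\<lambda>r. g (- r)) \<circ> (\<lambda>x. x + (- t))) s = (cf JM ((\<epsilon> * exp s) *\<^sub>R exp (- t) *\<^sub>R \<xi>) - 1) / of_real (\<epsilon>\<^sup>2)"
      by (simp only: g_def comp_def)
  qed
  finally show ?thesis ..
qed

lemma fourier_transport:
  fixes g h :: "'a \<Rightarrow> real"
  assumes e: "0 < \<epsilon>" and g: "integrable lborel g" and h: "AE x in lborel. h x = g x"
  shows "fourierL (transport \<epsilon> r h) \<xi> = of_real (exp (- (r / \<epsilon>\<^sup>2))) * fourier g (exp (- r) *\<^sub>R \<xi>)"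
proof -
  have [measurable]: "g \<in> borel_measurable borel" using g by (auto dest: borel_measurable_integrable)
  have "fourierL (transport \<epsilon> r h) \<xi> = fourier (\<lambda>x. exp (- (r / \<epsilon>\<^sup>2)) * dil r g x) \<xi>"
  proof (rule fourierL_eq)
    have "AE x in lborel. h (0 + exp r *\<^sub>R x) = g (0 + exp r *\<^sub>R x)"
      by (rule AE_lborel_affine[OF h]) simp
    then show "AE x in lborel. transport \<epsilon> r h x = exp (- (r / \<epsilon>\<^sup>2)) * dil r g x"
    proof eventually_elim
      case (elim x)
      have "(real DIM('a) - 1 / \<epsilon>\<^sup>2) * r = - (r / \<epsilon>\<^sup>2) + real DIM('a) * r" by (simp add: algebra_simps)
      then have "exp ((real DIM('a) - 1 / \<epsilon>\<^sup>2) * r) = exp (- (r / \<epsilon>\<^sup>2)) * exp (real DIM('a) * r)"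
        by (simp only: exp_add)
      with elim show ?case by (simp add: transport_def dil_def)
    qed
  qed measurable
  also have "\<dots> = of_real (exp (- (r / \<epsilon>\<^sup>2))) * fourier (dil r g) \<xi>"
    unfolding fourier_def
    by (subst integral_mult_right_zero[symmetric]) (simp add: scaleR_conv_of_real mult.assoc)
  finally show ?thesis by (simp add: fourier_dil[OF g])
qed

text \<open>The ray \<open>exp t *\<^sub>R \<zeta>\<close> is a characteristic of the drift: along
  it the dilations in Duhamel's formula cancel, and what remains is a scalar linear integral
  equation for each \<zeta> separately.\<close>

lemma mild_solution_fourier:
  assumes e: "0 < \<epsilon>" and sol: "mild_solution w J \<epsilon> u0 u" and w: "\<And>x. 1 \<le> w x"
    and int: "\<And>f. f \<in> L1w w \<Longrightarrow> integrable lebesgue f" and wm: "w \<in> borel_measurable borel" and T: "0 \<le> T"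
  shows "fourierL (u T) \<xi> = fourierL u0 (exp (- T) *\<^sub>R \<xi>) * exp (psi \<epsilon> T \<xi>)"
proof -
  define \<zeta> where "\<zeta> = exp (- T) *\<^sub>R \<xi>"
  have \<zeta>: "exp T *\<^sub>R \<zeta> = \<xi>" by (simp add: \<zeta>_def exp_minus)
  define U where "U t \<eta> = fourierL (u t) \<eta>" for t \<eta>
  \<comment> \<open>The factor compensates the loss rate \<open>1 / \<epsilon>\<^sup>2\<close> in
    \<open>transport\<close>, so that the integral equation is \<open>y t = y 0\<close> plus the
    integral of \<open>A s * y s\<close>.\<close>
  define y where "y t = of_real (exp (t / \<epsilon>\<^sup>2)) * U t (exp t *\<^sub>R \<zeta>)" for t
  define A where "A s = cf JM ((\<epsilon> * exp s) *\<^sub>R \<zeta>) / of_real (\<epsilon>\<^sup>2)" for s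
  have u0L: "u0 \<in> L1w w" and uL: "\<And>t. 0 \<le> t \<Longrightarrow> u t \<in> L1w w"
    using sol unfolding mild_solution_def by auto
  have ver: "\<exists>g. integrable lborel g \<and> (AE x in lborel. f x = g x)" if "f \<in> L1w w" for f
  proof -
    have "f \<in> borel_measurable lebesgue" using that by (simp add: L1w_def)
    then obtain g where g: "g \<in> borel_measurable borel" "AE x in lborel. f x = g x" by (rule obtain_borel_version)
    with lebesgue_integrable_AE[OF g] int[OF that] show ?thesis by auto
  qed
  obtain g0 where g0: "integrable lborel g0" "AE x in lborel. u0 x = g0 x" using ver[OF u0L] by blast
  have [measurable]: "g0 \<in> borel_measurable borel" using g0(1) by (auto dest: borel_measurable_integrable)
  have A_cont: "continuous_on X A" for X
    unfolding A_def using e by (intro continuous_intros continuous_cf_JM) auto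
  have hi: "((\<lambda>s. A s * y s) has_integral (y t - fourierL u0 \<zeta>)) {0..t}" if t: "0 \<le> t" for t
  proof -
    obtain I where I: "has_integral_L1w w (\<lambda>s. transport \<epsilon> (t - s) (convolve (rescale \<epsilon> J) (u s))) I 0 t"
      and eq: "AE x in lebesgue. u t x = transport \<epsilon> t u0 x + 1 / \<epsilon>\<^sup>2 * I x"
      using sol t unfolding mild_solution_def by blast
    have IL: "I \<in> L1w w" using I unfolding has_integral_L1w_def by (elim conjE)
    obtain i where i: "integrable lborel i" "AE x in lborel. I x = i x" using ver[OF IL] by blast
    have [measurable]: "i \<in> borel_measurable borel" using i(1) by (auto dest: borel_measurable_integrable)
    let ?\<eta> = "exp t *\<^sub>R \<zeta>"
    have G: "fourierL (transport \<epsilon> (t - s) (convolve (rescale \<epsilon> J) (u s))) ?\<eta> =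
        of_real (\<epsilon>\<^sup>2) * of_real (exp (- (t / \<epsilon>\<^sup>2))) * (A s * y s)" if s: "s \<in> {0..t}" for s
    proof -
      obtain g where g: "integrable lborel g" "AE x in lborel. u s x = g x" using ver[OF uL] s by auto
      have [measurable]: "g \<in> borel_measurable borel" using g(1) by (auto dest: borel_measurable_integrable)
      have "fourierL (transport \<epsilon> (t - s) (convolve (rescale \<epsilon> J) (u s))) ?\<eta> =
          of_real (exp (- ((t - s) / \<epsilon>\<^sup>2))) * fourier (conv g (jm \<epsilon>)) (exp (- (t - s)) *\<^sub>R ?\<eta>)"
        by (rule fourier_transport[OF e integrable_conv[OF borel_prob_jm g(1)]])
          (simp add: convolve_eq[OF e _ g(2)])
      also have "exp (- (t - s)) *\<^sub>R ?\<eta> = exp s *\<^sub>R \<zeta>"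
        by (simp add: exp_add[symmetric])
      also have "fourier (conv g (jm \<epsilon>)) (exp s *\<^sub>R \<zeta>) = U s (exp s *\<^sub>R \<zeta>) * cf JM ((\<epsilon> * exp s) *\<^sub>R \<zeta>)"
        unfolding U_def fourierL_eq[OF \<open>g \<in> borel_measurable borel\<close> g(2)]
        by (subst fourier_conv[OF borel_prob_jm g(1)]) (simp add: cf_jm)
      also have "exp (- ((t - s) / \<epsilon>\<^sup>2)) = exp (- (t / \<epsilon>\<^sup>2)) * exp (s / \<epsilon>\<^sup>2)"
        by (simp add: exp_add[symmetric] diff_divide_distrib)
      finally show ?thesis using e by (simp add: A_def y_def)
    qed
    have "((\<lambda>s. fourierL (transport \<epsilon> (t - s) (convolve (rescale \<epsilon> J) (u s))) ?\<eta>) has_integral fourierL I ?\<eta>) {0..t}"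
      by (rule has_integral_fourierL[OF I w int wm])
    then have hi': "((\<lambda>s. of_real (\<epsilon>\<^sup>2) * of_real (exp (- (t / \<epsilon>\<^sup>2))) * (A s * y s)) has_integral fourierL I ?\<eta>) {0..t}"
      by (rule has_integral_eq[rotated]) (simp only: G)
    have hi: "((\<lambda>s. A s * y s) has_integral (of_real (exp (t / \<epsilon>\<^sup>2)) / of_real (\<epsilon>\<^sup>2) * fourierL I ?\<eta>)) {0..t}"
    proof -
      have "complex_of_real (exp (t / \<epsilon>\<^sup>2)) / of_real (\<epsilon>\<^sup>2) * (of_real (\<epsilon>\<^sup>2) * of_real (exp (- (t / \<epsilon>\<^sup>2))) * z) = z" for z
        using e by (simp add: exp_minus)
      then show ?thesis using has_integral_mult_right[OF hi', of "of_real (exp (t / \<epsilon>\<^sup>2)) / of_real (\<epsilon>\<^sup>2)"]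
        by (simp only:)
    qed
    have "U t ?\<eta> = fourier (\<lambda>x. exp (- (t / \<epsilon>\<^sup>2)) * dil t g0 x + 1 / \<epsilon>\<^sup>2 * i x) ?\<eta>"
      unfolding U_def
    proof (rule fourierL_eq)
      have "AE x in lborel. u0 (0 + exp t *\<^sub>R x) = g0 (0 + exp t *\<^sub>R x)"
        by (rule AE_lborel_affine[OF g0(2)]) simp
      with i(2) eq[unfolded AE_completion_iff] show "AE x in lborel. u t x = exp (- (t / \<epsilon>\<^sup>2)) * dil t g0 x + 1 / \<epsilon>\<^sup>2 * i x"
      proof eventually_elim
        case (elim x)
        have "(real DIM('a) - 1 / \<epsilon>\<^sup>2) * t = - (t / \<epsilon>\<^sup>2) + real DIM('a) * t" by (simp add: algebra_simps)
        then have "exp ((real DIM('a) - 1 / \<epsilon>\<^sup>2) * t) = exp (- (t / \<epsilon>\<^sup>2)) * exp (real DIM('a) * t)"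
          by (simp only: exp_add)
        with elim show ?case by (simp add: transport_def dil_def)
      qed
    qed measurable
    also have "\<dots> = of_real (exp (- (t / \<epsilon>\<^sup>2))) * fourier (dil t g0) ?\<eta> + 1 / of_real (\<epsilon>\<^sup>2) * fourier i ?\<eta>"
    proof -
      have "fourier (\<lambda>x. exp (- (t / \<epsilon>\<^sup>2)) * dil t g0 x + 1 / \<epsilon>\<^sup>2 * i x) ?\<eta> =
          (LINT x|lborel. of_real (exp (- (t / \<epsilon>\<^sup>2))) * (dil t g0 x *\<^sub>R cis (?\<eta> \<bullet> x)) + 1 / of_real (\<epsilon>\<^sup>2) * (i x *\<^sub>R cis (?\<eta> \<bullet> x)))"
        unfolding fourier_def by (intro Bochner_Integration.integral_cong) (auto simp: scaleR_conv_of_real algebra_simps)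
      also have "\<dots> = of_real (exp (- (t / \<epsilon>\<^sup>2))) * fourier (dil t g0) ?\<eta> + 1 / of_real (\<epsilon>\<^sup>2) * fourier i ?\<eta>"
        unfolding fourier_def
        by (subst Bochner_Integration.integral_add[OF integrable_mult_right[OF integrable_fourier[OF integrable_dil[OF g0(1)]]]
              integrable_mult_right[OF integrable_fourier[OF i(1)]]])
          (simp only: integral_mult_right_zero)
      finally show ?thesis .
    qed
    also have "fourier (dil t g0) ?\<eta> = fourierL u0 \<zeta>"
      unfolding fourier_dil[OF g0(1)] fourierL_eq[OF \<open>g0 \<in> borel_measurable borel\<close> g0(2)] by (simp add: exp_minus)
    also have "fourier i ?\<eta> = fourierL I ?\<eta>"
      by (rule fourierL_eq[OF _ i(2), symmetric]) measurable
    finally have "U t ?\<eta> = of_real (exp (- (t / \<epsilon>\<^sup>2))) * fourierL u0 \<zeta> + 1 / of_real (\<epsilon>\<^sup>2) * fourierL I ?\<eta>" .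
    then have "y t = of_real (exp (t / \<epsilon>\<^sup>2)) * (of_real (exp (- (t / \<epsilon>\<^sup>2))) * fourierL u0 \<zeta> + 1 / of_real (\<epsilon>\<^sup>2) * fourierL I ?\<eta>)"
      by (simp only: y_def)
    also have "\<dots> = (of_real (exp (t / \<epsilon>\<^sup>2)) * of_real (exp (- (t / \<epsilon>\<^sup>2)))) * fourierL u0 \<zeta> + of_real (exp (t / \<epsilon>\<^sup>2)) / of_real (\<epsilon>\<^sup>2) * fourierL I ?\<eta>"
      by (simp add: distrib_left)
    also have "of_real (exp (t / \<epsilon>\<^sup>2)) * of_real (exp (- (t / \<epsilon>\<^sup>2))) = (1 :: complex)"
      unfolding of_real_mult[symmetric] exp_add[symmetric] by simp
    finally have "y t - fourierL u0 \<zeta> = of_real (exp (t / \<epsilon>\<^sup>2)) / of_real (\<epsilon>\<^sup>2) * fourierL I ?\<eta>"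
      by simp
    with hi show ?thesis by simp
  qed
  have yt: "y t = fourierL u0 \<zeta> + integral {0..t} (\<lambda>s. A s * y s)" if "0 \<le> t" for t
    using integral_unique[OF hi[OF that]] by simp
  have y0: "y 0 = fourierL u0 \<zeta>" using yt[of 0] by simp
  \<comment> \<open>Bootstrap: the gauge integral gives integrability of \<open>A s * y s\<close>,
    hence continuity of \<open>y\<close>, and only then does the fundamental theorem give
    differentiability.\<close>
  have y_cont: "continuous_on {0..T} y"
  proof -
    have "continuous_on {0..T} (\<lambda>t. fourierL u0 \<zeta> + integral {0..t} (\<lambda>s. A s * y s))"
      using hi[OF T] by (intro continuous_intros indefinite_integral_continuous_1) (auto simp: has_integral_integrable)
    then show ?thesis by (rule continuous_on_eq) (simp add: yt)
  qed
  have "y T = y 0 * exp (integral {0..T} A)"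
  proof (rule linear_ode_solution[OF A_cont T])
    fix t assume t: "t \<in> {0..T}"
    have "((\<lambda>t. integral {0..t} (\<lambda>s. A s * y s)) has_vector_derivative A t * y t) (at t within {0..T})"
      by (rule integral_has_vector_derivative[OF _ t]) (intro continuous_intros A_cont y_cont)
    then have "((\<lambda>t. fourierL u0 \<zeta> + integral {0..t} (\<lambda>s. A s * y s)) has_vector_derivative 0 + A t * y t) (at t within {0..T})"
      by (intro has_vector_derivative_add has_vector_derivative_const)
    then show "(y has_vector_derivative A t * y t) (at t within {0..T})"
      using has_vector_derivative_transform[OF t, of y "\<lambda>t. fourierL u0 \<zeta> + integral {0..t} (\<lambda>s. A s * y s)"] yt by simp
  qed
  moreover have "y T = of_real (exp (T / \<epsilon>\<^sup>2)) * fourierL (u T) \<xi>"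
    by (simp add: y_def U_def \<zeta>)
  \<comment> \<open>\<open>A\<close> holds the gain term alone; the loss term went into the factor
    of \<open>y\<close> and comes back as the \<open>- 1\<close> in \<open>psi\<close>.\<close>
  moreover have "integral {0..T} A = psi \<epsilon> T \<xi> + of_real (T / \<epsilon>\<^sup>2)"
  proof -
    have "psi \<epsilon> T \<xi> = integral {0..T} (\<lambda>s. A s - 1 / of_real (\<epsilon>\<^sup>2))"
      unfolding psi_reversed[OF e T, symmetric] A_def \<zeta>_def by (simp add: diff_divide_distrib)
    also have "\<dots> = integral {0..T} A - integral {0..T} (\<lambda>s. 1 / of_real (\<epsilon>\<^sup>2))"
      by (rule Henstock_Kurzweil_Integration.integral_diff) (auto intro!: integrable_continuous_interval A_cont)
    also have "integral {0..T} (\<lambda>s. 1 / of_real (\<epsilon>\<^sup>2)) = (of_real (T / \<epsilon>\<^sup>2) :: complex)"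
      using T by (simp add: scaleR_conv_of_real)
    finally show ?thesis by simp
  qed
  ultimately have "of_real (exp (T / \<epsilon>\<^sup>2)) * fourierL (u T) \<xi> = fourierL u0 \<zeta> * (exp (psi \<epsilon> T \<xi>) * of_real (exp (T / \<epsilon>\<^sup>2)))"
    using y0 by (simp only: exp_add exp_of_real)
  then show ?thesis by (simp add: \<zeta>_def)
qed

text \<open>Uniqueness of mild solutions: each has, at every time, the Fourier transform of the
  explicit orbit.\<close>

lemma mild_solution_eq_S:
  assumes e: "0 < \<epsilon>" and sol: "mild_solution w J \<epsilon> u0 u" and w: "\<And>x. 1 \<le> w x"
    and int: "\<And>f. f \<in> L1w w \<Longrightarrow> integrable lebesgue f" and wm: "w \<in> borel_measurable borel" and T: "0 < T"
    and g0: "g0 \<in> borel_measurable borel" "AE x in lborel. u0 x = g0 x"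
  shows "AE x in lborel. u T x = S \<epsilon> T g0 x"
proof -
  have u0L: "u0 \<in> L1w w" and uL: "u T \<in> L1w w"
    using sol T unfolding mild_solution_def by auto
  have "u T \<in> borel_measurable lebesgue" using uL by (simp add: L1w_def)
  then obtain g where g: "g \<in> borel_measurable borel" "AE x in lborel. u T x = g x" by (rule obtain_borel_version)
  have gi: "integrable lborel g" using lebesgue_integrable_AE[OF g] int[OF uL] by simp
  have g0i: "integrable lborel g0" using lebesgue_integrable_AE[OF g0] int[OF u0L] by simp
  have "AE x in lborel. g x = S \<epsilon> T g0 x"
  proof (rule fourier_eq_AE[OF gi integrable_S[OF g0i]])
    fix \<xi>
    have "fourier g \<xi> = fourierL (u T) \<xi>" by (rule fourierL_eq[OF g, symmetric])
    also have "\<dots> = fourierL u0 (exp (- T) *\<^sub>R \<xi>) * exp (psi \<epsilon> T \<xi>)"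
      by (rule mild_solution_fourier[OF e sol w int wm]) (use T in auto)
    also have "\<dots> = fourier (S \<epsilon> T g0) \<xi>"
      unfolding fourier_S[OF e T g0i] fourierL_eq[OF g0] ..
    finally show "fourier g \<xi> = fourier (S \<epsilon> T g0) \<xi>" .
  qed
  with g(2) show ?thesis by eventually_elim simp
qed

end

section \<open>Equilibria\<close>

lemma test_function_facts:
  fixes \<phi> :: "'a::euclidean_space \<Rightarrow> real"
  assumes "test_function \<phi>"
  shows "\<And>x. (\<phi> has_derivative frechet_derivative \<phi> (at x)) (at x)"
    and "continuous_on UNIV \<phi>"
    and "\<exists>B. \<forall>x. \<bar>\<phi> x\<bar> \<le> B"
    and "continuous_on UNIV (\<lambda>x. frechet_derivative \<phi> (at x) x)"
    and "\<exists>B. \<forall>x. \<bar>frechet_derivative \<phi> (at x) x\<bar> \<le> B"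
proof -
  have C1: "C_k (Suc 0) \<phi>" using assms unfolding test_function_def by blast
  obtain K where K: "compact K" "\<And>x. x \<notin> K \<Longrightarrow> \<phi> x = 0" using assms unfolding test_function_def by blast
  show der: "(\<phi> has_derivative frechet_derivative \<phi> (at x)) (at x)" for x
    using C1 by (simp add: frechet_derivative_works)
  show cont: "continuous_on UNIV \<phi>"
    using der by (intro continuous_at_imp_continuous_on ballI) (rule has_derivative_continuous)
  \<comment> \<open>\<open>C_k\<close> speaks of derivatives along basis vectors, so the radial
    derivative is expanded in coordinates to obtain its continuity.\<close>
  have lin: "frechet_derivative \<phi> (at x) x = (\<Sum>i\<in>Basis. (x \<bullet> i) * frechet_derivative \<phi> (at x) i)" for x
  proof -
    have l: "linear (frechet_derivative \<phi> (at x))" using der by (rule has_derivative_linear)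
    have "frechet_derivative \<phi> (at x) x = frechet_derivative \<phi> (at x) (\<Sum>i\<in>Basis. (x \<bullet> i) *\<^sub>R i)"
      by (simp add: euclidean_representation)
    also have "\<dots> = (\<Sum>i\<in>Basis. (x \<bullet> i) * frechet_derivative \<phi> (at x) i)"
      by (simp add: linear_sum[OF l] linear_scale[OF l])
    finally show ?thesis .
  qed
  show dcont: "continuous_on UNIV (\<lambda>x. frechet_derivative \<phi> (at x) x)"
    unfolding lin using C1 by (intro continuous_intros) auto
  have bd: "\<exists>B. \<forall>x. \<bar>f x\<bar> \<le> B" if f: "continuous_on UNIV f" and 0: "\<And>x. x \<notin> K \<Longrightarrow> f x = 0" for f :: "'a \<Rightarrow> real"
  proof -
    have "bounded (f ` K)"
      by (intro compact_imp_bounded compact_continuous_image continuous_on_subset[OF f] K) auto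
    then obtain B where B: "\<And>x. x \<in> K \<Longrightarrow> \<bar>f x\<bar> \<le> B" by (auto simp: bounded_iff)
    have "\<bar>f x\<bar> \<le> max B 0" for x using B[of x] 0[of x] by (cases "x \<in> K") auto
    then show ?thesis by blast
  qed
  show "\<exists>B. \<forall>x. \<bar>\<phi> x\<bar> \<le> B" by (rule bd[OF cont K(2)])
  show "\<exists>B. \<forall>x. \<bar>frechet_derivative \<phi> (at x) x\<bar> \<le> B"
  proof (rule bd[OF dcont])
    fix x assume x: "x \<notin> K"
    have "((\<lambda>_. 0) has_derivative (\<lambda>_. 0)) (at x)" by (rule has_derivative_const)
    then have "(\<phi> has_derivative (\<lambda>_. 0)) (at x)"
    proof (rule has_derivative_transform_within_open)
      show "open (- K)" using K(1) by (simp add: compact_imp_closed open_Compl)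
    qed (use x K(2) in auto)
    then have "frechet_derivative \<phi> (at x) = (\<lambda>_. 0)" by (rule frechet_derivative_at[symmetric])
    then show "frechet_derivative \<phi> (at x) x = 0" by simp
  qed
qed

lemma ray_derivative:
  fixes \<phi> :: "'a::euclidean_space \<Rightarrow> real"
  assumes d: "\<And>x. (\<phi> has_derivative frechet_derivative \<phi> (at x)) (at x)"
  shows "((\<lambda>t. \<phi> (exp (- t) *\<^sub>R x)) has_real_derivative
    - frechet_derivative \<phi> (at (exp (- t) *\<^sub>R x)) (exp (- t) *\<^sub>R x)) (at t)"
proof -
  let ?D = "frechet_derivative \<phi> (at (exp (- t) *\<^sub>R x))"
  have l: "linear ?D" using d by (rule has_derivative_linear)
  have "((\<lambda>t. exp (- t) *\<^sub>R x) has_derivative (\<lambda>h. (- (h * exp (- t))) *\<^sub>R x)) (at t)"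
    by (auto intro!: derivative_eq_intros)
  from has_derivative_compose[OF this d]
  have "((\<lambda>t. \<phi> (exp (- t) *\<^sub>R x)) has_derivative (\<lambda>h. ?D ((- (h * exp (- t))) *\<^sub>R x))) (at t)" .
  also have "(\<lambda>h. ?D ((- (h * exp (- t))) *\<^sub>R x)) = (*) (- ?D (exp (- t) *\<^sub>R x))"
    by (auto simp: linear_scale[OF l] fun_eq_iff linear_neg[OF l])
  finally show ?thesis unfolding has_field_derivative_def .
qed

text \<open>For small intensity there is at most one jump: two or more have probability
  \<open>1 - exp (- l) * (1 + l)\<close>, at most \<open>l\<^sup>2\<close>. This allows
  differentiation of the semigroup at time \<open>0\<close>.\<close>

lemma cpoisson_first_order:
  fixes f :: "'a::euclidean_space \<Rightarrow> real"
  assumes M: "borel_prob M" and l: "0 < l" and f[measurable]: "f \<in> borel_measurable borel" and B: "\<And>x. \<bar>f x\<bar> \<le> B"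
  shows "\<bar>(LINT z|cpoisson l M. f z) - exp (- l) * (f 0 + l * (LINT z|M. f z))\<bar> \<le> B * l\<^sup>2"
proof -
  interpret M: borel_prob M by fact
  let ?w = "\<lambda>n. l ^ n / fact n * exp (- l)" and ?I = "\<lambda>n. LINT z|convpow M n. f z"
  have B0: "0 \<le> B" using B[of 0] by linarith
  have s: "(\<lambda>n. ?w n * ?I n) sums (LINT z|cpoisson l M. f z)" by (rule cpoisson_sums[OF M l f B])
  have ws: "?w sums 1" using sums_mult[OF exp_converges[of l], of "exp (- l)"] by (simp add: exp_minus field_simps)
  have I: "\<bar>?I n\<bar> \<le> B" for n
    using borel_prob.integral_bounded_le[OF borel_prob_convpow[OF M], of f B n] B by simp
  have I0: "?I 0 = f 0" by (simp add: integral_return)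
  have I1: "?I (Suc 0) = (LINT z|M. f z)"
  proof -
    have "?I (Suc 0) = (LINT x|return borel 0. LINT y|M. f (x + y))"
      using borel_prob_convpow[OF M, of 0] by (simp add: integral_conv2[OF _ M f, of _ B] B)
    also have "\<dots> = (LINT y|M. f (0 + y))" by (rule integral_return) auto
    finally show ?thesis by simp
  qed
  have s2: "(\<lambda>n. ?w (n + 2) * ?I (n + 2)) sums ((LINT z|cpoisson l M. f z) - exp (- l) * (f 0 + l * (LINT z|M. f z)))"
    using sums_split_initial_segment[OF s, of 2] I0 I1 by (simp add: numeral_2_eq_2 algebra_simps)
  have w2: "(\<lambda>n. B * ?w (n + 2)) sums (B * (1 - exp (- l) * (1 + l)))"
    using sums_mult[OF sums_split_initial_segment[OF ws, of 2], of B] by (simp add: numeral_2_eq_2 algebra_simps)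
  have le: "\<bar>?w (n + 2) * ?I (n + 2)\<bar> \<le> B * ?w (n + 2)" for n
  proof -
    have wn: "0 \<le> ?w (n + 2)" using l by simp
    have "\<bar>?w (n + 2) * ?I (n + 2)\<bar> = ?w (n + 2) * \<bar>?I (n + 2)\<bar>"
      by (simp only: abs_mult[of "?w (n + 2)"] abs_of_nonneg[OF wn])
    also have "\<dots> \<le> ?w (n + 2) * B" by (rule mult_left_mono[OF I wn])
    finally show ?thesis by (simp only: mult.commute)
  qed
  have "norm (suminf (\<lambda>n. ?w (n + 2) * ?I (n + 2))) \<le> suminf (\<lambda>n. B * ?w (n + 2))"
    using le w2 by (intro norm_suminf_le) (auto simp: sums_iff)
  then have "\<bar>(LINT z|cpoisson l M. f z) - exp (- l) * (f 0 + l * (LINT z|M. f z))\<bar> \<le> B * (1 - exp (- l) * (1 + l))"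
    using s2 w2 by (simp add: sums_iff)
  also have "\<dots> \<le> B * l\<^sup>2"
  proof (rule mult_left_mono[OF _ B0])
    have "1 - l \<le> exp (- l)" using exp_ge_add_one_self[of "- l"] by simp
    then have "(1 - l) * (1 + l) \<le> exp (- l) * (1 + l)" using l by (intro mult_right_mono) auto
    then show "1 - exp (- l) * (1 + l) \<le> l\<^sup>2" by (simp add: algebra_simps power2_eq_square)
  qed
  finally show ?thesis .
qed

context jump_version
begin

lemma kap_tendsto:
  fixes \<phi> :: "'a \<Rightarrow> real"
  assumes \<phi>: "continuous_on UNIV \<phi>" and B: "\<And>x. \<bar>\<phi> x\<bar> \<le> B" and t: "t \<longlonglongrightarrow> 0"
  shows "(\<lambda>n. LINT z|kap \<epsilon> (t n). \<phi> (exp (- t n) *\<^sub>R y + z)) \<longlonglongrightarrow> (LINT z|JM. \<phi> (y + \<epsilon> *\<^sub>R z))"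
proof -
  interpret U: prob_space unif by (rule prob_space_unif)
  have [measurable]: "\<phi> \<in> borel_measurable borel" by (intro borel_measurable_continuous_onI \<phi>)
  have k: "(LINT z|kap \<epsilon> (t n). \<phi> (exp (- t n) *\<^sub>R y + z)) =
      (LINT r|unif. LINT z|JM. \<phi> (exp (- t n) *\<^sub>R y + (\<epsilon> * exp (- (t n * r))) *\<^sub>R z))" for n
    by (rule integral_kap[of _ B]) (use B in auto)
  have bd: "\<bar>LINT z|JM. \<phi> (f z)\<bar> \<le> B" for f
    using JM.integral_bounded_le[of "\<lambda>z. \<phi> (f z)" B] B by simp
  have "(\<lambda>n. LINT r|unif. LINT z|JM. \<phi> (exp (- t n) *\<^sub>R y + (\<epsilon> * exp (- (t n * r))) *\<^sub>R z)) \<longlonglongrightarrow>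
      (LINT r|unif. LINT z|JM. \<phi> (y + \<epsilon> *\<^sub>R z))"
  proof (rule integral_dominated_convergence[where w = "\<lambda>_. B"])
    show "AE r in unif. (\<lambda>n. LINT z|JM. \<phi> (exp (- t n) *\<^sub>R y + (\<epsilon> * exp (- (t n * r))) *\<^sub>R z)) \<longlonglongrightarrow> (LINT z|JM. \<phi> (y + \<epsilon> *\<^sub>R z))"
    proof (rule AE_I2)
      fix r
      show "(\<lambda>n. LINT z|JM. \<phi> (exp (- t n) *\<^sub>R y + (\<epsilon> * exp (- (t n * r))) *\<^sub>R z)) \<longlonglongrightarrow> (LINT z|JM. \<phi> (y + \<epsilon> *\<^sub>R z))"
      proof (rule integral_dominated_convergence[where w = "\<lambda>_. B"])
        show "AE z in JM. (\<lambda>n. \<phi> (exp (- t n) *\<^sub>R y + (\<epsilon> * exp (- (t n * r))) *\<^sub>R z)) \<longlonglongrightarrow> \<phi> (y + \<epsilon> *\<^sub>R z)"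
        proof (rule AE_I2)
          fix z
          have "(\<lambda>n. exp (- t n) *\<^sub>R y + (\<epsilon> * exp (- (t n * r))) *\<^sub>R z) \<longlonglongrightarrow> exp (- 0) *\<^sub>R y + (\<epsilon> * exp (- (0 * r))) *\<^sub>R z"
            by (intro tendsto_intros t)
          then show "(\<lambda>n. \<phi> (exp (- t n) *\<^sub>R y + (\<epsilon> * exp (- (t n * r))) *\<^sub>R z)) \<longlonglongrightarrow> \<phi> (y + \<epsilon> *\<^sub>R z)"
            by (intro continuous_on_tendsto_compose[OF \<phi>]) auto
        qed
      qed (use B in auto)
    qed
  qed (use bd in auto)
  also have "(LINT r|unif. LINT z|JM. \<phi> (y + \<epsilon> *\<^sub>R z)) = (LINT z|JM. \<phi> (y + \<epsilon> *\<^sub>R z))"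
    using U.prob_space by simp
  finally show ?thesis unfolding k .
qed

end

lemma weak_form_algebra: "f * (- p + - 1 * (q / d) + k / d) = 1 / d * (f * k - f * q) - f * p" for f p q k d :: real
  by (cases "d = 0") (simp_all add: field_simps)

context jump_version
begin

text \<open>The weak equation is the derivative at time \<open>0\<close> of the constant pairing of
  \<open>S \<epsilon> t F\<close> with \<phi>. The difference quotients \<open>Q n\<close> of the
  adjoint evolution of \<phi> converge boundedly to the generator, so dominated convergence against
  \<open>F\<close> suffices.\<close>

lemma stationary_weak:
  fixes \<phi> :: "'a \<Rightarrow> real"
  assumes e: "0 < \<epsilon>" and F: "integrable lborel F" and st: "\<And>t. 0 < t \<Longrightarrow> AE x in lborel. S \<epsilon> t F x = F x"
    and test: "test_function \<phi>"
  shows "1 / \<epsilon>\<^sup>2 * ((LINT y|lborel. F y * (LINT z|JM. \<phi> (y + \<epsilon> *\<^sub>R z))) - (LINT y|lborel. F y * \<phi> y)) -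
    (LINT y|lborel. F y * frechet_derivative \<phi> (at y) y) = 0"
proof -
  note d = test_function_facts(1)[OF test] and cont = test_function_facts(2)[OF test]
  obtain B where B: "\<And>x. \<bar>\<phi> x\<bar> \<le> B" using test_function_facts(3)[OF test] by blast
  define \<psi> where "\<psi> y = frechet_derivative \<phi> (at y) y" for y
  obtain B' where B': "\<And>x. \<bar>\<psi> x\<bar> \<le> B'" using test_function_facts(5)[OF test] unfolding \<psi>_def by blast
  have B0: "0 \<le> B" "0 \<le> B'" using B[of 0] B'[of 0] by linarith+
  have [measurable]: "\<phi> \<in> borel_measurable borel" by (intro borel_measurable_continuous_onI cont)
  have [measurable]: "\<psi> \<in> borel_measurable borel"
    unfolding \<psi>_def by (intro borel_measurable_continuous_onI test_function_facts(4)[OF test])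
  have [measurable]: "F \<in> borel_measurable borel" using F by (auto dest: borel_measurable_integrable)
  have der: "((\<lambda>t. \<phi> (exp (- t) *\<^sub>R y)) has_real_derivative - \<psi> (exp (- t) *\<^sub>R y)) (at t)" for t y
    unfolding \<psi>_def by (rule ray_derivative[OF d])
  have lip: "\<bar>\<phi> (exp (- t) *\<^sub>R y) - \<phi> y\<bar> \<le> B' * t" if t: "0 < t" for t y
  proof -
    obtain s where "0 < s" "s < t" "\<phi> (exp (- t) *\<^sub>R y) - \<phi> (exp (- 0) *\<^sub>R y) = (t - 0) * - \<psi> (exp (- s) *\<^sub>R y)"
      using MVT2[OF t der[of y]] by blast
    then have "\<bar>\<phi> (exp (- t) *\<^sub>R y) - \<phi> y\<bar> = t * \<bar>\<psi> (exp (- s) *\<^sub>R y)\<bar>"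
      using t by (simp add: abs_mult)
    also have "\<dots> \<le> t * B'" using t by (intro mult_left_mono B') auto
    finally show ?thesis by (simp add: mult.commute)
  qed
  define t where "t n = inverse (real (Suc n))" for n
  have t: "0 < t n" "t n \<le> 1" for n by (auto simp: t_def field_simps)
  have t0: "t \<longlonglongrightarrow> 0" unfolding t_def by (rule LIMSEQ_inverse_real_of_nat)
  define l where "l n = t n / \<epsilon>\<^sup>2" for n
  have l: "0 < l n" for n using t e by (simp add: l_def)
  have l0: "l \<longlonglongrightarrow> 0" unfolding l_def using tendsto_divide[OF t0 tendsto_const[of "\<epsilon>\<^sup>2"]] e by simp
  define P where "P n y = (LINT z|mu \<epsilon> (t n). \<phi> (exp (- t n) *\<^sub>R y + z))" for n y
  define k where "k n y = (LINT z|kap \<epsilon> (t n). \<phi> (exp (- t n) *\<^sub>R y + z))" for n y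
  define r where "r n y = (P n y - exp (- l n) * (\<phi> (exp (- t n) *\<^sub>R y) + l n * k n y)) / t n" for n y
  define Q where "Q n y = (P n y - \<phi> y) / t n" for n y
  have rle: "\<bar>r n y\<bar> \<le> B / (\<epsilon>\<^sup>2)\<^sup>2 * t n" for n y
  proof -
    have "\<bar>P n y - exp (- l n) * (\<phi> (exp (- t n) *\<^sub>R y + 0) + l n * k n y)\<bar> \<le> B * (l n)\<^sup>2"
      unfolding P_def k_def mu_def l_def[symmetric]
      by (rule cpoisson_first_order[OF borel_prob_kap l]) (use B in auto)
    then have "\<bar>r n y\<bar> \<le> B * (l n)\<^sup>2 / t n"
      using t[of n] by (simp add: r_def divide_right_mono)
    also have "\<dots> = B / (\<epsilon>\<^sup>2)\<^sup>2 * t n"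
      using t[of n] by (simp add: l_def power_divide power2_eq_square)
    finally show ?thesis .
  qed
  have kle: "\<bar>k n y\<bar> \<le> B" for n y
    unfolding k_def using borel_prob.integral_bounded_le[OF borel_prob_kap, of "\<lambda>z. \<phi> (exp (- t n) *\<^sub>R y + z)" B] B by simp
  define dq where "dq n y = (\<phi> (exp (- t n) *\<^sub>R y) - \<phi> y) / t n" for n y
  define el where "el n = (exp (- l n) - 1) / l n" for n
  \<comment> \<open>The four parts are: two or more jumps, the drift, the loss of the event without
    jumps, and the gain by one jump.\<close>
  have Q: "Q n y = r n y + exp (- l n) * dq n y + el n * (\<phi> y / \<epsilon>\<^sup>2) + exp (- l n) * (k n y / \<epsilon>\<^sup>2)" for n y
    using t[of n] e by (simp add: Q_def r_def l_def dq_def el_def field_simps)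
  have expl: "el \<longlonglongrightarrow> - 1"
  proof -
    have "((\<lambda>x::real. exp (- x)) has_real_derivative - 1) (at 0)"
      by (auto intro!: derivative_eq_intros)
    then have "((\<lambda>h. (exp (- h) - 1) / h) \<longlongrightarrow> - 1) (at (0 :: real))"
      by (simp add: DERIV_def)
    then show ?thesis
      unfolding tendsto_at_iff_sequentially comp_def el_def[abs_def] using l0 l by (auto simp: less_imp_neq[symmetric])
  qed
  have expl_bd: "\<bar>el n\<bar> \<le> 1" for n
  proof -
    have "1 - l n \<le> exp (- l n)" using exp_ge_add_one_self[of "- l n"] by simp
    then show ?thesis using l[of n] by (simp add: el_def abs_if field_simps)
  qed
  have exp1: "exp (- l n) \<le> 1" for n using l[of n] by simp
  have lim: "(\<lambda>n. Q n y) \<longlonglongrightarrow> 0 + exp (- 0) * (- \<psi> y) + - 1 * (\<phi> y / \<epsilon>\<^sup>2) + exp (- 0) * ((LINT z|JM. \<phi> (y + \<epsilon> *\<^sub>R z)) / \<epsilon>\<^sup>2)" for y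
  proof -
    have L1: "(\<lambda>n. r n y) \<longlonglongrightarrow> 0"
    proof (rule Lim_null_comparison)
      show "\<forall>\<^sub>F n in sequentially. norm (r n y) \<le> B / (\<epsilon>\<^sup>2)\<^sup>2 * t n"
        unfolding real_norm_def using rle by (intro always_eventually allI)
      show "(\<lambda>n. B / (\<epsilon>\<^sup>2)\<^sup>2 * t n) \<longlonglongrightarrow> 0" using tendsto_mult_right_zero[OF t0] .
    qed
    have "((\<lambda>h. (\<phi> (exp (- (0 + h)) *\<^sub>R y) - \<phi> (exp (- 0) *\<^sub>R y)) / h) \<longlongrightarrow> - \<psi> (exp (- 0) *\<^sub>R y)) (at 0)"
      using der[of y 0] by (simp only: DERIV_def)
    then have "((\<lambda>h. (\<phi> (exp (- h) *\<^sub>R y) - \<phi> y) / h) \<longlongrightarrow> - \<psi> y) (at 0)" by simp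
    then have L2: "(\<lambda>n. dq n y) \<longlonglongrightarrow> - \<psi> y"
      unfolding dq_def tendsto_at_iff_sequentially comp_def using t0 t by (auto simp: less_imp_neq[symmetric])
    have L3: "(\<lambda>n. k n y) \<longlonglongrightarrow> (LINT z|JM. \<phi> (y + \<epsilon> *\<^sub>R z))"
      unfolding k_def by (rule kap_tendsto[OF cont B t0])
    show ?thesis
      unfolding Q by (intro tendsto_intros L1 L2 L3 l0 expl) (use e in auto)
  qed
  define c where "c = B / (\<epsilon>\<^sup>2)\<^sup>2 + B' + B / \<epsilon>\<^sup>2 + B / \<epsilon>\<^sup>2"
  have Qle: "\<bar>Q n y\<bar> \<le> c" for n y
  proof -
    have 1: "\<bar>r n y\<bar> \<le> B / (\<epsilon>\<^sup>2)\<^sup>2"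
    proof -
      have "B / (\<epsilon>\<^sup>2)\<^sup>2 * t n \<le> B / (\<epsilon>\<^sup>2)\<^sup>2 * 1" using B0 by (intro mult_left_mono t(2)) auto
      then show ?thesis using rle[of n y] by linarith
    qed
    have "\<bar>dq n y\<bar> \<le> B'"
      unfolding dq_def using lip[OF t(1), of n y] t(1)[of n] by (simp add: divide_le_eq)
    then have 2: "\<bar>exp (- l n) * dq n y\<bar> \<le> 1 * B'"
      using exp1[of n] unfolding abs_mult by (intro mult_mono) auto
    have 3: "\<bar>el n * (\<phi> y / \<epsilon>\<^sup>2)\<bar> \<le> 1 * (B / \<epsilon>\<^sup>2)"
      unfolding abs_mult using expl_bd[of n] B[of y] e by (intro mult_mono) (auto intro: divide_right_mono)
    have 4: "\<bar>exp (- l n) * (k n y / \<epsilon>\<^sup>2)\<bar> \<le> 1 * (B / \<epsilon>\<^sup>2)"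
      unfolding abs_mult using exp1[of n] kle[of n y] e by (intro mult_mono) (auto intro: divide_right_mono)
    show ?thesis using 1 2 3 4 unfolding Q c_def by linarith
  qed
  have [measurable]: "P n \<in> borel_measurable borel" for n
  proof -
    interpret borel_prob "mu \<epsilon> (t n)" by (rule borel_prob_mu)
    show ?thesis unfolding P_def[abs_def] by measurable
  qed
  have [measurable]: "Q n \<in> borel_measurable borel" for n unfolding Q_def[abs_def] by measurable
  have Ple: "\<bar>P n y\<bar> \<le> B" for n y
    unfolding P_def using borel_prob.integral_bounded_le[OF borel_prob_mu, of "\<lambda>z. \<phi> (exp (- t n) *\<^sub>R y + z)" B] B by simp
  have FI: "integrable lborel (\<lambda>y. F y * f y)" if [measurable]: "f \<in> borel_measurable borel" and "\<And>y. \<bar>f y\<bar> \<le> C" for f C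
  proof -
    have "integrable lborel (\<lambda>y. F y *\<^sub>R f y)"
      by (rule integrable_mult_bounded[OF F, of f C]) (use that in simp_all)
    then show ?thesis by simp
  qed
  \<comment> \<open>By stationarity and duality \<open>F\<close> pairs equally with \<phi> and with
    its evolution \<open>P n\<close>.\<close>
  have Q0: "(LINT y|lborel. F y * Q n y) = 0" for n
  proof -
    have "(LINT y|lborel. F y * P n y) = (LINT x|lborel. S \<epsilon> (t n) F x * \<phi> x)"
      unfolding P_def by (rule S_pairing[OF F _ B, symmetric]) measurable
    also have "\<dots> = (LINT x|lborel. F x * \<phi> x)"
      by (rule integral_cong_AE) (use st[OF t(1), of n] in \<open>auto elim!: eventually_mono\<close>)
    finally have "(LINT y|lborel. F y * P n y) = (LINT x|lborel. F x * \<phi> x)" .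
    then have "(LINT y|lborel. F y * P n y - F y * \<phi> y) = 0"
    proof -
      have "integrable lborel (\<lambda>y. F y * P n y)" by (rule FI[of "P n" B]) (measurable, rule Ple)
      moreover have "integrable lborel (\<lambda>y. F y * \<phi> y)" by (rule FI[of \<phi> B]) (measurable, rule B)
      ultimately show ?thesis using \<open>(LINT y|lborel. F y * P n y) = (LINT x|lborel. F x * \<phi> x)\<close>
        by (simp only: Bochner_Integration.integral_diff)
    qed
    moreover have "F y * Q n y = (F y * P n y - F y * \<phi> y) / t n" for y
      by (simp add: Q_def algebra_simps diff_divide_distrib)
    ultimately show ?thesis by simp
  qed
  let ?K = "\<lambda>y. LINT z|JM. \<phi> (y + \<epsilon> *\<^sub>R z)"
  have Kle: "\<bar>?K y\<bar> \<le> B" for y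
    using JM.integral_bounded_le[of "\<lambda>z. \<phi> (y + \<epsilon> *\<^sub>R z)" B] B by simp
  have "(\<lambda>n. LINT y|lborel. F y * Q n y) \<longlonglongrightarrow> (LINT y|lborel. F y * (- \<psi> y + - 1 * (\<phi> y / \<epsilon>\<^sup>2) + ?K y / \<epsilon>\<^sup>2))"
  proof (rule integral_dominated_convergence[where w = "\<lambda>y. c * \<bar>F y\<bar>"])
    show "AE y in lborel. (\<lambda>n. F y * Q n y) \<longlonglongrightarrow> F y * (- \<psi> y + - 1 * (\<phi> y / \<epsilon>\<^sup>2) + ?K y / \<epsilon>\<^sup>2)"
      using lim by (intro AE_I2 tendsto_mult tendsto_const) simp
    show "AE y in lborel. norm (F y * Q n y) \<le> c * \<bar>F y\<bar>" for n
      using mult_right_mono[OF Qle abs_ge_zero] by (intro AE_I2) (simp add: abs_mult mult.commute)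
  qed (use F in auto)
  then have "(LINT y|lborel. F y * (- \<psi> y + - 1 * (\<phi> y / \<epsilon>\<^sup>2) + ?K y / \<epsilon>\<^sup>2)) = 0"
    unfolding Q0 by (simp add: LIMSEQ_const_iff)
  also have "(\<lambda>y. F y * (- \<psi> y + - 1 * (\<phi> y / \<epsilon>\<^sup>2) + ?K y / \<epsilon>\<^sup>2)) = (\<lambda>y. 1 / \<epsilon>\<^sup>2 * (F y * ?K y - F y * \<phi> y) - F y * \<psi> y)"
    by (rule ext) (rule weak_form_algebra)
  finally have "(LINT y|lborel. 1 / \<epsilon>\<^sup>2 * (F y * ?K y - F y * \<phi> y) - F y * \<psi> y) = 0" .
  note z = this
  have i1: "integrable lborel (\<lambda>y. F y * ?K y)" by (rule FI[of ?K B]) (measurable, rule Kle)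
  have i2: "integrable lborel (\<lambda>y. F y * \<phi> y)" by (rule FI[of \<phi> B]) (measurable, rule B)
  have i3: "integrable lborel (\<lambda>y. F y * \<psi> y)" by (rule FI[of \<psi> B']) (measurable, rule B')
  have "(LINT y|lborel. 1 / \<epsilon>\<^sup>2 * (F y * ?K y - F y * \<phi> y) - F y * \<psi> y) =
      1 / \<epsilon>\<^sup>2 * ((LINT y|lborel. F y * ?K y) - (LINT y|lborel. F y * \<phi> y)) - (LINT y|lborel. F y * \<psi> y)"
    unfolding Bochner_Integration.integral_diff[OF integrable_mult_right[OF Bochner_Integration.integrable_diff[OF i1 i2]] i3]
      integral_mult_right_zero Bochner_Integration.integral_diff[OF i1 i2] ..
  with z show ?thesis unfolding \<psi>_def by (simp only:)
qed

lemma stationary_imp_equilibrium: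
  assumes e: "0 < \<epsilon>" and F: "integrable lborel F" and st: "\<And>t. 0 < t \<Longrightarrow> AE x in lborel. S \<epsilon> t F x = F x"
  shows "equilibrium J \<epsilon> F"
  unfolding equilibrium_def
proof (intro conjI allI impI)
  have [measurable]: "F \<in> borel_measurable borel" using F by (auto dest: borel_measurable_integrable)
  show "integrable lebesgue F" using lebesgue_integrable_AE[of F F] F by simp
  fix \<phi> :: "'a \<Rightarrow> real" assume test: "test_function \<phi>"
  have [measurable]: "\<phi> \<in> borel_measurable borel"
    by (intro borel_measurable_continuous_onI test_function_facts[OF test])
  have [measurable]: "(\<lambda>x. frechet_derivative \<phi> (at x) x) \<in> borel_measurable borel"
    by (intro borel_measurable_continuous_onI test_function_facts[OF test])
  obtain B where B: "\<And>x. \<bar>\<phi> x\<bar> \<le> B" using test_function_facts(3)[OF test] by blast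
  let ?c = "conv F (jm \<epsilon>)"
  have [measurable]: "?c \<in> borel_measurable borel" by (intro conv_measurable borel_prob_jm) measurable
  have ci: "integrable lborel ?c" by (rule integrable_conv[OF borel_prob_jm F])
  have FI: "integrable lborel (\<lambda>y. f y * \<phi> y)" if "integrable lborel f" for f
    using integrable_mult_bounded[OF that, of \<phi> B] B by simp
  have "(LINT x|lebesgue. 1 / \<epsilon>\<^sup>2 * (convolve (rescale \<epsilon> J) F x - F x) * \<phi> x) =
      (LINT x|lborel. 1 / \<epsilon>\<^sup>2 * (?c x - F x) * \<phi> x)"
    by (rule lebesgue_integral_AE) (auto simp: convolve_eq[OF e])
  also have "\<dots> = (LINT x|lborel. 1 / \<epsilon>\<^sup>2 * (?c x * \<phi> x - F x * \<phi> x))"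
    by (simp add: algebra_simps)
  also have "\<dots> = 1 / \<epsilon>\<^sup>2 * ((LINT x|lborel. ?c x * \<phi> x) - (LINT x|lborel. F x * \<phi> x))"
    using FI[OF ci] FI[OF F] by simp
  also have "(LINT x|lborel. ?c x * \<phi> x) = (LINT y|lborel. F y * (LINT z|JM. \<phi> (y + \<epsilon> *\<^sub>R z)))"
    using integral_conv_pairing[OF borel_prob_jm F, of \<phi> B \<epsilon>] B by (simp add: jm_def integral_distr)
  finally have 1: "(LINT x|lebesgue. 1 / \<epsilon>\<^sup>2 * (convolve (rescale \<epsilon> J) F x - F x) * \<phi> x) =
      1 / \<epsilon>\<^sup>2 * ((LINT y|lborel. F y * (LINT z|JM. \<phi> (y + \<epsilon> *\<^sub>R z))) - (LINT x|lborel. F x * \<phi> x))" .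
  have 2: "(LINT x|lebesgue. F x * frechet_derivative \<phi> (at x) x) = (LINT x|lborel. F x * frechet_derivative \<phi> (at x) x)"
    by (rule lebesgue_integral_AE) auto
  show "(LINT x|lebesgue. 1 / \<epsilon>\<^sup>2 * (convolve (rescale \<epsilon> J) F x - F x) * \<phi> x) -
      (LINT x|lebesgue. F x * frechet_derivative \<phi> (at x) x) = 0"
    unfolding 1 2 by (rule stationary_weak[OF e F st test])
qed

end

section \<open>Smooth functions and cut-offs\<close>

lemma C_k_Suc: "C_k (Suc n) f \<Longrightarrow> C_k n f"
proof (induction n arbitrary: f)
  case 0
  then have "\<forall>x. f differentiable (at x)" by simp
  then show ?case by (simp add: continuous_at_imp_continuous_on differentiable_imp_continuous_within)
next
  case (Suc n)
  show ?case unfolding C_k.simps(2)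
  proof (intro conjI ballI)
    show "\<forall>x. f differentiable (at x)" using Suc.prems by simp
    fix i :: 'a assume "i \<in> Basis"
    then have "C_k (Suc n) (\<lambda>x. frechet_derivative f (at x) i)" using Suc.prems by (simp only: C_k.simps(2)) blast
    then show "C_k n (\<lambda>x. frechet_derivative f (at x) i)" by (rule Suc.IH)
  qed
qed

lemma C_k_SucI:
  fixes f :: "'a::euclidean_space \<Rightarrow> real"
  assumes d: "\<And>x. (f has_derivative D x) (at x)" and C: "\<And>i. i \<in> Basis \<Longrightarrow> C_k n (\<lambda>x. D x i)"
  shows "C_k (Suc n) f"
proof -
  have "frechet_derivative f (at x) = D x" for x using frechet_derivative_at[OF d] by simp
  moreover have "f differentiable (at x)" for x using d by (auto simp: differentiable_def)
  ultimately show ?thesis using C by simp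
qed

lemma C_k_derivative: "C_k (Suc n) f \<Longrightarrow> (f has_derivative frechet_derivative f (at x)) (at x)"
  by (simp add: frechet_derivative_works)

lemma C_k_const: "C_k n (\<lambda>x :: 'a::euclidean_space. c)"
proof (induction n arbitrary: c)
  case (Suc n)
  show ?case by (rule C_k_SucI[where D = "\<lambda>_ _. 0"]) (auto intro: Suc)
qed simp

lemma C_k_inner: "C_k n (\<lambda>x :: 'a::euclidean_space. u \<bullet> x)"
proof (cases n)
  case (Suc m)
  show ?thesis unfolding Suc
    by (rule C_k_SucI[where D = "\<lambda>_ h. u \<bullet> h"]) (auto intro: C_k_const derivative_intros)
qed (auto intro: continuous_intros)

lemma C_k_add:
  fixes f g :: "'a::euclidean_space \<Rightarrow> real"
  shows "C_k n f \<Longrightarrow> C_k n g \<Longrightarrow> C_k n (\<lambda>x. f x + g x)"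
proof (induction n arbitrary: f g)
  case (Suc n)
  show ?case
  proof (rule C_k_SucI)
    show "((\<lambda>x. f x + g x) has_derivative (\<lambda>h. frechet_derivative f (at x) h + frechet_derivative g (at x) h)) (at x)" for x
      by (intro has_derivative_add C_k_derivative[OF Suc.prems(1)] C_k_derivative[OF Suc.prems(2)])
    show "C_k n (\<lambda>x. frechet_derivative f (at x) i + frechet_derivative g (at x) i)" if "i \<in> Basis" for i
      using Suc.prems that by (intro Suc.IH) auto
  qed
qed (auto intro: continuous_intros)

lemma C_k_mult:
  fixes f g :: "'a::euclidean_space \<Rightarrow> real"
  shows "C_k n f \<Longrightarrow> C_k n g \<Longrightarrow> C_k n (\<lambda>x. f x * g x)"
proof (induction n arbitrary: f g)
  case (Suc n)
  show ?case
  proof (rule C_k_SucI)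
    show "((\<lambda>x. f x * g x) has_derivative (\<lambda>h. f x * frechet_derivative g (at x) h + frechet_derivative f (at x) h * g x)) (at x)" for x
      by (intro has_derivative_mult C_k_derivative[OF Suc.prems(1)] C_k_derivative[OF Suc.prems(2)])
    show "C_k n (\<lambda>x. f x * frechet_derivative g (at x) i + frechet_derivative f (at x) i * g x)" if "i \<in> Basis" for i
      using Suc.prems that C_k_Suc[OF Suc.prems(1)] C_k_Suc[OF Suc.prems(2)] by (intro C_k_add Suc.IH) auto
  qed
qed (auto intro: continuous_intros)

text \<open>\<open>H\<close> lists a smooth function with all its derivatives, so that the induction
  over \<open>n\<close> can move from \<open>H m\<close> to \<open>H (Suc m)\<close> by the chain
  rule.\<close>

lemma C_k_compose:
  fixes f :: "'a::euclidean_space \<Rightarrow> real" and H :: "nat \<Rightarrow> real \<Rightarrow> real"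
  assumes H: "\<And>m y. (H m has_real_derivative H (Suc m) y) (at y)"
  shows "C_k n f \<Longrightarrow> C_k n (\<lambda>x. H m (f x))"
proof (induction n arbitrary: m)
  case 0
  have "continuous_on UNIV (H m)"
    using H by (intro continuous_at_imp_continuous_on ballI DERIV_isCont)
  then show ?case using 0 by (auto intro: continuous_on_compose2)
next
  case (Suc n)
  show ?case
  proof (rule C_k_SucI)
    show "((\<lambda>x. H m (f x)) has_derivative (\<lambda>h. H (Suc m) (f x) * frechet_derivative f (at x) h)) (at x)" for x
      using has_derivative_compose[OF C_k_derivative[OF Suc.prems] H[unfolded has_field_derivative_def]] .
    show "C_k n (\<lambda>x. H (Suc m) (f x) * frechet_derivative f (at x) i)" if "i \<in> Basis" for i
      using Suc.prems that C_k_Suc[OF Suc.prems] by (intro C_k_mult Suc.IH) auto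
  qed
qed

lemma C_k_norm_square: "C_k n (\<lambda>x :: 'a::euclidean_space. (norm x)\<^sup>2)"
proof -
  have "C_k n (\<lambda>x :: 'a. \<Sum>i\<in>I. (i \<bullet> x) * (i \<bullet> x))" if "finite I" for I
    using that
  proof induction
    case (insert i I)
    have "C_k n (\<lambda>x :: 'a. (i \<bullet> x) * (i \<bullet> x) + (\<Sum>i\<in>I. (i \<bullet> x) * (i \<bullet> x)))"
      by (intro C_k_add[OF _ insert.IH] C_k_mult C_k_inner)
    then show ?case using insert.hyps by simp
  qed (simp add: C_k_const)
  from this[OF finite_Basis] show ?thesis
    by (simp add: power2_norm_eq_inner euclidean_inner[of x x for x] inner_commute)
qed

text \<open>The derivatives of \<open>exp (- 1 / x)\<close>, extended by \<open>0\<close>, are of this form.\<close>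

definition flat :: "real poly \<Rightarrow> real \<Rightarrow> real" where
  "flat p x = (if 0 < x then poly p (1 / x) * exp (- (1 / x)) else 0)"

text \<open>The extra power \<open>y ^ k\<close> lets the induction over the coefficients of
  \<open>p\<close> run, as each step passes a factor \<open>y\<close> to the remaining
  polynomial.\<close>

lemma poly_exp_decay:
  fixes p :: "real poly"
  shows "((\<lambda>y. y ^ k * poly p y * exp (- y)) \<longlongrightarrow> 0) at_top"
proof (induction p arbitrary: k)
  case (pCons a p)
  have "((\<lambda>y :: real. y ^ k / exp y) \<longlongrightarrow> 0) at_top" by (rule tendsto_power_div_exp_0)
  then have "((\<lambda>y. a * (y ^ k / exp y) + y ^ Suc k * poly p y * exp (- y)) \<longlongrightarrow> a * 0 + 0) at_top"
    by (intro tendsto_intros pCons.IH)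
  then show ?case by (simp add: exp_minus field_simps)
qed simp

text \<open>With \<open>y = 1 / x\<close> the chain rule gives \<open>- y\<^sup>2\<close> times
  \<open>(pderiv p - p) * exp (- y)\<close>, whence the polynomial. At \<open>0\<close> the
  difference quotient from the right is \<open>y * poly p y * exp (- y)\<close> with
  \<open>y\<close> tending to infinity.\<close>

lemma flat_derivative:
  "(flat p has_real_derivative flat ([:0, 0, 1:] * (p - pderiv p)) x) (at x)"
proof -
  let ?q = "[:0, 0, 1:] * (p - pderiv p)"
  consider "0 < x" | "x < 0" | "x = 0" by linarith
  then show ?thesis
  proof cases
    case 1
    have "((\<lambda>x. poly p (1 / x) * exp (- (1 / x))) has_real_derivative flat ?q x) (at x)"
      using 1 by (auto intro!: derivative_eq_intros poly_DERIV[THEN DERIV_chain2] simp: flat_def power2_eq_square field_simps)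
    then show ?thesis
      by (rule has_field_derivative_transform_within_open[of _ _ _ "{0<..}"]) (use 1 in \<open>auto simp: flat_def\<close>)
  next
    case 2
    have "((\<lambda>_. 0) has_real_derivative 0) (at x)" by simp
    then have "(flat p has_real_derivative 0) (at x)"
      by (rule has_field_derivative_transform_within_open[of _ _ _ "{..<0}"]) (use 2 in \<open>auto simp: flat_def\<close>)
    then show ?thesis using 2 by (simp add: flat_def)
  next
    case 3
    have "((\<lambda>h. flat p h / h) \<longlongrightarrow> 0) (at 0)"
    proof (rule filterlim_split_at)
      have "((\<lambda>h. flat p h / h) \<longlongrightarrow> 0) (at_left 0) \<longleftrightarrow> ((\<lambda>h. 0 :: real) \<longlongrightarrow> 0) (at_left (0 :: real))"
        by (intro filterlim_cong refl) (auto simp: eventually_at_left_field flat_def intro: exI[of _ "- 1"])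
      then show "((\<lambda>h. flat p h / h) \<longlongrightarrow> 0) (at_left 0)" by simp
      have "((\<lambda>h. (\<lambda>y. y ^ 1 * poly p y * exp (- y)) (inverse h)) \<longlongrightarrow> 0) (at_right 0)"
        by (rule filterlim_compose[OF poly_exp_decay filterlim_inverse_at_top_right])
      moreover have "((\<lambda>h. flat p h / h) \<longlongrightarrow> 0) (at_right 0) \<longleftrightarrow>
          ((\<lambda>h. (\<lambda>y. y ^ 1 * poly p y * exp (- y)) (inverse h)) \<longlongrightarrow> 0) (at_right 0)"
        by (intro filterlim_cong refl) (auto simp: eventually_at_right_field flat_def field_simps intro!: exI[of _ 1])
      ultimately show "((\<lambda>h. flat p h / h) \<longlongrightarrow> 0) (at_right 0)" by simp
    qed
    then show ?thesis using 3 by (simp add: DERIV_def flat_def)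
  qed
qed

definition flat_seq :: "nat \<Rightarrow> real \<Rightarrow> real" where
  "flat_seq m = flat (((\<lambda>p. [:0, 0, 1:] * (p - pderiv p)) ^^ m) 1)"

lemma flat_seq_derivative: "(flat_seq m has_real_derivative flat_seq (Suc m) y) (at y)"
  unfolding flat_seq_def using flat_derivative by simp

lemma flat_seq_0: "flat_seq 0 x = (if 0 < x then exp (- (1 / x)) else 0)"
  by (simp add: flat_seq_def flat_def)

lemma flat_seq_neg: "x \<le> 0 \<Longrightarrow> flat_seq m x = 0"
  by (simp add: flat_seq_def flat_def)

text \<open>The factor \<open>exp 1\<close> normalises the value at the origin to \<open>1\<close>;
  the squared norm keeps the argument smooth there.\<close>

definition cutoff :: "real \<Rightarrow> 'a::euclidean_space \<Rightarrow> real" where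
  "cutoff R x = exp 1 * flat_seq 0 (1 - (norm x)\<^sup>2 / R\<^sup>2)"

lemma cutoff_range: "0 \<le> cutoff R x" "cutoff R x \<le> 1"
proof -
  let ?u = "1 - (norm x)\<^sup>2 / R\<^sup>2"
  show "0 \<le> cutoff R x" by (simp add: cutoff_def flat_seq_0)
  show "cutoff R x \<le> 1"
  proof (cases "0 < ?u")
    case True
    have "?u \<le> 1" by simp
    then have "1 \<le> 1 / ?u" using True by simp
    then have "exp 1 * exp (- (1 / ?u)) \<le> 1" unfolding exp_add[symmetric] by simp
    then show ?thesis using True by (simp add: cutoff_def flat_seq_0)
  qed (simp add: cutoff_def flat_seq_neg)
qed

lemma cutoff_derivative:
  assumes "0 < R"
  shows "(cutoff R has_derivative (\<lambda>h. exp 1 * (flat_seq 1 (1 - (norm x)\<^sup>2 / R\<^sup>2) * (- (2 * (x \<bullet> h)) / R\<^sup>2)))) (at x)"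
proof -
  have i: "((\<lambda>x. 1 - (norm x)\<^sup>2 / R\<^sup>2) has_derivative (\<lambda>h. - (2 * (x \<bullet> h)) / R\<^sup>2)) (at x)"
  proof -
    have "((\<lambda>x. 1 + (- 1 / R\<^sup>2) * (x \<bullet> x)) has_derivative (\<lambda>h. 0 + (- 1 / R\<^sup>2) * (x \<bullet> h + h \<bullet> x))) (at x)"
      by (intro has_derivative_add has_derivative_const has_derivative_mult_right has_derivative_inner has_derivative_ident)
    then show ?thesis by (simp add: power2_norm_eq_inner inner_commute)
  qed
  have "((\<lambda>x. flat_seq 0 (1 - (norm x)\<^sup>2 / R\<^sup>2)) has_derivative (\<lambda>h. flat_seq 1 (1 - (norm x)\<^sup>2 / R\<^sup>2) * (- (2 * (x \<bullet> h)) / R\<^sup>2))) (at x)"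
    using has_derivative_compose[OF i flat_seq_derivative[unfolded has_field_derivative_def, of 0]] by simp
  then show ?thesis
    unfolding cutoff_def[abs_def] by (rule has_derivative_mult_right)
qed

lemma cutoff_product_test_function:
  fixes H :: "nat \<Rightarrow> real \<Rightarrow> real"
  assumes R: "0 < R" and H: "\<And>m y. (H m has_real_derivative H (Suc m) y) (at y)"
  shows "test_function (\<lambda>x :: 'a::euclidean_space. cutoff R x * H 0 (\<xi> \<bullet> x))"
  unfolding test_function_def
proof (intro conjI allI exI[of _ "cball 0 R"] impI)
  fix n
  have "C_k n (\<lambda>x :: 'a. 1 + (- 1 / R\<^sup>2) * (norm x)\<^sup>2)"
    by (intro C_k_add C_k_mult C_k_const C_k_norm_square)
  then have "C_k n (\<lambda>x :: 'a. flat_seq 0 (1 + (- 1 / R\<^sup>2) * (norm x)\<^sup>2))"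
    by (rule C_k_compose[of flat_seq _ _ 0, rotated]) (rule flat_seq_derivative)
  then have "C_k n (\<lambda>x :: 'a. flat_seq 0 (1 - (norm x)\<^sup>2 / R\<^sup>2))" by simp
  then have "C_k n (\<lambda>x :: 'a. exp 1 * flat_seq 0 (1 - (norm x)\<^sup>2 / R\<^sup>2))"
    by (intro C_k_mult C_k_const)
  then show "C_k n (\<lambda>x :: 'a. cutoff R x * H 0 (\<xi> \<bullet> x))"
    unfolding cutoff_def[abs_def] 
    by (rule C_k_mult) (intro C_k_compose[of H, OF H] C_k_inner)
next
  show "compact (cball (0 :: 'a) R)" by simp
  fix x :: 'a assume "x \<notin> cball 0 R"
  then have "R\<^sup>2 \<le> (norm x)\<^sup>2" using R by (intro power_mono) auto
  then have "1 - (norm x)\<^sup>2 / R\<^sup>2 \<le> 0" using R by (simp add: field_simps)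
  then show "cutoff R x * H 0 (\<xi> \<bullet> x) = 0" by (simp add: cutoff_def flat_seq_neg)
qed

section \<open>From equilibria to fixed points of the semigroup\<close>

text \<open>The form of the derivative to which dominated convergence along sequences
  applies.\<close>

lemma has_vector_derivative_iff_quotient:
  fixes f :: "real \<Rightarrow> 'b::real_normed_vector"
  shows "(f has_vector_derivative D) (at x within A) \<longleftrightarrow> ((\<lambda>y. (f y - f x) /\<^sub>R (y - x)) \<longlongrightarrow> D) (at x within A)"
proof -
  have "norm ((1 / norm (y - x)) *\<^sub>R (f y - (f x + (y - x) *\<^sub>R D))) = norm ((f y - f x) /\<^sub>R (y - x) - D)" if "y \<noteq> x" for y
  proof -
    have "(f y - f x) /\<^sub>R (y - x) - D = inverse (y - x) *\<^sub>R (f y - (f x + (y - x) *\<^sub>R D))"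
      using that by (simp add: scaleR_diff_right scaleR_add_right)
    then show ?thesis by (simp add: divide_inverse)
  qed
  then have *: "\<forall>\<^sub>F y in at x within A. norm ((1 / norm (y - x)) *\<^sub>R (f y - (f x + (y - x) *\<^sub>R D))) = norm ((f y - f x) /\<^sub>R (y - x) - D)"
    by (auto simp: eventually_at_filter)
  have "(f has_vector_derivative D) (at x within A) \<longleftrightarrow>
      ((\<lambda>y. norm ((1 / norm (y - x)) *\<^sub>R (f y - (f x + (y - x) *\<^sub>R D)))) \<longlongrightarrow> 0) (at x within A)"
    unfolding has_vector_derivative_def has_derivative_within
    by (simp only: bounded_linear_scaleR_left tendsto_norm_zero_iff simp_thms)
  also have "\<dots> \<longleftrightarrow> ((\<lambda>y. norm ((f y - f x) /\<^sub>R (y - x) - D)) \<longlongrightarrow> 0) (at x within A)"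
    by (rule tendsto_cong[OF *])
  also have "\<dots> \<longleftrightarrow> ((\<lambda>y. (f y - f x) /\<^sub>R (y - x)) \<longlongrightarrow> D) (at x within A)"
    by (simp add: tendsto_norm_zero_iff LIM_zero_iff)
  finally show ?thesis .
qed

lemma norm_cis_diff_le: "norm (cis a - cis b) \<le> \<bar>a - b\<bar>"
proof -
  have "cis a - cis b = cis b * (cis (a - b) - 1)"
    by (simp add: algebra_simps cis_mult)
  then have "norm (cis a - cis b) = norm (cis (a - b) - 1)"
    by (simp add: norm_mult)
  also have "\<dots> \<le> \<bar>a - b\<bar>"
    using iexp_approx1[of "a - b" 0] by (simp add: cis_conv_exp)
  finally show ?thesis .
qed

lemma exp_lipschitz_le:
  fixes a b t :: real
  assumes "a \<le> t" "b \<le> t"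
  shows "\<bar>exp a - exp b\<bar> \<le> exp t * \<bar>a - b\<bar>"
proof -
  have *: "exp b - exp a \<le> exp t * (b - a)" if "a \<le> b" "b \<le> t" for a b :: real
  proof -
    have "exp b - exp a = exp b * (1 - exp (a - b))" by (simp add: algebra_simps exp_diff)
    also have "\<dots> \<le> exp b * (b - a)" using exp_ge_add_one_self[of "a - b"] by (intro mult_left_mono) (linarith, simp)
    also have "\<dots> \<le> exp t * (b - a)" using that by (intro mult_right_mono) auto
    finally show ?thesis .
  qed
  show ?thesis using *[of a b] *[of b a] assms by (cases "a \<le> b") (auto simp: abs_if)
qed

text \<open>Differentiation under the integral: \<open>cis\<close> is Lipschitz, so the difference
  quotients are dominated by a multiple of \<open>norm x * \<bar>g x\<bar>\<close>.\<close>

lemma fourier_ray_derivative: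
  fixes g :: "'a::euclidean_space \<Rightarrow> real"
  assumes g: "integrable lborel g" and g1: "integrable lborel (\<lambda>x. norm x * \<bar>g x\<bar>)"
    and s: "s \<in> {0..t}"
  shows "((\<lambda>s. fourier g (exp s *\<^sub>R \<zeta>)) has_vector_derivative
    (LINT x|lborel. g x *\<^sub>R (((exp s *\<^sub>R \<zeta>) \<bullet> x) *\<^sub>R (\<i> * cis ((exp s *\<^sub>R \<zeta>) \<bullet> x))))) (at s within {0..t})"
  unfolding has_vector_derivative_iff_quotient tendsto_at_iff_sequentially comp_def
proof (intro allI impI)
  fix X assume X: "\<forall>i. X i \<in> {0..t} - {s}" "X \<longlonglongrightarrow> s"
  have [measurable]: "g \<in> borel_measurable borel" using g by (auto dest: borel_measurable_integrable)
  let ?c = "\<lambda>s x. cis (exp s * (\<zeta> \<bullet> x))"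
  let ?q = "\<lambda>i x. (g x *\<^sub>R ?c (X i) x - g x *\<^sub>R ?c s x) /\<^sub>R (X i - s)"
  let ?h = "\<lambda>x. g x *\<^sub>R ((exp s * (\<zeta> \<bullet> x)) *\<^sub>R (\<i> * ?c s x))"
  have I: "integrable lborel (\<lambda>x. g x *\<^sub>R ?c s x)" for s
    using integrable_fourier[OF g, of "exp s *\<^sub>R \<zeta>"] by simp
  have "(\<lambda>i. LINT x|lborel. ?q i x) \<longlonglongrightarrow> (LINT x|lborel. ?h x)"
  proof (rule integral_dominated_convergence)
    show "integrable lborel (\<lambda>x. exp t * norm \<zeta> * (norm x * \<bar>g x\<bar>))" using g1 by simp
    show "AE x in lborel. (\<lambda>i. ?q i x) \<longlonglongrightarrow> ?h x"
    proof (intro AE_I2)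
      fix x
      have "((\<lambda>s. ?c s x) has_vector_derivative ((exp s * (\<zeta> \<bullet> x)) *\<^sub>R (\<i> * ?c s x))) (at s within {0..t})"
      proof -
        have e: "((\<lambda>s. exp s * (\<zeta> \<bullet> x)) has_vector_derivative exp s * (\<zeta> \<bullet> x)) (at s within {0..t})"
          by (auto intro!: derivative_eq_intros simp: has_real_derivative_iff_has_vector_derivative[symmetric])
        have "(cis has_vector_derivative \<i> * cis y) (at y within B)" for y B
          unfolding has_vector_derivative_complex_iff
          by (auto intro!: derivative_eq_intros simp: has_real_derivative_iff_has_vector_derivative[symmetric])
        from vector_diff_chain_within[OF e this] show ?thesis by (simp add: comp_def)
      qed
      then have "((\<lambda>y. (?c y x - ?c s x) /\<^sub>R (y - s)) \<longlongrightarrow> (exp s * (\<zeta> \<bullet> x)) *\<^sub>R (\<i> * ?c s x)) (at s within {0..t})"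
        unfolding has_vector_derivative_iff_quotient .
      then have "(\<lambda>i. (?c (X i) x - ?c s x) /\<^sub>R (X i - s)) \<longlonglongrightarrow> (exp s * (\<zeta> \<bullet> x)) *\<^sub>R (\<i> * ?c s x)"
        unfolding tendsto_at_iff_sequentially comp_def using X by blast
      from tendsto_scaleR[OF tendsto_const[of "g x"] this]
      show "(\<lambda>i. ?q i x) \<longlonglongrightarrow> ?h x"
        by (simp add: scaleR_diff_right mult.commute)
    qed
    show "AE x in lborel. norm (?q i x) \<le> exp t * norm \<zeta> * (norm x * \<bar>g x\<bar>)" for i
    proof (intro AE_I2)
      fix x
      have Xi: "X i \<in> {0..t}" "X i \<noteq> s" using X(1)[rule_format, of i] by auto
      have "norm (?q i x) = \<bar>g x\<bar> * norm (?c (X i) x - ?c s x) / \<bar>X i - s\<bar>"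
        by (simp add: scaleR_diff_right[symmetric] divide_inverse abs_mult mult_ac)
      also have "\<dots> \<le> \<bar>g x\<bar> * \<bar>exp (X i) * (\<zeta> \<bullet> x) - exp s * (\<zeta> \<bullet> x)\<bar> / \<bar>X i - s\<bar>"
        by (intro divide_right_mono mult_left_mono norm_cis_diff_le) auto
      also have "\<bar>exp (X i) * (\<zeta> \<bullet> x) - exp s * (\<zeta> \<bullet> x)\<bar> = \<bar>exp (X i) - exp s\<bar> * \<bar>\<zeta> \<bullet> x\<bar>"
        by (simp add: left_diff_distrib[symmetric] abs_mult)
      also have "\<bar>g x\<bar> * (\<bar>exp (X i) - exp s\<bar> * \<bar>\<zeta> \<bullet> x\<bar>) / \<bar>X i - s\<bar> \<le>
          \<bar>g x\<bar> * ((exp t * \<bar>X i - s\<bar>) * (norm \<zeta> * norm x)) / \<bar>X i - s\<bar>"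
        using Xi s by (intro divide_right_mono mult_left_mono mult_mono exp_lipschitz_le Cauchy_Schwarz_ineq2) auto
      also have "\<dots> = exp t * norm \<zeta> * (norm x * \<bar>g x\<bar>)" using Xi by simp
      finally show "norm (?q i x) \<le> exp t * norm \<zeta> * (norm x * \<bar>g x\<bar>)" .
    qed
  qed measurable
  moreover have "(LINT x|lborel. ?q i x) = (fourier g (exp (X i) *\<^sub>R \<zeta>) - fourier g (exp s *\<^sub>R \<zeta>)) /\<^sub>R (X i - s)" for i
    unfolding fourier_def inner_scaleR_left using I[of "X i"] I[of s]
    by (simp add: Bochner_Integration.integral_diff)
  ultimately show "(\<lambda>i. (fourier g (exp (X i) *\<^sub>R \<zeta>) - fourier g (exp s *\<^sub>R \<zeta>)) /\<^sub>R (X i - s)) \<longlonglongrightarrow>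
      (LINT x|lborel. g x *\<^sub>R (((exp s *\<^sub>R \<zeta>) \<bullet> x) *\<^sub>R (\<i> * cis ((exp s *\<^sub>R \<zeta>) \<bullet> x))))"
    by (simp only: inner_scaleR_left)
qed

lemma cutoff_tendsto: "(\<lambda>n. cutoff (real n + 1) x) \<longlonglongrightarrow> 1"
  and cutoff_gradient_tendsto:
    "(\<lambda>n. exp 1 * (flat_seq 1 (1 - (norm x)\<^sup>2 / (real n + 1)\<^sup>2) * (- (2 * (x \<bullet> x)) / (real n + 1)\<^sup>2))) \<longlonglongrightarrow> 0"
proof -
  have lim: "(\<lambda>n. c / (real n + 1)\<^sup>2) \<longlonglongrightarrow> 0" for c :: real by real_asymp
  from tendsto_diff[OF tendsto_const[of 1] this]
  have u: "(\<lambda>n. 1 - (norm x)\<^sup>2 / (real n + 1)\<^sup>2) \<longlonglongrightarrow> 1" by simp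
  have c: "isCont (flat_seq m) y" for m y using flat_seq_derivative by (rule DERIV_isCont)
  have f: "(\<lambda>n. flat_seq m (1 - (norm x)\<^sup>2 / (real n + 1)\<^sup>2)) \<longlonglongrightarrow> flat_seq m 1" for m
    by (rule isCont_tendsto_compose[OF c u])
  show "(\<lambda>n. cutoff (real n + 1) x) \<longlonglongrightarrow> 1"
    using tendsto_mult[OF tendsto_const[of "exp 1"] f[of 0]] by (simp add: cutoff_def flat_seq_0 exp_minus)
  show "(\<lambda>n. exp 1 * (flat_seq 1 (1 - (norm x)\<^sup>2 / (real n + 1)\<^sup>2) * (- (2 * (x \<bullet> x)) / (real n + 1)\<^sup>2))) \<longlonglongrightarrow> 0"
    using tendsto_mult[OF tendsto_const[of "exp 1"] tendsto_mult[OF f[of 1] lim[of "- (2 * (x \<bullet> x))"]]] by simp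
qed

text \<open>The radial derivative \<open>x \<bullet> \<nabla>\<close> commutes with dilations, so
  its value on the cut-off depends only on \<open>norm x / R\<close>: the growth of the drift is
  offset by the flattening of the cut-off.\<close>

lemma cutoff_gradient_bounded:
  "\<exists>B. \<forall>R>0. \<forall>x::'a::euclidean_space. \<bar>exp 1 * (flat_seq 1 (1 - (norm x)\<^sup>2 / R\<^sup>2) * (- (2 * (x \<bullet> x)) / R\<^sup>2))\<bar> \<le> B"
proof -
  have "continuous_on {0..1} (flat_seq 1)"
    using flat_seq_derivative by (intro continuous_at_imp_continuous_on ballI DERIV_isCont)
  then have "bounded (flat_seq 1 ` {0..1})" by (intro compact_imp_bounded compact_continuous_image) auto
  then obtain B where B: "\<And>y. y \<in> {0..1} \<Longrightarrow> \<bar>flat_seq 1 y\<bar> \<le> B" 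
    unfolding bounded_iff by (metis imageI real_norm_def)
  have B0: "0 \<le> B" using B[of 0] by simp
  have "\<bar>exp 1 * (flat_seq 1 (1 - (norm x)\<^sup>2 / R\<^sup>2) * (- (2 * (x \<bullet> x)) / R\<^sup>2))\<bar> \<le> exp 1 * (B * 2)" if R: "R > 0" for R and x :: 'a
  proof (cases "(norm x)\<^sup>2 / R\<^sup>2 \<le> 1")
    case True
    have "\<bar>flat_seq 1 (1 - (norm x)\<^sup>2 / R\<^sup>2)\<bar> \<le> B" using True by (intro B) auto
    moreover have "\<bar>- (2 * (x \<bullet> x)) / R\<^sup>2\<bar> \<le> 2"
      using True by (simp add: power2_norm_eq_inner abs_mult)
    ultimately show ?thesis unfolding abs_mult using B0 by (intro mult_mono) auto
  next
    case False
    then show ?thesis using B0 by (simp add: flat_seq_neg)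
  qed
  then show ?thesis by blast
qed

lemma fourier_eq_Complex:
  assumes "integrable lborel f"
  shows "fourier f \<xi> = Complex (LINT x|lborel. f x * cos (\<xi> \<bullet> x)) (LINT x|lborel. f x * sin (\<xi> \<bullet> x))"
  using integral_Re[OF integrable_fourier[OF assms, of \<xi>]] integral_Im[OF integrable_fourier[OF assms, of \<xi>]]
  by (simp add: complex_eq_iff fourier_def)

context jump_version
begin

lemma equilibrium_borel:
  assumes e: "0 < \<epsilon>" and eq: "equilibrium J \<epsilon> G" and [measurable]: "g \<in> borel_measurable borel" and Gg: "AE x in lborel. G x = g x"
    and test: "test_function \<phi>"
  shows "1 / \<epsilon>\<^sup>2 * (LINT x|lborel. (conv g (jm \<epsilon>) x - g x) * \<phi> x) = (LINT x|lborel. g x * frechet_derivative \<phi> (at x) x)"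
proof -
  have [measurable]: "\<phi> \<in> borel_measurable borel"
    by (intro borel_measurable_continuous_onI test_function_facts[OF test])
  have [measurable]: "(\<lambda>x. frechet_derivative \<phi> (at x) x) \<in> borel_measurable borel"
    by (intro borel_measurable_continuous_onI test_function_facts[OF test])
  have [measurable]: "conv g (jm \<epsilon>) \<in> borel_measurable borel" by (intro conv_measurable borel_prob_jm) measurable
  have "(LINT x|lebesgue. 1 / \<epsilon>\<^sup>2 * (convolve (rescale \<epsilon> J) G x - G x) * \<phi> x) =
      (LINT x|lborel. 1 / \<epsilon>\<^sup>2 * (conv g (jm \<epsilon>) x - g x) * \<phi> x)"
  proof (rule lebesgue_integral_AE)
    show "AE x in lborel. 1 / \<epsilon>\<^sup>2 * (convolve (rescale \<epsilon> J) G x - G x) * \<phi> x = 1 / \<epsilon>\<^sup>2 * (conv g (jm \<epsilon>) x - g x) * \<phi> x"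
      using Gg by eventually_elim (simp add: convolve_eq[OF e _ Gg])
  qed measurable
  moreover have "(LINT x|lebesgue. G x * frechet_derivative \<phi> (at x) x) = (LINT x|lborel. g x * frechet_derivative \<phi> (at x) x)"
    by (rule lebesgue_integral_AE) (use Gg in \<open>auto elim!: eventually_mono\<close>)
  moreover have "(LINT x|lebesgue. 1 / \<epsilon>\<^sup>2 * (convolve (rescale \<epsilon> J) G x - G x) * \<phi> x) =
      (LINT x|lebesgue. G x * frechet_derivative \<phi> (at x) x)"
    using eq test unfolding equilibrium_def by auto
  ultimately show ?thesis using e by (simp add: mult.assoc)
qed

text \<open>The plane waves \<open>H 0 (\<xi> \<bullet> x)\<close>, with \<open>H m\<close> the \<open>m\<close>-th derivative of a sine or cosine, are
  limits of test functions; the first moment controls the drift term.\<close>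

lemma equilibrium_wave:
  fixes H :: "nat \<Rightarrow> real \<Rightarrow> real"
  assumes e: "0 < \<epsilon>" and eq: "equilibrium J \<epsilon> G" and g: "integrable lborel g" and Gg: "AE x in lborel. G x = g x"
    and g1: "integrable lborel (\<lambda>x. norm x * \<bar>g x\<bar>)"
    and H: "\<And>m y. (H m has_real_derivative H (Suc m) y) (at y)" and bd: "\<And>m y. \<bar>H m y\<bar> \<le> 1"
  shows "1 / \<epsilon>\<^sup>2 * (LINT x|lborel. (conv g (jm \<epsilon>) x - g x) * H 0 (\<xi> \<bullet> x)) = (LINT x|lborel. g x * ((\<xi> \<bullet> x) * H 1 (\<xi> \<bullet> x)))"
proof -
  have [measurable]: "g \<in> borel_measurable borel" using g by (auto dest: borel_measurable_integrable)
  have [measurable]: "H m \<in> borel_measurable borel" for m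
    using H by (intro borel_measurable_continuous_onI continuous_at_imp_continuous_on ballI DERIV_isCont)
  have [measurable]: "flat_seq m \<in> borel_measurable borel" for m
    using flat_seq_derivative by (intro borel_measurable_continuous_onI continuous_at_imp_continuous_on ballI DERIV_isCont)
  have [measurable]: "cutoff R \<in> borel_measurable borel" for R :: real
    unfolding cutoff_def[abs_def] by measurable
  have [measurable]: "conv g (jm \<epsilon>) \<in> borel_measurable borel" by (intro conv_measurable borel_prob_jm) measurable
  have ci: "integrable lborel (conv g (jm \<epsilon>))" by (rule integrable_conv[OF borel_prob_jm g])
  let ?R = "\<lambda>n. real n + 1"
  let ?d = "\<lambda>n x. exp 1 * (flat_seq 1 (1 - (norm x)\<^sup>2 / (?R n)\<^sup>2) * (- (2 * (x \<bullet> x)) / (?R n)\<^sup>2))"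
  obtain B where B: "\<And>n x. \<bar>?d n (x :: 'a)\<bar> \<le> B"
    using cutoff_gradient_bounded[where 'a = 'a] by (metis add_nonneg_pos of_nat_0_le_iff zero_less_one)
  have B0: "0 \<le> B" using B[of 0 0] by (rule order_trans[OF abs_ge_zero])
  have lhs: "(\<lambda>n. LINT x|lborel. (conv g (jm \<epsilon>) x - g x) * (cutoff (?R n) x * H 0 (\<xi> \<bullet> x))) \<longlonglongrightarrow>
      (LINT x|lborel. (conv g (jm \<epsilon>) x - g x) * H 0 (\<xi> \<bullet> x))"
  proof (rule integral_dominated_convergence)
    show "integrable lborel (\<lambda>x. \<bar>conv g (jm \<epsilon>) x - g x\<bar>)" using ci g by simp
    show "AE x in lborel. (\<lambda>n. (conv g (jm \<epsilon>) x - g x) * (cutoff (?R n) x * H 0 (\<xi> \<bullet> x))) \<longlonglongrightarrow> (conv g (jm \<epsilon>) x - g x) * H 0 (\<xi> \<bullet> x)"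
      by (intro AE_I2 tendsto_mult tendsto_const tendsto_mult[OF cutoff_tendsto tendsto_const, simplified])
    show "AE x in lborel. norm ((conv g (jm \<epsilon>) x - g x) * (cutoff (?R n) x * H 0 (\<xi> \<bullet> x))) \<le> \<bar>conv g (jm \<epsilon>) x - g x\<bar>" for n
    proof (intro AE_I2)
      fix x
      have "\<bar>cutoff (?R n) x * H 0 (\<xi> \<bullet> x)\<bar> \<le> 1 * 1"
        unfolding abs_mult using cutoff_range[of "?R n" x] bd by (intro mult_mono) auto
      then show "norm ((conv g (jm \<epsilon>) x - g x) * (cutoff (?R n) x * H 0 (\<xi> \<bullet> x))) \<le> \<bar>conv g (jm \<epsilon>) x - g x\<bar>"
        using mult_left_mono[of "\<bar>cutoff (?R n) x * H 0 (\<xi> \<bullet> x)\<bar>" 1 "\<bar>conv g (jm \<epsilon>) x - g x\<bar>"] by (simp add: abs_mult)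
    qed
  qed measurable
  \<comment> \<open>The product rule gives two terms: the derivative of the wave, dominated by the
    first moment, and that of the cut-off, which is bounded and tends to \<open>0\<close>
    pointwise.\<close>
  have rhs: "(\<lambda>n. LINT x|lborel. g x * (cutoff (?R n) x * ((\<xi> \<bullet> x) * H 1 (\<xi> \<bullet> x)) + ?d n x * H 0 (\<xi> \<bullet> x))) \<longlonglongrightarrow>
      (LINT x|lborel. g x * ((\<xi> \<bullet> x) * H 1 (\<xi> \<bullet> x)))"
  proof (rule integral_dominated_convergence)
    show "integrable lborel (\<lambda>x. norm \<xi> * (norm x * \<bar>g x\<bar>) + B * \<bar>g x\<bar>)" using g1 g by simp
    show "AE x in lborel. (\<lambda>n. g x * (cutoff (?R n) x * ((\<xi> \<bullet> x) * H 1 (\<xi> \<bullet> x)) + ?d n x * H 0 (\<xi> \<bullet> x))) \<longlonglongrightarrow> g x * ((\<xi> \<bullet> x) * H 1 (\<xi> \<bullet> x))"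
    proof (intro AE_I2)
      fix x :: 'a
      have "(\<lambda>n. g x * (cutoff (?R n) x * ((\<xi> \<bullet> x) * H 1 (\<xi> \<bullet> x)) + ?d n x * H 0 (\<xi> \<bullet> x))) \<longlonglongrightarrow>
          g x * (1 * ((\<xi> \<bullet> x) * H 1 (\<xi> \<bullet> x)) + 0 * H 0 (\<xi> \<bullet> x))"
        by (intro tendsto_intros cutoff_tendsto cutoff_gradient_tendsto)
      then show "(\<lambda>n. g x * (cutoff (?R n) x * ((\<xi> \<bullet> x) * H 1 (\<xi> \<bullet> x)) + ?d n x * H 0 (\<xi> \<bullet> x))) \<longlonglongrightarrow> g x * ((\<xi> \<bullet> x) * H 1 (\<xi> \<bullet> x))"
        by (simp only: mult_1_left mult_zero_left add_0_right)
    qed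
    show "AE x in lborel. norm (g x * (cutoff (?R n) x * ((\<xi> \<bullet> x) * H 1 (\<xi> \<bullet> x)) + ?d n x * H 0 (\<xi> \<bullet> x))) \<le> norm \<xi> * (norm x * \<bar>g x\<bar>) + B * \<bar>g x\<bar>" for n
    proof (intro AE_I2)
      fix x :: 'a
      have 1: "\<bar>cutoff (?R n) x * ((\<xi> \<bullet> x) * H 1 (\<xi> \<bullet> x))\<bar> \<le> 1 * ((norm \<xi> * norm x) * 1)"
        unfolding abs_mult using cutoff_range[of "?R n" x] bd by (intro mult_mono Cauchy_Schwarz_ineq2) auto
      have 2: "\<bar>?d n x * H 0 (\<xi> \<bullet> x)\<bar> \<le> B * 1"
        unfolding abs_mult[of "?d n x"] using B[of x n] bd[of 0] B0 by (intro mult_mono) auto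
      have "norm (g x * (cutoff (?R n) x * ((\<xi> \<bullet> x) * H 1 (\<xi> \<bullet> x)) + ?d n x * H 0 (\<xi> \<bullet> x))) \<le> \<bar>g x\<bar> * (norm \<xi> * norm x + B)"
        unfolding real_norm_def abs_mult[of "g x"]
        using 1 2 by (intro mult_left_mono order_trans[OF abs_triangle_ineq]) auto
      then show "norm (g x * (cutoff (?R n) x * ((\<xi> \<bullet> x) * H 1 (\<xi> \<bullet> x)) + ?d n x * H 0 (\<xi> \<bullet> x))) \<le> norm \<xi> * (norm x * \<bar>g x\<bar>) + B * \<bar>g x\<bar>"
        by (simp only: distrib_left mult_ac)
    qed
  qed measurable
  have "1 / \<epsilon>\<^sup>2 * (LINT x|lborel. (conv g (jm \<epsilon>) x - g x) * (cutoff (?R n) x * H 0 (\<xi> \<bullet> x))) =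
      (LINT x|lborel. g x * (cutoff (?R n) x * ((\<xi> \<bullet> x) * H 1 (\<xi> \<bullet> x)) + ?d n x * H 0 (\<xi> \<bullet> x)))" for n
  proof -
    have "frechet_derivative (\<lambda>x. cutoff (?R n) x * H 0 (\<xi> \<bullet> x)) (at x) x =
        cutoff (?R n) x * ((\<xi> \<bullet> x) * H 1 (\<xi> \<bullet> x)) + ?d n x * H 0 (\<xi> \<bullet> x)" for x
    proof -
      have 1: "((\<lambda>x. H 0 (\<xi> \<bullet> x)) has_derivative (\<lambda>h. H 1 (\<xi> \<bullet> x) * (\<xi> \<bullet> h))) (at x)"
        using has_derivative_compose[OF has_derivative_inner_right[OF has_derivative_ident] H[unfolded has_field_derivative_def, of 0]]
        by simp
      have 2: "0 < ?R n" by simp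
      from frechet_derivative_at[OF has_derivative_mult[OF cutoff_derivative[OF 2] 1], symmetric]
      show ?thesis by (simp add: mult.commute)
    qed
    then show ?thesis
      using equilibrium_borel[OF e eq _ Gg cutoff_product_test_function[of "?R n" H \<xi>, OF _ H]] by simp
  qed
  with rhs have "(\<lambda>n. 1 / \<epsilon>\<^sup>2 * (LINT x|lborel. (conv g (jm \<epsilon>) x - g x) * (cutoff (?R n) x * H 0 (\<xi> \<bullet> x)))) \<longlonglongrightarrow>
      (LINT x|lborel. g x * ((\<xi> \<bullet> x) * H 1 (\<xi> \<bullet> x)))" by (simp only:)
  from LIMSEQ_unique[OF tendsto_mult[OF tendsto_const lhs] this] show ?thesis .
qed

text \<open>Tested with plane waves, the weak equation says that the radial derivative of the
  transform is the Levy symbol times the transform. On the segment from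
  \<open>exp (- t) *\<^sub>R \<xi>\<close> to \<xi> this is the same differential equation that the
  explicit semigroup solves.\<close>

lemma equilibrium_imp_stationary:
  assumes e: "0 < \<epsilon>" and eq: "equilibrium J \<epsilon> G" and g: "integrable lborel g" and Gg: "AE x in lborel. G x = g x"
    and g1: "integrable lborel (\<lambda>x. norm x * \<bar>g x\<bar>)" and t: "0 < t"
  shows "AE x in lborel. S \<epsilon> t g x = g x"
proof (rule fourier_eq_AE)
  show "integrable lborel (S \<epsilon> t g)" by (rule integrable_S[OF g])
  fix \<xi> :: 'a
  have [measurable]: "g \<in> borel_measurable borel" using g by (auto dest: borel_measurable_integrable)
  have ci: "integrable lborel (conv g (jm \<epsilon>))" by (rule integrable_conv[OF borel_prob_jm g])
  let ?D = "\<lambda>\<xi>. LINT x|lborel. g x *\<^sub>R ((\<xi> \<bullet> x) *\<^sub>R (\<i> * cis (\<xi> \<bullet> x)))"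
  have D: "?D \<xi> = (cf JM (\<epsilon> *\<^sub>R \<xi>) - 1) / of_real (\<epsilon>\<^sup>2) * fourier g \<xi>" for \<xi>
  proof -
    have tI: "integrable lborel (\<lambda>x. f x * trig (\<xi> \<bullet> x))"
      if "integrable lborel f" "trig \<in> borel_measurable borel" "\<And>y. \<bar>trig y\<bar> \<le> 1" for f :: "'a \<Rightarrow> real" and trig :: "real \<Rightarrow> real"
      using integrable_mult_bounded[OF that(1), of "\<lambda>x. trig (\<xi> \<bullet> x)" 1] that by simp
    have wave: "1 / \<epsilon>\<^sup>2 * ((LINT x|lborel. conv g (jm \<epsilon>) x * H 0 (\<xi> \<bullet> x)) - (LINT x|lborel. g x * H 0 (\<xi> \<bullet> x))) =
        (LINT x|lborel. g x * ((\<xi> \<bullet> x) * H 1 (\<xi> \<bullet> x)))"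
      if H: "\<And>m y. (H m has_real_derivative H (Suc m) y) (at y)" and bd: "\<And>m y. \<bar>H m y\<bar> \<le> 1"
      for H :: "nat \<Rightarrow> real \<Rightarrow> real"
    proof -
      have "H 0 \<in> borel_measurable borel"
        using H by (intro borel_measurable_continuous_onI continuous_at_imp_continuous_on ballI DERIV_isCont)
      then show ?thesis
        using equilibrium_wave[where H = H and \<xi> = \<xi>, OF e eq g Gg g1 H bd] tI[OF ci, of "H 0"] tI[OF g, of "H 0"] bd
        by (simp add: left_diff_distrib)
    qed
    have c: "1 / \<epsilon>\<^sup>2 * ((LINT x|lborel. conv g (jm \<epsilon>) x * cos (\<xi> \<bullet> x)) - (LINT x|lborel. g x * cos (\<xi> \<bullet> x))) =
        (LINT x|lborel. g x * ((\<xi> \<bullet> x) * - sin (\<xi> \<bullet> x)))"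
    proof -
      \<comment> \<open>Differentiating a cosine is a phase shift by \<open>pi / 2\<close>, which
        gives all derivatives by one formula, each bounded by \<open>1\<close>.\<close>
      let ?H = "\<lambda>m y. cos (y + real m * (pi / 2))"
      have shift: "cos (y + real (Suc m) * (pi / 2)) = - sin (y + real m * (pi / 2))" for m y
        using cos_add[of "y + real m * (pi / 2)" "pi / 2"] by (simp add: algebra_simps add_divide_distrib)
      have "(?H m has_real_derivative ?H (Suc m) y) (at y)" for m y
        unfolding shift by (auto intro!: derivative_eq_intros)
      from wave[of ?H, OF this] show ?thesis using shift[of _ 0] by simp
    qed
    have s: "1 / \<epsilon>\<^sup>2 * ((LINT x|lborel. conv g (jm \<epsilon>) x * sin (\<xi> \<bullet> x)) - (LINT x|lborel. g x * sin (\<xi> \<bullet> x))) =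
        (LINT x|lborel. g x * ((\<xi> \<bullet> x) * cos (\<xi> \<bullet> x)))"
    proof -
      let ?H = "\<lambda>m y. sin (y + real m * (pi / 2))"
      have shift: "sin (y + real (Suc m) * (pi / 2)) = cos (y + real m * (pi / 2))" for m y
        using sin_add[of "y + real m * (pi / 2)" "pi / 2"] by (simp add: algebra_simps add_divide_distrib)
      have "(?H m has_real_derivative ?H (Suc m) y) (at y)" for m y
        unfolding shift by (auto intro!: derivative_eq_intros)
      from wave[of ?H, OF this] show ?thesis using shift[of _ 0] by simp
    qed
    have DI: "integrable lborel (\<lambda>x. g x *\<^sub>R ((\<xi> \<bullet> x) *\<^sub>R (\<i> * cis (\<xi> \<bullet> x))))"
    proof (rule Bochner_Integration.integrable_bound)
      show "integrable lborel (\<lambda>x. norm \<xi> * (norm x * \<bar>g x\<bar>))" using g1 by simp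
      show "AE x in lborel. norm (g x *\<^sub>R ((\<xi> \<bullet> x) *\<^sub>R (\<i> * cis (\<xi> \<bullet> x)))) \<le> norm (norm \<xi> * (norm x * \<bar>g x\<bar>))"
      proof (intro AE_I2)
        fix x
        show "norm (g x *\<^sub>R ((\<xi> \<bullet> x) *\<^sub>R (\<i> * cis (\<xi> \<bullet> x)))) \<le> norm (norm \<xi> * (norm x * \<bar>g x\<bar>))"
          using mult_left_mono[OF Cauchy_Schwarz_ineq2[of \<xi> x], of "\<bar>g x\<bar>"] by (simp add: norm_mult abs_mult mult_ac)
      qed
    qed measurable
    have "?D \<xi> = Complex (LINT x|lborel. g x * ((\<xi> \<bullet> x) * - sin (\<xi> \<bullet> x))) (LINT x|lborel. g x * ((\<xi> \<bullet> x) * cos (\<xi> \<bullet> x)))"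
      using integral_Re[OF DI] integral_Im[OF DI] by (simp add: complex_eq_iff mult.assoc)
    also have "\<dots> = (fourier (conv g (jm \<epsilon>)) \<xi> - fourier g \<xi>) / of_real (\<epsilon>\<^sup>2)"
      unfolding c[symmetric] s[symmetric] fourier_eq_Complex[OF ci] fourier_eq_Complex[OF g]
      by (simp add: complex_eq_iff diff_divide_distrib[symmetric])
    also have "\<dots> = (cf JM (\<epsilon> *\<^sub>R \<xi>) - 1) / of_real (\<epsilon>\<^sup>2) * fourier g \<xi>"
      unfolding fourier_conv[OF borel_prob_jm g] cf_jm by (simp add: algebra_simps diff_divide_distrib)
    finally show ?thesis .
  qed
  let ?A = "\<lambda>s. (cf JM ((\<epsilon> * exp s) *\<^sub>R exp (- t) *\<^sub>R \<xi>) - 1) / of_real (\<epsilon>\<^sup>2)"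
  have "fourier g (exp t *\<^sub>R exp (- t) *\<^sub>R \<xi>) = fourier g (exp 0 *\<^sub>R exp (- t) *\<^sub>R \<xi>) * exp (integral {0..t} ?A)"
  proof (rule linear_ode_solution)
    show "continuous_on {0..t} ?A"
      using e by (intro continuous_intros continuous_cf_JM) auto
    fix s assume "s \<in> {0..t}"
    from fourier_ray_derivative[OF g g1 this, of "exp (- t) *\<^sub>R \<xi>"]
    show "((\<lambda>s. fourier g (exp s *\<^sub>R exp (- t) *\<^sub>R \<xi>)) has_vector_derivative
        ?A s * fourier g (exp s *\<^sub>R exp (- t) *\<^sub>R \<xi>)) (at s within {0..t})"
      unfolding D by (simp add: mult.assoc)
  qed (use t in simp)
  then show "fourier (S \<epsilon> t g) \<xi> = fourier g \<xi>"
    using t psi_reversed[OF e, of t \<xi>] by (simp add: fourier_S[OF e t g] exp_minus)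
qed (rule g)

end

section \<open>Uniqueness and decay\<close>

text \<open>\<open>w\<close> is the weight in which solutions are measured and \<open>V\<close> the
  smooth one in which the semigroup contracts; \<open>c\<close> is the constant of their
  equivalence.\<close>

locale weighted_version = jump_version J0 J + weighted_jump_kernel J0 V M
  for J0 J V :: "'a::euclidean_space \<Rightarrow> real" and M :: real +
  fixes w :: "'a \<Rightarrow> real" and c :: real
  assumes w_measurable [measurable]: "w \<in> borel_measurable borel"
    and w_ge_1: "\<And>x. 1 \<le> w x"
    and w_le: "\<And>x. w x \<le> c * V x"
    and V_le: "\<And>x. V x \<le> c * w x"
begin

lemma w_nonneg: "0 \<le> w x"
  using w_ge_1[of x] by simp

lemma c_pos: "0 < c"
  using w_ge_1[of 0] w_le[of 0] V_pos[of 0] by (smt (verit) mult_nonpos_nonneg)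

lemma VL_iff: "g \<in> borel_measurable borel \<Longrightarrow> VL g \<longleftrightarrow> integrable lborel (\<lambda>x. w x * \<bar>g x\<bar>)"
proof -
  assume [measurable]: "g \<in> borel_measurable borel"
  have "integrable lborel (\<lambda>x. b x * \<bar>g x\<bar>)"
    if "integrable lborel (\<lambda>x. a x * \<bar>g x\<bar>)" "\<And>x. 0 \<le> b x" "\<And>x. b x \<le> c * a x" "b \<in> borel_measurable borel" for a b
  proof (rule Bochner_Integration.integrable_bound)
    show "integrable lborel (\<lambda>x. c * (a x * \<bar>g x\<bar>))" using that(1) by simp
    show "AE x in lborel. norm (b x * \<bar>g x\<bar>) \<le> norm (c * (a x * \<bar>g x\<bar>))"
    proof (intro AE_I2)
      fix x
      have "b x * \<bar>g x\<bar> \<le> (c * a x) * \<bar>g x\<bar>" using that(3) by (rule mult_right_mono) simp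
      then have "norm (b x * \<bar>g x\<bar>) \<le> c * (a x * \<bar>g x\<bar>)" using that(2)[of x] by (simp add: abs_mult mult.assoc)
      then show "norm (b x * \<bar>g x\<bar>) \<le> norm (c * (a x * \<bar>g x\<bar>))" unfolding real_norm_def by (rule order_trans[OF _ abs_ge_self])
    qed
    show "(\<lambda>x. b x * \<bar>g x\<bar>) \<in> borel_measurable lborel" using that(4) by measurable
  qed
  from this[of w V] this[of V w] show ?thesis
    unfolding VL_def using V_nonneg w_nonneg V_le w_le by auto
qed

lemma L1w_iff:
  assumes [measurable]: "g \<in> borel_measurable borel" and fg: "AE x in lborel. f x = g x"
  shows "f \<in> L1w w \<longleftrightarrow> VL g"
proof -
  have "AE x in lborel. w x * \<bar>f x\<bar> = w x * \<bar>g x\<bar>" using fg by eventually_elim simp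
  then have "integrable lebesgue (\<lambda>x. w x * \<bar>f x\<bar>) \<longleftrightarrow> integrable lborel (\<lambda>x. w x * \<bar>g x\<bar>)"
    by (intro lebesgue_integrable_AE) measurable
  then show ?thesis
    unfolding L1w_def using lebesgue_measurable_AE[OF assms] VL_iff[OF assms(1)] by simp
qed

lemma obtain_VL_version:
  assumes "f \<in> L1w w"
  obtains g where "VL g" "g \<in> borel_measurable borel" "AE x in lborel. f x = g x"
proof -
  have "f \<in> borel_measurable lebesgue" using assms by (simp add: L1w_def)
  then obtain g where "g \<in> borel_measurable borel" "AE x in lborel. f x = g x" by (rule obtain_borel_version)
  then show ?thesis using that L1w_iff assms by blast
qed

lemma L1w_integrable: "f \<in> L1w w \<Longrightarrow> integrable lebesgue f"
  by (metis obtain_VL_version VL_integrable lebesgue_integrable_AE)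

lemma
  assumes g: "VL g" and fg: "AE x in lborel. f x = g x"
  shows L1w_norm_le_NV: "L1w_norm w f \<le> c * NV g" and NV_le_L1w_norm: "NV g \<le> c * L1w_norm w f"
proof -
  have [measurable]: "g \<in> borel_measurable borel" using g by measurable
  have wi: "integrable lborel (\<lambda>x. w x * \<bar>g x\<bar>)" using g VL_iff[of g] by simp
  have "AE x in lborel. w x * \<bar>f x\<bar> = w x * \<bar>g x\<bar>" using fg by eventually_elim simp
  then have n: "L1w_norm w f = (LINT x|lborel. w x * \<bar>g x\<bar>)"
    unfolding L1w_norm_def by (intro lebesgue_integral_AE) measurable
  have "(LINT x|lborel. w x * \<bar>g x\<bar>) \<le> (LINT x|lborel. c * (V x * \<bar>g x\<bar>))"
    using wi VL_V[OF g] mult_right_mono[OF w_le abs_ge_zero]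
    by (intro integral_mono) (auto simp: mult.assoc)
  then show "L1w_norm w f \<le> c * NV g" by (simp add: n NV_def)
  have "(LINT x|lborel. V x * \<bar>g x\<bar>) \<le> (LINT x|lborel. c * (w x * \<bar>g x\<bar>))"
    using wi VL_V[OF g] mult_right_mono[OF V_le abs_ge_zero]
    by (intro integral_mono) (auto simp: mult.assoc)
  then show "NV g \<le> c * L1w_norm w f" by (simp add: n NV_def)
qed

text \<open>The bound by \<open>b\<close> gives every competitor a finite first moment, so it is
  stationary as well; the difference of two stationary densities has mean zero and vanishes by
  \<open>stationary_zero\<close>.\<close>

lemma stationary_unique_equilibrium:
  assumes e: "0 < \<epsilon>" "\<epsilon> \<le> 1" and F: "VL F" "AE x in lborel. 0 \<le> F x" "(LINT x|lborel. F x) = 1"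
    and st: "\<And>t. 0 < t \<Longrightarrow> AE x in lborel. S \<epsilon> t F x = F x"
    and b: "\<And>x. norm x \<le> b * w x"
  shows "unique_probability_equilibrium_in w J \<epsilon> F"
  unfolding unique_probability_equilibrium_in_def probability_equilibrium_def
proof (intro conjI allI impI)
  have [measurable]: "F \<in> borel_measurable borel" using F by measurable
  show "F \<in> L1w w" using L1w_iff[of F F] F by simp
  show "equilibrium J \<epsilon> F" by (rule stationary_imp_equilibrium[OF e(1) VL_integrable[OF F(1)] st])
  show "probability_density F"
    unfolding probability_density_def has_bochner_integral_iff
    using F lebesgue_integrable_AE[of F F] lebesgue_integral_AE[of F F] VL_integrable[OF F(1)]
    by (simp add: AE_completion_iff)
  fix G assume "G \<in> L1w w \<and> equilibrium J \<epsilon> G \<and> probability_density G"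
  then have G: "G \<in> L1w w" "equilibrium J \<epsilon> G" "probability_density G" by auto
  obtain g where g: "VL g" and [measurable]: "g \<in> borel_measurable borel" and Gg: "AE x in lborel. G x = g x"
    by (rule obtain_VL_version[OF G(1)])
  have b0: "0 \<le> b" using b[of 0] w_ge_1[of 0] by (simp add: zero_le_mult_iff)
  have "integrable lborel (\<lambda>x. norm x * \<bar>g x\<bar>)"
  proof (rule Bochner_Integration.integrable_bound)
    show "integrable lborel (\<lambda>x. b * (w x * \<bar>g x\<bar>))" using g VL_iff[of g] by simp
    show "AE x in lborel. norm (norm x * \<bar>g x\<bar>) \<le> norm (b * (w x * \<bar>g x\<bar>))"
      using mult_right_mono[OF b abs_ge_zero] w_nonneg b0 by (intro AE_I2) (simp add: abs_mult mult.assoc)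
  qed measurable
  then have gst: "AE x in lborel. S \<epsilon> t g x = g x" if "0 < t" for t
    using equilibrium_imp_stationary[OF e(1) G(2) VL_integrable[OF g] Gg] that by blast
  have "(LINT x|lborel. g x) = 1"
    using G(3) lebesgue_integral_AE[of g G] Gg unfolding probability_density_def has_bochner_integral_iff by simp
  then have i: "(LINT x|lborel. g x - F x) = 0" using VL_integrable[OF g] VL_integrable[OF F(1)] F(3) by simp
  have "AE x in lborel. g x - F x = 0"
  proof (rule stationary_zero[OF e VL_diff[OF g F(1)] i])
    fix t :: real assume t: "0 < t"
    from S_diff[OF VL_integrable[OF g] VL_integrable[OF F(1)] e(1) t] gst[OF t] st[OF t]
    show "AE x in lborel. S \<epsilon> t (\<lambda>x. g x - F x) x = g x - F x" by eventually_elim simp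
  qed
  with Gg have "AE x in lborel. G x = F x" by eventually_elim simp
  then show "AE x in lebesgue. G x = F x" by (simp add: AE_completion_iff)
qed

text \<open>Time \<open>0\<close> is treated apart because the results on \<open>S\<close> concern
  positive times; here it follows from the transform, as \<open>psi\<close> vanishes at time
  \<open>0\<close>.\<close>

lemma mild_solution_initial:
  assumes e: "0 < \<epsilon>" and sol: "mild_solution w J \<epsilon> u0 u"
  shows "AE x in lborel. u 0 x = u0 x"
proof -
  have L: "u0 \<in> L1w w" "u 0 \<in> L1w w" using sol unfolding mild_solution_def by auto
  obtain g0 where g0: "VL g0" "g0 \<in> borel_measurable borel" "AE x in lborel. u0 x = g0 x"
    by (rule obtain_VL_version[OF L(1)])
  obtain g where g: "VL g" "g \<in> borel_measurable borel" "AE x in lborel. u 0 x = g x"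
    by (rule obtain_VL_version[OF L(2)])
  have "AE x in lborel. g x = g0 x"
  proof (rule fourier_eq_AE[OF VL_integrable[OF g(1)] VL_integrable[OF g0(1)]])
    fix \<xi>
    have "fourierL (u 0) \<xi> = fourierL u0 (exp (- 0) *\<^sub>R \<xi>) * exp (psi \<epsilon> 0 \<xi>)"
      by (rule mild_solution_fourier[OF e sol w_ge_1 L1w_integrable w_measurable order_refl])
    then show "fourier g \<xi> = fourier g0 \<xi>"
      using fourierL_eq[OF g(2,3)] fourierL_eq[OF g0(2,3)] by (simp add: psi_def)
  qed
  with g(3) g0(3) show ?thesis by eventually_elim simp
qed

lemma mild_solution_decay:
  obtains C \<gamma> where "C \<ge> 1" "\<gamma> > 0"
    "\<And>\<epsilon> F u0 u t. \<epsilon> \<in> {0<..1} \<Longrightarrow> VL F \<Longrightarrow> (LINT x|lborel. F x) = 1 \<Longrightarrow>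
      (\<forall>t>0. AE x in lborel. S \<epsilon> t F x = F x) \<Longrightarrow>
      probability_density u0 \<Longrightarrow> mild_solution w J \<epsilon> u0 u \<Longrightarrow> 0 \<le> t \<Longrightarrow>
      L1w_norm w (\<lambda>x. u t x - F x) \<le> C * exp (- \<gamma> * t) * L1w_norm w (\<lambda>x. u0 x - F x)"
proof -
  obtain C \<gamma> where C: "C \<ge> 1" "\<gamma> > 0" and contr:
    "\<And>\<epsilon> f t. 0 < \<epsilon> \<Longrightarrow> \<epsilon> \<le> 1 \<Longrightarrow> VL f \<Longrightarrow> (LINT x|lborel. f x) = 0 \<Longrightarrow> 0 < t \<Longrightarrow>
      NV (S \<epsilon> t f) \<le> C * exp (- \<gamma> * t) * NV f"
    using exponential_contraction by blast
  \<comment> \<open>Two changes of norm cost a factor \<open>c\<close> each; the maximum with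
    \<open>1\<close> covers the time \<open>0\<close>.\<close>
  define D where "D = max 1 (c * (C * c))"
  have "L1w_norm w (\<lambda>x. u t x - F x) \<le> D * exp (- \<gamma> * t) * L1w_norm w (\<lambda>x. u0 x - F x)"
    if e: "\<epsilon> \<in> {0<..1}" and F: "VL F" "(LINT x|lborel. F x) = 1" and st: "\<forall>t>0. AE x in lborel. S \<epsilon> t F x = F x"
      and u0: "probability_density u0" and sol: "mild_solution w J \<epsilon> u0 u" and t: "0 \<le> t" for \<epsilon> F u0 u t
  proof -
    have e': "0 < \<epsilon>" "\<epsilon> \<le> 1" using e by auto
    have [measurable]: "F \<in> borel_measurable borel" using F by measurable
    have L: "u0 \<in> L1w w" using sol unfolding mild_solution_def by auto
    obtain g where g: "VL g" and [measurable]: "g \<in> borel_measurable borel" and ug: "AE x in lborel. u0 x = g x"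
      by (rule obtain_VL_version[OF L])
    have d: "VL (\<lambda>x. g x - F x)" by (rule VL_diff[OF g F(1)])
    have ud: "AE x in lborel. u0 x - F x = g x - F x" using ug by eventually_elim simp
    have N0: "0 \<le> L1w_norm w (\<lambda>x. u0 x - F x)"
      unfolding L1w_norm_def using w_nonneg by (intro integral_nonneg_AE) simp
    show ?thesis
    proof (cases "t = 0")
      case True
      have "AE x in lborel. u 0 x - F x = g x - F x"
        using mild_solution_initial[OF e'(1) sol] ug by eventually_elim simp
      then have "AE x in lborel. w x * \<bar>u 0 x - F x\<bar> = w x * \<bar>g x - F x\<bar>" by eventually_elim simp
      moreover have "AE x in lborel. w x * \<bar>u0 x - F x\<bar> = w x * \<bar>g x - F x\<bar>" using ud by eventually_elim simp
      ultimately have "L1w_norm w (\<lambda>x. u 0 x - F x) = L1w_norm w (\<lambda>x. u0 x - F x)"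
        unfolding L1w_norm_def
        by (subst (1 2) lebesgue_integral_AE[where G = "\<lambda>x. w x * \<bar>g x - F x\<bar>"]) simp_all
      then show ?thesis using True N0 mult_right_mono[of 1 D "L1w_norm w (\<lambda>x. u0 x - F x)"] by (simp add: D_def)
    next
      case False
      then have t: "0 < t" using t by simp
      have "(LINT x|lborel. g x) = 1"
        using u0 lebesgue_integral_AE[of g u0] ug unfolding probability_density_def has_bochner_integral_iff by simp
      then have i: "(LINT x|lborel. g x - F x) = 0" using VL_integrable[OF g] VL_integrable[OF F(1)] F(2) by simp
      have "AE x in lborel. u t x = S \<epsilon> t g x"
        by (rule mild_solution_eq_S[OF e'(1) sol w_ge_1 L1w_integrable w_measurable t _ ug]) measurable
      moreover have "AE x in lborel. S \<epsilon> t F x = F x" using st t by blast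
      ultimately have "AE x in lborel. u t x - F x = S \<epsilon> t (\<lambda>x. g x - F x) x"
        using S_diff[OF VL_integrable[OF g] VL_integrable[OF F(1)] e'(1) t] by eventually_elim simp
      then have "L1w_norm w (\<lambda>x. u t x - F x) \<le> c * NV (S \<epsilon> t (\<lambda>x. g x - F x))"
        by (rule L1w_norm_le_NV[OF S_bounded(1)[OF d e' t]])
      also have "\<dots> \<le> c * (C * exp (- \<gamma> * t) * NV (\<lambda>x. g x - F x))"
        using c_pos by (intro mult_left_mono contr[OF e' d i t]) auto
      also have "\<dots> \<le> c * (C * exp (- \<gamma> * t) * (c * L1w_norm w (\<lambda>x. u0 x - F x)))"
        using c_pos C by (intro mult_left_mono NV_le_L1w_norm[OF d ud]) auto
      also have "\<dots> = (c * (C * c)) * (exp (- \<gamma> * t) * L1w_norm w (\<lambda>x. u0 x - F x))" by (simp only: mult_ac)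
      also have "\<dots> \<le> D * (exp (- \<gamma> * t) * L1w_norm w (\<lambda>x. u0 x - F x))"
        unfolding D_def using N0 by (intro mult_right_mono) auto
      finally show ?thesis by (simp only: mult.assoc)
    qed
  qed
  moreover have "1 \<le> D" by (simp add: D_def)
  ultimately show thesis using C(2) that by blast
qed

end

section \<open>Application to the two families of weights\<close>

context jump_version
begin

lemma weighted_version_pow:
  assumes mean: "\<And>u. integrable lborel (\<lambda>y. J0 y * (u \<bullet> y))" "\<And>u. (LINT y|lborel. J0 y * (u \<bullet> y)) = 0"
    and k': "integrable lborel (\<lambda>y. J0 y * (1 + norm y powr k'))" and k: "0 < k" "k \<le> k'" "2 \<le> k'"
  shows "\<exists>M c. weighted_version J0 J (Vpow k) M (weight_pow k) c"
proof -
  obtain M where M: "weighted_jump_kernel J0 (Vpow k) M"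
    using weighted_Vpow[OF mean k' k] by blast
  have "weighted_version J0 J (Vpow k) M (weight_pow k) (max 2 (2 powr k))"
  proof (intro weighted_version.intro weighted_version_axioms.intro)
    show "jump_version J0 J" by (rule jump_version_axioms)
    show "weighted_jump_kernel J0 (Vpow k) M" by (rule M)
    show "weight_pow k \<in> borel_measurable borel" unfolding weight_pow_def[abs_def] by measurable
    fix x :: 'a
    show "1 \<le> weight_pow k x" by (simp add: weight_pow_def)
    have "weight_pow k x \<le> 2 * Vpow k x"
      using Vpow_lower[OF k(1), of x] Vpow_ge_1[of k x] k(1) by (simp add: weight_pow_def)
    also have "\<dots> \<le> max 2 (2 powr k) * Vpow k x" using Vpow_pos[of k x] by (intro mult_right_mono) auto
    finally show "weight_pow k x \<le> max 2 (2 powr k) * Vpow k x" .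
    have "Vpow k x \<le> 2 powr k * weight_pow k x" unfolding weight_pow_def by (rule Vpow_upper[OF k(1)])
    also have "\<dots> \<le> max 2 (2 powr k) * weight_pow k x"
      by (intro mult_right_mono) (auto simp: weight_pow_def add_nonneg_nonneg)
    finally show "Vpow k x \<le> max 2 (2 powr k) * weight_pow k x" .
  qed
  then show ?thesis by blast
qed

lemma weighted_version_exp:
  assumes mean: "\<And>u. integrable lborel (\<lambda>y. J0 y * (u \<bullet> y))" "\<And>u. (LINT y|lborel. J0 y * (u \<bullet> y)) = 0"
    and a': "integrable lborel (\<lambda>y. J0 y * exp (a' * norm y))" and a: "0 < a" "a < a'"
  shows "\<exists>M c. weighted_version J0 J (Vexp a) M (weight_exp a) c"
proof -
  obtain M where M: "weighted_jump_kernel J0 (Vexp a) M"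
    using weighted_Vexp[OF mean a' a] by blast
  have "weighted_version J0 J (Vexp a) M (weight_exp a) (exp a)"
  proof (intro weighted_version.intro weighted_version_axioms.intro)
    show "jump_version J0 J" by (rule jump_version_axioms)
    show "weighted_jump_kernel J0 (Vexp a) M" by (rule M)
    show "weight_exp a \<in> borel_measurable borel" unfolding weight_exp_def[abs_def] by measurable
    fix x :: 'a
    show "1 \<le> weight_exp a x" using a by (simp add: weight_exp_def)
    have "weight_exp a x \<le> 1 * Vexp a x"
      using Vexp_lower[of a x] a by (simp add: weight_exp_def)
    also have "\<dots> \<le> exp a * Vexp a x" using a Vexp_ge_1[of a x] by (intro mult_right_mono) auto
    finally show "weight_exp a x \<le> exp a * Vexp a x" .
    show "Vexp a x \<le> exp a * weight_exp a x" unfolding weight_exp_def using a by (intro Vexp_upper) auto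
  qed
  then show ?thesis by blast
qed

text \<open>The equilibria are constructed once, in the strongest weight, and only the contraction
  is redone for each smaller \<open>k\<close>. Thus \<open>F\<close> does not depend on
  \<open>k\<close>, whereas the constants may; uniqueness is proved in the weight \<open>k'\<close>,
  which controls the first moment.\<close>

lemma polynomial_weights:
  assumes mean: "\<And>u. integrable lborel (\<lambda>y. J0 y * (u \<bullet> y))" "\<And>u. (LINT y|lborel. J0 y * (u \<bullet> y)) = 0"
    and k': "2 < k'" and JL: "J \<in> L1w (weight_pow k')"
  shows "\<exists>F :: real \<Rightarrow> 'a \<Rightarrow> real.
    (\<forall>\<epsilon>\<in>{0<..1}. unique_probability_equilibrium_in (weight_pow k') J \<epsilon> (F \<epsilon>)) \<and>
    (\<forall>k\<in>{0<..k'}. \<exists>C\<ge>1. \<exists>\<gamma>>0. \<forall>\<epsilon>\<in>{0<..1}. \<forall>u0 u.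
       probability_density u0 \<and> mild_solution (weight_pow k) J \<epsilon> u0 u \<longrightarrow>
       (\<forall>t\<ge>0. L1w_norm (weight_pow k) (\<lambda>x. u t x - F \<epsilon> x)
                \<le> C * exp (- \<gamma> * t) * L1w_norm (weight_pow k) (\<lambda>x. u0 x - F \<epsilon> x)))"
proof -
  have "integrable lebesgue (\<lambda>y. weight_pow k' y * \<bar>J y\<bar>)" using JL by (simp add: L1w_def)
  moreover have "AE y in lborel. weight_pow k' y * \<bar>J y\<bar> = J0 y * (1 + norm y powr k')"
    using J_AE by eventually_elim (simp add: weight_pow_def J_nonneg)
  ultimately have Ji: "integrable lborel (\<lambda>y. J0 y * (1 + norm y powr k'))"
    by (subst (asm) lebesgue_integrable_AE[where G = "\<lambda>y. J0 y * (1 + norm y powr k')"]) simp_all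
  obtain M c where W: "weighted_version J0 J (Vpow k') M (weight_pow k') c"
    using weighted_version_pow[OF mean Ji] k' by fastforce
  interpret W: weighted_version J0 J "Vpow k'" M "weight_pow k'" c by (rule W)
  have "\<exists>F. W.VL F \<and> (AE x in lborel. 0 \<le> F x) \<and> (LINT x|lborel. F x) = 1 \<and> (\<forall>t>0. AE x in lborel. S \<epsilon> t F x = F x)"
    if "\<epsilon> \<in> {0<..1}" for \<epsilon>
  proof -
    have e: "0 < \<epsilon>" "\<epsilon> \<le> 1" using that by auto
    show ?thesis by (rule W.exists_stationary[OF e]) (intro exI conjI allI impI)
  qed
  then have "\<forall>\<epsilon>\<in>{0<..1}. \<exists>F. W.VL F \<and> (AE x in lborel. 0 \<le> F x) \<and> (LINT x|lborel. F x) = 1 \<and>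
      (\<forall>t>0. AE x in lborel. S \<epsilon> t F x = F x)" by (intro ballI)
  from bchoice[OF this] obtain F where F: "\<forall>\<epsilon>\<in>{0<..1}. W.VL (F \<epsilon>) \<and> (AE x in lborel. 0 \<le> F \<epsilon> x) \<and> (LINT x|lborel. F \<epsilon> x) = 1 \<and>
      (\<forall>t>0. AE x in lborel. S \<epsilon> t (F \<epsilon>) x = F \<epsilon> x)"
    by (elim exE)
  have "unique_probability_equilibrium_in (weight_pow k') J \<epsilon> (F \<epsilon>)" if "\<epsilon> \<in> {0<..1}" for \<epsilon>
  proof (rule W.stationary_unique_equilibrium)
    show "norm x \<le> 1 * weight_pow k' x" for x :: 'a
      using powr_le_1_plus[of "norm x" 1 k'] k' by (simp add: weight_pow_def)
  qed (use F[rule_format, OF that] that in auto)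
  moreover have "\<exists>C\<ge>1. \<exists>\<gamma>>0. \<forall>\<epsilon>\<in>{0<..1}. \<forall>u0 u.
       probability_density u0 \<and> mild_solution (weight_pow k) J \<epsilon> u0 u \<longrightarrow>
       (\<forall>t\<ge>0. L1w_norm (weight_pow k) (\<lambda>x. u t x - F \<epsilon> x)
                \<le> C * exp (- \<gamma> * t) * L1w_norm (weight_pow k) (\<lambda>x. u0 x - F \<epsilon> x))" if k: "k \<in> {0<..k'}" for k
  proof -
    obtain N d where U: "weighted_version J0 J (Vpow k) N (weight_pow k) d"
      using weighted_version_pow[OF mean Ji, of k] k k' by fastforce
    interpret U: weighted_version J0 J "Vpow k" N "weight_pow k" d by (rule U)
    have VL: "U.VL (F \<epsilon>)" if e: "\<epsilon> \<in> {0<..1}" for \<epsilon>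
    proof -
      have [measurable]: "F \<epsilon> \<in> borel_measurable borel" using F[rule_format, OF e] W.VL_measurable by blast
      have "integrable lborel (\<lambda>x. weight_pow k x * \<bar>F \<epsilon> x\<bar>)"
      proof (rule Bochner_Integration.integrable_bound)
        show "integrable lborel (\<lambda>x. 2 * (weight_pow k' x * \<bar>F \<epsilon> x\<bar>))"
          using F[rule_format, OF e] W.VL_iff[of "F \<epsilon>"] by simp
        show "AE x in lborel. norm (weight_pow k x * \<bar>F \<epsilon> x\<bar>) \<le> norm (2 * (weight_pow k' x * \<bar>F \<epsilon> x\<bar>))"
        proof (intro AE_I2)
          fix x :: 'a
          have "norm x powr k \<le> 1 + norm x powr k'" using k by (intro powr_le_1_plus) auto
          then have "weight_pow k x \<le> 2 * weight_pow k' x" unfolding weight_pow_def by (smt (verit) powr_ge_zero)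
          from mult_right_mono[OF this, of "\<bar>F \<epsilon> x\<bar>"]
          show "norm (weight_pow k x * \<bar>F \<epsilon> x\<bar>) \<le> norm (2 * (weight_pow k' x * \<bar>F \<epsilon> x\<bar>))"
            using U.w_nonneg[of x] W.w_nonneg[of x] by (simp add: abs_mult mult.assoc)
        qed
      qed measurable
      then show ?thesis using U.VL_iff[of "F \<epsilon>"] by simp
    qed
    show ?thesis
    proof (rule U.mild_solution_decay, goal_cases)
      case (1 C \<gamma>)
      show ?case
        by (intro exI[of _ C] exI[of _ \<gamma>] conjI 1(1,2) ballI allI impI 1(3)) (use F VL in auto)
    qed
  qed
  ultimately show ?thesis by blast
qed

text \<open>One family \<open>F\<close> must serve all exponents. It is built with a single
  admissible exponent, and the higher exponential moments follow from the last clause of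
  \<open>exists_stationary\<close>, which also places \<open>F\<close> in every space where
  uniqueness and decay are then proved.\<close>

lemma exponential_weights:
  assumes mean: "\<And>u. integrable lborel (\<lambda>y. J0 y * (u \<bullet> y))" "\<And>u. (LINT y|lborel. J0 y * (u \<bullet> y)) = 0"
    and a': "0 < a'" and JL: "J \<in> L1w (weight_exp a')"
  shows "\<exists>F :: real \<Rightarrow> 'a \<Rightarrow> real.
    (\<forall>\<epsilon>\<in>{0<..1}. \<forall>a\<in>{0<..<a'}. unique_probability_equilibrium_in (weight_exp a) J \<epsilon> (F \<epsilon>)) \<and>
    (\<forall>a\<in>{0<..<a'}. \<exists>C\<ge>1. \<exists>\<gamma>>0. \<forall>\<epsilon>\<in>{0<..1}. \<forall>u0 u.
       probability_density u0 \<and> mild_solution (weight_exp a) J \<epsilon> u0 u \<longrightarrow>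
       (\<forall>t\<ge>0. L1w_norm (weight_exp a) (\<lambda>x. u t x - F \<epsilon> x)
                \<le> C * exp (- \<gamma> * t) * L1w_norm (weight_exp a) (\<lambda>x. u0 x - F \<epsilon> x))) \<and>
    (\<forall>\<epsilon>\<in>{0<..1}. \<forall>b < a' * inverse \<epsilon>. F \<epsilon> \<in> L1w (weight_exp b))"
proof -
  have "integrable lebesgue (\<lambda>y. weight_exp a' y * \<bar>J y\<bar>)" using JL by (simp add: L1w_def)
  moreover have "AE y in lborel. weight_exp a' y * \<bar>J y\<bar> = J0 y * exp (a' * norm y)"
    using J_AE by eventually_elim (simp add: weight_exp_def J_nonneg)
  ultimately have Ji: "integrable lborel (\<lambda>y. J0 y * exp (a' * norm y))"
    by (subst (asm) lebesgue_integrable_AE[where G = "\<lambda>y. J0 y * exp (a' * norm y)"]) simp_all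
  \<comment> \<open>Any exponent strictly between \<open>0\<close> and \<open>a'\<close> would serve
    for the construction.\<close>
  obtain M c where W: "weighted_version J0 J (Vexp (a' / 2)) M (weight_exp (a' / 2)) c"
    using weighted_version_exp[OF mean Ji, of "a' / 2"] a' by auto
  interpret W: weighted_version J0 J "Vexp (a' / 2)" M "weight_exp (a' / 2)" c by (rule W)
  have "\<exists>F. W.VL F \<and> (AE x in lborel. 0 \<le> F x) \<and> (LINT x|lborel. F x) = 1 \<and> (\<forall>t>0. AE x in lborel. S \<epsilon> t F x = F x) \<and>
      (\<forall>b \<in> {0..<a' * inverse \<epsilon>}. integrable lborel (\<lambda>x. Vexp b x * \<bar>F x\<bar>))"
    if e: "\<epsilon> \<in> {0<..1}" for \<epsilon>
  proof -
    have e': "0 < \<epsilon>" "\<epsilon> \<le> 1" using e by auto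
    show ?thesis
    proof (rule W.exists_stationary[OF e'])
      fix F assume F: "W.VL F" "AE x in lborel. 0 \<le> F x" "(LINT x|lborel. F x) = 1" "\<And>t. 0 < t \<Longrightarrow> AE x in lborel. S \<epsilon> t F x = F x"
        and I: "\<And>W m. continuous_on UNIV W \<Longrightarrow> (\<And>x. 0 \<le> W x) \<Longrightarrow>
        (\<And>\<theta> x. 0 \<le> \<theta> \<Longrightarrow> \<theta> \<le> 1 \<Longrightarrow> W (\<theta> *\<^sub>R x) \<le> W x) \<Longrightarrow> 0 \<le> m \<Longrightarrow>
        (\<And>c x. 0 \<le> c \<Longrightarrow> c \<le> \<epsilon> \<Longrightarrow>
          (\<integral>\<^sup>+y. ennreal (W (x + c *\<^sub>R y)) \<partial>JM) \<le> ennreal (1 + m * c\<^sup>2) * ennreal (W x)) \<Longrightarrow>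
        integrable lborel (\<lambda>x. W x * \<bar>F x\<bar>)"
      have "integrable lborel (\<lambda>x. Vexp b x * \<bar>F x\<bar>)" if "b \<in> {0..<a' * inverse \<epsilon>}" for b
      proof -
        have b: "0 \<le> b" "b * \<epsilon> < a'" using that e' by (auto simp: field_simps)
        obtain m where m: "m \<ge> 0" "\<And>c x. 0 \<le> c \<Longrightarrow> c \<le> \<epsilon> \<Longrightarrow>
            (\<integral>\<^sup>+y. ennreal (Vexp b (x + c *\<^sub>R y)) \<partial>JM) \<le> ennreal (1 + m * c\<^sup>2) * ennreal (Vexp b x)"
          using Vexp_jump[OF mean Ji b(1) less_imp_le[OF e'(1)] b(2)] by (auto simp del: ennreal_plus)
        show ?thesis
          by (rule I[OF continuous_Vexp _ _ m]) (use Vexp_ray[OF b(1)] Vexp_ge_1[OF b(1)] in \<open>auto simp: Vexp_def\<close>)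
      qed
      with F show ?thesis by (intro exI[of _ F] conjI allI impI ballI)
    qed
  qed
  then have "\<forall>\<epsilon>\<in>{0<..1}. \<exists>F. W.VL F \<and> (AE x in lborel. 0 \<le> F x) \<and> (LINT x|lborel. F x) = 1 \<and>
      (\<forall>t>0. AE x in lborel. S \<epsilon> t F x = F x) \<and>
      (\<forall>b \<in> {0..<a' * inverse \<epsilon>}. integrable lborel (\<lambda>x. Vexp b x * \<bar>F x\<bar>))" by (intro ballI)
  from bchoice[OF this] obtain F where F: "\<forall>\<epsilon>\<in>{0<..1}. W.VL (F \<epsilon>) \<and> (AE x in lborel. 0 \<le> F \<epsilon> x) \<and> (LINT x|lborel. F \<epsilon> x) = 1 \<and>
      (\<forall>t>0. AE x in lborel. S \<epsilon> t (F \<epsilon>) x = F \<epsilon> x) \<and>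
      (\<forall>b \<in> {0..<a' * inverse \<epsilon>}. integrable lborel (\<lambda>x. Vexp b x * \<bar>F \<epsilon> x\<bar>))"
    by (elim exE)
  have Fm: "F \<epsilon> \<in> borel_measurable borel" if "\<epsilon> \<in> {0<..1}" for \<epsilon>
    using F[rule_format, OF that] W.VL_measurable by blast
  have "unique_probability_equilibrium_in (weight_exp a) J \<epsilon> (F \<epsilon>)" if e: "\<epsilon> \<in> {0<..1}" and a: "a \<in> {0<..<a'}" for \<epsilon> a
  proof -
    obtain N d where U: "weighted_version J0 J (Vexp a) N (weight_exp a) d"
      using weighted_version_exp[OF mean Ji, of a] a by auto
    interpret U: weighted_version J0 J "Vexp a" N "weight_exp a" d by (rule U)
    show ?thesis
    proof (rule U.stationary_unique_equilibrium)
      \<comment> \<open>As \<open>\<epsilon> \<le> 1\<close>, the moments obtained include every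
        exponent below \<open>a'\<close>.\<close>
      have "a' \<le> a' * inverse \<epsilon>" using e a' by (simp add: field_simps)
      from less_le_trans[OF _ this, of a] have "a \<in> {0..<a' * inverse \<epsilon>}" using a by simp
      then show "U.VL (F \<epsilon>)" using F[rule_format, OF e] Fm[OF e] by (simp add: U.VL_def)
      show "norm x \<le> 1 / a * weight_exp a x" for x :: 'a
      proof -
        have "a * norm x \<le> exp (a * norm x)" using exp_ge_add_one_self[of "a * norm x"] by linarith
        then show ?thesis using a by (simp add: weight_exp_def field_simps)
      qed
    qed (use F[rule_format, OF e] e in auto)
  qed
  moreover have "\<exists>C\<ge>1. \<exists>\<gamma>>0. \<forall>\<epsilon>\<in>{0<..1}. \<forall>u0 u.
       probability_density u0 \<and> mild_solution (weight_exp a) J \<epsilon> u0 u \<longrightarrow>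
       (\<forall>t\<ge>0. L1w_norm (weight_exp a) (\<lambda>x. u t x - F \<epsilon> x)
                \<le> C * exp (- \<gamma> * t) * L1w_norm (weight_exp a) (\<lambda>x. u0 x - F \<epsilon> x))" if a: "a \<in> {0<..<a'}" for a
  proof -
    obtain N d where U: "weighted_version J0 J (Vexp a) N (weight_exp a) d"
      using weighted_version_exp[OF mean Ji, of a] a by auto
    interpret U: weighted_version J0 J "Vexp a" N "weight_exp a" d by (rule U)
    have VL: "U.VL (F \<epsilon>)" if e: "\<epsilon> \<in> {0<..1}" for \<epsilon>
    proof -
      have "a' \<le> a' * inverse \<epsilon>" using e a' by (simp add: field_simps)
      from less_le_trans[OF _ this, of a] have "a \<in> {0..<a' * inverse \<epsilon>}" using a by simp
      then show ?thesis using F[rule_format, OF e] Fm[OF e] by (simp add: U.VL_def)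
    qed
    show ?thesis
    proof (rule U.mild_solution_decay, goal_cases)
      case (1 C \<gamma>)
      show ?case
        by (intro exI[of _ C] exI[of _ \<gamma>] conjI 1(1,2) ballI allI impI 1(3)) (use F VL in auto)
    qed
  qed
  moreover have "F \<epsilon> \<in> L1w (weight_exp b)" if e: "\<epsilon> \<in> {0<..1}" and b: "b < a' * inverse \<epsilon>" for \<epsilon> b
  proof -
    have [measurable]: "F \<epsilon> \<in> borel_measurable borel" by (rule Fm[OF e])
    have [measurable]: "weight_exp b \<in> borel_measurable (borel :: 'a measure)" unfolding weight_exp_def[abs_def] by measurable
    have [measurable]: "Vexp b \<in> borel_measurable (borel :: 'a measure)" for b
      by (intro borel_measurable_continuous_onI continuous_Vexp)
    \<comment> \<open>Negative \<open>b\<close> are allowed in the conclusion, while the jump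
      estimate is for nonnegative exponents; a larger exponent gives a larger weight.\<close>
    let ?b = "max b 0"
    have "?b \<in> {0..<a' * inverse \<epsilon>}" using b a' e by auto
    then have I: "integrable lborel (\<lambda>x. Vexp ?b x * \<bar>F \<epsilon> x\<bar>)" using F[rule_format, OF e] by blast
    have "integrable lborel (\<lambda>x. weight_exp b x * \<bar>F \<epsilon> x\<bar>)"
    proof (rule Bochner_Integration.integrable_bound[OF I])
      show "AE x in lborel. norm (weight_exp b x * \<bar>F \<epsilon> x\<bar>) \<le> norm (Vexp ?b x * \<bar>F \<epsilon> x\<bar>)"
      proof (intro AE_I2)
        fix x :: 'a
        have "weight_exp b x \<le> exp (?b * norm x)" by (simp add: weight_exp_def mult_right_mono)
        also have "\<dots> \<le> Vexp ?b x" by (intro Vexp_lower) simp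
        finally show "norm (weight_exp b x * \<bar>F \<epsilon> x\<bar>) \<le> norm (Vexp ?b x * \<bar>F \<epsilon> x\<bar>)"
          by (simp add: abs_mult weight_exp_def mult_right_mono)
      qed
    qed measurable
    then show ?thesis
      using lebesgue_integrable_AE[of "\<lambda>x. weight_exp b x * \<bar>F \<epsilon> x\<bar>" "\<lambda>x. weight_exp b x * \<bar>F \<epsilon> x\<bar>"] lebesgue_measurable_AE[of "F \<epsilon>" "F \<epsilon>"]
      by (simp add: L1w_def)
  qed
  ultimately show ?thesis by blast
qed

end

theorem theorem1p1:
  fixes J :: "'a::euclidean_space \<Rightarrow> real" and p :: ennreal
  assumes J_nonneg: "\<And>x. 0 \<le> J x"
    and J_mass: "has_bochner_integral lebesgue J 1"
    and J_mean: "has_bochner_integral lebesgue (\<lambda>x. J x *\<^sub>R x) 0"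
    and J_second: "\<And>i j. i \<in> Basis \<Longrightarrow> j \<in> Basis \<Longrightarrow>
      has_bochner_integral lebesgue (\<lambda>x. J x * ((x \<bullet> i) * (x \<bullet> j))) (if i = j then 2 else 0)"
    and p: "1 < p"
    and J_Lp: "in_Lp p J"
  shows
    "(\<forall>k'>2. J \<in> L1w (weight_pow k') \<longrightarrow>
        (\<exists>F :: real \<Rightarrow> 'a \<Rightarrow> real.
          (\<forall>\<epsilon>\<in>{0<..1}. unique_probability_equilibrium_in (weight_pow k') J \<epsilon> (F \<epsilon>)) \<and>
          (\<forall>k\<in>{0<..k'}. \<exists>C\<ge>1. \<exists>\<gamma>>0. \<forall>\<epsilon>\<in>{0<..1}. \<forall>u0 u.
             probability_density u0 \<and> mild_solution (weight_pow k) J \<epsilon> u0 u \<longrightarrow>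
             (\<forall>t\<ge>0. L1w_norm (weight_pow k) (\<lambda>x. u t x - F \<epsilon> x)
                      \<le> C * exp (- \<gamma> * t) * L1w_norm (weight_pow k) (\<lambda>x. u0 x - F \<epsilon> x))))) \<and>
     (\<forall>a'>0. J \<in> L1w (weight_exp a') \<longrightarrow>
        (\<exists>F :: real \<Rightarrow> 'a \<Rightarrow> real.
          (\<forall>\<epsilon>\<in>{0<..1}. \<forall>a\<in>{0<..<a'}.
             unique_probability_equilibrium_in (weight_exp a) J \<epsilon> (F \<epsilon>)) \<and>
          (\<forall>a\<in>{0<..<a'}. \<exists>C\<ge>1. \<exists>\<gamma>>0. \<forall>\<epsilon>\<in>{0<..1}. \<forall>u0 u.
             probability_density u0 \<and> mild_solution (weight_exp a) J \<epsilon> u0 u \<longrightarrow>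
             (\<forall>t\<ge>0. L1w_norm (weight_exp a) (\<lambda>x. u t x - F \<epsilon> x)
                      \<le> C * exp (- \<gamma> * t) * L1w_norm (weight_exp a) (\<lambda>x. u0 x - F \<epsilon> x))) \<and>
          (\<forall>\<epsilon>\<in>{0<..1}. \<forall>b < a' * inverse \<epsilon>. F \<epsilon> \<in> L1w (weight_exp b))))"
proof -
  have "J \<in> borel_measurable lebesgue" using J_mass by (simp add: has_bochner_integral_iff borel_measurable_integrable)
  then obtain g where [measurable]: "g \<in> borel_measurable borel" and Jg: "AE x in lborel. J x = g x"
    by (rule obtain_borel_version)
  \<comment> \<open>A Borel version may be negative on a null set; truncation makes the sign hold at
    every point.\<close>
  define J0 where "J0 x = max 0 (g x)" for x
  have J0[measurable]: "J0 \<in> borel_measurable borel" unfolding J0_def by measurable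
  have J0_nonneg: "0 \<le> J0 x" for x by (simp add: J0_def)
  have JJ0: "AE x in lborel. J x = J0 x"
    using Jg by eventually_elim (metis J_nonneg J0_def max.absorb2)
  have "integrable lborel J0" "(LINT x|lborel. J0 x) = 1"
    using J_mass lebesgue_integrable_AE[OF J0 JJ0] lebesgue_integral_AE[OF J0 JJ0]
    by (auto simp: has_bochner_integral_iff)
  then have "(\<integral>\<^sup>+x. ennreal (J0 x) \<partial>lborel) = 1"
    by (subst nn_integral_eq_integral) (simp_all add: J0_nonneg)
  then interpret jump_version J0 J
    by unfold_locales (rule J0 J0_nonneg JJ0 | assumption)+
  have x[measurable]: "(\<lambda>x. J0 x *\<^sub>R x) \<in> borel_measurable borel" by measurable
  have "AE x in lborel. J x *\<^sub>R x = J0 x *\<^sub>R x" using JJ0 by eventually_elim simp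
  then have "integrable lborel (\<lambda>x. J0 x *\<^sub>R x)" "(LINT x|lborel. J0 x *\<^sub>R x) = 0"
    using J_mean lebesgue_integrable_AE[OF x] lebesgue_integral_AE[OF x]
    by (auto simp: has_bochner_integral_iff)
  then have mean: "integrable lborel (\<lambda>y. J0 y * (u \<bullet> y))" "(LINT y|lborel. J0 y * (u \<bullet> y)) = 0" for u
    using integrable_inner_right[of u lborel "\<lambda>x. J0 x *\<^sub>R x"] integral_inner_right[of u lborel "\<lambda>x. J0 x *\<^sub>R x"] by auto
  show ?thesis
    by (intro conjI allI impI polynomial_weights[OF mean] exponential_weights[OF mean])
qed

end
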